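(* Let $\mathbf{B}$ be a binomial ring. The functor $P_n\mathrm{Hom}(\mathbf{B}^n,-)$ is a small projective generator for the category $\mathcal{N}_n$ of numerical functors of degree $n$, through which there is an equivalence of categories $$\Phi\colon\mathcal{N}_n\to{}_{P_n(\mathbf{B}^{n\times n})}\mathfrak{Mod},\qquad F\mapsto F(\mathbf{B}^n).$$ The left module structure on $F(\mathbf{B}^n)$ is given by $[\tau]\cdot x=F(\tau)(x)$ for $\tau\in\mathbf{B}^{n\times n}=\mathrm{End}(\mathbf{B}^n)$, $x\in F(\mathbf{B}^n)$.
   Context: A ring $\mathbf{B}$ is binomial if it is commutative, unital, torsion-free (so that it embeds into $\mathbb{Q}\otimes_{\mathbb{Z}}\mathbf{B}$), and closed under $r\mapsto\binom{r}{m}$, $m\in\mathbb{N}$. Modules and $\mathrm{Hom}$ are over $\mathbf{B}$; $\mathfrak{Mod}$ is the category of $\mathbf{B}$-modules, $\mathfrak{FMod}$ its subcategory of finitely generated free modules. Functors are not assumed additive. For a map $\varphi\colon M\to N$ of modules (not assumed linear), put $\varphi(x_1\diamond\cdots\diamond x_k)=\sum_{S\subseteq\{1,\dots,k\}}(-1)^{k-|S|}\varphi\left(\sum_{i\in S}x_i\right)$; $\lozenge_k x$ means $x\diamond\cdots\diamond x$ ($k$ times), and for $k=0$ the deviation is $\varphi(0)$. The map $\varphi$ is polynomial of degree $n$ if $\varphi(x_1\diamond\cdots\diamond x_{n+1})=0$ for all $x_i\in M$. A polynomial map of degree $n$ is numerical of degree $n$ if moreover $\varphi(rx)=\sum_{k=0}^n\binom{r}{k}\varphi(\lozenge_k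 x)$ for all $r\in\mathbf{B}$, $x\in M$. A functor $F\colon\mathfrak{FMod}\to\mathfrak{Mod}$ is numerical of degree $n$ if every arrow map $\mathrm{Hom}(M,N)\to\mathrm{Hom}(F(M),F(N))$ is. $\mathcal{N}_n$ is the category of numerical functors of degree $n$ and natural transformations. For a module $M$, let $\mathbf{B}[M]$ be the free module on the set $M$ with basis $[x]$ $(x\in M)$, with the multiplication $[x][y]=[x+y]$, and with deviations $[x_1\diamond\cdots\diamond x_k]$ formed for the map $x\mapsto[x]$. Put $P_n(M)=\mathbf{B}[M]/I$, where $I$ is the ideal generated by all $[x_1\diamond\cdots\diamond x_{n+1}]$ and all $[rx]-\sum_{k=0}^n\binom{r}{k}[\lozenge_k x]$ ($r\in\mathbf{B}$, $x,x_i\in M$). $P_n\mathrm{Hom}(\mathbf{B}^n,-)$ sends $M$ to $P_n(\mathrm{Hom}(\mathbf{B}^n,M))$ and $\chi\colon M\to N$ to the linear map $[\alpha]\mapsto[\chi\alpha]$. $P_n(\mathbf{B}^{n\times n})$ is regarded as a ring under the multiplication $[\sigma]\circ[\tau]=[\sigma\tau]$ induced by matrix multiplication. An object $Q$ of $\mathcal{N}_n$ is small if $\mathrm{Nat}(Q,-)$, the functor of natural transformations out of $Q$, preserves direct sums.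
   Formalization: P_n(M) is B[M] modulo the B-submodule spanned by the relations, not the ideal they generate; with the ideal, [τ]·x=F(τ)(x) is ill-defined, e.g. for B=Q(t), n=2 (via q(a,b)=a'b−ab'), and wherever the stated claim holds the two agree. *)

theory Defs
  imports "HOL-Algebra.Module" "HOL-Algebra.AbelCoset"
begin

section \<open>Categories\<close>

text \<open>In \<open>cmp C X Y Z g f\<close>, the arrow \<open>f\<close> goes from \<open>X\<close> to \<open>Y\<close> and \<open>g\<close> from \<open>Y\<close> to \<open>Z\<close>.\<close>

record ('o, 'a) cat =
  obj :: "'o set"
  arr :: "'o \<Rightarrow> 'o \<Rightarrow> 'a set"
  ident :: "'o \<Rightarrow> 'a"
  cmp :: "'o \<Rightarrow> 'o \<Rightarrow> 'o \<Rightarrow> 'a \<Rightarrow> 'a \<Rightarrow> 'a"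

locale category =
  fixes C :: "('o, 'a) cat"
  assumes ident_arr: "X \<in> obj C \<Longrightarrow> ident C X \<in> arr C X X"
    and cmp_arr: "\<lbrakk>X \<in> obj C; Y \<in> obj C; Z \<in> obj C; f \<in> arr C X Y; g \<in> arr C Y Z\<rbrakk>
      \<Longrightarrow> cmp C X Y Z g f \<in> arr C X Z"
    and cmp_ident: "\<lbrakk>X \<in> obj C; Y \<in> obj C; f \<in> arr C X Y\<rbrakk> \<Longrightarrow> cmp C X X Y f (ident C X) = f"
    and ident_cmp: "\<lbrakk>X \<in> obj C; Y \<in> obj C; f \<in> arr C X Y\<rbrakk> \<Longrightarrow> cmp C X Y Y (ident C Y) f = f"
    and cmp_assoc: "\<lbrakk>W \<in> obj C; X \<in> obj C; Y \<in> obj C; Z \<in> obj C;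
        f \<in> arr C W X; g \<in> arr C X Y; h \<in> arr C Y Z\<rbrakk>
      \<Longrightarrow> cmp C W Y Z h (cmp C W X Y g f) = cmp C W X Z (cmp C X Y Z h g) f"

definition iso_arrow :: "('o, 'a) cat \<Rightarrow> 'o \<Rightarrow> 'o \<Rightarrow> 'a \<Rightarrow> bool" where
  "iso_arrow C X Y f \<longleftrightarrow> f \<in> arr C X Y \<and>
     (\<exists>g \<in> arr C Y X. cmp C X Y X g f = ident C X \<and> cmp C Y X Y f g = ident C Y)"

definition epi_arrow :: "('o, 'a) cat \<Rightarrow> 'o \<Rightarrow> 'o \<Rightarrow> 'a \<Rightarrow> bool" where
  "epi_arrow C X Y p \<longleftrightarrow> p \<in> arr C X Y \<and>
     (\<forall>Z \<in> obj C. \<forall>f \<in> arr C Y Z. \<forall>g \<in> arr C Y Z. cmp C X Y Z f p = cmp C X Y Z g p \<longrightarrow> f = g)"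

definition projective_object :: "('o, 'a) cat \<Rightarrow> 'o \<Rightarrow> bool" where
  "projective_object C Q \<longleftrightarrow> Q \<in> obj C \<and>
     (\<forall>X \<in> obj C. \<forall>Y \<in> obj C. \<forall>p. epi_arrow C X Y p \<longrightarrow>
        (\<forall>g \<in> arr C Q Y. \<exists>h \<in> arr C Q X. cmp C Q X Y p h = g))"

definition generator_object :: "('o, 'a) cat \<Rightarrow> 'o \<Rightarrow> bool" where
  "generator_object C Q \<longleftrightarrow> Q \<in> obj C \<and>
     (\<forall>X \<in> obj C. \<forall>Y \<in> obj C. \<forall>f \<in> arr C X Y. \<forall>g \<in> arr C X Y.
        f \<noteq> g \<longrightarrow> (\<exists>h \<in> arr C Q X. cmp C Q X Y f h \<noteq> cmp C Q X Y g h))"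

record ('o, 'a, 'p, 'c) ftr =
  fobj :: "'o \<Rightarrow> 'p"
  farr :: "'o \<Rightarrow> 'o \<Rightarrow> 'a \<Rightarrow> 'c"

definition is_functor :: "('o, 'a) cat \<Rightarrow> ('p, 'c) cat \<Rightarrow> ('o, 'a, 'p, 'c) ftr \<Rightarrow> bool" where
  "is_functor C D F \<longleftrightarrow> category C \<and> category D \<and>
     (\<forall>X \<in> obj C. fobj F X \<in> obj D) \<and>
     (\<forall>X \<in> obj C. \<forall>Y \<in> obj C. \<forall>f \<in> arr C X Y. farr F X Y f \<in> arr D (fobj F X) (fobj F Y)) \<and>
     (\<forall>X \<in> obj C. farr F X X (ident C X) = ident D (fobj F X)) \<and>
     (\<forall>X \<in> obj C. \<forall>Y \<in> obj C. \<forall>Z \<in> obj C. \<forall>f \<in> arr C X Y. \<forall>g \<in> arr C Y Z.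
        farr F X Z (cmp C X Y Z g f)
          = cmp D (fobj F X) (fobj F Y) (fobj F Z) (farr F Y Z g) (farr F X Y f))"

definition id_functor :: "('o, 'a, 'o, 'a) ftr" where
  "id_functor = \<lparr>fobj = (\<lambda>X. X), farr = (\<lambda>X Y f. f)\<rparr>"

definition comp_functor :: "('p, 'c, 'q, 'd) ftr \<Rightarrow> ('o, 'a, 'p, 'c) ftr \<Rightarrow> ('o, 'a, 'q, 'd) ftr" where
  "comp_functor G F = \<lparr>fobj = (\<lambda>X. fobj G (fobj F X)),
     farr = (\<lambda>X Y f. farr G (fobj F X) (fobj F Y) (farr F X Y f))\<rparr>"

definition nat_trans ::
  "('o, 'a) cat \<Rightarrow> ('p, 'c) cat \<Rightarrow> ('o, 'a, 'p, 'c) ftr \<Rightarrow> ('o, 'a, 'p, 'c) ftr \<Rightarrow> ('o \<Rightarrow> 'c) set" where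
  "nat_trans C D F G = {\<eta> \<in> extensional (obj C).
     (\<forall>X \<in> obj C. \<eta> X \<in> arr D (fobj F X) (fobj G X)) \<and>
     (\<forall>X \<in> obj C. \<forall>Y \<in> obj C. \<forall>f \<in> arr C X Y.
        cmp D (fobj F X) (fobj F Y) (fobj G Y) (\<eta> Y) (farr F X Y f)
          = cmp D (fobj F X) (fobj G X) (fobj G Y) (farr G X Y f) (\<eta> X))}"

definition fun_cat :: "('o, 'a) cat \<Rightarrow> ('p, 'c) cat \<Rightarrow> (('o, 'a, 'p, 'c) ftr, 'o \<Rightarrow> 'c) cat" where
  "fun_cat C D = \<lparr>obj = {F. is_functor C D F}, arr = nat_trans C D,
     ident = (\<lambda>F. \<lambda>X \<in> obj C. ident D (fobj F X)),
     cmp = (\<lambda>F G H \<theta> \<eta>. \<lambda>X \<in> obj C. cmp D (fobj F X) (fobj G X) (fobj H X) (\<theta> X) (\<eta> X))\<rparr>"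

definition naturally_isomorphic ::
  "('o, 'a) cat \<Rightarrow> ('p, 'c) cat \<Rightarrow> ('o, 'a, 'p, 'c) ftr \<Rightarrow> ('o, 'a, 'p, 'c) ftr \<Rightarrow> bool" where
  "naturally_isomorphic C D F G \<longleftrightarrow>
     (\<exists>\<eta> \<in> nat_trans C D F G. \<forall>X \<in> obj C. iso_arrow D (fobj F X) (fobj G X) (\<eta> X))"

definition equivalence_functor :: "('o, 'a) cat \<Rightarrow> ('p, 'c) cat \<Rightarrow> ('o, 'a, 'p, 'c) ftr \<Rightarrow> bool" where
  "equivalence_functor C D F \<longleftrightarrow> is_functor C D F \<and>
     (\<exists>G. is_functor D C G \<and>
        naturally_isomorphic C C (comp_functor G F) id_functor \<and>
        naturally_isomorphic D D (comp_functor F G) id_functor)"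


section \<open>Binomial rings and modules\<close>

definition binomial_ring :: "('b, 'z) ring_scheme \<Rightarrow> bool" where
  "binomial_ring B \<longleftrightarrow> cring B \<and>
     (\<forall>k::nat. \<forall>r \<in> carrier B. 0 < k \<longrightarrow> [k] \<cdot>\<^bsub>B\<^esub> r = \<zero>\<^bsub>B\<^esub> \<longrightarrow> r = \<zero>\<^bsub>B\<^esub>) \<and>
     (\<forall>m::nat. \<forall>r \<in> carrier B. \<exists>s \<in> carrier B.
        [(fact m :: nat)] \<cdot>\<^bsub>B\<^esub> s = (\<Otimes>\<^bsub>B\<^esub>i\<in>{..<m}. r \<ominus>\<^bsub>B\<^esub> [i] \<cdot>\<^bsub>B\<^esub> \<one>\<^bsub>B\<^esub>))"

text \<open>The element \<open>r (r - 1) \<dots> (r - m + 1) / m!\<close> of the rationalisation of \<open>B\<close>, taken in \<open>B\<close> itself;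
  it is unique because \<open>B\<close> is torsion-free.\<close>

definition binom :: "('b, 'z) ring_scheme \<Rightarrow> 'b \<Rightarrow> nat \<Rightarrow> 'b" where
  "binom B r m = (THE s. s \<in> carrier B \<and>
     [(fact m :: nat)] \<cdot>\<^bsub>B\<^esub> s = (\<Otimes>\<^bsub>B\<^esub>i\<in>{..<m}. r \<ominus>\<^bsub>B\<^esub> [i] \<cdot>\<^bsub>B\<^esub> \<one>\<^bsub>B\<^esub>))"

text \<open>The library locale \<^locale>\<open>module\<close> demands a commutative ring of scalars.\<close>

locale left_module = R?: ring R + M?: abelian_group M
  for R :: "('r, 'z) ring_scheme" (structure) and M :: "('r, 'm) module" (structure) +
  assumes smult_closed: "\<lbrakk>a \<in> carrier R; x \<in> carrier M\<rbrakk> \<Longrightarrow> a \<odot>\<^bsub>M\<^esub> x \<in> carrier M"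
    and smult_l_distr: "\<lbrakk>a \<in> carrier R; b \<in> carrier R; x \<in> carrier M\<rbrakk>
      \<Longrightarrow> (a \<oplus>\<^bsub>R\<^esub> b) \<odot>\<^bsub>M\<^esub> x = a \<odot>\<^bsub>M\<^esub> x \<oplus>\<^bsub>M\<^esub> b \<odot>\<^bsub>M\<^esub> x"
    and smult_r_distr: "\<lbrakk>a \<in> carrier R; x \<in> carrier M; y \<in> carrier M\<rbrakk>
      \<Longrightarrow> a \<odot>\<^bsub>M\<^esub> (x \<oplus>\<^bsub>M\<^esub> y) = a \<odot>\<^bsub>M\<^esub> x \<oplus>\<^bsub>M\<^esub> a \<odot>\<^bsub>M\<^esub> y"
    and smult_assoc1: "\<lbrakk>a \<in> carrier R; b \<in> carrier R; x \<in> carrier M\<rbrakk>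
      \<Longrightarrow> (a \<otimes>\<^bsub>R\<^esub> b) \<odot>\<^bsub>M\<^esub> x = a \<odot>\<^bsub>M\<^esub> (b \<odot>\<^bsub>M\<^esub> x)"
    and smult_one: "x \<in> carrier M \<Longrightarrow> \<one>\<^bsub>R\<^esub> \<odot>\<^bsub>M\<^esub> x = x"

lemma left_module_iff_module:
  assumes "cring R"
  shows "left_module R M \<longleftrightarrow> module R M"
proof
  assume "left_module R M"
  then interpret left_module R M .
  show "module R M"
    by (intro moduleI assms M.abelian_group_axioms smult_closed smult_l_distr
        smult_r_distr smult_assoc1 smult_one)
next
  assume "module R M"
  then interpret module R M .
  show "left_module R M"
    by (intro left_module.intro left_module_axioms.intro R.ring_axioms M.abelian_group_axioms
        smult_closed smult_l_distr smult_r_distr smult_assoc1 smult_one)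
qed

text \<open>The type \<^typ>\<open>('r, 'm) module\<close> also carries a multiplication and a unit on \<^typ>\<open>'m\<close>, which
  play no role for modules.\<close>

definition plain_module ::
  "'m set \<Rightarrow> 'm \<Rightarrow> ('m \<Rightarrow> 'm \<Rightarrow> 'm) \<Rightarrow> ('r \<Rightarrow> 'm \<Rightarrow> 'm) \<Rightarrow> ('r, 'm) module" where
  "plain_module A z a s =
     \<lparr>carrier = A, mult = undefined, one = undefined, zero = z, add = a, smult = s\<rparr>"

definition lin_maps ::
  "('r, 'z) ring_scheme \<Rightarrow> ('r, 'm) module \<Rightarrow> ('r, 'k) module \<Rightarrow> ('m \<Rightarrow> 'k) set" where
  "lin_maps R M N = {f \<in> carrier M \<rightarrow>\<^sub>E carrier N.
     (\<forall>x \<in> carrier M. \<forall>y \<in> carrier M. f (x \<oplus>\<^bsub>M\<^esub> y) = f x \<oplus>\<^bsub>N\<^esub> f y) \<and>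
     (\<forall>r \<in> carrier R. \<forall>x \<in> carrier M. f (r \<odot>\<^bsub>M\<^esub> x) = r \<odot>\<^bsub>N\<^esub> f x)}"

definition mod_isos ::
  "('r, 'z) ring_scheme \<Rightarrow> ('r, 'm) module \<Rightarrow> ('r, 'k) module \<Rightarrow> ('m \<Rightarrow> 'k) set" where
  "mod_isos R M N = {f \<in> lin_maps R M N. bij_betw f (carrier M) (carrier N)}"

text \<open>The type \<^typ>\<open>'m\<close> is the universe: all modules whose underlying set lies in it are objects.\<close>

definition mod_cat :: "('r, 'z) ring_scheme \<Rightarrow> (('r, 'm) module, 'm \<Rightarrow> 'm) cat" where
  "mod_cat R = \<lparr>obj = {M. left_module R M}, arr = lin_maps R,
     ident = (\<lambda>M. \<lambda>x \<in> carrier M. x), cmp = (\<lambda>L M N g f. compose (carrier L) g f)\<rparr>"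

definition fg_free :: "('r, 'z) ring_scheme \<Rightarrow> ('r, 'm) module \<Rightarrow> bool" where
  "fg_free R M \<longleftrightarrow> (\<exists>S. finite S \<and> S \<subseteq> carrier M \<and>
     (\<forall>x \<in> carrier M. \<exists>!c. c \<in> S \<rightarrow>\<^sub>E carrier R \<and> x = (\<Oplus>\<^bsub>M\<^esub>s\<in>S. c s \<odot>\<^bsub>M\<^esub> s)))"

definition fmod_cat :: "('r, 'z) ring_scheme \<Rightarrow> (('r, 'm) module, 'm \<Rightarrow> 'm) cat" where
  "fmod_cat R = (mod_cat R)\<lparr>obj := {M \<in> obj (mod_cat R). fg_free R M}\<rparr>"

definition free_mod :: "('r, 'z) ring_scheme \<Rightarrow> nat \<Rightarrow> ('r, nat \<Rightarrow> 'r) module" where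
  "free_mod R k = plain_module ({..<k} \<rightarrow>\<^sub>E carrier R) (\<lambda>i \<in> {..<k}. \<zero>\<^bsub>R\<^esub>)
     (\<lambda>x y. \<lambda>i \<in> {..<k}. x i \<oplus>\<^bsub>R\<^esub> y i) (\<lambda>r x. \<lambda>i \<in> {..<k}. r \<otimes>\<^bsub>R\<^esub> x i)"

definition Hom_mod ::
  "('r, 'z) ring_scheme \<Rightarrow> ('r, 'm) module \<Rightarrow> ('r, 'k) module \<Rightarrow> ('r, 'm \<Rightarrow> 'k) module" where
  "Hom_mod R M N = plain_module (lin_maps R M N) (\<lambda>x \<in> carrier M. \<zero>\<^bsub>N\<^esub>)
     (\<lambda>f g. \<lambda>x \<in> carrier M. f x \<oplus>\<^bsub>N\<^esub> g x) (\<lambda>r f. \<lambda>x \<in> carrier M. r \<odot>\<^bsub>N\<^esub> f x)"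

text \<open>The copy of \<open>M\<close> along a map \<open>h\<close> that is injective on the carrier of \<open>M\<close>. It is used to move
  modules into the universe.\<close>

definition copy_mod :: "('m \<Rightarrow> 'k) \<Rightarrow> ('r, 'm) module \<Rightarrow> ('r, 'k) module" where
  "copy_mod h M = (let u = inv_into (carrier M) h in
     plain_module (h ` carrier M) (h \<zero>\<^bsub>M\<^esub>) (\<lambda>x y. h (u x \<oplus>\<^bsub>M\<^esub> u y)) (\<lambda>r x. h (r \<odot>\<^bsub>M\<^esub> u x)))"

definition copy_functor :: "('o \<Rightarrow> 'm \<Rightarrow> 'k)
    \<Rightarrow> ('o, 'a, ('r, 'm) module, 'm \<Rightarrow> 'm) ftr \<Rightarrow> ('o, 'a, ('r, 'k) module, 'k \<Rightarrow> 'k) ftr" where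
  "copy_functor j F = \<lparr>fobj = (\<lambda>M. copy_mod (j M) (fobj F M)),
     farr = (\<lambda>M N f. \<lambda>y \<in> j M ` carrier (fobj F M).
        j N (farr F M N f (inv_into (carrier (fobj F M)) (j M) y)))\<rparr>"

text \<open>The maps \<open>\<iota> i\<close> exhibit \<open>S\<close> as the direct sum of the modules \<open>X i\<close>, \<open>i \<in> I\<close>.\<close>

definition is_direct_sum :: "('r, 'z) ring_scheme \<Rightarrow> 'i set \<Rightarrow> ('i \<Rightarrow> ('r, 'm) module)
    \<Rightarrow> ('i \<Rightarrow> 'm \<Rightarrow> 'k) \<Rightarrow> ('r, 'k) module \<Rightarrow> bool" where
  "is_direct_sum R I X \<iota> S \<longleftrightarrow> (\<forall>i \<in> I. \<iota> i \<in> lin_maps R (X i) S) \<and>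
     bij_betw (\<lambda>x. \<Oplus>\<^bsub>S\<^esub>i\<in>{i \<in> I. x i \<noteq> \<zero>\<^bsub>X i\<^esub>}. \<iota> i (x i))
       {x \<in> \<Pi>\<^sub>E i\<in>I. carrier (X i). finite {i \<in> I. x i \<noteq> \<zero>\<^bsub>X i\<^esub>}} (carrier S)"


section \<open>Numerical maps and numerical functors\<close>

definition deviation :: "('x, 'p) ring_scheme \<Rightarrow> ('y, 'q) ring_scheme
    \<Rightarrow> ('x \<Rightarrow> 'y) \<Rightarrow> nat \<Rightarrow> (nat \<Rightarrow> 'x) \<Rightarrow> 'y" where
  "deviation M N \<phi> k x =
     (\<Oplus>\<^bsub>N\<^esub>S\<in>Pow {..<k}. [((-1 :: int) ^ (k - card S))] \<cdot>\<^bsub>N\<^esub> \<phi> (\<Oplus>\<^bsub>M\<^esub>i\<in>S. x i))"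

definition polynomial_map :: "nat \<Rightarrow> ('x, 'p) ring_scheme \<Rightarrow> ('y, 'q) ring_scheme
    \<Rightarrow> ('x \<Rightarrow> 'y) \<Rightarrow> bool" where
  "polynomial_map n M N \<phi> \<longleftrightarrow> \<phi> \<in> carrier M \<rightarrow> carrier N \<and>
     (\<forall>x \<in> {..<Suc n} \<rightarrow> carrier M. deviation M N \<phi> (Suc n) x = \<zero>\<^bsub>N\<^esub>)"

definition numerical_map :: "('b, 'z) ring_scheme \<Rightarrow> nat \<Rightarrow> ('b, 'x) module \<Rightarrow> ('b, 'y) module
    \<Rightarrow> ('x \<Rightarrow> 'y) \<Rightarrow> bool" where
  "numerical_map B n M N \<phi> \<longleftrightarrow> polynomial_map n M N \<phi> \<and>
     (\<forall>r \<in> carrier B. \<forall>x \<in> carrier M.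
        \<phi> (r \<odot>\<^bsub>M\<^esub> x) = (\<Oplus>\<^bsub>N\<^esub>k\<in>{..n}. binom B r k \<odot>\<^bsub>N\<^esub> deviation M N \<phi> k (\<lambda>_. x)))"

type_synonym ('b, 'm) mod_functor = "(('b, 'm) module, 'm \<Rightarrow> 'm, ('b, 'm) module, 'm \<Rightarrow> 'm) ftr"

definition numerical_functor :: "('b, 'z) ring_scheme \<Rightarrow> nat \<Rightarrow> ('b, 'm) mod_functor \<Rightarrow> bool" where
  "numerical_functor B n F \<longleftrightarrow> is_functor (fmod_cat B) (mod_cat B) F \<and>
     (\<forall>M \<in> obj (fmod_cat B). \<forall>N \<in> obj (fmod_cat B).
        numerical_map B n (Hom_mod B M N) (Hom_mod B (fobj F M) (fobj F N)) (farr F M N))"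

definition num_cat :: "('b, 'z) ring_scheme \<Rightarrow> nat
    \<Rightarrow> (('b, 'm) mod_functor, ('b, 'm) module \<Rightarrow> 'm \<Rightarrow> 'm) cat" where
  "num_cat B n = (fun_cat (fmod_cat B) (mod_cat B))\<lparr>obj := {F. numerical_functor B n F}\<rparr>"

definition Nat_mod :: "('b, 'z) ring_scheme \<Rightarrow> nat \<Rightarrow> ('b, 'm) mod_functor \<Rightarrow> ('b, 'm) mod_functor
    \<Rightarrow> ('b, ('b, 'm) module \<Rightarrow> 'm \<Rightarrow> 'm) module" where
  "Nat_mod B n Q F = plain_module (arr (num_cat B n) Q F)
     (\<lambda>M \<in> obj (fmod_cat B). \<lambda>x \<in> carrier (fobj Q M). \<zero>\<^bsub>fobj F M\<^esub>)
     (\<lambda>\<eta> \<theta>. \<lambda>M \<in> obj (fmod_cat B). \<lambda>x \<in> carrier (fobj Q M). \<eta> M x \<oplus>\<^bsub>fobj F M\<^esub> \<theta> M x)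
     (\<lambda>r \<eta>. \<lambda>M \<in> obj (fmod_cat B). \<lambda>x \<in> carrier (fobj Q M). r \<odot>\<^bsub>fobj F M\<^esub> \<eta> M x)"

text \<open>Direct sums of functors are formed pointwise. The type \<^typ>\<open>'i\<close> supplies the index sets.\<close>

definition small_object :: "'i itself \<Rightarrow> ('b, 'z) ring_scheme \<Rightarrow> nat
    \<Rightarrow> ('b, 'm) mod_functor \<Rightarrow> bool" where
  "small_object TI B n Q \<longleftrightarrow> Q \<in> obj (num_cat B n) \<and>
     (\<forall>(I :: 'i set) F S \<iota>.
        (\<forall>i \<in> I. F i \<in> obj (num_cat B n)) \<and> S \<in> obj (num_cat B n) \<and>
        (\<forall>i \<in> I. \<iota> i \<in> arr (num_cat B n) (F i) S) \<and>
        (\<forall>M \<in> obj (fmod_cat B). is_direct_sum B I (\<lambda>i. fobj (F i) M) (\<lambda>i. \<iota> i M) (fobj S M))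
        \<longrightarrow> is_direct_sum B I (\<lambda>i. Nat_mod B n Q (F i))
              (\<lambda>i. \<lambda>\<eta> \<in> arr (num_cat B n) Q (F i). cmp (num_cat B n) Q (F i) S (\<iota> i) \<eta>)
              (Nat_mod B n Q S))"


section \<open>The modules \<open>P\<^sub>n(M)\<close>\<close>

definition supp :: "('b, 'z) ring_scheme \<Rightarrow> ('x \<Rightarrow> 'b) \<Rightarrow> 'x set" where
  "supp B f = {x. f x \<noteq> \<zero>\<^bsub>B\<^esub>}"

text \<open>The formal sum \<open>\<Sum> f x [x]\<close> is encoded by its coefficient function \<open>f\<close>, and \<open>delta B x\<close> is
  \<open>[x]\<close>.  The product \<open>conv B m\<close> is the bilinear extension of \<open>[x] [y] = [m x y]\<close>.\<close>

definition delta :: "('b, 'z) ring_scheme \<Rightarrow> 'x \<Rightarrow> 'x \<Rightarrow> 'b" where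
  "delta B x = (\<lambda>y. if y = x then \<one>\<^bsub>B\<^esub> else \<zero>\<^bsub>B\<^esub>)"

definition conv :: "('b, 'z) ring_scheme \<Rightarrow> ('x \<Rightarrow> 'y \<Rightarrow> 'w) \<Rightarrow> ('x \<Rightarrow> 'b) \<Rightarrow> ('y \<Rightarrow> 'b) \<Rightarrow> 'w \<Rightarrow> 'b" where
  "conv B m f g = (\<lambda>w. \<Oplus>\<^bsub>B\<^esub>p\<in>{p \<in> supp B f \<times> supp B g. m (fst p) (snd p) = w}.
     f (fst p) \<otimes>\<^bsub>B\<^esub> g (snd p))"

definition push :: "('b, 'z) ring_scheme \<Rightarrow> ('x \<Rightarrow> 'w) \<Rightarrow> ('x \<Rightarrow> 'b) \<Rightarrow> 'w \<Rightarrow> 'b" where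
  "push B h f = (\<lambda>w. \<Oplus>\<^bsub>B\<^esub>x\<in>{x \<in> supp B f. h x = w}. f x)"

definition free_alg :: "('b, 'z) ring_scheme \<Rightarrow> ('b, 'x) module \<Rightarrow> ('b, 'x \<Rightarrow> 'b) module" where
  "free_alg B M = \<lparr>
     carrier = {f. (\<forall>x. f x \<in> carrier B) \<and> supp B f \<subseteq> carrier M \<and> finite (supp B f)},
     mult = conv B (add M), one = delta B \<zero>\<^bsub>M\<^esub>,
     zero = (\<lambda>_. \<zero>\<^bsub>B\<^esub>), add = (\<lambda>f g x. f x \<oplus>\<^bsub>B\<^esub> g x),
     smult = (\<lambda>r f x. r \<otimes>\<^bsub>B\<^esub> f x)\<rparr>"

definition Pn_relations :: "('b, 'z) ring_scheme \<Rightarrow> nat \<Rightarrow> ('b, 'x) module \<Rightarrow> ('x \<Rightarrow> 'b) set" where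
  "Pn_relations B n M =
     {deviation M (free_alg B M) (delta B) (Suc n) x | x. x \<in> {..<Suc n} \<rightarrow> carrier M} \<union>
     {delta B (r \<odot>\<^bsub>M\<^esub> x) \<ominus>\<^bsub>free_alg B M\<^esub>
        (\<Oplus>\<^bsub>free_alg B M\<^esub>k\<in>{..n}. binom B r k \<odot>\<^bsub>free_alg B M\<^esub>
           deviation M (free_alg B M) (delta B) k (\<lambda>_. x)) | r x. r \<in> carrier B \<and> x \<in> carrier M}"

text \<open>The relations are divided out as a submodule, not as an ideal for the product
  \<open>[x] [y] = [x + y]\<close>. A map on \<open>M\<close> is numerical of degree \<open>n\<close> exactly if its linear extension
  vanishes on \<^const>\<open>Pn_relations\<close>, so that \<open>P\<^sub>n(M)\<close> below is the target of the universal numerical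
  map on \<open>M\<close>. The ideal generated by the relations can be strictly larger, as \<^const>\<open>numerical_map\<close>
  is not a translation invariant condition: over the binomial ring of rational functions in \<open>t\<close>,
  the map \<open>q (a, b) = a' b - a b'\<close> on pairs is numerical of degree 2, but its translate by \<open>(1, 0)\<close>
  is not, since \<open>q (1, t) = -1\<close> while the other side of the equation for \<open>r = t\<close>, \<open>x = (0, 1)\<close>
  is 0. Whenever the submodule is an ideal, it is the ideal generated by the relations.\<close>

definition Pn_kernel :: "('b, 'z) ring_scheme \<Rightarrow> nat \<Rightarrow> ('b, 'x) module \<Rightarrow> ('x \<Rightarrow> 'b) set" where
  "Pn_kernel B n M = \<Inter>{J. submodule J B (free_alg B M) \<and> Pn_relations B n M \<subseteq> J}"

definition Pn_coset :: "('b, 'z) ring_scheme \<Rightarrow> nat \<Rightarrow> ('b, 'x) module \<Rightarrow> ('x \<Rightarrow> 'b) \<Rightarrow> ('x \<Rightarrow> 'b) set" where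
  "Pn_coset B n M f = Pn_kernel B n M +>\<^bsub>free_alg B M\<^esub> f"

definition Pn :: "('b, 'z) ring_scheme \<Rightarrow> nat \<Rightarrow> ('b, 'x) module \<Rightarrow> ('b, ('x \<Rightarrow> 'b) set) module" where
  "Pn B n M = plain_module (a_rcosets\<^bsub>free_alg B M\<^esub> (Pn_kernel B n M)) (Pn_kernel B n M)
     (set_add (free_alg B M)) (\<lambda>r X. \<Union>f\<in>X. Pn_coset B n M (r \<odot>\<^bsub>free_alg B M\<^esub> f))"

definition Pn_hom :: "('b, 'z) ring_scheme \<Rightarrow> nat \<Rightarrow> ('b, 'm) module \<Rightarrow>
    (('b, 'm) module, 'm \<Rightarrow> 'm, ('b, (('m \<Rightarrow> 'm) \<Rightarrow> 'b) set) module,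
     (('m \<Rightarrow> 'm) \<Rightarrow> 'b) set \<Rightarrow> (('m \<Rightarrow> 'm) \<Rightarrow> 'b) set) ftr" where
  "Pn_hom B n E = \<lparr>fobj = (\<lambda>M. Pn B n (Hom_mod B E M)),
     farr = (\<lambda>M N \<chi>. \<lambda>X \<in> carrier (Pn B n (Hom_mod B E M)).
        \<Union>f\<in>X. Pn_coset B n (Hom_mod B E N) (push B (compose (carrier E) \<chi>) f))\<rparr>"

text \<open>The bilinear extension of \<open>([\<alpha>], [\<tau>]) \<mapsto> [\<alpha> \<tau>]\<close> for \<open>\<alpha> : E \<rightarrow> M\<close> and \<open>\<tau> : E \<rightarrow> E\<close>.\<close>

definition Pn_comp :: "('b, 'z) ring_scheme \<Rightarrow> nat \<Rightarrow> ('b, 'm) module \<Rightarrow> ('b, 'm) module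
    \<Rightarrow> (('m \<Rightarrow> 'm) \<Rightarrow> 'b) set \<Rightarrow> (('m \<Rightarrow> 'm) \<Rightarrow> 'b) set \<Rightarrow> (('m \<Rightarrow> 'm) \<Rightarrow> 'b) set" where
  "Pn_comp B n E M X A =
     (\<Union>f\<in>X. \<Union>g\<in>A. Pn_coset B n (Hom_mod B E M) (conv B (compose (carrier E)) f g))"

definition Pn_End :: "('b, 'z) ring_scheme \<Rightarrow> nat \<Rightarrow> ('b, 'm) module
    \<Rightarrow> ((('m \<Rightarrow> 'm) \<Rightarrow> 'b) set) ring" where
  "Pn_End B n E = \<lparr>carrier = carrier (Pn B n (Hom_mod B E E)), mult = Pn_comp B n E E,
     one = Pn_coset B n (Hom_mod B E E) (delta B (\<lambda>x \<in> carrier E. x)),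
     zero = \<zero>\<^bsub>Pn B n (Hom_mod B E E)\<^esub>, add = add (Pn B n (Hom_mod B E E))\<rparr>"


section \<open>The functor \<open>\<Phi>\<close>\<close>

text \<open>The class of \<open>\<Sum> f \<tau> [\<tau>]\<close> acts on \<open>F(E)\<close> by \<open>x \<mapsto> \<Sum> f \<tau> F(\<tau>)(x)\<close>. The description requires this
  value to be the same for all representatives \<open>f\<close>.\<close>

definition Phi_smult :: "('b, 'z) ring_scheme \<Rightarrow> ('b, 'm) module \<Rightarrow> ('b, 'm) mod_functor
    \<Rightarrow> (('m \<Rightarrow> 'm) \<Rightarrow> 'b) set \<Rightarrow> 'm \<Rightarrow> 'm" where
  "Phi_smult B E F A x = (THE y. \<forall>f \<in> A.
     y = (\<Oplus>\<^bsub>fobj F E\<^esub>\<tau>\<in>supp B f. f \<tau> \<odot>\<^bsub>fobj F E\<^esub> farr F E E \<tau> x))"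

definition Phi :: "('b, 'z) ring_scheme \<Rightarrow> ('b, 'm) module \<Rightarrow>
    (('b, 'm) mod_functor, ('b, 'm) module \<Rightarrow> 'm \<Rightarrow> 'm,
     ((('m \<Rightarrow> 'm) \<Rightarrow> 'b) set, 'm) module, 'm \<Rightarrow> 'm) ftr" where
  "Phi B E = \<lparr>fobj = (\<lambda>F. plain_module (carrier (fobj F E)) \<zero>\<^bsub>fobj F E\<^esub> (add (fobj F E))
        (Phi_smult B E F)),
     farr = (\<lambda>F G \<eta>. \<eta> E)\<rparr>"

text \<open>The maps \<open>j M\<close> embed the modules \<open>P\<^sub>n(Hom(E, M))\<close> into the universe.\<close>

definition Pn_hom_embedding :: "('b, 'z) ring_scheme \<Rightarrow> nat \<Rightarrow> ('b, 'm) module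
    \<Rightarrow> (('b, 'm) module \<Rightarrow> (('m \<Rightarrow> 'm) \<Rightarrow> 'b) set \<Rightarrow> 'm) \<Rightarrow> bool" where
  "Pn_hom_embedding B n E j \<longleftrightarrow>
     (\<forall>M \<in> obj (fmod_cat B). inj_on (j M) (carrier (fobj (Pn_hom B n E) M)))"

text \<open>\<open>Nat_left\<close> is \<open>Nat(P\<^sub>n Hom(E, -), F)\<close> as a left module over \<open>P\<^sub>n(End E)\<close>, which acts by
  precomposition with the endomorphisms \<open>[\<alpha>] \<mapsto> [\<alpha> \<tau>]\<close> of \<open>P\<^sub>n Hom(E, -)\<close>.\<close>

definition Pn_hom_endo :: "('b, 'z) ring_scheme \<Rightarrow> nat \<Rightarrow> ('b, 'm) module
    \<Rightarrow> (('b, 'm) module \<Rightarrow> (('m \<Rightarrow> 'm) \<Rightarrow> 'b) set \<Rightarrow> 'm)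
    \<Rightarrow> (('m \<Rightarrow> 'm) \<Rightarrow> 'b) set \<Rightarrow> ('b, 'm) module \<Rightarrow> 'm \<Rightarrow> 'm" where
  "Pn_hom_endo B n E j A = (\<lambda>M \<in> obj (fmod_cat B).
     \<lambda>y \<in> carrier (fobj (copy_functor j (Pn_hom B n E)) M).
       j M (Pn_comp B n E M (inv_into (carrier (fobj (Pn_hom B n E) M)) (j M) y) A))"

definition Nat_left :: "('b, 'z) ring_scheme \<Rightarrow> nat \<Rightarrow> ('b, 'm) module
    \<Rightarrow> (('b, 'm) module \<Rightarrow> (('m \<Rightarrow> 'm) \<Rightarrow> 'b) set \<Rightarrow> 'm) \<Rightarrow> ('b, 'm) mod_functor
    \<Rightarrow> ((('m \<Rightarrow> 'm) \<Rightarrow> 'b) set, ('b, 'm) module \<Rightarrow> 'm \<Rightarrow> 'm) module" where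
  "Nat_left B n E j F = (let Q = copy_functor j (Pn_hom B n E) in
     plain_module (carrier (Nat_mod B n Q F)) \<zero>\<^bsub>Nat_mod B n Q F\<^esub> (add (Nat_mod B n Q F))
       (\<lambda>A \<eta>. cmp (num_cat B n) Q Q F \<eta> (Pn_hom_endo B n E j A)))"

definition eval_at_one :: "('b, 'z) ring_scheme \<Rightarrow> nat \<Rightarrow> ('b, 'm) module
    \<Rightarrow> (('b, 'm) module \<Rightarrow> (('m \<Rightarrow> 'm) \<Rightarrow> 'b) set \<Rightarrow> 'm) \<Rightarrow> ('b, 'm) mod_functor
    \<Rightarrow> (('b, 'm) module \<Rightarrow> 'm \<Rightarrow> 'm) \<Rightarrow> 'm" where
  "eval_at_one B n E j F =
     (\<lambda>\<eta> \<in> carrier (Nat_left B n E j F). \<eta> E (j E \<one>\<^bsub>Pn_End B n E\<^esub>))"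

end

theory Submission
  imports Defs "HOL-Algebra.Generated_Groups"
begin

text \<open>
  Numericality is linearity in disguise. A map on \<open>M\<close> is numerical of degree \<open>n\<close> exactly if its linear
  extension to formal sums kills the relations of \<open>P\<^sub>n(M)\<close>, so numerical maps \<open>M \<rightarrow> N\<close> are the same
  as linear maps \<open>P\<^sub>n(M) \<rightarrow> N\<close> (\<open>lift_lin\<close>, \<open>lift_unique\<close>). Composition of linear maps is linear
  in each factor, hence induces bilinear compositions between the modules
  \<open>P M N = P\<^sub>n(Hom(M, N))\<close> (\<open>Pn_comp_eq_comp\<close>). These are the arrow modules of a linear category, and
  a numerical functor \<open>F\<close> is the same as a linear action \<open>P M N \<rightarrow> Hom(F(M), F(N))\<close> of this category
  (\<open>act_comp\<close>, \<open>numerical_into_linear\<close>). The theorem thereby becomes Morita theory: the functor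
  represented by \<open>E = B\<^sup>n\<close> is \<open>P\<^sub>nHom(E, -)\<close>, the Yoneda lemma gives \<open>Nat(P\<^sub>nHom(E, -), F) = F(E)\<close>, and what
  remains is that \<open>E\<close> generates the linear category.

  The degree enters here. The identity of a free module \<open>M\<close> is the sum of its coordinate
  projections. As the map \<open>\<chi> \<mapsto> [\<chi>]\<close> is polynomial of degree \<open>n\<close>, the class \<open>[1]\<close> is an integral
  combination of classes of partial sums with at most \<open>n\<close> terms (\<open>polynomial_map_sum\<close>), and these
  factor through \<open>E\<close>. So \<open>[1] = \<Sum> A\<^sub>i C\<^sub>i\<close> with \<open>C\<^sub>i\<close> in \<open>P M E\<close> and \<open>A\<^sub>i\<close> in \<open>P E M\<close>
  (\<open>ident_decomposition\<close>), and every \<open>x\<close> in \<open>F(M)\<close> is \<open>\<Sum> A\<^sub>i (C\<^sub>i x)\<close> with \<open>C\<^sub>i x\<close> in \<open>F(E)\<close>. Hence \<open>\<Phi>\<close> is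
  faithful and full (\<open>nat_trans_faithful\<close>, \<open>nat_trans_full\<close>).

  For essential surjectivity, a module \<open>A\<close> over \<open>R = P E E\<close> is the value at \<open>E\<close> of the functor
  \<open>M \<mapsto> Hom\<^sub>R(P M E, A)\<close>. Its elements are functions, determined by finitely many values because of the
  decomposition of \<open>[1]\<close>, so the functor can be moved into the universe. The same is done for
  \<open>P\<^sub>nHom(E, -)\<close>: a nontrivial binomial ring is infinite, and an infinite set has room for the finite
  lists of its elements.

  Evaluation at \<open>E\<close> commutes with pointwise direct sums, which gives smallness; by faithfulness it
  separates natural transformations, which gives the generator. Projectivity needs that an
  epimorphism \<open>p\<close> is surjective at \<open>E\<close>: the cokernel of \<open>p\<^sub>E\<close> is a value of \<open>\<Phi>\<close>, and by fullness the
  projection onto it is natural (\<open>epi_surjective_at_E\<close>).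
\<close>

section \<open>Additive maps and left modules\<close>

lemma abelian_group_hom_of_additive:
  assumes "abelian_group G" "abelian_group H" "h \<in> carrier G \<rightarrow> carrier H"
    and "\<And>x y. \<lbrakk>x \<in> carrier G; y \<in> carrier G\<rbrakk> \<Longrightarrow> h (x \<oplus>\<^bsub>G\<^esub> y) = h x \<oplus>\<^bsub>H\<^esub> h y"
  shows "abelian_group_hom G H h"
  using assms by (intro abelian_group_homI group_hom.intro group_hom_axioms.intro)
    (auto simp: hom_def abelian_group.a_group)

context abelian_group_hom
begin

lemma hom_finsum: "f \<in> A \<rightarrow> carrier G \<Longrightarrow> h (finsum G f A) = (\<Oplus>\<^bsub>H\<^esub>i\<in>A. h (f i))"
proof (induct A rule: infinite_finite_induct)
  case (insert a A)
  have fA: "f \<in> A \<rightarrow> carrier G" and fa: "f a \<in> carrier G" using insert.prems by auto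
  have "h (finsum G f (insert a A)) = h (f a \<oplus>\<^bsub>G\<^esub> finsum G f A)"
    using G.finsum_insert[OF insert.hyps(1,2) fA fa] by simp
  also have "\<dots> = h (f a) \<oplus>\<^bsub>H\<^esub> (\<Oplus>\<^bsub>H\<^esub>i\<in>A. h (f i))"
    using insert.hyps(3)[OF fA] fa G.finsum_closed[OF fA] by (simp add: hom_add)
  also have "\<dots> = (\<Oplus>\<^bsub>H\<^esub>i\<in>insert a A. h (f i))"
    using insert.hyps(1,2) fA fa hom_closed
    by (intro H.finsum_insert[symmetric]) (auto simp: Pi_iff)
  finally show ?case .
qed simp_all

lemma hom_add_pow: "x \<in> carrier G \<Longrightarrow> h ([(k::int)] \<cdot>\<^bsub>G\<^esub> x) = [k] \<cdot>\<^bsub>H\<^esub> h x"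
  using group_hom.hom_int_pow[OF group_hom.intro, of "add_monoid G" "add_monoid H" h x k]
    a_group_hom G.a_group H.a_group by (simp add: add_pow_def group_hom_def)

lemma hom_deviation:
  assumes "\<phi> \<in> carrier M \<rightarrow> carrier G" "abelian_group M" "x \<in> {..<k} \<rightarrow> carrier M"
  shows "h (deviation M G \<phi> k x) = deviation M H (\<lambda>y. h (\<phi> y)) k x"
proof -
  interpret M: abelian_group M by fact
  have *: "(\<Oplus>\<^bsub>M\<^esub>i\<in>S. x i) \<in> carrier M" if "S \<in> Pow {..<k}" for S
    using assms(3) that by (intro M.finsum_closed) auto
  have c: "\<phi> (\<Oplus>\<^bsub>M\<^esub>i\<in>S. x i) \<in> carrier G" if "S \<in> Pow {..<k}" for S
    using *[OF that] assms(1) by auto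
  show ?thesis unfolding deviation_def
    apply (subst hom_finsum)
    using c apply (auto intro!: G.add.int_pow_closed)[1]
    apply (rule H.finsum_cong')
    using c by (auto simp: hom_add_pow)
qed

lemma deviation_hom:
  assumes "\<phi> \<in> carrier H \<rightarrow> carrier N" "abelian_group N" "x \<in> {..<k} \<rightarrow> carrier G"
  shows "deviation G N (\<lambda>y. \<phi> (h y)) k x = deviation H N \<phi> k (\<lambda>i. h (x i))"
proof -
  interpret N: abelian_group N by fact
  have *: "(\<Oplus>\<^bsub>G\<^esub>i\<in>S. x i) \<in> carrier G \<and> h (\<Oplus>\<^bsub>G\<^esub>i\<in>S. x i) = (\<Oplus>\<^bsub>H\<^esub>i\<in>S. h (x i))"
    if "S \<in> Pow {..<k}" for S
    using assms(3) that by (intro conjI G.finsum_closed hom_finsum) auto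
  have c: "\<phi> (\<Oplus>\<^bsub>H\<^esub>i\<in>S. h (x i)) \<in> carrier N" if "S \<in> Pow {..<k}" for S
    using *[OF that] assms(1) hom_closed by (metis Pi_mem)
  show ?thesis unfolding deviation_def
    apply (rule N.finsum_cong')
    using c * by (auto intro!: N.add.int_pow_closed)
qed

end

lemma deviation_closed:
  assumes "abelian_group M" "abelian_group N" "\<phi> \<in> carrier M \<rightarrow> carrier N" "x \<in> {..<k} \<rightarrow> carrier M"
  shows "deviation M N \<phi> k x \<in> carrier N"
proof -
  interpret M: abelian_group M by fact
  interpret N: abelian_group N by fact
  have "\<phi> (\<Oplus>\<^bsub>M\<^esub>i\<in>S. x i) \<in> carrier N" if "S \<in> Pow {..<k}" for S
    using assms(3,4) that by (auto intro!: M.finsum_closed Pi_mem[OF assms(3)])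
  then show ?thesis unfolding deviation_def
    by (intro N.finsum_closed) (auto intro!: N.add.int_pow_closed)
qed

lemma deviation_cong:
  assumes "abelian_group M" "abelian_group N" "\<psi> \<in> carrier M \<rightarrow> carrier N" "x \<in> {..<k} \<rightarrow> carrier M"
    and "\<And>y. y \<in> carrier M \<Longrightarrow> \<phi> y = \<psi> y"
  shows "deviation M N \<phi> k x = deviation M N \<psi> k x"
proof -
  interpret M: abelian_group M by fact
  interpret N: abelian_group N by fact
  have *: "(\<Oplus>\<^bsub>M\<^esub>i\<in>S. x i) \<in> carrier M" if "S \<in> Pow {..<k}" for S
    using assms(4) that by (intro M.finsum_closed) auto
  show ?thesis unfolding deviation_def
    apply (rule N.finsum_cong')
    using * assms(3,5) by (auto intro!: N.add.int_pow_closed Pi_mem[OF assms(3)])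
qed

context left_module
begin

lemma hom_smult_scalar:
  assumes "x \<in> carrier M" shows "abelian_group_hom R M (\<lambda>a. a \<odot>\<^bsub>M\<^esub> x)"
  by (rule abelian_group_hom_of_additive)
    (auto simp: assms smult_closed smult_l_distr R.abelian_group_axioms M.abelian_group_axioms)

lemma hom_smult_vector:
  assumes "a \<in> carrier R" shows "abelian_group_hom M M (\<lambda>x. a \<odot>\<^bsub>M\<^esub> x)"
  by (rule abelian_group_hom_of_additive)
    (auto simp: assms smult_closed smult_r_distr M.abelian_group_axioms)

lemma smult_l_null: "x \<in> carrier M \<Longrightarrow> \<zero>\<^bsub>R\<^esub> \<odot>\<^bsub>M\<^esub> x = \<zero>\<^bsub>M\<^esub>"
  using abelian_group_hom.hom_zero[OF hom_smult_scalar] .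

lemma smult_r_null: "a \<in> carrier R \<Longrightarrow> a \<odot>\<^bsub>M\<^esub> \<zero>\<^bsub>M\<^esub> = \<zero>\<^bsub>M\<^esub>"
  using abelian_group_hom.hom_zero[OF hom_smult_vector] .

lemma smult_minus_one: "x \<in> carrier M \<Longrightarrow> (\<ominus>\<^bsub>R\<^esub> \<one>\<^bsub>R\<^esub>) \<odot>\<^bsub>M\<^esub> x = \<ominus>\<^bsub>M\<^esub> x"
  using abelian_group_hom.hom_a_inv[OF hom_smult_scalar, of x "\<one>\<^bsub>R\<^esub>"] by (simp add: smult_one)

lemma finsum_smult_r: "\<lbrakk>a \<in> carrier R; f \<in> A \<rightarrow> carrier M\<rbrakk>
    \<Longrightarrow> a \<odot>\<^bsub>M\<^esub> finsum M f A = (\<Oplus>\<^bsub>M\<^esub>i\<in>A. a \<odot>\<^bsub>M\<^esub> f i)"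
  using abelian_group_hom.hom_finsum[OF hom_smult_vector] .

end

text \<open>The axioms are equations, apart from the existence of negatives, and equations can be tested
  after an injective map that respects the operations. The negative of \<open>x\<close> is \<open>(- 1) x\<close>.\<close>

lemma left_module_by_embedding:
  fixes N :: "('r, 'n) module"
  assumes M: "left_module R M" and f: "f \<in> carrier N \<rightarrow> carrier M" "inj_on f (carrier N)"
    and zero: "\<zero>\<^bsub>N\<^esub> \<in> carrier N" "f \<zero>\<^bsub>N\<^esub> = \<zero>\<^bsub>M\<^esub>"
    and add: "\<And>x y. \<lbrakk>x \<in> carrier N; y \<in> carrier N\<rbrakk> \<Longrightarrow> x \<oplus>\<^bsub>N\<^esub> y \<in> carrier N"
      "\<And>x y. \<lbrakk>x \<in> carrier N; y \<in> carrier N\<rbrakk> \<Longrightarrow> f (x \<oplus>\<^bsub>N\<^esub> y) = f x \<oplus>\<^bsub>M\<^esub> f y"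
    and smult: "\<And>a x. \<lbrakk>a \<in> carrier R; x \<in> carrier N\<rbrakk> \<Longrightarrow> a \<odot>\<^bsub>N\<^esub> x \<in> carrier N"
      "\<And>a x. \<lbrakk>a \<in> carrier R; x \<in> carrier N\<rbrakk> \<Longrightarrow> f (a \<odot>\<^bsub>N\<^esub> x) = a \<odot>\<^bsub>M\<^esub> f x"
  shows "left_module R N"
proof -
  interpret M: left_module R M by fact
  have fc: "x \<in> carrier N \<Longrightarrow> f x \<in> carrier M" for x using f by auto
  have eq: "x = y" if "f x = f y" "x \<in> carrier N" "y \<in> carrier N" for x y
    using f(2) that by (auto dest: inj_onD)
  have "abelian_group N"
  proof (rule abelian_groupI)
    fix x assume x: "x \<in> carrier N"
    have "f ((\<ominus>\<^bsub>R\<^esub> \<one>\<^bsub>R\<^esub>) \<odot>\<^bsub>N\<^esub> x \<oplus>\<^bsub>N\<^esub> x) = f \<zero>\<^bsub>N\<^esub>"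
      using x by (simp add: add smult zero M.smult_minus_one fc M.l_neg)
    then have "(\<ominus>\<^bsub>R\<^esub> \<one>\<^bsub>R\<^esub>) \<odot>\<^bsub>N\<^esub> x \<oplus>\<^bsub>N\<^esub> x = \<zero>\<^bsub>N\<^esub>"
      using x by (intro eq) (auto simp: add smult zero)
    then show "\<exists>y\<in>carrier N. y \<oplus>\<^bsub>N\<^esub> x = \<zero>\<^bsub>N\<^esub>"
      using x smult by blast
  qed (auto intro!: eq simp: add zero fc M.a_ac)
  then show ?thesis
    by (intro left_module.intro left_module_axioms.intro M.R.ring_axioms)
      (auto intro!: eq simp: add zero fc smult M.smult_l_distr M.smult_r_distr M.smult_assoc1
        M.smult_one M.smult_closed)
qed

lemma plain_module_simps [simp]:
  "carrier (plain_module A z a s) = A" "zero (plain_module A z a s) = z"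
  "add (plain_module A z a s) = a" "smult (plain_module A z a s) = s"
  by (simp_all add: plain_module_def)


section \<open>Linear maps\<close>

lemma lin_mapsI:
  assumes "f \<in> carrier M \<rightarrow> carrier N" "f \<in> extensional (carrier M)"
    and "\<And>x y. \<lbrakk>x \<in> carrier M; y \<in> carrier M\<rbrakk> \<Longrightarrow> f (x \<oplus>\<^bsub>M\<^esub> y) = f x \<oplus>\<^bsub>N\<^esub> f y"
    and "\<And>r x. \<lbrakk>r \<in> carrier R; x \<in> carrier M\<rbrakk> \<Longrightarrow> f (r \<odot>\<^bsub>M\<^esub> x) = r \<odot>\<^bsub>N\<^esub> f x"
  shows "f \<in> lin_maps R M N"
  using assms unfolding lin_maps_def PiE_def by blast

lemma lin_maps_restrictI:
  assumes "left_module R M" "\<And>x. x \<in> carrier M \<Longrightarrow> f x \<in> carrier N"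
    and "\<And>x y. \<lbrakk>x \<in> carrier M; y \<in> carrier M\<rbrakk> \<Longrightarrow> f (x \<oplus>\<^bsub>M\<^esub> y) = f x \<oplus>\<^bsub>N\<^esub> f y"
    and "\<And>r x. \<lbrakk>r \<in> carrier R; x \<in> carrier M\<rbrakk> \<Longrightarrow> f (r \<odot>\<^bsub>M\<^esub> x) = r \<odot>\<^bsub>N\<^esub> f x"
  shows "(\<lambda>x\<in>carrier M. f x) \<in> lin_maps R M N"
proof -
  interpret left_module R M by fact
  show ?thesis by (rule lin_mapsI) (auto simp: assms smult_closed)
qed

lemma
  assumes "f \<in> lin_maps R M N"
  shows lin_maps_closed: "x \<in> carrier M \<Longrightarrow> f x \<in> carrier N"
    and lin_maps_add: "\<lbrakk>x \<in> carrier M; y \<in> carrier M\<rbrakk> \<Longrightarrow> f (x \<oplus>\<^bsub>M\<^esub> y) = f x \<oplus>\<^bsub>N\<^esub> f y"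
    and lin_maps_smult: "\<lbrakk>r \<in> carrier R; x \<in> carrier M\<rbrakk> \<Longrightarrow> f (r \<odot>\<^bsub>M\<^esub> x) = r \<odot>\<^bsub>N\<^esub> f x"
    and lin_maps_extensional: "f \<in> extensional (carrier M)"
  using assms by (auto simp: lin_maps_def PiE_def)

lemma lin_maps_eqI:
  assumes "f \<in> lin_maps R M N" "g \<in> lin_maps R M N'" "\<And>x. x \<in> carrier M \<Longrightarrow> f x = g x"
  shows "f = g"
  using assms(1,2)[THEN lin_maps_extensional] assms(3) by (rule extensionalityI)

lemma lin_maps_hom:
  assumes "left_module R M" "left_module R N" "f \<in> lin_maps R M N"
  shows "abelian_group_hom M N f"
  using assms lin_maps_closed[OF assms(3)] lin_maps_add[OF assms(3)]
  by (intro abelian_group_hom_of_additive) (auto simp: left_module_def)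

lemma lin_maps_zero:
  assumes "left_module R M" "left_module R N" "f \<in> lin_maps R M N"
  shows "f \<zero>\<^bsub>M\<^esub> = \<zero>\<^bsub>N\<^esub>"
  by (rule abelian_group_hom.hom_zero[OF lin_maps_hom[OF assms]])

lemma lin_maps_finsum:
  assumes "left_module R M" "left_module R N" "f \<in> lin_maps R M N" "g \<in> A \<rightarrow> carrier M"
  shows "f (finsum M g A) = (\<Oplus>\<^bsub>N\<^esub>i\<in>A. f (g i))"
  by (rule abelian_group_hom.hom_finsum[OF lin_maps_hom[OF assms(1-3)] assms(4)])

lemma lin_maps_compose:
  assumes "left_module R L" "f \<in> lin_maps R L M" "g \<in> lin_maps R M N"
  shows "compose (carrier L) g f \<in> lin_maps R L N"
proof -
  interpret left_module R L by fact
  show ?thesis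
    using lin_maps_closed[OF assms(2)] lin_maps_closed[OF assms(3)]
    by (intro lin_mapsI)
      (auto simp: compose_def smult_closed lin_maps_add[OF assms(2)] lin_maps_add[OF assms(3)]
        lin_maps_smult[OF assms(2)] lin_maps_smult[OF assms(3)])
qed

lemma lin_maps_ident: "left_module R M \<Longrightarrow> (\<lambda>x\<in>carrier M. x) \<in> lin_maps R M M"
  by (rule lin_maps_restrictI) auto

lemma category_mod_cat: "category (mod_cat R)"
proof
  fix W X Y Z and f g h
  show "ident (mod_cat R) X \<in> arr (mod_cat R) X X" if "X \<in> obj (mod_cat R)"
    using that by (simp add: mod_cat_def lin_maps_ident)
  show "cmp (mod_cat R) X Y Z g f \<in> arr (mod_cat R) X Z"
    if "X \<in> obj (mod_cat R)" "f \<in> arr (mod_cat R) X Y" "g \<in> arr (mod_cat R) Y Z"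
    using that by (simp add: mod_cat_def lin_maps_compose)
  show "cmp (mod_cat R) X X Y f (ident (mod_cat R) X) = f" if "f \<in> arr (mod_cat R) X Y"
    using lin_maps_extensional[of f R X Y] that
    by (auto simp: mod_cat_def compose_def fun_eq_iff extensional_def)
  show "cmp (mod_cat R) X Y Y (ident (mod_cat R) Y) f = f" if "f \<in> arr (mod_cat R) X Y"
    using lin_maps_extensional[of f R X Y] that
    by (auto simp: mod_cat_def compose_def fun_eq_iff extensional_def lin_maps_closed)
  show "cmp (mod_cat R) W Y Z h (cmp (mod_cat R) W X Y g f)
      = cmp (mod_cat R) W X Z (cmp (mod_cat R) X Y Z h g) f" if "f \<in> arr (mod_cat R) W X"
    using that by (auto simp: mod_cat_def compose_def lin_maps_closed fun_eq_iff)
qed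

section \<open>Functor categories and equivalences\<close>

lemma category_restrict_obj: "\<lbrakk>category C; Q \<subseteq> obj C\<rbrakk> \<Longrightarrow> category (C\<lparr>obj := Q\<rparr>)"
  unfolding category_def by (simp add: subset_iff)

lemma
  assumes "\<eta> \<in> nat_trans C D F G"
  shows nat_trans_arr: "X \<in> obj C \<Longrightarrow> \<eta> X \<in> arr D (fobj F X) (fobj G X)"
    and nat_trans_natural: "\<lbrakk>X \<in> obj C; Y \<in> obj C; f \<in> arr C X Y\<rbrakk>
      \<Longrightarrow> cmp D (fobj F X) (fobj F Y) (fobj G Y) (\<eta> Y) (farr F X Y f)
        = cmp D (fobj F X) (fobj G X) (fobj G Y) (farr G X Y f) (\<eta> X)"
    and nat_trans_extensional: "\<eta> \<in> extensional (obj C)"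
  using assms by (auto simp: nat_trans_def)

lemma nat_transI:
  assumes "\<eta> \<in> extensional (obj C)" "\<And>X. X \<in> obj C \<Longrightarrow> \<eta> X \<in> arr D (fobj F X) (fobj G X)"
    and "\<And>X Y f. \<lbrakk>X \<in> obj C; Y \<in> obj C; f \<in> arr C X Y\<rbrakk>
      \<Longrightarrow> cmp D (fobj F X) (fobj F Y) (fobj G Y) (\<eta> Y) (farr F X Y f)
        = cmp D (fobj F X) (fobj G X) (fobj G Y) (farr G X Y f) (\<eta> X)"
  shows "\<eta> \<in> nat_trans C D F G"
  using assms by (auto simp: nat_trans_def)

lemma
  assumes "is_functor C D F"
  shows functor_source: "category C" and functor_target: "category D"
    and functor_obj: "X \<in> obj C \<Longrightarrow> fobj F X \<in> obj D"
    and functor_arr: "\<lbrakk>X \<in> obj C; Y \<in> obj C; f \<in> arr C X Y\<rbrakk>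
      \<Longrightarrow> farr F X Y f \<in> arr D (fobj F X) (fobj F Y)"
    and functor_ident: "X \<in> obj C \<Longrightarrow> farr F X X (ident C X) = ident D (fobj F X)"
    and functor_cmp: "\<lbrakk>X \<in> obj C; Y \<in> obj C; Z \<in> obj C; f \<in> arr C X Y; g \<in> arr C Y Z\<rbrakk>
      \<Longrightarrow> farr F X Z (cmp C X Y Z g f)
        = cmp D (fobj F X) (fobj F Y) (fobj F Z) (farr F Y Z g) (farr F X Y f)"
  using assms unfolding is_functor_def by blast+

lemma category_fun_cat:
  assumes "category C" "category D"
  shows "category (fun_cat C D)"
proof -
  interpret C: category C by fact
  interpret D: category D by fact
  note D_rules = D.cmp_assoc D.cmp_ident D.ident_cmp D.cmp_arr D.ident_arr
  show ?thesis
  proof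
    fix F G H K :: "('a, 'b, 'c, 'd) ftr" and \<eta> \<theta> \<mu>
    let ?A = "fun_cat C D"
    show "ident ?A F \<in> arr ?A F F" if "F \<in> obj ?A"
      using that by (auto simp: fun_cat_def D_rules functor_obj functor_arr intro!: nat_transI)
    show "cmp ?A F G H \<theta> \<eta> \<in> arr ?A F H"
      if o: "F \<in> obj ?A" "G \<in> obj ?A" "H \<in> obj ?A" and "\<eta> \<in> arr ?A F G" "\<theta> \<in> arr ?A G H"
    proof -
      have F: "is_functor C D F" "is_functor C D G" "is_functor C D H"
        and n: "\<eta> \<in> nat_trans C D F G" "\<theta> \<in> nat_trans C D G H"
        using that by (simp_all add: fun_cat_def)
      note ob = F[THEN functor_obj] and ar = F[THEN functor_arr]
        and tr = n[THEN nat_trans_arr] and nat = n[THEN nat_trans_natural]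
      have "cmp D (fobj F X) (fobj F Y) (fobj H Y)
            (cmp D (fobj F Y) (fobj G Y) (fobj H Y) (\<theta> Y) (\<eta> Y)) (farr F X Y f)
          = cmp D (fobj F X) (fobj H X) (fobj H Y) (farr H X Y f)
            (cmp D (fobj F X) (fobj G X) (fobj H X) (\<theta> X) (\<eta> X))" (is "?l = ?r")
        if X: "X \<in> obj C" "Y \<in> obj C" "f \<in> arr C X Y" for X Y f
      proof -
        have "?l = cmp D (fobj F X) (fobj G Y) (fobj H Y) (\<theta> Y)
            (cmp D (fobj F X) (fobj F Y) (fobj G Y) (\<eta> Y) (farr F X Y f))"
          using X by (intro D.cmp_assoc[symmetric] ob ar tr) auto
        also have "\<dots> = cmp D (fobj F X) (fobj G Y) (fobj H Y) (\<theta> Y)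
            (cmp D (fobj F X) (fobj G X) (fobj G Y) (farr G X Y f) (\<eta> X))"
          using X by (simp only: nat)
        also have "\<dots> = cmp D (fobj F X) (fobj G X) (fobj H Y)
            (cmp D (fobj G X) (fobj G Y) (fobj H Y) (\<theta> Y) (farr G X Y f)) (\<eta> X)"
          using X by (intro D.cmp_assoc ob ar tr) auto
        also have "\<dots> = cmp D (fobj F X) (fobj G X) (fobj H Y)
            (cmp D (fobj G X) (fobj H X) (fobj H Y) (farr H X Y f) (\<theta> X)) (\<eta> X)"
          using X by (simp only: nat)
        also have "\<dots> = ?r"
          using X by (intro D.cmp_assoc[symmetric] ob ar tr) auto
        finally show ?thesis .
      qed
      then show ?thesis
        using ob tr by (auto simp: fun_cat_def intro!: nat_transI D.cmp_arr)
    qed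
    show "cmp ?A F F G \<eta> (ident ?A F) = \<eta>" if "F \<in> obj ?A" "G \<in> obj ?A" "\<eta> \<in> arr ?A F G"
      using that by (auto simp: fun_cat_def D_rules functor_obj nat_trans_arr
          intro!: extensionalityI[OF restrict_extensional nat_trans_extensional])
    show "cmp ?A F G G (ident ?A G) \<eta> = \<eta>" if "F \<in> obj ?A" "G \<in> obj ?A" "\<eta> \<in> arr ?A F G"
      using that by (auto simp: fun_cat_def D_rules functor_obj nat_trans_arr
          intro!: extensionalityI[OF restrict_extensional nat_trans_extensional])
    show "cmp ?A F G K \<mu> (cmp ?A F H G \<theta> \<eta>) = cmp ?A F H K (cmp ?A H G K \<mu> \<theta>) \<eta>"
      if "F \<in> obj ?A" "H \<in> obj ?A" "G \<in> obj ?A" "K \<in> obj ?A"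
        "\<eta> \<in> arr ?A F H" "\<theta> \<in> arr ?A H G" "\<mu> \<in> arr ?A G K"
      using that by (auto simp: fun_cat_def fun_eq_iff
          intro!: D.cmp_assoc functor_obj nat_trans_arr)
  qed
qed

text \<open>A quasi-inverse of \<open>F\<close> picks, for each object \<open>Y\<close>, an object that \<open>F\<close> sends to an isomorphic
  copy of \<open>Y\<close>, and transports arrows along these isomorphisms.\<close>

lemma equivalence_functorI:
  assumes F: "is_functor C D F"
    and full_faithful: "\<And>X Y g. \<lbrakk>X \<in> obj C; Y \<in> obj C; g \<in> arr D (fobj F X) (fobj F Y)\<rbrakk>
      \<Longrightarrow> \<exists>!f. f \<in> arr C X Y \<and> farr F X Y f = g"
    and ess_surj: "\<And>Y. Y \<in> obj D \<Longrightarrow> \<exists>X \<in> obj C. \<exists>i. iso_arrow D (fobj F X) Y i"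
  shows "equivalence_functor C D F"
proof -
  interpret C: category C using F by (rule functor_source)
  interpret D: category D using F by (rule functor_target)
  note ob = functor_obj[OF F] and ar = functor_arr[OF F]
  define G0 where "G0 Y = (SOME X. X \<in> obj C \<and> (\<exists>i. iso_arrow D (fobj F X) Y i))" for Y
  define i where "i Y = (SOME i. iso_arrow D (fobj F (G0 Y)) Y i)" for Y
  have G0: "G0 Y \<in> obj C" "iso_arrow D (fobj F (G0 Y)) Y (i Y)" if "Y \<in> obj D" for Y
  proof -
    have "G0 Y \<in> obj C \<and> (\<exists>i. iso_arrow D (fobj F (G0 Y)) Y i)"
      unfolding G0_def by (rule someI_ex) (use ess_surj[OF that] in blast)
    then show "G0 Y \<in> obj C" "iso_arrow D (fobj F (G0 Y)) Y (i Y)"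
      unfolding i_def by (auto intro: someI_ex)
  qed
  define i' where "i' Y = (SOME g. g \<in> arr D Y (fobj F (G0 Y)) \<and>
      cmp D (fobj F (G0 Y)) Y (fobj F (G0 Y)) g (i Y) = ident D (fobj F (G0 Y)) \<and>
      cmp D Y (fobj F (G0 Y)) Y (i Y) g = ident D Y)" for Y
  have i: "i Y \<in> arr D (fobj F (G0 Y)) Y" if "Y \<in> obj D" for Y
    using G0(2)[OF that] by (simp add: iso_arrow_def)
  have i': "i' Y \<in> arr D Y (fobj F (G0 Y)) \<and>
      cmp D (fobj F (G0 Y)) Y (fobj F (G0 Y)) (i' Y) (i Y) = ident D (fobj F (G0 Y)) \<and>
      cmp D Y (fobj F (G0 Y)) Y (i Y) (i' Y) = ident D Y" if "Y \<in> obj D" for Y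
    unfolding i'_def by (rule someI_ex) (use G0(2)[OF that] in \<open>auto simp: iso_arrow_def\<close>)
  define L where "L X Y g = (THE f. f \<in> arr C X Y \<and> farr F X Y f = g)" for X Y g
  have L: "L X Y g \<in> arr C X Y" "farr F X Y (L X Y g) = g"
    if "X \<in> obj C" "Y \<in> obj C" "g \<in> arr D (fobj F X) (fobj F Y)" for X Y g
    using theI'[OF full_faithful[OF that]] unfolding L_def by auto
  have faithful: "f = g" if "X \<in> obj C" "Y \<in> obj C" "f \<in> arr C X Y" "g \<in> arr C X Y"
      "farr F X Y f = farr F X Y g" for X Y f g
    using full_faithful[OF that(1,2) ar[OF that(1-3)]] that by metis
  \<comment> \<open>conjugation by the chosen isomorphisms\<close>
  define k where "k Y Z g = cmp D (fobj F (G0 Y)) Z (fobj F (G0 Z)) (i' Z)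
      (cmp D (fobj F (G0 Y)) Y Z g (i Y))" for Y Z g
  define G where "G = \<lparr>fobj = G0, farr = (\<lambda>Y Z g. L (G0 Y) (G0 Z) (k Y Z g))\<rparr>"
  have k: "k Y Z g \<in> arr D (fobj F (G0 Y)) (fobj F (G0 Z))"
    if "Y \<in> obj D" "Z \<in> obj D" "g \<in> arr D Y Z" for Y Z g
    unfolding k_def using that i i' G0(1) by (auto intro!: D.cmp_arr ob)
  have ik: "cmp D (fobj F (G0 Y)) (fobj F (G0 Z)) Z (i Z) (k Y Z g)
      = cmp D (fobj F (G0 Y)) Y Z g (i Y)" (is "?l = ?r")
    if "Y \<in> obj D" "Z \<in> obj D" "g \<in> arr D Y Z" for Y Z g
  proof -
    have "?l = cmp D (fobj F (G0 Y)) Z Z (cmp D Z (fobj F (G0 Z)) Z (i Z) (i' Z)) ?r"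
      unfolding k_def using that i i' G0(1) by (intro D.cmp_assoc D.cmp_arr ob) auto
    also have "\<dots> = ?r"
      using that i i' G0(1) by (auto intro!: D.ident_cmp D.cmp_arr ob)
    finally show ?thesis .
  qed
  \<comment> \<open>left cancellation of the isomorphisms\<close>
  have i_cancel: "f = g" if Y: "Y \<in> obj D" "W \<in> obj D"
      and fg: "f \<in> arr D W (fobj F (G0 Y))" "g \<in> arr D W (fobj F (G0 Y))"
      and e: "cmp D W (fobj F (G0 Y)) Y (i Y) f = cmp D W (fobj F (G0 Y)) Y (i Y) g" for Y W f g
  proof -
    have "cmp D W Y (fobj F (G0 Y)) (i' Y) (cmp D W (fobj F (G0 Y)) Y (i Y) h) = h"
      if "h \<in> arr D W (fobj F (G0 Y))" for h
      using D.cmp_assoc[OF Y(2) ob[OF G0(1)[OF Y(1)]] Y(1) ob[OF G0(1)[OF Y(1)]] that i[OF Y(1)]]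
        i'[OF Y(1)] D.ident_cmp[OF Y(2) ob[OF G0(1)[OF Y(1)]] that] by auto
    then show ?thesis using fg e by metis
  qed
  have FG: "farr F (G0 Y) (G0 Z) (farr G Y Z g) = k Y Z g"
    and G_arr: "farr G Y Z g \<in> arr C (G0 Y) (G0 Z)"
    if "Y \<in> obj D" "Z \<in> obj D" "g \<in> arr D Y Z" for Y Z g
    using L[OF G0(1)[OF that(1)] G0(1)[OF that(2)] k[OF that]] by (simp_all add: G_def)
  have G: "is_functor D C G"
    unfolding is_functor_def
  proof (intro conjI ballI C.category_axioms D.category_axioms)
    fix Y assume Y: "Y \<in> obj D"
    show "fobj G Y \<in> obj C" using G0[OF Y] by (simp add: G_def)
    have "k Y Y (ident D Y) = ident D (fobj F (G0 Y))"
      unfolding k_def using Y i[OF Y] i'[OF Y] by (simp add: D.ident_cmp ob G0(1))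
    then show "farr G Y Y (ident D Y) = ident C (fobj G Y)"
      using FG[OF Y Y D.ident_arr[OF Y]] G_arr[OF Y Y D.ident_arr[OF Y]] G0(1)[OF Y]
      by (intro faithful) (auto simp: G_def functor_ident[OF F] C.ident_arr)
  next
    fix Y Z g assume "Y \<in> obj D" "Z \<in> obj D" "g \<in> arr D Y Z"
    then show "farr G Y Z g \<in> arr C (fobj G Y) (fobj G Z)"
      using G_arr by (simp add: G_def)
  next
    fix X Y Z f g assume X: "X \<in> obj D" "Y \<in> obj D" "Z \<in> obj D"
      and f: "f \<in> arr D X Y" and g: "g \<in> arr D Y Z"
    note O = X ob[OF G0(1)[OF X(1)]] ob[OF G0(1)[OF X(2)]] ob[OF G0(1)[OF X(3)]]
    have gf: "cmp D X Y Z g f \<in> arr D X Z" using X f g by (intro D.cmp_arr)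
    note K = k[OF X(1,2) f] k[OF X(2,3) g]
    have c: "cmp D (fobj F (G0 X)) (fobj F (G0 Y)) (fobj F (G0 Z)) (k Y Z g) (k X Y f)
        = k X Z (cmp D X Y Z g f)" (is "?l = _")
    proof (rule i_cancel)
      have "cmp D (fobj F (G0 X)) (fobj F (G0 Z)) Z (i Z) ?l
          = cmp D (fobj F (G0 X)) (fobj F (G0 Y)) Z
              (cmp D (fobj F (G0 Y)) (fobj F (G0 Z)) Z (i Z) (k Y Z g)) (k X Y f)"
        using O K i X by (intro D.cmp_assoc) auto
      also have "\<dots> = cmp D (fobj F (G0 X)) (fobj F (G0 Y)) Z
              (cmp D (fobj F (G0 Y)) Y Z g (i Y)) (k X Y f)"
        using ik[OF X(2,3) g] by simp
      also have "\<dots> = cmp D (fobj F (G0 X)) Y Z g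
              (cmp D (fobj F (G0 X)) (fobj F (G0 Y)) Y (i Y) (k X Y f))"
        using O K i X g by (intro D.cmp_assoc[symmetric]) auto
      also have "\<dots> = cmp D (fobj F (G0 X)) Y Z g (cmp D (fobj F (G0 X)) X Y f (i X))"
        using ik[OF X(1,2) f] by simp
      also have "\<dots> = cmp D (fobj F (G0 X)) X Z (cmp D X Y Z g f) (i X)"
        using O i X f g by (intro D.cmp_assoc) auto
      also have "\<dots> = cmp D (fobj F (G0 X)) (fobj F (G0 Z)) Z (i Z) (k X Z (cmp D X Y Z g f))"
        using ik[OF X(1,3) gf] by simp
      finally show "cmp D (fobj F (G0 X)) (fobj F (G0 Z)) Z (i Z) ?l = \<dots>" .
    qed (use O K k[OF X(1,3) gf] in \<open>auto intro!: D.cmp_arr\<close>)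
    note g0 = G0(1)[OF X(1)] G0(1)[OF X(2)] G0(1)[OF X(3)]
    note Gf = G_arr[OF X(1,2) f] and Gg = G_arr[OF X(2,3) g]
    have "farr G X Z (cmp D X Y Z g f) = cmp C (G0 X) (G0 Y) (G0 Z) (farr G Y Z g) (farr G X Y f)"
    proof (rule faithful[OF g0(1,3) G_arr[OF X(1,3) gf] C.cmp_arr[OF g0 Gf Gg]])
      show "farr F (G0 X) (G0 Z) (farr G X Z (cmp D X Y Z g f))
          = farr F (G0 X) (G0 Z) (cmp C (G0 X) (G0 Y) (G0 Z) (farr G Y Z g) (farr G X Y f))"
        by (simp only: functor_cmp[OF F g0 Gf Gg] FG[OF X(1,3) gf] FG[OF X(1,2) f]
          FG[OF X(2,3) g] c)
    qed
    then show "farr G X Z (cmp D X Y Z g f)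
        = cmp C (fobj G X) (fobj G Y) (fobj G Z) (farr G Y Z g) (farr G X Y f)"
      by (simp add: G_def)
  qed
  have G_simps: "fobj G = G0" by (simp add: G_def)
  have "naturally_isomorphic D D (comp_functor F G) id_functor"
    unfolding naturally_isomorphic_def
  proof (intro bexI[of _ "\<lambda>Y\<in>obj D. i Y"] ballI nat_transI)
    show "cmp D (fobj (comp_functor F G) X) (fobj (comp_functor F G) Y) (fobj id_functor Y)
        ((\<lambda>Y\<in>obj D. i Y) Y) (farr (comp_functor F G) X Y f)
      = cmp D (fobj (comp_functor F G) X) (fobj id_functor X) (fobj id_functor Y)
        (farr id_functor X Y f) ((\<lambda>Y\<in>obj D. i Y) X)"
      if "X \<in> obj D" "Y \<in> obj D" "f \<in> arr D X Y" for X Y f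
      using that ik[OF that] FG[OF that] by (simp add: comp_functor_def id_functor_def G_simps)
  qed (use i G0(2) in \<open>auto simp: comp_functor_def id_functor_def G_simps\<close>)
  moreover have "naturally_isomorphic C C (comp_functor G F) id_functor"
    unfolding naturally_isomorphic_def
  proof (intro bexI[of _ "\<lambda>X\<in>obj C. L (G0 (fobj F X)) X (i (fobj F X))"] ballI nat_transI)
    fix X assume X: "X \<in> obj C"
    let ?G = "G0 (fobj F X)"
    have g: "?G \<in> obj C" using G0(1)[OF ob[OF X]] .
    note l = L[OF g X i[OF ob[OF X]]]
    show "(\<lambda>X\<in>obj C. L (G0 (fobj F X)) X (i (fobj F X))) X
        \<in> arr C (fobj (comp_functor G F) X) (fobj id_functor X)"
      using X l by (simp add: comp_functor_def id_functor_def G_simps)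
    let ?m = "L X ?G (i' (fobj F X))"
    note i'X = i'[OF ob[OF X]]
    note m = L[OF X g i'X[THEN conjunct1]]
    have "cmp C ?G X ?G ?m (L ?G X (i (fobj F X))) = ident C ?G"
    proof (rule faithful[OF g g C.cmp_arr[OF g X g l(1) m(1)] C.ident_arr[OF g]])
      show "farr F ?G ?G (cmp C ?G X ?G ?m (L ?G X (i (fobj F X)))) = farr F ?G ?G (ident C ?G)"
        using i'X by (simp only: functor_cmp[OF F g X g l(1) m(1)] functor_ident[OF F g] l(2) m(2))
    qed
    moreover have "cmp C X ?G X (L ?G X (i (fobj F X))) ?m = ident C X"
    proof (rule faithful[OF X X C.cmp_arr[OF X g X m(1) l(1)] C.ident_arr[OF X]])
      show "farr F X X (cmp C X ?G X (L ?G X (i (fobj F X))) ?m) = farr F X X (ident C X)"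
        using i'X by (simp only: functor_cmp[OF F X g X m(1) l(1)] functor_ident[OF F X] l(2) m(2))
    qed
    ultimately show "iso_arrow C (fobj (comp_functor G F) X) (fobj id_functor X)
        ((\<lambda>X\<in>obj C. L (G0 (fobj F X)) X (i (fobj F X))) X)"
      using X l m by (auto simp: iso_arrow_def comp_functor_def id_functor_def G_simps)
  next
    fix X Y f assume X: "X \<in> obj C" "Y \<in> obj C" and f: "f \<in> arr C X Y"
    note g = G0(1)[OF ob[OF X(1)]] G0(1)[OF ob[OF X(2)]]
    note l = L[OF g(1) X(1) i[OF ob[OF X(1)]]] L[OF g(2) X(2) i[OF ob[OF X(2)]]]
    note fg = FG[OF ob[OF X(1)] ob[OF X(2)] ar[OF X f]] G_arr[OF ob[OF X(1)] ob[OF X(2)] ar[OF X f]]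
    have "cmp C (G0 (fobj F X)) (G0 (fobj F Y)) Y (L (G0 (fobj F Y)) Y (i (fobj F Y)))
          (farr G (fobj F X) (fobj F Y) (farr F X Y f))
        = cmp C (G0 (fobj F X)) X Y f (L (G0 (fobj F X)) X (i (fobj F X)))"
    proof (rule faithful[OF g(1) X(2) C.cmp_arr[OF g X(2) fg(2) l(3)]
          C.cmp_arr[OF g(1) X l(1) f]])
      show "farr F (G0 (fobj F X)) Y (cmp C (G0 (fobj F X)) (G0 (fobj F Y)) Y
            (L (G0 (fobj F Y)) Y (i (fobj F Y))) (farr G (fobj F X) (fobj F Y) (farr F X Y f)))
          = farr F (G0 (fobj F X)) Y (cmp C (G0 (fobj F X)) X Y f (L (G0 (fobj F X)) X (i (fobj F X))))"
        by (simp only: functor_cmp[OF F g X(2) fg(2) l(3)] functor_cmp[OF F g(1) X l(1) f]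
          l(2,4) fg(1) ik[OF ob[OF X(1)] ob[OF X(2)] ar[OF X f]])
    qed
    then show "cmp C (fobj (comp_functor G F) X) (fobj (comp_functor G F) Y) (fobj id_functor Y)
        ((\<lambda>X\<in>obj C. L (G0 (fobj F X)) X (i (fobj F X))) Y) (farr (comp_functor G F) X Y f)
      = cmp C (fobj (comp_functor G F) X) (fobj id_functor X) (fobj id_functor Y)
        (farr id_functor X Y f) ((\<lambda>X\<in>obj C. L (G0 (fobj F X)) X (i (fobj F X))) X)"
      using X by (simp add: comp_functor_def id_functor_def G_simps)
  qed simp
  ultimately show ?thesis
    unfolding equivalence_functor_def using F G by blast
qed

section \<open>Copies, quotients and modules of linear maps\<close>

lemma copy_mod_simps [simp]:
  "carrier (copy_mod h M) = h ` carrier M"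
  "zero (copy_mod h M) = h \<zero>\<^bsub>M\<^esub>"
  "add (copy_mod h M) x y = h (inv_into (carrier M) h x \<oplus>\<^bsub>M\<^esub> inv_into (carrier M) h y)"
  "smult (copy_mod h M) r x = h (r \<odot>\<^bsub>M\<^esub> inv_into (carrier M) h x)"
  by (simp_all add: copy_mod_def Let_def)

lemma
  assumes M: "left_module R M" and h: "inj_on h (carrier M)"
  shows left_module_copy: "left_module R (copy_mod h M)"
    and copy_lin: "(\<lambda>x\<in>carrier M. h x) \<in> lin_maps R M (copy_mod h M)"
    and uncopy_lin: "(\<lambda>y\<in>h ` carrier M. inv_into (carrier M) h y) \<in> lin_maps R (copy_mod h M) M"
proof -
  interpret left_module R M by fact
  note inv = inv_into_f_f[OF h] and inv' = inv_into_into[of _ h "carrier M"]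
  show C: "left_module R (copy_mod h M)"
    by (rule left_module_by_embedding[OF M, of "inv_into (carrier M) h"])
      (auto simp: inv smult_closed inj_on_inv_into)
  show "(\<lambda>x\<in>carrier M. h x) \<in> lin_maps R M (copy_mod h M)"
    by (rule lin_maps_restrictI[OF M]) (auto simp: inv)
  show "(\<lambda>y\<in>h ` carrier M. inv_into (carrier M) h y) \<in> lin_maps R (copy_mod h M) M"
  proof -
    have "(\<lambda>y\<in>carrier (copy_mod h M). inv_into (carrier M) h y) \<in> lin_maps R (copy_mod h M) M"
      by (rule lin_maps_restrictI[OF C]) (auto simp: inv smult_closed)
    then show ?thesis by simp
  qed
qed

text \<open>Equations pass to images, and the negative of \<open>f x\<close> is \<open>f (- x)\<close>.\<close>

lemma left_module_by_surjection:
  fixes N :: "('r, 'n) module"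
  assumes M: "left_module R M" and f: "f ` carrier M = carrier N"
    and zero: "f \<zero>\<^bsub>M\<^esub> = \<zero>\<^bsub>N\<^esub>"
    and add: "\<And>x y. \<lbrakk>x \<in> carrier M; y \<in> carrier M\<rbrakk> \<Longrightarrow> f x \<oplus>\<^bsub>N\<^esub> f y = f (x \<oplus>\<^bsub>M\<^esub> y)"
    and smult: "\<And>a x. \<lbrakk>a \<in> carrier R; x \<in> carrier M\<rbrakk> \<Longrightarrow> a \<odot>\<^bsub>N\<^esub> f x = f (a \<odot>\<^bsub>M\<^esub> x)"
  shows "left_module R N"
proof -
  interpret M: left_module R M by fact
  have "abelian_group N"
  proof (rule abelian_groupI, unfold f[symmetric] zero[symmetric])
    fix y assume "y \<in> f ` carrier M"
    then obtain x where "x \<in> carrier M" "y = f x" by blast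
    then show "\<exists>z\<in>f ` carrier M. z \<oplus>\<^bsub>N\<^esub> y = f \<zero>\<^bsub>M\<^esub>"
      by (intro bexI[of _ "f (\<ominus>\<^bsub>M\<^esub> x)"]) (auto simp: add M.l_neg)
  qed (auto simp: add M.a_ac)
  then show ?thesis
    by (intro left_module.intro left_module_axioms.intro M.R.ring_axioms, unfold f[symmetric])
      (auto simp: add smult M.smult_l_distr M.smult_r_distr M.smult_assoc1
        M.smult_one M.smult_closed)
qed

text \<open>With formal sums for \<open>M\<close> and the span of the relations for \<open>K\<close> this is \<open>P\<^sub>n\<close>; it also serves for cokernels
  of module homomorphisms.\<close>

definition quot_mod :: "('r, 'z) ring_scheme \<Rightarrow> ('r, 'm) module \<Rightarrow> 'm set \<Rightarrow> ('r, 'm set) module" where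
  "quot_mod R M K = plain_module (a_rcosets\<^bsub>M\<^esub> K) K (set_add M)
     (\<lambda>r X. \<Union>x\<in>X. K +>\<^bsub>M\<^esub> (r \<odot>\<^bsub>M\<^esub> x))"

locale quotient = left_module +
  fixes K assumes K: "submodule K R M"
begin

sublocale K: abelian_subgroup K M
  using K M.abelian_group_axioms
  by (intro abelian_subgroupI3 additive_subgroupI) (simp_all add: submodule_def)

lemma carrier_quot: "carrier (quot_mod R M K) = (\<lambda>x. K +>\<^bsub>M\<^esub> x) ` carrier M"
  by (auto simp: quot_mod_def A_RCOSETS_def')

lemma coset_eq_iff:
  assumes "x \<in> carrier M" "y \<in> carrier M"
  shows "K +>\<^bsub>M\<^esub> x = K +>\<^bsub>M\<^esub> y \<longleftrightarrow> x \<ominus>\<^bsub>M\<^esub> y \<in> K"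
proof
  assume "K +>\<^bsub>M\<^esub> x = K +>\<^bsub>M\<^esub> y"
  then have "x \<in> K +>\<^bsub>M\<^esub> y" using K.a_rcos_self[OF assms(1)] by simp
  then show "x \<ominus>\<^bsub>M\<^esub> y \<in> K" using K.a_rcos_module[OF assms(2,1)] by (simp add: a_minus_def)
next
  assume "x \<ominus>\<^bsub>M\<^esub> y \<in> K"
  then have "x \<in> K +>\<^bsub>M\<^esub> y" using K.a_rcos_module[OF assms(2,1)] by (simp add: a_minus_def)
  from K.a_repr_independence'[OF this assms(2)] show "K +>\<^bsub>M\<^esub> x = K +>\<^bsub>M\<^esub> y" by simp
qed

lemma coset_eq_kernel_iff: "x \<in> carrier M \<Longrightarrow> K +>\<^bsub>M\<^esub> x = K \<longleftrightarrow> x \<in> K"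
proof -
  assume x: "x \<in> carrier M"
  show ?thesis using K.a_rcos_self[OF x] K.a_rcos_const[of x] by metis
qed

lemma quot_smult:
  assumes "r \<in> carrier R" "x \<in> carrier M"
  shows "r \<odot>\<^bsub>quot_mod R M K\<^esub> (K +>\<^bsub>M\<^esub> x) = K +>\<^bsub>M\<^esub> (r \<odot>\<^bsub>M\<^esub> x)"
proof -
  have "K +>\<^bsub>M\<^esub> (r \<odot>\<^bsub>M\<^esub> y) = K +>\<^bsub>M\<^esub> (r \<odot>\<^bsub>M\<^esub> x)" if y: "y \<in> K +>\<^bsub>M\<^esub> x" for y
  proof -
    have yM: "y \<in> carrier M" by (rule K.a_elemrcos_carrier[OF assms(2) y])
    have "y \<ominus>\<^bsub>M\<^esub> x \<in> K"
      using K.a_rcos_module[OF assms(2) yM] y by (simp add: a_minus_def)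
    then have "r \<odot>\<^bsub>M\<^esub> (y \<ominus>\<^bsub>M\<^esub> x) \<in> K" by (rule submodule.smult_closed[OF K assms(1)])
    also have "r \<odot>\<^bsub>M\<^esub> (y \<ominus>\<^bsub>M\<^esub> x) = r \<odot>\<^bsub>M\<^esub> y \<ominus>\<^bsub>M\<^esub> r \<odot>\<^bsub>M\<^esub> x"
      using abelian_group_hom.hom_a_inv[OF hom_smult_vector[OF assms(1)] assms(2)]
        smult_r_distr[OF assms(1) yM M.a_inv_closed[OF assms(2)]] by (simp only: a_minus_def)
    finally show ?thesis
      using coset_eq_iff[OF smult_closed[OF assms(1) yM] smult_closed[OF assms]] by simp
  qed
  then have "(\<Union>y\<in>K +>\<^bsub>M\<^esub> x. K +>\<^bsub>M\<^esub> (r \<odot>\<^bsub>M\<^esub> y)) = K +>\<^bsub>M\<^esub> (r \<odot>\<^bsub>M\<^esub> x)"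
    by (intro UN_constant_eq[OF K.a_rcos_self[OF assms(2)]] ballI)
  then show ?thesis by (simp only: quot_mod_def plain_module_simps)
qed

lemma quot_add:
  "\<lbrakk>x \<in> carrier M; y \<in> carrier M\<rbrakk>
    \<Longrightarrow> (K +>\<^bsub>M\<^esub> x) \<oplus>\<^bsub>quot_mod R M K\<^esub> (K +>\<^bsub>M\<^esub> y) = K +>\<^bsub>M\<^esub> (x \<oplus>\<^bsub>M\<^esub> y)"
  by (simp add: quot_mod_def K.a_rcos_sum)

lemma quot_zero: "\<zero>\<^bsub>quot_mod R M K\<^esub> = K"
  by (simp add: quot_mod_def)

lemma left_module_quot: "left_module R (quot_mod R M K)"
  by (rule left_module_by_surjection[OF left_module_axioms, of "\<lambda>x. K +>\<^bsub>M\<^esub> x"])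
    (auto simp: carrier_quot quot_add quot_smult quot_zero coset_eq_kernel_iff)

lemma quot_lin: "(\<lambda>x\<in>carrier M. K +>\<^bsub>M\<^esub> x) \<in> lin_maps R M (quot_mod R M K)"
  by (rule lin_maps_restrictI[OF left_module_axioms]) (auto simp: carrier_quot quot_add quot_smult)

end

lemma submodule_kernel:
  assumes "left_module R M" "left_module R N" "f \<in> lin_maps R M N"
  shows "submodule {x \<in> carrier M. f x = \<zero>\<^bsub>N\<^esub>} R M"
proof -
  interpret M: left_module R M by fact
  interpret N: left_module R N by fact
  interpret f: abelian_group_hom M N f by (rule lin_maps_hom[OF assms])
  have "additive_subgroup (a_kernel M N f) M" by (rule f.additive_subgroup_a_kernel)
  then show ?thesis
    using lin_maps_smult[OF assms(3)]
    by (auto simp: a_kernel_def' submodule_def submodule_axioms_def additive_subgroup_def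
        M.smult_closed N.smult_r_null)
qed

lemma Hom_mod_simps [simp]:
  "carrier (Hom_mod R M N) = lin_maps R M N"
  "zero (Hom_mod R M N) = (\<lambda>x\<in>carrier M. \<zero>\<^bsub>N\<^esub>)"
  "add (Hom_mod R M N) f g = (\<lambda>x\<in>carrier M. f x \<oplus>\<^bsub>N\<^esub> g x)"
  "smult (Hom_mod R M N) r f = (\<lambda>x\<in>carrier M. r \<odot>\<^bsub>N\<^esub> f x)"
  by (simp_all add: Hom_mod_def)

lemma left_module_Hom:
  assumes "cring R" "left_module R M" "left_module R N"
  shows "left_module R (Hom_mod R M N)"
proof -
  interpret R: cring R by fact
  interpret M: left_module R M by fact
  interpret N: left_module R N by fact
  have z: "(\<lambda>x\<in>carrier M. \<zero>\<^bsub>N\<^esub>) \<in> lin_maps R M N"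
    by (rule lin_maps_restrictI[OF assms(2)]) (auto simp: N.smult_r_null)
  have s: "(\<lambda>x\<in>carrier M. r \<odot>\<^bsub>N\<^esub> f x) \<in> lin_maps R M N"
    if "r \<in> carrier R" "f \<in> lin_maps R M N" for r f
    using that lin_maps_closed[OF that(2)] lin_maps_add[OF that(2)] lin_maps_smult[OF that(2)]
    by (intro lin_maps_restrictI[OF assms(2)])
      (auto simp: N.smult_r_distr N.smult_closed R.m_comm N.smult_assoc1[symmetric])
  have a: "(\<lambda>x\<in>carrier M. f x \<oplus>\<^bsub>N\<^esub> g x) \<in> lin_maps R M N"
    if "f \<in> lin_maps R M N" "g \<in> lin_maps R M N" for f g
    using that[THEN lin_maps_closed] that[THEN lin_maps_add] that[THEN lin_maps_smult]
    by (intro lin_maps_restrictI[OF assms(2)])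
      (auto simp: N.smult_r_distr N.a_ac)
  have u: "f x = undefined" if "f \<in> lin_maps R M N" "x \<notin> carrier M" for f x
    using lin_maps_extensional[OF that(1)] that(2) by (rule extensional_arb)
  note c = lin_maps_closed[of _ R M N]
  have "abelian_group (Hom_mod R M N)"
  proof (rule abelian_groupI)
    fix f assume f: "f \<in> carrier (Hom_mod R M N)"
    then show "\<exists>g\<in>carrier (Hom_mod R M N). g \<oplus>\<^bsub>Hom_mod R M N\<^esub> f = \<zero>\<^bsub>Hom_mod R M N\<^esub>"
      using s[of "\<ominus>\<^bsub>R\<^esub> \<one>\<^bsub>R\<^esub>" f]
      by (intro bexI[of _ "\<lambda>x\<in>carrier M. (\<ominus>\<^bsub>R\<^esub> \<one>\<^bsub>R\<^esub>) \<odot>\<^bsub>N\<^esub> f x"])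
        (auto simp: c N.smult_minus_one N.l_neg fun_eq_iff)
  qed (auto simp: a z c u N.a_ac fun_eq_iff)
  then show ?thesis
    by (intro left_module.intro left_module_axioms.intro R.ring_axioms)
      (auto simp: s a c u fun_eq_iff N.smult_l_distr N.smult_r_distr N.smult_assoc1 N.smult_one
        N.smult_closed)
qed

lemma Hom_mod_eval:
  assumes "cring R" "left_module R M" "left_module R N" "x \<in> carrier M"
  shows "abelian_group_hom (Hom_mod R M N) N (\<lambda>f. f x)"
proof -
  interpret H: left_module R "Hom_mod R M N" using assms by (intro left_module_Hom)
  interpret N: left_module R N by fact
  show ?thesis
    using assms(4) lin_maps_closed
    by (intro abelian_group_hom_of_additive H.M.abelian_group_axioms N.M.abelian_group_axioms) auto
qed

lemma compose_left_lin:
  assumes "cring R" "left_module R L" "left_module R M" "left_module R N" "g \<in> lin_maps R M N"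
  shows "(\<lambda>f\<in>lin_maps R L M. compose (carrier L) g f) \<in> lin_maps R (Hom_mod R L M) (Hom_mod R L N)"
proof -
  have "(\<lambda>f\<in>carrier (Hom_mod R L M). compose (carrier L) g f)
      \<in> lin_maps R (Hom_mod R L M) (Hom_mod R L N)"
    by (rule lin_maps_restrictI[OF left_module_Hom[OF assms(1-3)]])
      (auto simp: lin_maps_compose[OF assms(2) _ assms(5), unfolded compose_def] compose_def fun_eq_iff lin_maps_closed
        lin_maps_add[OF assms(5)] lin_maps_smult[OF assms(5)])
  then show ?thesis by simp
qed

lemma compose_right_lin:
  assumes "cring R" "left_module R L" "left_module R M" "left_module R N" "f \<in> lin_maps R L M"
  shows "(\<lambda>g\<in>lin_maps R M N. compose (carrier L) g f) \<in> lin_maps R (Hom_mod R M N) (Hom_mod R L N)"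
proof -
  have "(\<lambda>g\<in>carrier (Hom_mod R M N). compose (carrier L) g f)
      \<in> lin_maps R (Hom_mod R M N) (Hom_mod R L N)"
    by (rule lin_maps_restrictI[OF left_module_Hom[OF assms(1,3,4)]])
      (auto simp: lin_maps_compose[OF assms(2,5), unfolded compose_def] compose_def fun_eq_iff
        lin_maps_closed[OF assms(5)])
  then show ?thesis by simp
qed


section \<open>Formal linear combinations\<close>

lemma free_alg_simps:
  "carrier (free_alg B M) = {f. (\<forall>x. f x \<in> carrier B) \<and> supp B f \<subseteq> carrier M \<and> finite (supp B f)}"
  "zero (free_alg B M) = (\<lambda>_. \<zero>\<^bsub>B\<^esub>)" "add (free_alg B M) f g = (\<lambda>x. f x \<oplus>\<^bsub>B\<^esub> g x)"
  "smult (free_alg B M) r f = (\<lambda>x. r \<otimes>\<^bsub>B\<^esub> f x)"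
  by (simp_all add: free_alg_def)

lemma left_module_free_alg:
  assumes "cring B"
  shows "left_module B (free_alg B M)"
proof -
  interpret B: cring B by fact
  have a: "f \<oplus>\<^bsub>free_alg B M\<^esub> g \<in> carrier (free_alg B M)"
    if "f \<in> carrier (free_alg B M)" "g \<in> carrier (free_alg B M)" for f g
  proof -
    have "supp B (\<lambda>x. f x \<oplus>\<^bsub>B\<^esub> g x) \<subseteq> supp B f \<union> supp B g" by (auto simp: supp_def)
    with that show ?thesis by (auto simp: free_alg_simps intro: finite_subset)
  qed
  have s: "r \<odot>\<^bsub>free_alg B M\<^esub> f \<in> carrier (free_alg B M)"
    if "r \<in> carrier B" "f \<in> carrier (free_alg B M)" for r f
  proof -
    have "supp B (\<lambda>x. r \<otimes>\<^bsub>B\<^esub> f x) \<subseteq> supp B f" using that by (auto simp: supp_def)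
    with that show ?thesis by (auto simp: free_alg_simps intro: finite_subset)
  qed
  have v: "f x \<in> carrier B" if "f \<in> carrier (free_alg B M)" for f x
    using that by (simp add: free_alg_simps)
  have z: "\<zero>\<^bsub>free_alg B M\<^esub> \<in> carrier (free_alg B M)" by (auto simp: free_alg_simps supp_def)
  have "abelian_group (free_alg B M)"
  proof (rule abelian_groupI)
    fix f assume f: "f \<in> carrier (free_alg B M)"
    then have "supp B (\<lambda>x. \<ominus>\<^bsub>B\<^esub> f x) \<subseteq> supp B f" by (auto simp: supp_def free_alg_simps)
    then have "(\<lambda>x. \<ominus>\<^bsub>B\<^esub> f x) \<in> carrier (free_alg B M)"
      using f by (auto simp: free_alg_simps intro: finite_subset)
    then show "\<exists>g\<in>carrier (free_alg B M). g \<oplus>\<^bsub>free_alg B M\<^esub> f = \<zero>\<^bsub>free_alg B M\<^esub>"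
      by (rule bexI[rotated]) (use v[OF f] in \<open>simp add: free_alg_simps B.l_neg\<close>)
  qed (auto simp: a z, auto simp: free_alg_simps(2-4) v B.a_ac)
  then show ?thesis
    by (intro left_module.intro left_module_axioms.intro B.ring_axioms s)
      (auto simp: free_alg_simps(2-4) v B.l_distr B.r_distr B.m_assoc)
qed

lemma delta_in_free_alg:
  assumes "cring B" "x \<in> carrier M"
  shows "delta B x \<in> carrier (free_alg B M)"
proof -
  interpret B: cring B by fact
  have "supp B (delta B x) \<subseteq> {x}" by (auto simp: supp_def delta_def)
  then show ?thesis using assms(2)
    by (auto simp: free_alg_simps delta_def intro: finite_subset)
qed

lemma free_alg_induct [consumes 2, case_names zero delta add smult]:
  assumes "cring B" "f \<in> carrier (free_alg B M)"
    and zero: "P \<zero>\<^bsub>free_alg B M\<^esub>"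
    and delta: "\<And>x. x \<in> carrier M \<Longrightarrow> P (delta B x)"
    and add: "\<And>f g. \<lbrakk>f \<in> carrier (free_alg B M); g \<in> carrier (free_alg B M); P f; P g\<rbrakk>
      \<Longrightarrow> P (f \<oplus>\<^bsub>free_alg B M\<^esub> g)"
    and smult: "\<And>r f. \<lbrakk>r \<in> carrier B; f \<in> carrier (free_alg B M); P f\<rbrakk>
      \<Longrightarrow> P (r \<odot>\<^bsub>free_alg B M\<^esub> f)"
  shows "P f"
proof -
  interpret B: cring B by fact
  interpret F: left_module B "free_alg B M" by (rule left_module_free_alg[OF assms(1)])
  have "finite S \<Longrightarrow> f \<in> carrier (free_alg B M) \<Longrightarrow> supp B f \<subseteq> S \<Longrightarrow> P f" for S f
  proof (induct S arbitrary: f rule: finite_induct)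
    case empty
    then have "f = \<zero>\<^bsub>free_alg B M\<^esub>" by (auto simp: supp_def free_alg_simps)
    then show ?case using zero by simp
  next
    case (insert x S)
    have fx: "f y \<in> carrier B" for y using insert.prems by (simp add: free_alg_simps)
    show ?case
    proof (cases "f x = \<zero>\<^bsub>B\<^esub>")
      case True
      then have "supp B f \<subseteq> S" using insert.prems by (auto simp: supp_def)
      then show ?thesis using insert by blast
    next
      case False
      then have x: "x \<in> carrier M" using insert.prems(1) by (auto simp: free_alg_simps supp_def)
      define g where "g = f(x := \<zero>\<^bsub>B\<^esub>)"
      have sub: "supp B g \<subseteq> S" "supp B g \<subseteq> supp B f"
        using insert.prems by (auto simp: g_def supp_def split: if_splits)
      have g: "g \<in> carrier (free_alg B M)"
        using insert.prems(1) sub(2) by (auto simp: free_alg_simps g_def intro: finite_subset)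
      have eq: "f = g \<oplus>\<^bsub>free_alg B M\<^esub> (f x \<odot>\<^bsub>free_alg B M\<^esub> delta B x)"
        using fx by (auto simp: free_alg_simps g_def delta_def fun_eq_iff)
      show ?thesis
        using insert.hyps(3)[OF g sub(1)] fx delta_in_free_alg[OF assms(1) x]
        by (subst eq) (intro add smult g delta[OF x] F.smult_closed)
    qed
  qed
  then show ?thesis using assms(2) by (auto simp: free_alg_simps)
qed

text \<open>The linear extension of \<open>\<phi>\<close> to formal sums.\<close>

definition lin_ext :: "('b, 'z) ring_scheme \<Rightarrow> ('b, 'y) module \<Rightarrow> ('x \<Rightarrow> 'y) \<Rightarrow> ('x \<Rightarrow> 'b) \<Rightarrow> 'y" where
  "lin_ext B N \<phi> f = (\<Oplus>\<^bsub>N\<^esub>x\<in>supp B f. f x \<odot>\<^bsub>N\<^esub> \<phi> x)"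

context
  fixes B :: "('b, 'z) ring_scheme" and M :: "('b, 'x) module" and N :: "('b, 'y) module" and \<phi>
  assumes B: "cring B" and N: "left_module B N" and \<phi>: "\<phi> \<in> carrier M \<rightarrow> carrier N"
begin

interpretation B: cring B by (rule B)
interpretation N: left_module B N by (rule N)

lemma lin_ext_superset:
  assumes f: "f \<in> carrier (free_alg B M)" and S: "finite S" "supp B f \<subseteq> S" "S \<subseteq> carrier M"
  shows "lin_ext B N \<phi> f = (\<Oplus>\<^bsub>N\<^esub>x\<in>S. f x \<odot>\<^bsub>N\<^esub> \<phi> x)"
  unfolding lin_ext_def
proof (rule N.add.finprod_mono_neutral_cong_left[OF S(1,2)])
  show "f x \<odot>\<^bsub>N\<^esub> \<phi> x = \<zero>\<^bsub>N\<^esub>" if "x \<in> S - supp B f" for x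
    using that S(3) \<phi> by (auto simp: supp_def intro!: N.smult_l_null)
  show "(\<lambda>x. f x \<odot>\<^bsub>N\<^esub> \<phi> x) \<in> S \<rightarrow> carrier N"
    using f S(3) \<phi> by (auto simp: free_alg_simps intro!: N.smult_closed)
qed simp

lemma lin_ext_delta: "x \<in> carrier M \<Longrightarrow> lin_ext B N \<phi> (delta B x) = \<phi> x"
proof -
  assume x: "x \<in> carrier M"
  have "lin_ext B N \<phi> (delta B x) = (\<Oplus>\<^bsub>N\<^esub>y\<in>{x}. delta B x y \<odot>\<^bsub>N\<^esub> \<phi> y)"
    by (rule lin_ext_superset[OF delta_in_free_alg[OF B x]])
      (use x in \<open>auto simp: supp_def delta_def split: if_splits\<close>)
  also have "\<dots> = delta B x x \<odot>\<^bsub>N\<^esub> \<phi> x"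
    using x \<phi> N.M.finsum_insert[of "{}" x "\<lambda>y. delta B x y \<odot>\<^bsub>N\<^esub> \<phi> y"]
    by (auto simp: delta_def N.smult_closed Pi_iff N.smult_one)
  also have "\<dots> = \<phi> x" using x \<phi> by (auto simp: delta_def Pi_iff N.smult_one)
  finally show ?thesis .
qed

lemma lin_ext_lin: "(\<lambda>f\<in>carrier (free_alg B M). lin_ext B N \<phi> f) \<in> lin_maps B (free_alg B M) N"
proof (rule lin_maps_restrictI[OF left_module_free_alg[OF B]])
  interpret F: left_module B "free_alg B M" by (rule left_module_free_alg[OF B])
  have v: "f x \<in> carrier B" if "f \<in> carrier (free_alg B M)" for f x
    using that by (simp add: free_alg_simps)
  have s: "finite (supp B f)" "supp B f \<subseteq> carrier M" if "f \<in> carrier (free_alg B M)" for f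
    using that by (simp_all add: free_alg_simps)
  fix f g r assume f: "f \<in> carrier (free_alg B M)"
  show "lin_ext B N \<phi> f \<in> carrier N"
    unfolding lin_ext_def using s(2)[OF f] v[OF f] \<phi> by (auto intro!: N.finsum_closed N.smult_closed)
  have "lin_ext B N \<phi> (r \<odot>\<^bsub>free_alg B M\<^esub> f) = (\<Oplus>\<^bsub>N\<^esub>x\<in>supp B f. r \<odot>\<^bsub>N\<^esub> (f x \<odot>\<^bsub>N\<^esub> \<phi> x))"
    if r: "r \<in> carrier B"
    apply (subst lin_ext_superset[OF F.smult_closed[OF r f] s(1)[OF f] _ s(2)[OF f]])
     apply (use r in \<open>auto simp: supp_def free_alg_simps\<close>)[1]
    apply (rule N.finsum_cong')
    using s(2)[OF f] v[OF f] \<phi> r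
    by (auto simp: free_alg_simps N.smult_assoc1 Pi_iff subset_iff intro!: N.smult_closed)
  also have "\<dots> = r \<odot>\<^bsub>N\<^esub> lin_ext B N \<phi> f" if "r \<in> carrier B"
    unfolding lin_ext_def using s(2)[OF f] v[OF f] \<phi> that
    by (intro N.finsum_smult_r[symmetric]) (auto intro!: N.smult_closed)
  finally show "lin_ext B N \<phi> (r \<odot>\<^bsub>free_alg B M\<^esub> f) = r \<odot>\<^bsub>N\<^esub> lin_ext B N \<phi> f"
    if "r \<in> carrier B" using that by simp
  assume g: "g \<in> carrier (free_alg B M)"
  let ?S = "supp B f \<union> supp B g"
  have S: "finite ?S" "?S \<subseteq> carrier M" using s[OF f] s[OF g] by auto
  have "lin_ext B N \<phi> (f \<oplus>\<^bsub>free_alg B M\<^esub> g)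
      = (\<Oplus>\<^bsub>N\<^esub>x\<in>?S. f x \<odot>\<^bsub>N\<^esub> \<phi> x \<oplus>\<^bsub>N\<^esub> g x \<odot>\<^bsub>N\<^esub> \<phi> x)"
    apply (subst lin_ext_superset[OF F.a_closed[OF f g] S(1) _ S(2)])
     apply (auto simp: supp_def free_alg_simps)[1]
    apply (rule N.finsum_cong')
    using S(2) v[OF f] v[OF g] \<phi>
    by (auto simp: free_alg_simps N.smult_l_distr Pi_iff subset_iff intro!: N.smult_closed)
  also have "\<dots> = (\<Oplus>\<^bsub>N\<^esub>x\<in>?S. f x \<odot>\<^bsub>N\<^esub> \<phi> x) \<oplus>\<^bsub>N\<^esub> (\<Oplus>\<^bsub>N\<^esub>x\<in>?S. g x \<odot>\<^bsub>N\<^esub> \<phi> x)"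
    using S(2) v[OF f] v[OF g] \<phi>
    by (intro N.finsum_addf) (auto simp: Pi_iff subset_iff intro!: N.smult_closed)
  also have "\<dots> = lin_ext B N \<phi> f \<oplus>\<^bsub>N\<^esub> lin_ext B N \<phi> g"
    using lin_ext_superset[OF f S(1) _ S(2)] lin_ext_superset[OF g S(1) _ S(2)] by simp
  finally show "lin_ext B N \<phi> (f \<oplus>\<^bsub>free_alg B M\<^esub> g) = lin_ext B N \<phi> f \<oplus>\<^bsub>N\<^esub> lin_ext B N \<phi> g" .
qed

end

lemma free_alg_lin_maps_eqI:
  assumes "cring B" "left_module B N" "h \<in> lin_maps B (free_alg B M) N" "k \<in> lin_maps B (free_alg B M) N"
    and "\<And>x. x \<in> carrier M \<Longrightarrow> h (delta B x) = k (delta B x)"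
  shows "h = k"
proof (rule lin_maps_eqI[OF assms(3,4)])
  fix f assume "f \<in> carrier (free_alg B M)"
  with assms(1) show "h f = k f"
    by (induct rule: free_alg_induct) (simp_all add: assms(5) lin_maps_add[OF assms(3)]
        lin_maps_add[OF assms(4)] lin_maps_smult[OF assms(3)] lin_maps_smult[OF assms(4)]
        lin_maps_zero[OF left_module_free_alg[OF assms(1)] assms(2)] assms(3,4))
qed

section \<open>The universal numerical map\<close>

lemma (in abelian_group) minus_eq_zero_iff:
  "\<lbrakk>x \<in> carrier G; y \<in> carrier G\<rbrakk> \<Longrightarrow> x \<ominus> y = \<zero> \<longleftrightarrow> x = y"
  by (metis a_inv_closed minus_eq minus_equality minus_minus r_neg)

lemma binomial_ring_cring: "binomial_ring B \<Longrightarrow> cring B"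
  by (simp add: binomial_ring_def)

lemma binom_closed:
  assumes "binomial_ring B" "r \<in> carrier B"
  shows "binom B r m \<in> carrier B"
proof -
  interpret B: cring B using assms(1) by (rule binomial_ring_cring)
  let ?P = "\<lambda>s. s \<in> carrier B \<and>
     [(fact m :: nat)] \<cdot>\<^bsub>B\<^esub> s = (\<Otimes>\<^bsub>B\<^esub>i\<in>{..<m}. r \<ominus>\<^bsub>B\<^esub> [i] \<cdot>\<^bsub>B\<^esub> \<one>\<^bsub>B\<^esub>)"
  have "s = t" if "?P s" "?P t" for s t
  proof -
    have "[(fact m :: nat)] \<cdot>\<^bsub>B\<^esub> (s \<ominus>\<^bsub>B\<^esub> t)
        = [(fact m :: nat)] \<cdot>\<^bsub>B\<^esub> s \<ominus>\<^bsub>B\<^esub> [(fact m :: nat)] \<cdot>\<^bsub>B\<^esub> t"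
      using that by (simp add: a_minus_def B.add.nat_pow_distrib B.add.nat_pow_inv)
    also have "\<dots> = \<zero>\<^bsub>B\<^esub>"
      using that B.add.nat_pow_closed[of t "fact m"] by (metis B.minus_eq B.r_neg)
    finally have "s \<ominus>\<^bsub>B\<^esub> t = \<zero>\<^bsub>B\<^esub>"
      using assms(1) that unfolding binomial_ring_def by (meson B.minus_closed fact_gt_zero)
    then show ?thesis using that by (simp add: B.minus_eq_zero_iff)
  qed
  moreover obtain s where "?P s" using assms unfolding binomial_ring_def by blast
  ultimately have "?P (binom B r m)" unfolding binom_def by (intro theI[of ?P s])
  then show ?thesis ..
qed

lemma numerical_map_closed: "numerical_map B n M N \<phi> \<Longrightarrow> x \<in> carrier M \<Longrightarrow> \<phi> x \<in> carrier N"
  by (auto simp: numerical_map_def polynomial_map_def)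

lemma numerical_map_cong:
  assumes "left_module B M" "left_module B N" "\<And>x. x \<in> carrier M \<Longrightarrow> \<phi> x = \<psi> x"
    and "numerical_map B n M N \<psi>"
  shows "numerical_map B n M N \<phi>"
proof -
  interpret M: left_module B M by fact
  interpret N: left_module B N by fact
  have psi: "\<psi> \<in> carrier M \<rightarrow> carrier N"
    using numerical_map_closed[OF assms(4)] by auto
  note d = deviation_cong[OF M.M.abelian_group_axioms N.M.abelian_group_axioms psi _ assms(3)]
  show ?thesis
    using assms(3,4) psi unfolding numerical_map_def polynomial_map_def
    by (auto simp: d M.smult_closed Pi_iff)
qed

locale numerical_degree =
  fixes B :: "('b, 'z) ring_scheme" and n :: nat
  assumes binomial: "binomial_ring B"
begin

sublocale B: cring B using binomial by (rule binomial_ring_cring)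

lemma abelian_group_left_module: "left_module R M \<Longrightarrow> abelian_group M"
  by (simp add: left_module_def)

lemma deviation_delta_closed:
  assumes "left_module B M" "x \<in> {..<k} \<rightarrow> carrier M"
  shows "deviation M (free_alg B M) (delta B) k x \<in> carrier (free_alg B M)"
  using assms
  by (intro deviation_closed abelian_group_left_module[OF assms(1)]
      abelian_group_left_module[OF left_module_free_alg[OF B.is_cring]])
    (auto intro: delta_in_free_alg[OF B.is_cring])

lemma Pn_relations_closed:
  assumes "left_module B M"
  shows "Pn_relations B n M \<subseteq> carrier (free_alg B M)"
proof -
  interpret M: left_module B M by fact
  interpret F: left_module B "free_alg B M" by (rule left_module_free_alg[OF B.is_cring])
  show ?thesis
    unfolding Pn_relations_def
    by (auto intro!: deviation_delta_closed[OF assms] F.M.minus_closed F.finsum_closed F.smult_closed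
        delta_in_free_alg[OF B.is_cring] M.smult_closed binom_closed[OF binomial])
qed

text \<open>A linear map on formal sums commutes with the formation of deviations, so the defining
  equations of a numerical map say that its linear extension kills the relations.\<close>

lemma numerical_map_iff_relations:
  assumes M: "left_module B M" and N: "left_module B N" and h: "h \<in> lin_maps B (free_alg B M) N"
  shows "numerical_map B n M N (\<lambda>x. h (delta B x)) \<longleftrightarrow> (\<forall>f \<in> Pn_relations B n M. h f = \<zero>\<^bsub>N\<^esub>)"
proof -
  let ?F = "free_alg B M" and ?\<phi> = "\<lambda>x. h (delta B x)"
  interpret M: left_module B M by fact
  interpret N: left_module B N by fact
  interpret F: left_module B ?F by (rule left_module_free_alg[OF B.is_cring])
  interpret h: abelian_group_hom ?F N h by (rule lin_maps_hom[OF F.left_module_axioms N h])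
  have del: "delta B \<in> carrier M \<rightarrow> carrier ?F" using delta_in_free_alg[OF B.is_cring] by auto
  then have c: "?\<phi> \<in> carrier M \<rightarrow> carrier N" using h.hom_closed by blast
  have dev: "h (deviation M ?F (delta B) k x) = deviation M N ?\<phi> k x"
    if "x \<in> {..<k} \<rightarrow> carrier M" for k x
    by (rule h.hom_deviation[OF del M.M.abelian_group_axioms that])
  note dc = deviation_delta_closed[OF M]
  note dN = deviation_closed[OF M.M.abelian_group_axioms N.M.abelian_group_axioms c]
  have rel: "h (delta B (r \<odot>\<^bsub>M\<^esub> x) \<ominus>\<^bsub>?F\<^esub>
        (\<Oplus>\<^bsub>?F\<^esub>k\<in>{..n}. binom B r k \<odot>\<^bsub>?F\<^esub> deviation M ?F (delta B) k (\<lambda>_. x))) = \<zero>\<^bsub>N\<^esub>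
      \<longleftrightarrow> ?\<phi> (r \<odot>\<^bsub>M\<^esub> x) = (\<Oplus>\<^bsub>N\<^esub>k\<in>{..n}. binom B r k \<odot>\<^bsub>N\<^esub> deviation M N ?\<phi> k (\<lambda>_. x))"
    (is "h (?a \<ominus>\<^bsub>?F\<^esub> ?s) = _ \<longleftrightarrow> _ = ?t")
    if r: "r \<in> carrier B" and x: "x \<in> carrier M" for r x
  proof -
    have t: "binom B r k \<odot>\<^bsub>?F\<^esub> deviation M ?F (delta B) k (\<lambda>_. x) \<in> carrier ?F" for k
      using x r by (intro F.smult_closed dc binom_closed[OF binomial]) auto
    have a: "?a \<in> carrier ?F" using r x M.smult_closed del by auto
    have s: "?s \<in> carrier ?F" using t by (intro F.M.finsum_closed) auto
    have "h ?s = (\<Oplus>\<^bsub>N\<^esub>k\<in>{..n}. h (binom B r k \<odot>\<^bsub>?F\<^esub> deviation M ?F (delta B) k (\<lambda>_. x)))"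
      using t by (intro h.hom_finsum) auto
    also have "\<dots> = ?t"
    proof (rule N.M.finsum_cong'[OF refl])
      show "(\<lambda>k. binom B r k \<odot>\<^bsub>N\<^esub> deviation M N ?\<phi> k (\<lambda>_. x)) \<in> {..n} \<rightarrow> carrier N"
        using x r by (intro Pi_I N.smult_closed dN binom_closed[OF binomial]) auto
      show "h (binom B r k \<odot>\<^bsub>?F\<^esub> deviation M ?F (delta B) k (\<lambda>_. x))
          = binom B r k \<odot>\<^bsub>N\<^esub> deviation M N ?\<phi> k (\<lambda>_. x)" for k
        using x by (subst lin_maps_smult[OF h binom_closed[OF binomial r] dc]) (auto simp: dev)
    qed
    finally have hs: "h ?s = ?t" .
    have "h (?a \<ominus>\<^bsub>?F\<^esub> ?s) = ?\<phi> (r \<odot>\<^bsub>M\<^esub> x) \<ominus>\<^bsub>N\<^esub> ?t"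
      using a s hs by (simp add: a_minus_def)
    moreover have "?t \<in> carrier N" using h.hom_closed[OF s] hs by simp
    moreover have "?\<phi> (r \<odot>\<^bsub>M\<^esub> x) \<in> carrier N" by (rule h.hom_closed[OF a])
    ultimately show ?thesis by (simp add: N.M.minus_eq_zero_iff)
  qed
  show ?thesis
    unfolding numerical_map_def polynomial_map_def
  proof (intro iffI conjI ballI)
    fix f assume n: "(?\<phi> \<in> carrier M \<rightarrow> carrier N \<and> (\<forall>x\<in>{..<Suc n} \<rightarrow> carrier M.
        deviation M N ?\<phi> (Suc n) x = \<zero>\<^bsub>N\<^esub>)) \<and> (\<forall>r\<in>carrier B. \<forall>x\<in>carrier M. ?\<phi> (r \<odot>\<^bsub>M\<^esub> x)
          = (\<Oplus>\<^bsub>N\<^esub>k\<in>{..n}. binom B r k \<odot>\<^bsub>N\<^esub> deviation M N ?\<phi> k (\<lambda>_. x)))"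
      and f: "f \<in> Pn_relations B n M"
    from f show "h f = \<zero>\<^bsub>N\<^esub>"
      unfolding Pn_relations_def
    proof (elim UnE CollectE exE conjE)
      fix x assume "f = deviation M ?F (delta B) (Suc n) x" "x \<in> {..<Suc n} \<rightarrow> carrier M"
      then show ?thesis using n dev[of x "Suc n"] by simp
    next
      fix r x assume "f = delta B (r \<odot>\<^bsub>M\<^esub> x) \<ominus>\<^bsub>?F\<^esub>
        (\<Oplus>\<^bsub>?F\<^esub>k\<in>{..n}. binom B r k \<odot>\<^bsub>?F\<^esub> deviation M ?F (delta B) k (\<lambda>_. x))"
        "r \<in> carrier B" "x \<in> carrier M"
      then show ?thesis using n rel[of r x] by simp
    qed
  next
    assume z: "\<forall>f \<in> Pn_relations B n M. h f = \<zero>\<^bsub>N\<^esub>"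
    show "?\<phi> \<in> carrier M \<rightarrow> carrier N" by (rule c)
    show "deviation M N ?\<phi> (Suc n) x = \<zero>\<^bsub>N\<^esub>" if x: "x \<in> {..<Suc n} \<rightarrow> carrier M" for x
    proof -
      have "deviation M ?F (delta B) (Suc n) x \<in> Pn_relations B n M"
        unfolding Pn_relations_def using x by blast
      then show ?thesis using z dev[OF x] by simp
    qed
    show "?\<phi> (r \<odot>\<^bsub>M\<^esub> x) = (\<Oplus>\<^bsub>N\<^esub>k\<in>{..n}. binom B r k \<odot>\<^bsub>N\<^esub> deviation M N ?\<phi> k (\<lambda>_. x))"
      if "r \<in> carrier B" "x \<in> carrier M" for r x
      using rel[OF that] that by (intro iffD1[OF rel[OF that]] bspec[OF z])
        (unfold Pn_relations_def, blast)
  qed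
qed

lemma numerical_map_lin_ext:
  assumes M: "left_module B M" and N: "left_module B N" and \<phi>: "\<phi> \<in> carrier M \<rightarrow> carrier N"
  shows "numerical_map B n M N \<phi> \<longleftrightarrow> (\<forall>f \<in> Pn_relations B n M. lin_ext B N \<phi> f = \<zero>\<^bsub>N\<^esub>)"
proof -
  let ?h = "\<lambda>f\<in>carrier (free_alg B M). lin_ext B N \<phi> f"
  have eq: "?h (delta B x) = \<phi> x" if "x \<in> carrier M" for x
    using that by (simp add: delta_in_free_alg[OF B.is_cring] lin_ext_delta[OF B.is_cring N \<phi>])
  have "numerical_map B n M N \<phi> \<longleftrightarrow> numerical_map B n M N (\<lambda>x. ?h (delta B x))"
    using numerical_map_cong[OF M N, of \<phi> "\<lambda>x. ?h (delta B x)"]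
      numerical_map_cong[OF M N, of "\<lambda>x. ?h (delta B x)" \<phi>] eq by auto
  also have "\<dots> \<longleftrightarrow> (\<forall>f \<in> Pn_relations B n M. ?h f = \<zero>\<^bsub>N\<^esub>)"
    by (rule numerical_map_iff_relations[OF M N lin_ext_lin[OF B.is_cring N \<phi>]])
  also have "\<dots> \<longleftrightarrow> (\<forall>f \<in> Pn_relations B n M. lin_ext B N \<phi> f = \<zero>\<^bsub>N\<^esub>)"
    using Pn_relations_closed[OF M] by (intro ball_cong) auto
  finally show ?thesis .
qed

lemma lin_ext_post:
  assumes M: "left_module B M" and N: "left_module B N" "left_module B N'"
    and \<phi>: "\<phi> \<in> carrier M \<rightarrow> carrier N" and h: "h \<in> lin_maps B N N'"
    and f: "f \<in> carrier (free_alg B M)"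
  shows "lin_ext B N' (\<lambda>x. h (\<phi> x)) f = h (lin_ext B N \<phi> f)"
proof -
  have h\<phi>: "(\<lambda>x. h (\<phi> x)) \<in> carrier M \<rightarrow> carrier N'" using \<phi> lin_maps_closed[OF h] by auto
  note F = left_module_free_alg[OF B.is_cring, of M] and d = delta_in_free_alg[OF B.is_cring, of _ M]
  have "(\<lambda>f\<in>carrier (free_alg B M). lin_ext B N' (\<lambda>x. h (\<phi> x)) f)
      = compose (carrier (free_alg B M)) h (\<lambda>f\<in>carrier (free_alg B M). lin_ext B N \<phi> f)"
    by (rule free_alg_lin_maps_eqI[OF B.is_cring N(2) lin_ext_lin[OF B.is_cring N(2) h\<phi>]
          lin_maps_compose[OF F lin_ext_lin[OF B.is_cring N(1) \<phi>] h]])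
      (simp add: d compose_def lin_ext_delta[OF B.is_cring N(2) h\<phi>]
        lin_ext_delta[OF B.is_cring N(1) \<phi>])
  from fun_cong[OF this, of f] f show ?thesis by (simp add: compose_def)
qed

text \<open>The linear extension of \<open>h \<circ> \<phi>\<close> is \<open>h\<close> after that of \<open>\<phi>\<close>, so it kills the same relations.\<close>

lemma numerical_map_post:
  assumes M: "left_module B M" and N: "left_module B N" "left_module B N'"
    and \<phi>: "numerical_map B n M N \<phi>" and h: "h \<in> lin_maps B N N'"
  shows "numerical_map B n M N' (\<lambda>x. h (\<phi> x))"
proof -
  have c: "\<phi> \<in> carrier M \<rightarrow> carrier N" using numerical_map_closed[OF \<phi>] by auto
  then have hc: "(\<lambda>x. h (\<phi> x)) \<in> carrier M \<rightarrow> carrier N'" using lin_maps_closed[OF h] by auto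
  show ?thesis
    using \<phi> Pn_relations_closed[OF M]
    by (auto simp: numerical_map_lin_ext[OF M N(1) c] numerical_map_lin_ext[OF M N(2) hc]
        lin_ext_post[OF M N c h] lin_maps_zero[OF N h] subset_iff)
qed

text \<open>Here the relations themselves are transported: a linear map \<open>u\<close> commutes with the sums and
  multiples in the arguments of a deviation.\<close>

lemma numerical_map_pre:
  assumes M: "left_module B M" "left_module B M'" and N: "left_module B N"
    and \<phi>: "numerical_map B n M N \<phi>" and u: "u \<in> lin_maps B M' M"
  shows "numerical_map B n M' N (\<lambda>x. \<phi> (u x))"
proof -
  interpret N: left_module B N by fact
  interpret u: abelian_group_hom M' M u by (rule lin_maps_hom[OF M(2,1) u])
  have c: "\<phi> \<in> carrier M \<rightarrow> carrier N" using numerical_map_closed[OF \<phi>] by auto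
  note d = u.deviation_hom[OF c N.M.abelian_group_axioms]
  have uc: "u x \<in> carrier M" if "x \<in> carrier M'" for x using that by simp
  show ?thesis
    unfolding numerical_map_def polynomial_map_def
  proof (intro conjI ballI)
    show "(\<lambda>x. \<phi> (u x)) \<in> carrier M' \<rightarrow> carrier N" using c uc by blast
    show "deviation M' N (\<lambda>x. \<phi> (u x)) (Suc n) x = \<zero>\<^bsub>N\<^esub>"
      if x: "x \<in> {..<Suc n} \<rightarrow> carrier M'" for x
    proof -
      have "(\<lambda>i. u (x i)) \<in> {..<Suc n} \<rightarrow> carrier M" using x uc by blast
      then show ?thesis using \<phi> d[OF x] by (simp add: numerical_map_def polynomial_map_def)
    qed
    fix r x assume r: "r \<in> carrier B" and x: "x \<in> carrier M'"
    have "deviation M' N (\<lambda>x. \<phi> (u x)) k (\<lambda>_. x) = deviation M N \<phi> k (\<lambda>_. u x)" for k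
      using x by (intro d) auto
    then show "\<phi> (u (r \<odot>\<^bsub>M'\<^esub> x))
        = (\<Oplus>\<^bsub>N\<^esub>k\<in>{..n}. binom B r k \<odot>\<^bsub>N\<^esub> deviation M' N (\<lambda>x. \<phi> (u x)) k (\<lambda>_. x))"
      using \<phi> r uc[OF x] lin_maps_smult[OF u r x] by (simp add: numerical_map_def)
  qed
qed

lemma submodule_Pn_kernel:
  assumes M: "left_module B M"
  shows "submodule (Pn_kernel B n M) B (free_alg B M)"
proof -
  interpret F: left_module B "free_alg B M" by (rule left_module_free_alg[OF B.is_cring])
  interpret F: module B "free_alg B M"
    using F.left_module_axioms left_module_iff_module[OF B.is_cring] by blast
  have c: "carrier (free_alg B M) \<in> {J. submodule J B (free_alg B M) \<and> Pn_relations B n M \<subseteq> J}"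
    using F.carrier_is_submodule Pn_relations_closed[OF M] by simp
  show ?thesis
    unfolding Pn_kernel_def
  proof (rule F.submoduleI)
    show "\<Inter>{J. submodule J B (free_alg B M) \<and> Pn_relations B n M \<subseteq> J} \<subseteq> carrier (free_alg B M)"
      using c by blast
    have "\<zero>\<^bsub>free_alg B M\<^esub> \<in> J" if "submodule J B (free_alg B M)" for J
      using subgroup.one_closed[OF submodule.axioms(1)[OF that]] by simp
    then show "\<zero>\<^bsub>free_alg B M\<^esub> \<in> \<Inter>{J. submodule J B (free_alg B M) \<and> Pn_relations B n M \<subseteq> J}"
      by blast
    fix f g r
    assume f: "f \<in> \<Inter>{J. submodule J B (free_alg B M) \<and> Pn_relations B n M \<subseteq> J}"
    then show "\<ominus>\<^bsub>free_alg B M\<^esub> f \<in> \<Inter>{J. submodule J B (free_alg B M) \<and> Pn_relations B n M \<subseteq> J}"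
      by (auto intro: F.submoduleE(3))
    show "r \<odot>\<^bsub>free_alg B M\<^esub> f \<in> \<Inter>{J. submodule J B (free_alg B M) \<and> Pn_relations B n M \<subseteq> J}"
      if "r \<in> carrier B"
      using f that by (auto intro: F.submoduleE(4))
    show "f \<oplus>\<^bsub>free_alg B M\<^esub> g \<in> \<Inter>{J. submodule J B (free_alg B M) \<and> Pn_relations B n M \<subseteq> J}"
      if "g \<in> \<Inter>{J. submodule J B (free_alg B M) \<and> Pn_relations B n M \<subseteq> J}"
      using f that by (auto intro: F.submoduleE(5))
  qed
qed

lemma Pn_kernel_subset_kernel:
  assumes M: "left_module B M" and N: "left_module B N" and h: "h \<in> lin_maps B (free_alg B M) N"
    and "numerical_map B n M N (\<lambda>x. h (delta B x))" and f: "f \<in> Pn_kernel B n M"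
  shows "h f = \<zero>\<^bsub>N\<^esub>"
proof -
  have "submodule {f \<in> carrier (free_alg B M). h f = \<zero>\<^bsub>N\<^esub>} B (free_alg B M)"
    by (rule submodule_kernel[OF left_module_free_alg[OF B.is_cring] N h])
  moreover have "Pn_relations B n M \<subseteq> {f \<in> carrier (free_alg B M). h f = \<zero>\<^bsub>N\<^esub>}"
    using assms(4) Pn_relations_closed[OF M] by (auto simp: numerical_map_iff_relations[OF M N h])
  ultimately show ?thesis using f unfolding Pn_kernel_def by blast
qed

end

lemma lin_maps_eval:
  assumes "cring R" "left_module R M" "left_module R N" "x \<in> carrier M"
  shows "(\<lambda>f\<in>lin_maps R M N. f x) \<in> lin_maps R (Hom_mod R M N) N"
proof -
  have "(\<lambda>f\<in>carrier (Hom_mod R M N). f x) \<in> lin_maps R (Hom_mod R M N) N"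
    using assms(4)
    by (intro lin_maps_restrictI[OF left_module_Hom[OF assms(1-3)]]) (auto simp: lin_maps_closed)
  then show ?thesis by simp
qed

lemma (in abelian_monoid) finsum_cartesian:
  assumes "finite S" "finite T" "f \<in> S \<times> T \<rightarrow> carrier G"
  shows "(\<Oplus>x\<in>S. \<Oplus>y\<in>T. f (x, y)) = finsum G f (S \<times> T)"
  using assms(1,3)
proof (induct S rule: finite_induct)
  case (insert a S)
  have T: "(\<lambda>y. f (a, y)) \<in> T \<rightarrow> carrier G" using insert.prems by auto
  have fS: "f \<in> S \<times> T \<rightarrow> carrier G" using insert.prems by auto
  have "finsum G f (insert a S \<times> T) = finsum G f (Pair a ` T \<union> S \<times> T)"
    by (rule arg_cong[of _ _ "finsum G f"]) auto
  also have "\<dots> = finsum G f (Pair a ` T) \<oplus> finsum G f (S \<times> T)"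
    using insert.hyps(1,2) assms(2) insert.prems by (intro finsum_Un_disjoint) auto
  also have "finsum G f (Pair a ` T) = (\<Oplus>y\<in>T. f (a, y))"
    using T by (intro finsum_reindex) (auto simp: inj_on_def)
  also have "(\<Oplus>y\<in>T. f (a, y)) \<oplus> finsum G f (S \<times> T)
      = (\<Oplus>x\<in>insert a S. \<Oplus>y\<in>T. f (x, y))"
    unfolding insert.hyps(3)[OF fS, symmetric] using insert.hyps(1,2) T insert.prems
    by (intro finsum_insert[symmetric]) (auto intro!: finsum_closed)
  finally show ?case by simp
qed simp

context numerical_degree
begin

abbreviation pt :: "('b, 'x) module \<Rightarrow> 'x \<Rightarrow> ('x \<Rightarrow> 'b) set" where
  "pt M x \<equiv> Pn_coset B n M (delta B x)"

lemma Pn_eq_quot: "Pn B n M = quot_mod B (free_alg B M) (Pn_kernel B n M)"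
  unfolding Pn_def quot_mod_def Pn_coset_def ..

lemma quotient_Pn: "left_module B M \<Longrightarrow> quotient B (free_alg B M) (Pn_kernel B n M)"
  by (intro quotient.intro quotient_axioms.intro left_module_free_alg[OF B.is_cring]
      submodule_Pn_kernel)

lemma left_module_Pn: "left_module B M \<Longrightarrow> left_module B (Pn B n M)"
  unfolding Pn_eq_quot by (rule quotient.left_module_quot[OF quotient_Pn])

lemma Pn_coset_lin:
  "left_module B M \<Longrightarrow> (\<lambda>f\<in>carrier (free_alg B M). Pn_coset B n M f) \<in> lin_maps B (free_alg B M) (Pn B n M)"
  unfolding Pn_eq_quot Pn_coset_def by (rule quotient.quot_lin[OF quotient_Pn])

lemma Pn_coset_closed:
  "\<lbrakk>left_module B M; f \<in> carrier (free_alg B M)\<rbrakk> \<Longrightarrow> Pn_coset B n M f \<in> carrier (Pn B n M)"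
  using lin_maps_closed[OF Pn_coset_lin] by fastforce

lemma Pn_coset_cases:
  assumes "left_module B M" "X \<in> carrier (Pn B n M)"
  obtains f where "f \<in> carrier (free_alg B M)" "X = Pn_coset B n M f"
  using assms(2) unfolding Pn_eq_quot quotient.carrier_quot[OF quotient_Pn[OF assms(1)]]
  by (auto simp: Pn_coset_def)

lemma Pn_coset_eq_kernel_iff:
  "\<lbrakk>left_module B M; f \<in> carrier (free_alg B M)\<rbrakk>
    \<Longrightarrow> Pn_coset B n M f = \<zero>\<^bsub>Pn B n M\<^esub> \<longleftrightarrow> f \<in> Pn_kernel B n M"
  unfolding Pn_eq_quot Pn_coset_def quotient.quot_zero[OF quotient_Pn]
  by (rule quotient.coset_eq_kernel_iff[OF quotient_Pn])

lemma
  assumes "left_module B M" "X \<in> carrier (Pn B n M)" "f \<in> X"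
  shows Pn_mem_free_alg: "f \<in> carrier (free_alg B M)" and Pn_mem_coset: "X = Pn_coset B n M f"
proof -
  interpret Q: quotient B "free_alg B M" "Pn_kernel B n M" by (rule quotient_Pn[OF assms(1)])
  obtain g where g: "g \<in> carrier (free_alg B M)" "X = Pn_coset B n M g"
    using assms(1,2) by (rule Pn_coset_cases)
  then have f: "f \<in> Pn_kernel B n M +>\<^bsub>free_alg B M\<^esub> g" using assms(3) by (simp add: Pn_coset_def)
  show "f \<in> carrier (free_alg B M)" by (rule Q.K.a_elemrcos_carrier[OF g(1) f])
  show "X = Pn_coset B n M f"
    unfolding g(2) Pn_coset_def by (rule Q.K.a_repr_independence'[OF f g(1)])
qed

lemma Pn_nonempty:
  assumes "left_module B M" "X \<in> carrier (Pn B n M)"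
  shows "\<exists>f. f \<in> X"
proof -
  interpret Q: quotient B "free_alg B M" "Pn_kernel B n M" by (rule quotient_Pn[OF assms(1)])
  obtain f where "f \<in> carrier (free_alg B M)" "X = Pn_coset B n M f"
    using assms by (rule Pn_coset_cases)
  then show ?thesis using Q.K.a_rcos_self by (auto simp: Pn_coset_def)
qed

lemma pt_closed: "\<lbrakk>left_module B M; x \<in> carrier M\<rbrakk> \<Longrightarrow> pt M x \<in> carrier (Pn B n M)"
  by (intro Pn_coset_closed delta_in_free_alg[OF B.is_cring])

text \<open>The projection onto \<open>P\<^sub>n(M)\<close> is a linear map on formal sums that kills the relations.\<close>

lemma numerical_pt:
  assumes M: "left_module B M"
  shows "numerical_map B n M (Pn B n M) (pt M)"
proof -
  let ?h = "\<lambda>f\<in>carrier (free_alg B M). Pn_coset B n M f"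
  have "?h f = \<zero>\<^bsub>Pn B n M\<^esub>" if f: "f \<in> Pn_relations B n M" for f
  proof -
    have "f \<in> carrier (free_alg B M)" using f Pn_relations_closed[OF M] by blast
    moreover have "f \<in> Pn_kernel B n M" using f by (auto simp: Pn_kernel_def)
    ultimately show ?thesis using Pn_coset_eq_kernel_iff[OF M] by simp
  qed
  then have n: "numerical_map B n M (Pn B n M) (\<lambda>x. ?h (delta B x))"
    unfolding numerical_map_iff_relations[OF M left_module_Pn[OF M] Pn_coset_lin[OF M]] by blast
  show ?thesis
    by (rule numerical_map_cong[OF M left_module_Pn[OF M] _ n])
      (simp add: delta_in_free_alg[OF B.is_cring])
qed

lemma Pn_induct [consumes 2, case_names zero pt add smult]:
  assumes M: "left_module B M" and X: "X \<in> carrier (Pn B n M)"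
    and zero: "P \<zero>\<^bsub>Pn B n M\<^esub>"
    and pt: "\<And>x. x \<in> carrier M \<Longrightarrow> P (pt M x)"
    and add: "\<And>X Y. \<lbrakk>X \<in> carrier (Pn B n M); Y \<in> carrier (Pn B n M); P X; P Y\<rbrakk>
      \<Longrightarrow> P (X \<oplus>\<^bsub>Pn B n M\<^esub> Y)"
    and smult: "\<And>r X. \<lbrakk>r \<in> carrier B; X \<in> carrier (Pn B n M); P X\<rbrakk> \<Longrightarrow> P (r \<odot>\<^bsub>Pn B n M\<^esub> X)"
  shows "P X"
proof -
  interpret F: left_module B "free_alg B M" by (rule left_module_free_alg[OF B.is_cring])
  note l = Pn_coset_lin[OF M] and c = Pn_coset_closed[OF M]
  obtain f where f: "f \<in> carrier (free_alg B M)" and Xf: "X = Pn_coset B n M f"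
    using M X by (rule Pn_coset_cases)
  from B.is_cring f have "P (Pn_coset B n M f)"
  proof (induct rule: free_alg_induct)
    case zero
    then show ?case
      using assms(3) lin_maps_zero[OF F.left_module_axioms left_module_Pn[OF M] l] by simp
  next
    case (add f g)
    then show ?case using assms(5)[of "Pn_coset B n M f" "Pn_coset B n M g"] lin_maps_add[OF l, of f g] c
      by simp
  next
    case (smult r f)
    then show ?case using assms(6)[of r "Pn_coset B n M f"] lin_maps_smult[OF l, of r f] c
      by (simp add: F.smult_closed)
  qed (rule pt)
  then show ?thesis using Xf by simp
qed

lemma Pn_lin_maps_eqI:
  assumes M: "left_module B M" and N: "left_module B N"
    and h: "h \<in> lin_maps B (Pn B n M) N" and k: "k \<in> lin_maps B (Pn B n M) N"
    and eq: "\<And>x. x \<in> carrier M \<Longrightarrow> h (pt M x) = k (pt M x)"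
  shows "h = k"
proof (rule lin_maps_eqI[OF h k])
  fix X assume "X \<in> carrier (Pn B n M)"
  with M show "h X = k X"
    by (induct rule: Pn_induct) (simp_all add: eq lin_maps_add[OF h] lin_maps_add[OF k]
        lin_maps_smult[OF h] lin_maps_smult[OF k] lin_maps_zero[OF left_module_Pn[OF M] N]  h k)
qed

text \<open>Any representative may be chosen, since the linear extension of a numerical map vanishes on the
  kernel of the projection.\<close>

definition lift :: "('b, 'x) module \<Rightarrow> ('b, 'y) module \<Rightarrow> ('x \<Rightarrow> 'y) \<Rightarrow> ('x \<Rightarrow> 'b) set \<Rightarrow> 'y" where
  "lift M N \<phi> = (\<lambda>X\<in>carrier (Pn B n M). lin_ext B N \<phi> (SOME f. f \<in> X))"

context
  fixes M :: "('b, 'x) module" and N :: "('b, 'y) module" and \<phi>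
  assumes M: "left_module B M" and N: "left_module B N" and \<phi>: "numerical_map B n M N \<phi>"
begin

lemma numerical_funcset: "\<phi> \<in> carrier M \<rightarrow> carrier N"
  using numerical_map_closed[OF \<phi>] by auto

lemma lift_coset:
  assumes f: "f \<in> carrier (free_alg B M)"
  shows "lift M N \<phi> (Pn_coset B n M f) = lin_ext B N \<phi> f"
proof -
  interpret Q: quotient B "free_alg B M" "Pn_kernel B n M" by (rule quotient_Pn[OF M])
  interpret N: left_module B N by (rule N)
  let ?X = "Pn_coset B n M f" and ?h = "\<lambda>f\<in>carrier (free_alg B M). lin_ext B N \<phi> f"
  note l = lin_ext_lin[OF B.is_cring N numerical_funcset]
  interpret h: abelian_group_hom "free_alg B M" N ?h
    by (rule lin_maps_hom[OF left_module_free_alg[OF B.is_cring] N l])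
  define g where "g = (SOME f. f \<in> ?X)"
  have X: "?X \<in> carrier (Pn B n M)" by (rule Pn_coset_closed[OF M f])
  have gX: "g \<in> ?X" unfolding g_def by (rule someI_ex[OF Pn_nonempty[OF M X]])
  have g: "g \<in> carrier (free_alg B M)" by (rule Pn_mem_free_alg[OF M X gX])
  have "g \<ominus>\<^bsub>free_alg B M\<^esub> f \<in> Pn_kernel B n M"
    using Pn_mem_coset[OF M X gX] Q.coset_eq_iff[OF g f] by (simp add: Pn_coset_def)
  moreover have "numerical_map B n M N (\<lambda>x. ?h (delta B x))"
    by (rule numerical_map_cong[OF M N _ \<phi>])
      (simp add: delta_in_free_alg[OF B.is_cring] lin_ext_delta[OF B.is_cring N numerical_funcset])
  ultimately have "?h (g \<ominus>\<^bsub>free_alg B M\<^esub> f) = \<zero>\<^bsub>N\<^esub>"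
    by (intro Pn_kernel_subset_kernel[OF M N l])
  moreover have "?h (g \<ominus>\<^bsub>free_alg B M\<^esub> f) = ?h g \<ominus>\<^bsub>N\<^esub> ?h f"
    using h.hom_add[OF g Q.M.a_inv_closed[OF f]] h.hom_a_inv[OF f] by (simp only: a_minus_def)
  ultimately have "?h g = ?h f"
    using N.M.minus_eq_zero_iff[OF h.hom_closed[OF g] h.hom_closed[OF f]] by (simp del: h.hom_closed)
  then show ?thesis using X f g by (simp add: lift_def g_def)
qed

lemma lift_lin: "lift M N \<phi> \<in> lin_maps B (Pn B n M) N"
proof -
  interpret F: left_module B "free_alg B M" by (rule left_module_free_alg[OF B.is_cring])
  note l = lin_ext_lin[OF B.is_cring N numerical_funcset]
  note cl = Pn_coset_lin[OF M]
  have add: "lift M N \<phi> (X \<oplus>\<^bsub>Pn B n M\<^esub> Y) = lift M N \<phi> X \<oplus>\<^bsub>N\<^esub> lift M N \<phi> Y"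
    if X: "X \<in> carrier (Pn B n M)" and Y: "Y \<in> carrier (Pn B n M)" for X Y
  proof -
    obtain f where f: "f \<in> carrier (free_alg B M)" "X = Pn_coset B n M f"
      using M X by (rule Pn_coset_cases)
    obtain g where g: "g \<in> carrier (free_alg B M)" "Y = Pn_coset B n M g"
      using M Y by (rule Pn_coset_cases)
    show ?thesis
      using lin_maps_add[OF l f(1) g(1)] lin_maps_add[OF cl f(1) g(1)] f g
      by (simp add: lift_coset F.a_closed flip: lift_coset)
  qed
  have smult: "lift M N \<phi> (r \<odot>\<^bsub>Pn B n M\<^esub> X) = r \<odot>\<^bsub>N\<^esub> lift M N \<phi> X" "lift M N \<phi> X \<in> carrier N"
    if X: "X \<in> carrier (Pn B n M)" and r: "r \<in> carrier B" for X r
  proof -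
    obtain f where f: "f \<in> carrier (free_alg B M)" "X = Pn_coset B n M f"
      using M X by (rule Pn_coset_cases)
    show "lift M N \<phi> (r \<odot>\<^bsub>Pn B n M\<^esub> X) = r \<odot>\<^bsub>N\<^esub> lift M N \<phi> X"
      using lin_maps_smult[OF l r f(1)] lin_maps_smult[OF cl r f(1)] f
      by (simp add: F.smult_closed r flip: lift_coset)
    show "lift M N \<phi> X \<in> carrier N"
      using lin_maps_closed[OF l f(1)] f by (simp add: lift_coset)
  qed
  show ?thesis
    by (rule lin_mapsI) (auto simp: add smult(1) smult(2)[OF _ B.zero_closed],
        simp add: lift_def)
qed

lemma lift_pt: "x \<in> carrier M \<Longrightarrow> lift M N \<phi> (pt M x) = \<phi> x"
  using lift_coset[OF delta_in_free_alg[OF B.is_cring]]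
    lin_ext_delta[OF B.is_cring N numerical_funcset] by simp

lemma lift_unique: "\<lbrakk>h \<in> lin_maps B (Pn B n M) N; \<And>x. x \<in> carrier M \<Longrightarrow> h (pt M x) = \<phi> x\<rbrakk>
    \<Longrightarrow> h = lift M N \<phi>"
  by (rule Pn_lin_maps_eqI[OF M N _ lift_lin]) (auto simp: lift_pt)

end

text \<open>Numericality of a map into a module of linear maps is a condition on the values, and these
  need to be tested on generators only.\<close>

lemma numerical_into_Hom_Pn:
  assumes A: "left_module B A" and M: "left_module B M" and N: "left_module B N"
    and C: "\<And>a. a \<in> carrier A \<Longrightarrow> C a \<in> lin_maps B (Pn B n M) N"
    and num: "\<And>x. x \<in> carrier M \<Longrightarrow> numerical_map B n A N (\<lambda>a. C a (pt M x))"
  shows "numerical_map B n A (Hom_mod B (Pn B n M) N) C"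
proof -
  let ?H = "Hom_mod B (Pn B n M) N"
  note P = left_module_Pn[OF M]
  note H = left_module_Hom[OF B.is_cring P N]
  interpret H: left_module B ?H by (rule H)
  have Cc: "C \<in> carrier A \<rightarrow> carrier ?H" using C by auto
  have "lin_ext B ?H C f = \<zero>\<^bsub>?H\<^esub>" if f: "f \<in> Pn_relations B n A" for f
  proof -
    have fF: "f \<in> carrier (free_alg B A)" using f Pn_relations_closed[OF A] by blast
    have cl: "lin_ext B ?H C f \<in> lin_maps B (Pn B n M) N"
      using lin_maps_closed[OF lin_ext_lin[OF B.is_cring H Cc] fF] fF by simp
    have "lin_ext B ?H C f (pt M x) = \<zero>\<^bsub>N\<^esub>" if x: "x \<in> carrier M" for x
    proof -
      let ?e = "\<lambda>f\<in>lin_maps B (Pn B n M) N. f (pt M x)"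
      have "?e (lin_ext B ?H C f) = lin_ext B N (\<lambda>a. ?e (C a)) f"
        by (rule lin_ext_post[OF A H N Cc _ fF, symmetric])
          (rule lin_maps_eval[OF B.is_cring P N pt_closed[OF M x]])
      also have "\<dots> = \<zero>\<^bsub>N\<^esub>"
      proof -
        have "numerical_map B n A N (\<lambda>a. ?e (C a))"
          by (rule numerical_map_cong[OF A N _ num[OF x]]) (use C in simp)
        then show ?thesis
          using f numerical_map_lin_ext[OF A N numerical_funcset[OF A N]] by blast
      qed
      finally show ?thesis using cl by simp
    qed
    then show ?thesis
      using H.M.zero_closed cl pt_closed[OF M] by (intro Pn_lin_maps_eqI[OF M N]) auto
  qed
  then show ?thesis using numerical_map_lin_ext[OF A H Cc] by blast
qed

end

section \<open>Composition of classes\<close>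

lemma free_alg_eval:
  assumes "cring B"
  shows "abelian_group_hom (free_alg B M) B (\<lambda>f. f w)"
proof -
  interpret B: cring B by fact
  interpret F: left_module B "free_alg B M" by (rule left_module_free_alg[OF assms])
  show ?thesis
    by (rule abelian_group_hom_of_additive[OF F.M.abelian_group_axioms B.abelian_group_axioms])
      (auto simp: free_alg_simps)
qed

lemma lin_ext_free_alg_apply:
  assumes "cring B" "\<psi> \<in> carrier M \<rightarrow> carrier (free_alg B W)" "f \<in> carrier (free_alg B M)"
  shows "lin_ext B (free_alg B W) \<psi> f w = (\<Oplus>\<^bsub>B\<^esub>x\<in>supp B f. f x \<otimes>\<^bsub>B\<^esub> \<psi> x w)"
proof -
  interpret F: left_module B "free_alg B W" by (rule left_module_free_alg[OF assms(1)])
  have "(\<lambda>x. f x \<odot>\<^bsub>free_alg B W\<^esub> \<psi> x) \<in> supp B f \<rightarrow> carrier (free_alg B W)"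
    using assms(2,3) by (auto simp: free_alg_simps(1)[of B M] intro!: F.smult_closed)
  then show ?thesis
    unfolding lin_ext_def by (simp add: abelian_group_hom.hom_finsum[OF free_alg_eval[OF assms(1)]])
      (simp add: free_alg_simps)
qed

lemma lin_ext_cong:
  assumes "left_module B N" "\<psi> \<in> carrier M \<rightarrow> carrier N" "f \<in> carrier (free_alg B M)"
    and "\<And>x. x \<in> carrier M \<Longrightarrow> \<phi> x = \<psi> x"
  shows "lin_ext B N \<phi> f = lin_ext B N \<psi> f"
proof -
  interpret N: left_module B N by fact
  have "f x \<in> carrier B" "supp B f \<subseteq> carrier M" for x
    using assms(3) by (auto simp: free_alg_simps)
  then show ?thesis
    unfolding lin_ext_def using assms(2,4)
    by (intro N.M.finsum_cong'[OF refl]) (auto simp: subset_iff Pi_iff intro!: N.smult_closed)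
qed

text \<open>The encodings of push-forward and convolution sum over fibres. As linear extensions they are
  visibly linear in each argument.\<close>

lemma push_eq_lin_ext:
  assumes "cring B" "h \<in> carrier M \<rightarrow> carrier W" "f \<in> carrier (free_alg B M)"
  shows "push B h f = lin_ext B (free_alg B W) (\<lambda>x. delta B (h x)) f"
proof
  fix w
  interpret B: cring B by fact
  have f: "f x \<in> carrier B" "finite (supp B f)" for x
    using assms(3) by (auto simp: free_alg_simps)
  have \<psi>: "(\<lambda>x. delta B (h x)) \<in> carrier M \<rightarrow> carrier (free_alg B W)"
    using assms(2) by (auto intro!: delta_in_free_alg[OF assms(1)])
  show "push B h f w = lin_ext B (free_alg B W) (\<lambda>x. delta B (h x)) f w"
    unfolding lin_ext_free_alg_apply[OF assms(1) \<psi> assms(3)] push_def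
    by (rule B.add.finprod_mono_neutral_cong_left[OF f(2)]) (use f in \<open>auto simp: delta_def\<close>)
qed

lemma conv_eq_lin_ext:
  assumes B: "cring B" and m: "\<And>x y. \<lbrakk>x \<in> carrier M; y \<in> carrier N\<rbrakk> \<Longrightarrow> m x y \<in> carrier W"
    and f: "f \<in> carrier (free_alg B M)" and g: "g \<in> carrier (free_alg B N)"
  shows "conv B m f g
    = lin_ext B (free_alg B W) (\<lambda>x. lin_ext B (free_alg B W) (\<lambda>y. delta B (m x y)) g) f"
proof
  fix w
  interpret B: cring B by fact
  let ?F = "free_alg B W"
  have fc: "f x \<in> carrier B" "finite (supp B f)" "supp B f \<subseteq> carrier M"
    and gc: "g y \<in> carrier B" "finite (supp B g)" "supp B g \<subseteq> carrier N" for x y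
    using f g by (auto simp: free_alg_simps)
  have d: "delta B x y \<in> carrier B" for x y by (simp add: delta_def)
  have in_F: "(\<lambda>y. delta B (m x y)) \<in> carrier N \<rightarrow> carrier ?F" if "x \<in> carrier M" for x
    using m[OF that] by (auto intro!: delta_in_free_alg[OF B])
  then have out_F: "(\<lambda>x. lin_ext B ?F (\<lambda>y. delta B (m x y)) g) \<in> carrier M \<rightarrow> carrier ?F"
    using lin_maps_closed[OF lin_ext_lin[OF B left_module_free_alg[OF B] in_F] g] g by simp
  have "lin_ext B ?F (\<lambda>x. lin_ext B ?F (\<lambda>y. delta B (m x y)) g) f w
      = (\<Oplus>\<^bsub>B\<^esub>x\<in>supp B f. f x \<otimes>\<^bsub>B\<^esub> lin_ext B ?F (\<lambda>y. delta B (m x y)) g w)"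
    by (rule lin_ext_free_alg_apply[OF B out_F f])
  also have "\<dots> = (\<Oplus>\<^bsub>B\<^esub>x\<in>supp B f. \<Oplus>\<^bsub>B\<^esub>y\<in>supp B g. f x \<otimes>\<^bsub>B\<^esub> (g y \<otimes>\<^bsub>B\<^esub> delta B (m x y) w))"
  proof (rule B.finsum_cong'[OF refl])
    fix x assume "x \<in> supp B f"
    then have x: "x \<in> carrier M" using fc(3) by auto
    show "f x \<otimes>\<^bsub>B\<^esub> lin_ext B ?F (\<lambda>y. delta B (m x y)) g w
        = (\<Oplus>\<^bsub>B\<^esub>y\<in>supp B g. f x \<otimes>\<^bsub>B\<^esub> (g y \<otimes>\<^bsub>B\<^esub> delta B (m x y) w))"
      unfolding lin_ext_free_alg_apply[OF B in_F[OF x] g]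
      by (rule B.finsum_rdistr) (auto simp: fc gc(1,2) d)
  qed (auto simp: fc(1) gc(1) d intro!: B.finsum_closed)
  also have "\<dots> = (\<Oplus>\<^bsub>B\<^esub>p\<in>supp B f \<times> supp B g. f (fst p) \<otimes>\<^bsub>B\<^esub> (g (snd p) \<otimes>\<^bsub>B\<^esub> delta B (m (fst p) (snd p)) w))"
    using B.finsum_cartesian[OF fc(2) gc(2),
        of "\<lambda>p. f (fst p) \<otimes>\<^bsub>B\<^esub> (g (snd p) \<otimes>\<^bsub>B\<^esub> delta B (m (fst p) (snd p)) w)"]
    by (simp add: fc(1) gc(1) d)
  also have "\<dots> = conv B m f g w"
    unfolding conv_def
    by (rule B.add.finprod_mono_neutral_cong_left[symmetric]) (use fc gc in \<open>auto simp: delta_def\<close>)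
  finally show "conv B m f g w
      = lin_ext B ?F (\<lambda>x. lin_ext B ?F (\<lambda>y. delta B (m x y)) g) f w" by simp
qed

context numerical_degree
begin

abbreviation P :: "('b, 'x) module \<Rightarrow> ('b, 'y) module \<Rightarrow> ('b, (('x \<Rightarrow> 'y) \<Rightarrow> 'b) set) module" where
  "P M N \<equiv> Pn B n (Hom_mod B M N)"

abbreviation arrow :: "('b, 'x) module \<Rightarrow> ('b, 'y) module \<Rightarrow> ('x \<Rightarrow> 'y) \<Rightarrow> (('x \<Rightarrow> 'y) \<Rightarrow> 'b) set" where
  "arrow M N \<alpha> \<equiv> pt (Hom_mod B M N) \<alpha>"

lemma arrow_closed:
  "\<lbrakk>left_module B L; left_module B M; \<alpha> \<in> lin_maps B L M\<rbrakk> \<Longrightarrow> arrow L M \<alpha> \<in> carrier (P L M)"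
  using pt_closed[OF left_module_Hom[OF B.is_cring], of L M \<alpha>] by simp

text \<open>The composition is defined by two applications of the universal property, since \<open>[\<alpha> \<beta>]\<close> is
  numerical in \<open>\<beta>\<close> for fixed \<open>\<alpha>\<close> and conversely. This makes it bilinear by construction.\<close>

definition post :: "('b, 'x) module \<Rightarrow> ('b, 'y) module \<Rightarrow> ('b, 'w) module \<Rightarrow> ('y \<Rightarrow> 'w)
    \<Rightarrow> (('x \<Rightarrow> 'y) \<Rightarrow> 'b) set \<Rightarrow> (('x \<Rightarrow> 'w) \<Rightarrow> 'b) set" where
  "post L M N \<alpha> = lift (Hom_mod B L M) (P L N) (\<lambda>\<beta>. arrow L N (compose (carrier L) \<alpha> \<beta>))"

definition comp :: "('b, 'x) module \<Rightarrow> ('b, 'y) module \<Rightarrow> ('b, 'w) module \<Rightarrow> (('y \<Rightarrow> 'w) \<Rightarrow> 'b) set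
    \<Rightarrow> (('x \<Rightarrow> 'y) \<Rightarrow> 'b) set \<Rightarrow> (('x \<Rightarrow> 'w) \<Rightarrow> 'b) set" where
  "comp L M N = lift (Hom_mod B M N) (Hom_mod B (P L M) (P L N)) (post L M N)"

context
  fixes L M N :: "('b, 'x) module"
  assumes L: "left_module B L" and M: "left_module B M" and N: "left_module B N"
begin

private lemmas LM = left_module_Hom[OF B.is_cring L M] and MN = left_module_Hom[OF B.is_cring M N]
  and LN = left_module_Hom[OF B.is_cring L N]
private lemmas PLM = left_module_Pn[OF LM] and PLN = left_module_Pn[OF LN]

lemma numerical_post:
  assumes "\<alpha> \<in> lin_maps B M N"
  shows "numerical_map B n (Hom_mod B L M) (P L N) (\<lambda>\<beta>. arrow L N (compose (carrier L) \<alpha> \<beta>))"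
  by (rule numerical_map_cong[OF LM PLN _ numerical_map_pre[OF LN LM PLN numerical_pt[OF LN]
          compose_left_lin[OF B.is_cring L M N assms]]]) simp

lemma numerical_pre:
  assumes "\<beta> \<in> lin_maps B L M"
  shows "numerical_map B n (Hom_mod B M N) (P L N) (\<lambda>\<alpha>. arrow L N (compose (carrier L) \<alpha> \<beta>))"
  by (rule numerical_map_cong[OF MN PLN _ numerical_map_pre[OF LN MN PLN numerical_pt[OF LN]
          compose_right_lin[OF B.is_cring L M N assms]]]) simp

lemma post_lin: "\<alpha> \<in> lin_maps B M N \<Longrightarrow> post L M N \<alpha> \<in> lin_maps B (P L M) (P L N)"
  unfolding post_def by (rule lift_lin[OF LM PLN numerical_post])

lemma post_arrow: "\<lbrakk>\<alpha> \<in> lin_maps B M N; \<beta> \<in> lin_maps B L M\<rbrakk>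
    \<Longrightarrow> post L M N \<alpha> (arrow L M \<beta>) = arrow L N (compose (carrier L) \<alpha> \<beta>)"
  unfolding post_def by (subst lift_pt[OF LM PLN numerical_post]) auto

lemma numerical_comp: "numerical_map B n (Hom_mod B M N) (Hom_mod B (P L M) (P L N)) (post L M N)"
proof (rule numerical_into_Hom_Pn[OF MN LM PLN])
  show "post L M N \<alpha> \<in> lin_maps B (P L M) (P L N)" if "\<alpha> \<in> carrier (Hom_mod B M N)" for \<alpha>
    using that post_lin by simp
  show "numerical_map B n (Hom_mod B M N) (P L N) (\<lambda>\<alpha>. post L M N \<alpha> (arrow L M \<beta>))"
    if "\<beta> \<in> carrier (Hom_mod B L M)" for \<beta>
    by (rule numerical_map_cong[OF MN PLN _ numerical_pre]) (use that in \<open>auto simp: post_arrow\<close>)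
qed

lemma comp_lin: "comp L M N \<in> lin_maps B (P M N) (Hom_mod B (P L M) (P L N))"
  unfolding comp_def by (rule lift_lin[OF MN left_module_Hom[OF B.is_cring PLM PLN] numerical_comp])

lemma comp_pt: "\<alpha> \<in> lin_maps B M N \<Longrightarrow> comp L M N (arrow M N \<alpha>) = post L M N \<alpha>"
  unfolding comp_def
  by (subst lift_pt[OF MN left_module_Hom[OF B.is_cring PLM PLN] numerical_comp]) auto

lemma compose_closed: "\<lbrakk>\<alpha> \<in> carrier (Hom_mod B M N); \<beta> \<in> carrier (Hom_mod B L M)\<rbrakk>
    \<Longrightarrow> compose (carrier L) \<alpha> \<beta> \<in> carrier (Hom_mod B L N)"
  by (simp add: lin_maps_compose[OF L])

lemma post_coset:
  assumes \<alpha>: "\<alpha> \<in> lin_maps B M N" and f: "f \<in> carrier (free_alg B (Hom_mod B L M))"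
  shows "post L M N \<alpha> (Pn_coset B n (Hom_mod B L M) f)
    = Pn_coset B n (Hom_mod B L N) (lin_ext B (free_alg B (Hom_mod B L N))
        (\<lambda>\<beta>. delta B (compose (carrier L) \<alpha> \<beta>)) f)"
proof -
  have d: "(\<lambda>\<beta>. delta B (compose (carrier L) \<alpha> \<beta>))
      \<in> carrier (Hom_mod B L M) \<rightarrow> carrier (free_alg B (Hom_mod B L N))"
    using \<alpha> by (intro Pi_I delta_in_free_alg[OF B.is_cring] compose_closed) auto
  note F = left_module_free_alg[OF B.is_cring]
  note l = lin_ext_post[OF LM F PLN d Pn_coset_lin[OF LN] f]
  have "post L M N \<alpha> (Pn_coset B n (Hom_mod B L M) f)
      = lin_ext B (P L N) (\<lambda>\<beta>. arrow L N (compose (carrier L) \<alpha> \<beta>)) f"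
    unfolding post_def by (rule lift_coset[OF LM PLN numerical_post[OF \<alpha>] f])
  also have "\<dots> = lin_ext B (P L N) (\<lambda>\<beta>. (\<lambda>f\<in>carrier (free_alg B (Hom_mod B L N)).
      Pn_coset B n (Hom_mod B L N) f) (delta B (compose (carrier L) \<alpha> \<beta>))) f"
    using d by (intro lin_ext_cong[OF PLN _ f]) (auto intro!: Pn_coset_closed[OF LN])
  also have "\<dots> = Pn_coset B n (Hom_mod B L N) (lin_ext B (free_alg B (Hom_mod B L N))
        (\<lambda>\<beta>. delta B (compose (carrier L) \<alpha> \<beta>)) f)"
    using l lin_maps_closed[OF lin_ext_lin[OF B.is_cring F d] f] f by simp
  finally show ?thesis .
qed

text \<open>For all representatives \<open>f\<close> and \<open>g\<close> the class of their convolution is the value of the bilinear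
  composition. In particular it does not depend on the representatives, so the union in
  \<^const>\<open>Pn_comp\<close> is over equal sets.\<close>

lemma Pn_comp_eq_comp:
  assumes X: "X \<in> carrier (P M N)" and A: "A \<in> carrier (P L M)"
  shows "Pn_comp B n L N X A = comp L M N X A"
proof -
  note F = left_module_free_alg[OF B.is_cring]
  have "Pn_coset B n (Hom_mod B L N) (conv B (compose (carrier L)) f g) = comp L M N X A"
    if f: "f \<in> X" and g: "g \<in> A" for f g
  proof -
    have fF: "f \<in> carrier (free_alg B (Hom_mod B M N))" by (rule Pn_mem_free_alg[OF MN X f])
    have gF: "g \<in> carrier (free_alg B (Hom_mod B L M))" by (rule Pn_mem_free_alg[OF LM A g])
    let ?\<Psi> = "\<lambda>\<alpha>. lin_ext B (free_alg B (Hom_mod B L N)) (\<lambda>\<beta>. delta B (compose (carrier L) \<alpha> \<beta>)) g"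
    let ?c = "\<lambda>f\<in>carrier (free_alg B (Hom_mod B L N)). Pn_coset B n (Hom_mod B L N) f"
    let ?e = "\<lambda>h\<in>lin_maps B (P L M) (P L N). h A"
    have d: "(\<lambda>\<beta>. delta B (compose (carrier L) \<alpha> \<beta>))
        \<in> carrier (Hom_mod B L M) \<rightarrow> carrier (free_alg B (Hom_mod B L N))"
      if "\<alpha> \<in> carrier (Hom_mod B M N)" for \<alpha>
      using that by (intro Pi_I delta_in_free_alg[OF B.is_cring] compose_closed)
    have \<Psi>: "?\<Psi> \<in> carrier (Hom_mod B M N) \<rightarrow> carrier (free_alg B (Hom_mod B L N))"
      using lin_maps_closed[OF lin_ext_lin[OF B.is_cring F d] gF] gF by (simp add: Pi_iff)
    have pc: "post L M N \<in> carrier (Hom_mod B M N) \<rightarrow> carrier (Hom_mod B (P L M) (P L N))"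
      using post_lin by simp
    have eq: "?c (?\<Psi> \<alpha>) = ?e (post L M N \<alpha>)" if "\<alpha> \<in> carrier (Hom_mod B M N)" for \<alpha>
      using post_coset[OF _ gF, of \<alpha>] Pn_mem_coset[OF LM A g] that \<Psi> post_lin by (simp add: Pi_iff)
    have "Pn_coset B n (Hom_mod B L N) (conv B (compose (carrier L)) f g)
        = ?c (lin_ext B (free_alg B (Hom_mod B L N)) ?\<Psi> f)"
      using conv_eq_lin_ext[OF B.is_cring compose_closed fF gF]
        lin_maps_closed[OF lin_ext_lin[OF B.is_cring F \<Psi>] fF] fF by simp
    also have "\<dots> = lin_ext B (P L N) (\<lambda>\<alpha>. ?c (?\<Psi> \<alpha>)) f"
      by (rule lin_ext_post[OF MN F PLN \<Psi> Pn_coset_lin[OF LN] fF, symmetric])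
    also have "\<dots> = lin_ext B (P L N) (\<lambda>\<alpha>. ?e (post L M N \<alpha>)) f"
      using post_lin lin_maps_closed[OF post_lin A]
      by (intro lin_ext_cong[OF PLN _ fF eq]) auto
    also have "\<dots> = ?e (lin_ext B (Hom_mod B (P L M) (P L N)) (post L M N) f)"
      by (rule lin_ext_post[OF MN left_module_Hom[OF B.is_cring PLM PLN] PLN pc
            lin_maps_eval[OF B.is_cring PLM PLN A] fF])
    also have "lin_ext B (Hom_mod B (P L M) (P L N)) (post L M N) f = comp L M N X"
      unfolding Pn_mem_coset[OF MN X f] comp_def
      by (rule lift_coset[OF MN left_module_Hom[OF B.is_cring PLM PLN] numerical_comp fF, symmetric])
    also have "?e (comp L M N X) = comp L M N X A"
      using lin_maps_closed[OF comp_lin X] by simp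
    finally show ?thesis .
  qed
  then show ?thesis
    unfolding Pn_comp_def using Pn_nonempty[OF MN X] Pn_nonempty[OF LM A] by auto
qed

lemma Pn_hom_arr_eq:
  assumes \<chi>: "\<chi> \<in> lin_maps B M N" and X: "X \<in> carrier (P L M)"
  shows "farr (Pn_hom B n L) M N \<chi> X = Pn_comp B n L N (arrow M N \<chi>) X"
proof -
  have "Pn_coset B n (Hom_mod B L N) (push B (compose (carrier L) \<chi>) f) = post L M N \<chi> X"
    if f: "f \<in> X" for f
  proof -
    have fF: "f \<in> carrier (free_alg B (Hom_mod B L M))" by (rule Pn_mem_free_alg[OF LM X f])
    have c: "compose (carrier L) \<chi> \<in> carrier (Hom_mod B L M) \<rightarrow> carrier (Hom_mod B L N)"
      using \<chi> compose_closed by simp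
    show ?thesis
      unfolding push_eq_lin_ext[OF B.is_cring c fF] Pn_mem_coset[OF LM X f]
      by (rule post_coset[OF \<chi> fF, symmetric])
  qed
  then have "farr (Pn_hom B n L) M N \<chi> X = post L M N \<chi> X"
    using X Pn_nonempty[OF LM X] by (auto simp: Pn_hom_def)
  also have "\<dots> = Pn_comp B n L N (arrow M N \<chi>) X"
    using X \<chi> by (subst Pn_comp_eq_comp) (auto simp: comp_pt intro!: pt_closed[OF MN])
  finally show ?thesis .
qed

lemma Pn_comp_left_lin:
  assumes X: "X \<in> carrier (P M N)"
  shows "(\<lambda>A\<in>carrier (P L M). Pn_comp B n L N X A) \<in> lin_maps B (P L M) (P L N)"
proof -
  have "comp L M N X \<in> lin_maps B (P L M) (P L N)"
    using lin_maps_closed[OF comp_lin X] by simp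
  moreover have "(\<lambda>A\<in>carrier (P L M). Pn_comp B n L N X A) = comp L M N X"
    using lin_maps_extensional[OF calculation] X
    by (intro extensionalityI[of _ "carrier (P L M)"]) (auto simp: Pn_comp_eq_comp)
  ultimately show ?thesis by simp
qed

lemma Pn_comp_right_lin:
  assumes A: "A \<in> carrier (P L M)"
  shows "(\<lambda>X\<in>carrier (P M N). Pn_comp B n L N X A) \<in> lin_maps B (P M N) (P L N)"
proof (rule lin_maps_restrictI[OF left_module_Pn[OF MN]])
  interpret PMN: left_module B "P M N" by (rule left_module_Pn[OF MN])
  fix X Y r assume X: "X \<in> carrier (P M N)"
  show "Pn_comp B n L N X A \<in> carrier (P L N)"
    using lin_maps_closed[OF Pn_comp_left_lin[OF X] A] A by simp
  show "Pn_comp B n L N (X \<oplus>\<^bsub>P M N\<^esub> Y) A = Pn_comp B n L N X A \<oplus>\<^bsub>P L N\<^esub> Pn_comp B n L N Y A"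
    if "Y \<in> carrier (P M N)"
    using that X A by (simp add: Pn_comp_eq_comp lin_maps_add[OF comp_lin])
  show "Pn_comp B n L N (r \<odot>\<^bsub>P M N\<^esub> X) A = r \<odot>\<^bsub>P L N\<^esub> Pn_comp B n L N X A"
    if "r \<in> carrier B"
    using that X A by (simp add: Pn_comp_eq_comp lin_maps_smult[OF comp_lin] PMN.smult_closed)
qed

lemma Pn_comp_closed [intro]:
  "\<lbrakk>X \<in> carrier (P M N); A \<in> carrier (P L M)\<rbrakk> \<Longrightarrow> Pn_comp B n L N X A \<in> carrier (P L N)"
  using lin_maps_closed[OF Pn_comp_left_lin] by simp

lemma
  assumes "X \<in> carrier (P M N)"
  shows Pn_comp_add_right: "\<lbrakk>A \<in> carrier (P L M); A' \<in> carrier (P L M)\<rbrakk>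
      \<Longrightarrow> Pn_comp B n L N X (A \<oplus>\<^bsub>P L M\<^esub> A') = Pn_comp B n L N X A \<oplus>\<^bsub>P L N\<^esub> Pn_comp B n L N X A'"
    and Pn_comp_smult_right: "\<lbrakk>r \<in> carrier B; A \<in> carrier (P L M)\<rbrakk>
      \<Longrightarrow> Pn_comp B n L N X (r \<odot>\<^bsub>P L M\<^esub> A) = r \<odot>\<^bsub>P L N\<^esub> Pn_comp B n L N X A"
    and Pn_comp_zero_right: "Pn_comp B n L N X \<zero>\<^bsub>P L M\<^esub> = \<zero>\<^bsub>P L N\<^esub>"
proof -
  interpret PLM: left_module B "P L M" by (rule PLM)
  note l = Pn_comp_left_lin[OF assms]
  show "\<lbrakk>A \<in> carrier (P L M); A' \<in> carrier (P L M)\<rbrakk>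
      \<Longrightarrow> Pn_comp B n L N X (A \<oplus>\<^bsub>P L M\<^esub> A') = Pn_comp B n L N X A \<oplus>\<^bsub>P L N\<^esub> Pn_comp B n L N X A'"
    using lin_maps_add[OF l, of A A'] by simp
  show "\<lbrakk>r \<in> carrier B; A \<in> carrier (P L M)\<rbrakk>
      \<Longrightarrow> Pn_comp B n L N X (r \<odot>\<^bsub>P L M\<^esub> A) = r \<odot>\<^bsub>P L N\<^esub> Pn_comp B n L N X A"
    using lin_maps_smult[OF l, of r A] by (simp add: PLM.smult_closed)
  show "Pn_comp B n L N X \<zero>\<^bsub>P L M\<^esub> = \<zero>\<^bsub>P L N\<^esub>"
    using lin_maps_zero[OF PLM PLN l] by simp
qed

lemma
  assumes "A \<in> carrier (P L M)"
  shows Pn_comp_add_left: "\<lbrakk>X \<in> carrier (P M N); X' \<in> carrier (P M N)\<rbrakk>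
      \<Longrightarrow> Pn_comp B n L N (X \<oplus>\<^bsub>P M N\<^esub> X') A = Pn_comp B n L N X A \<oplus>\<^bsub>P L N\<^esub> Pn_comp B n L N X' A"
    and Pn_comp_smult_left: "\<lbrakk>r \<in> carrier B; X \<in> carrier (P M N)\<rbrakk>
      \<Longrightarrow> Pn_comp B n L N (r \<odot>\<^bsub>P M N\<^esub> X) A = r \<odot>\<^bsub>P L N\<^esub> Pn_comp B n L N X A"
    and Pn_comp_zero_left: "Pn_comp B n L N \<zero>\<^bsub>P M N\<^esub> A = \<zero>\<^bsub>P L N\<^esub>"
proof -
  interpret PMN: left_module B "P M N" by (rule left_module_Pn[OF MN])
  note l = Pn_comp_right_lin[OF assms]
  show "\<lbrakk>X \<in> carrier (P M N); X' \<in> carrier (P M N)\<rbrakk>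
      \<Longrightarrow> Pn_comp B n L N (X \<oplus>\<^bsub>P M N\<^esub> X') A = Pn_comp B n L N X A \<oplus>\<^bsub>P L N\<^esub> Pn_comp B n L N X' A"
    using lin_maps_add[OF l, of X X'] by simp
  show "\<lbrakk>r \<in> carrier B; X \<in> carrier (P M N)\<rbrakk>
      \<Longrightarrow> Pn_comp B n L N (r \<odot>\<^bsub>P M N\<^esub> X) A = r \<odot>\<^bsub>P L N\<^esub> Pn_comp B n L N X A"
    using lin_maps_smult[OF l, of r X] by (simp add: PMN.smult_closed)
  show "Pn_comp B n L N \<zero>\<^bsub>P M N\<^esub> A = \<zero>\<^bsub>P L N\<^esub>"
    using lin_maps_zero[OF left_module_Pn[OF MN] PLN l] by simp
qed

lemma Pn_comp_arrow:
  assumes "\<alpha> \<in> lin_maps B M N" "\<beta> \<in> lin_maps B L M"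
  shows "Pn_comp B n L N (arrow M N \<alpha>) (arrow L M \<beta>) = arrow L N (compose (carrier L) \<alpha> \<beta>)"
  using assms
  by (subst Pn_comp_eq_comp)
    (auto simp: comp_pt post_arrow intro!: arrow_closed[OF M N] arrow_closed[OF L M])

end

text \<open>Both sides are linear in each of the three variables, so associativity is inherited from the
  composition of linear maps by three inductions over generators.\<close>

lemma Pn_comp_assoc:
  fixes K L M N :: "('b, 'x) module"
  assumes K: "left_module B K" and L: "left_module B L" and M: "left_module B M" and N: "left_module B N"
    and X: "X \<in> carrier (P M N)" and Y: "Y \<in> carrier (P L M)" and Z: "Z \<in> carrier (P K L)"
  shows "Pn_comp B n K N X (Pn_comp B n K M Y Z) = Pn_comp B n K N (Pn_comp B n L N X Y) Z"
proof -
  note H = left_module_Hom[OF B.is_cring]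
  interpret KL: left_module B "P K L" by (intro left_module_Pn H K L)
  interpret KM: left_module B "P K M" by (intro left_module_Pn H K M)
  interpret LM: left_module B "P L M" by (intro left_module_Pn H L M)
  interpret LN: left_module B "P L N" by (intro left_module_Pn H L N)
  interpret MN: left_module B "P M N" by (intro left_module_Pn H M N)
  note c = Pn_comp_closed[OF K M N] Pn_comp_closed[OF K L M] Pn_comp_closed[OF L M N]
    Pn_comp_closed[OF K L N]
  note l = Pn_comp_add_left[OF K M N] Pn_comp_add_left[OF K L M] Pn_comp_add_left[OF L M N]
    Pn_comp_add_left[OF K L N] Pn_comp_smult_left[OF K M N] Pn_comp_smult_left[OF K L M]
    Pn_comp_smult_left[OF L M N] Pn_comp_smult_left[OF K L N] Pn_comp_zero_left[OF K M N]
    Pn_comp_zero_left[OF K L M] Pn_comp_zero_left[OF L M N] Pn_comp_zero_left[OF K L N]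
  note r = Pn_comp_add_right[OF K M N] Pn_comp_add_right[OF K L M] Pn_comp_add_right[OF L M N]
    Pn_comp_add_right[OF K L N] Pn_comp_smult_right[OF K M N] Pn_comp_smult_right[OF K L M]
    Pn_comp_smult_right[OF L M N] Pn_comp_smult_right[OF K L N] Pn_comp_zero_right[OF K M N]
    Pn_comp_zero_right[OF K L M] Pn_comp_zero_right[OF L M N] Pn_comp_zero_right[OF K L N]
  have 1: "Pn_comp B n K N (arrow M N \<alpha>) (Pn_comp B n K M (arrow L M \<beta>) (arrow K L \<gamma>))
      = Pn_comp B n K N (Pn_comp B n L N (arrow M N \<alpha>) (arrow L M \<beta>)) (arrow K L \<gamma>)"
    if "\<alpha> \<in> lin_maps B M N" "\<beta> \<in> lin_maps B L M" "\<gamma> \<in> lin_maps B K L" for \<alpha> \<beta> \<gamma>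
    using that compose_assoc[of \<gamma> "carrier K" "carrier L" \<alpha> \<beta>] lin_maps_closed[OF that(3)]
    by (simp add: Pn_comp_arrow lin_maps_compose K L M N)
  have 2: "Pn_comp B n K N (arrow M N \<alpha>) (Pn_comp B n K M (arrow L M \<beta>) Z)
      = Pn_comp B n K N (Pn_comp B n L N (arrow M N \<alpha>) (arrow L M \<beta>)) Z"
    if a: "\<alpha> \<in> lin_maps B M N" "\<beta> \<in> lin_maps B L M" for \<alpha> \<beta>
    using H[OF K L] Z
    by (induct rule: Pn_induct)
      (use 1[OF a] a in \<open>simp_all add: l r c arrow_closed[OF M N] arrow_closed[OF L M]\<close>)
  have 3: "Pn_comp B n K N (arrow M N \<alpha>) (Pn_comp B n K M Y Z)
      = Pn_comp B n K N (Pn_comp B n L N (arrow M N \<alpha>) Y) Z" if a: "\<alpha> \<in> lin_maps B M N" for \<alpha>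
    using H[OF L M] Y
    by (induct rule: Pn_induct) (use 2[OF a] a Z in \<open>simp_all add: l r c arrow_closed[OF M N]\<close>)
  show ?thesis
    using H[OF M N] X
    by (induct rule: Pn_induct) (use 3 Y Z in \<open>simp_all add: l r c\<close>)
qed

definition ident_arrow :: "('b, 'x) module \<Rightarrow> (('x \<Rightarrow> 'x) \<Rightarrow> 'b) set" where
  "ident_arrow M = arrow M M (\<lambda>x\<in>carrier M. x)"

lemma ident_arrow_closed: "left_module B M \<Longrightarrow> ident_arrow M \<in> carrier (P M M)"
  unfolding ident_arrow_def by (intro arrow_closed lin_maps_ident)

lemma
  fixes L M :: "('b, 'x) module"
  assumes L: "left_module B L" and M: "left_module B M" and X: "X \<in> carrier (P L M)"
  shows Pn_comp_ident_left: "Pn_comp B n L M (ident_arrow M) X = X"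
    and Pn_comp_ident_right: "Pn_comp B n L M X (ident_arrow L) = X"
proof -
  note iL = ident_arrow_closed[OF L] and iM = ident_arrow_closed[OF M]
  have e: "Pn_comp B n L M (ident_arrow M) (arrow L M \<alpha>) = arrow L M \<alpha>"
      "Pn_comp B n L M (arrow L M \<alpha>) (ident_arrow L) = arrow L M \<alpha>"
    if a: "\<alpha> \<in> lin_maps B L M" for \<alpha>
  proof -
    have "compose (carrier L) (\<lambda>x\<in>carrier M. x) \<alpha> = \<alpha>" "compose (carrier L) \<alpha> (\<lambda>x\<in>carrier L. x) = \<alpha>"
      using lin_maps_extensional[OF a] lin_maps_closed[OF a]
      by (auto simp: compose_def fun_eq_iff extensional_def)
    then show "Pn_comp B n L M (ident_arrow M) (arrow L M \<alpha>) = arrow L M \<alpha>"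
      "Pn_comp B n L M (arrow L M \<alpha>) (ident_arrow L) = arrow L M \<alpha>"
      unfolding ident_arrow_def Pn_comp_arrow[OF L M M lin_maps_ident[OF M] a]
        Pn_comp_arrow[OF L L M a lin_maps_ident[OF L]] by simp_all
  qed
  have H: "left_module B (Hom_mod B L M)" by (rule left_module_Hom[OF B.is_cring L M])
  from H X show "Pn_comp B n L M (ident_arrow M) X = X"
    by (induct rule: Pn_induct) (simp_all add: Pn_comp_zero_right[OF L M M iM] e
        Pn_comp_add_right[OF L M M iM] Pn_comp_smult_right[OF L M M iM])
  from H X show "Pn_comp B n L M X (ident_arrow L) = X"
    by (induct rule: Pn_induct) (simp_all add: Pn_comp_zero_left[OF L L M iL] e
        Pn_comp_add_left[OF L L M iL] Pn_comp_smult_left[OF L L M iL])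
qed

lemma Pn_End_simps:
  "carrier (Pn_End B n E) = carrier (P E E)" "mult (Pn_End B n E) = Pn_comp B n E E"
  "one (Pn_End B n E) = ident_arrow E" "zero (Pn_End B n E) = \<zero>\<^bsub>P E E\<^esub>"
  "add (Pn_End B n E) = add (P E E)"
  by (simp_all add: Pn_End_def ident_arrow_def)

lemma ring_Pn_End:
  assumes E: "left_module B E"
  shows "ring (Pn_End B n E)"
proof -
  interpret EE: left_module B "P E E"
    by (intro left_module_Pn left_module_Hom[OF B.is_cring] E)
  have neg: "\<exists>y\<in>carrier (P E E). y \<oplus>\<^bsub>P E E\<^esub> x = \<zero>\<^bsub>P E E\<^esub>" if "x \<in> carrier (P E E)" for x
    using that EE.M.l_neg EE.M.a_inv_closed by blast
  show ?thesis
  proof (rule ringI)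
    show "abelian_group (Pn_End B n E)"
      by (rule abelian_groupI) (simp_all add: Pn_End_simps EE.M.a_ac neg)
    show "Group.monoid (Pn_End B n E)"
      by (rule monoidI) (simp_all add: Pn_End_simps Pn_comp_closed[OF E E E]
          ident_arrow_closed[OF E] Pn_comp_assoc[OF E E E E]
          Pn_comp_ident_left[OF E E] Pn_comp_ident_right[OF E E])
  qed (simp_all add: Pn_End_simps Pn_comp_add_left[OF E E E] Pn_comp_add_right[OF E E E])
qed

end

section \<open>Numerical functors as linear actions\<close>

lemma mod_cat_simps [simp]:
  "obj (mod_cat R) = {M. left_module R M}" "arr (mod_cat R) = lin_maps R"
  "ident (mod_cat R) M = (\<lambda>x\<in>carrier M. x)" "cmp (mod_cat R) L M N g f = compose (carrier L) g f"
  by (simp_all add: mod_cat_def)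

lemma fmod_cat_simps [simp]:
  "arr (fmod_cat R) = lin_maps R"
  "ident (fmod_cat R) M = (\<lambda>x\<in>carrier M. x)" "cmp (fmod_cat R) L M N g f = compose (carrier L) g f"
  by (simp_all add: fmod_cat_def)

lemma obj_fmod_cat: "M \<in> obj (fmod_cat R) \<longleftrightarrow> left_module R M \<and> fg_free R M"
  by (simp add: fmod_cat_def)

lemma category_fmod_cat: "category (fmod_cat R)"
  unfolding fmod_cat_def by (rule category_restrict_obj[OF category_mod_cat]) auto

lemma num_cat_simps:
  "obj (num_cat B n) = {F. numerical_functor B n F}"
  "arr (num_cat B n) = nat_trans (fmod_cat B) (mod_cat B)"
  "cmp (num_cat B n) F G H \<theta> \<eta> = (\<lambda>M\<in>obj (fmod_cat B). compose (carrier (fobj F M)) (\<theta> M) (\<eta> M))"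
  "ident (num_cat B n) F = (\<lambda>M\<in>obj (fmod_cat B). \<lambda>x\<in>carrier (fobj F M). x)"
  by (simp_all add: num_cat_def fun_cat_def)

lemma category_num_cat: "category (num_cat B n)"
  unfolding num_cat_def
  by (rule category_restrict_obj[OF category_fun_cat[OF category_fmod_cat category_mod_cat]])
    (auto simp: fun_cat_def numerical_functor_def)

context numerical_degree
begin

abbreviation Transf :: "(('b, 'm) module, 'm \<Rightarrow> 'm, ('b, 'k) module, 'k \<Rightarrow> 'k) ftr
    \<Rightarrow> (('b, 'm) module, 'm \<Rightarrow> 'm, ('b, 'k) module, 'k \<Rightarrow> 'k) ftr
    \<Rightarrow> (('b, 'm) module \<Rightarrow> 'k \<Rightarrow> 'k) set" where
  "Transf \<equiv> nat_trans (fmod_cat B) (mod_cat B)"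

abbreviation Ob :: "('b, 'm) module set" where
  "Ob \<equiv> obj (fmod_cat B)"

lemma Ob_left_module: "M \<in> Ob \<Longrightarrow> left_module B M"
  by (simp add: obj_fmod_cat)

text \<open>Unlike \<^const>\<open>numerical_functor\<close>, the values may lie in another universe.\<close>

definition numerical_into :: "(('b, 'm) module, 'm \<Rightarrow> 'm, ('b, 'k) module, 'k \<Rightarrow> 'k) ftr \<Rightarrow> bool" where
  "numerical_into F \<longleftrightarrow> is_functor (fmod_cat B) (mod_cat B) F \<and>
     (\<forall>M \<in> Ob. \<forall>N \<in> Ob.
        numerical_map B n (Hom_mod B M N) (Hom_mod B (fobj F M) (fobj F N)) (farr F M N))"

lemma numerical_functor_iff: "numerical_functor B n F \<longleftrightarrow> numerical_into F"
  by (simp add: numerical_into_def numerical_functor_def)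

text \<open>The linear extension of the arrow maps, by which the linear category of the modules \<open>P M N\<close> acts
  on the values of \<open>F\<close>.\<close>

definition act :: "(('b, 'm) module, 'm \<Rightarrow> 'm, ('b, 'k) module, 'k \<Rightarrow> 'k) ftr
    \<Rightarrow> ('b, 'm) module \<Rightarrow> ('b, 'm) module \<Rightarrow> (('m \<Rightarrow> 'm) \<Rightarrow> 'b) set \<Rightarrow> 'k \<Rightarrow> 'k" where
  "act F M N = lift (Hom_mod B M N) (Hom_mod B (fobj F M) (fobj F N)) (farr F M N)"

lemma left_module_P: "\<lbrakk>M \<in> Ob; N \<in> Ob\<rbrakk> \<Longrightarrow> left_module B (P M N)"
  by (intro left_module_Pn left_module_Hom[OF B.is_cring] Ob_left_module)

context
  fixes F :: "(('b, 'm) module, 'm \<Rightarrow> 'm, ('b, 'k) module, 'k \<Rightarrow> 'k) ftr"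
  assumes F: "numerical_into F"
begin

lemma value_left_module: "M \<in> Ob \<Longrightarrow> left_module B (fobj F M)"
  using F functor_obj[of "fmod_cat B" "mod_cat B" F M] by (simp add: numerical_into_def)

lemma value_arr: "\<lbrakk>M \<in> Ob; N \<in> Ob; \<alpha> \<in> lin_maps B M N\<rbrakk>
    \<Longrightarrow> farr F M N \<alpha> \<in> lin_maps B (fobj F M) (fobj F N)"
  using F functor_arr[of "fmod_cat B" "mod_cat B" F M N \<alpha>] by (simp add: numerical_into_def)

lemma value_compose: "\<lbrakk>L \<in> Ob; M \<in> Ob; N \<in> Ob; \<alpha> \<in> lin_maps B L M; \<beta> \<in> lin_maps B M N\<rbrakk>
    \<Longrightarrow> farr F L N (compose (carrier L) \<beta> \<alpha>) = compose (carrier (fobj F L)) (farr F M N \<beta>) (farr F L M \<alpha>)"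
  using F functor_cmp[of "fmod_cat B" "mod_cat B" F L M N \<alpha> \<beta>] by (simp add: numerical_into_def)

lemma value_ident: "M \<in> Ob \<Longrightarrow> farr F M M (\<lambda>x\<in>carrier M. x) = (\<lambda>x\<in>carrier (fobj F M). x)"
  using F functor_ident[of "fmod_cat B" "mod_cat B" F M] by (simp add: numerical_into_def)

context
  fixes M N :: "('b, 'm) module"
  assumes M: "M \<in> Ob" and N: "N \<in> Ob"
begin

private lemmas H = left_module_Hom[OF B.is_cring Ob_left_module[OF M] Ob_left_module[OF N]]
  and FH = left_module_Hom[OF B.is_cring value_left_module[OF M] value_left_module[OF N]]

private lemma num: "numerical_map B n (Hom_mod B M N) (Hom_mod B (fobj F M) (fobj F N)) (farr F M N)"
  using F M N by (simp add: numerical_into_def)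

lemma act_lin: "act F M N \<in> lin_maps B (P M N) (Hom_mod B (fobj F M) (fobj F N))"
  unfolding act_def by (rule lift_lin[OF H FH num])

lemma act_arrow: "\<alpha> \<in> lin_maps B M N \<Longrightarrow> act F M N (arrow M N \<alpha>) = farr F M N \<alpha>"
  unfolding act_def by (rule lift_pt[OF H FH num]) simp

lemma act_coset: "f \<in> carrier (free_alg B (Hom_mod B M N)) \<Longrightarrow>
    act F M N (Pn_coset B n (Hom_mod B M N) f) = lin_ext B (Hom_mod B (fobj F M) (fobj F N)) (farr F M N) f"
  unfolding act_def by (rule lift_coset[OF H FH num])

lemma act_unique:
  assumes "h \<in> lin_maps B (P M N) (Hom_mod B (fobj F M) (fobj F N))"
    and "\<And>\<alpha>. \<alpha> \<in> lin_maps B M N \<Longrightarrow> h (arrow M N \<alpha>) = farr F M N \<alpha>"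
  shows "act F M N = h"
  unfolding act_def using assms by (intro lift_unique[OF H FH num, symmetric]) auto

lemma act_in_lin_maps: "X \<in> carrier (P M N) \<Longrightarrow> act F M N X \<in> lin_maps B (fobj F M) (fobj F N)"
  using lin_maps_closed[OF act_lin] by simp

lemma act_closed: "\<lbrakk>X \<in> carrier (P M N); x \<in> carrier (fobj F M)\<rbrakk> \<Longrightarrow> act F M N X x \<in> carrier (fobj F N)"
  by (rule lin_maps_closed[OF act_in_lin_maps])

lemma act_vector_add: "\<lbrakk>X \<in> carrier (P M N); x \<in> carrier (fobj F M); y \<in> carrier (fobj F M)\<rbrakk>
    \<Longrightarrow> act F M N X (x \<oplus>\<^bsub>fobj F M\<^esub> y) = act F M N X x \<oplus>\<^bsub>fobj F N\<^esub> act F M N X y"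
  by (rule lin_maps_add[OF act_in_lin_maps])

lemma act_vector_smult: "\<lbrakk>X \<in> carrier (P M N); r \<in> carrier B; x \<in> carrier (fobj F M)\<rbrakk>
    \<Longrightarrow> act F M N X (r \<odot>\<^bsub>fobj F M\<^esub> x) = r \<odot>\<^bsub>fobj F N\<^esub> act F M N X x"
  by (rule lin_maps_smult[OF act_in_lin_maps])

lemma act_vector_zero: "X \<in> carrier (P M N) \<Longrightarrow> act F M N X \<zero>\<^bsub>fobj F M\<^esub> = \<zero>\<^bsub>fobj F N\<^esub>"
  by (rule lin_maps_zero[OF value_left_module[OF M] value_left_module[OF N] act_in_lin_maps])

lemma act_add: "\<lbrakk>X \<in> carrier (P M N); Y \<in> carrier (P M N); x \<in> carrier (fobj F M)\<rbrakk>
    \<Longrightarrow> act F M N (X \<oplus>\<^bsub>P M N\<^esub> Y) x = act F M N X x \<oplus>\<^bsub>fobj F N\<^esub> act F M N Y x"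
  by (simp add: lin_maps_add[OF act_lin])

lemma act_smult: "\<lbrakk>r \<in> carrier B; X \<in> carrier (P M N); x \<in> carrier (fobj F M)\<rbrakk>
    \<Longrightarrow> act F M N (r \<odot>\<^bsub>P M N\<^esub> X) x = r \<odot>\<^bsub>fobj F N\<^esub> act F M N X x"
  by (simp add: lin_maps_smult[OF act_lin])

lemma act_zero: "x \<in> carrier (fobj F M) \<Longrightarrow> act F M N \<zero>\<^bsub>P M N\<^esub> x = \<zero>\<^bsub>fobj F N\<^esub>"
  by (simp add: lin_maps_zero[OF left_module_P[OF M N] FH act_lin])

lemma act_scalar_lin: "x \<in> carrier (fobj F M)
    \<Longrightarrow> (\<lambda>X\<in>carrier (P M N). act F M N X x) \<in> lin_maps B (P M N) (fobj F N)"
  by (rule lin_maps_restrictI[OF left_module_P[OF M N]]) (simp_all add: act_closed act_add act_smult)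

end

text \<open>Linearity in \<open>X\<close> and \<open>Y\<close> reduces this to functoriality of \<open>F\<close>.\<close>

lemma act_comp:
  assumes L: "L \<in> Ob" and M: "M \<in> Ob" and N: "N \<in> Ob"
    and X: "X \<in> carrier (P M N)" and Y: "Y \<in> carrier (P L M)" and x: "x \<in> carrier (fobj F L)"
  shows "act F L N (Pn_comp B n L N X Y) x = act F M N X (act F L M Y x)"
proof -
  note lm = Ob_left_module[OF L] Ob_left_module[OF M] Ob_left_module[OF N]
  interpret MN: left_module B "P M N" by (rule left_module_P[OF M N])
  interpret LM: left_module B "P L M" by (rule left_module_P[OF L M])
  note Hom = left_module_Hom[OF B.is_cring]
  note c = Pn_comp_closed[OF lm] act_closed[OF L M _ x]
  note s = Pn_comp_add_left[OF lm] Pn_comp_add_right[OF lm] Pn_comp_smult_left[OF lm]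
    Pn_comp_smult_right[OF lm] Pn_comp_zero_left[OF lm] Pn_comp_zero_right[OF lm]
    act_add[OF M N] act_add[OF L M] act_add[OF L N] act_smult[OF M N] act_smult[OF L M]
    act_smult[OF L N] act_zero[OF M N] act_zero[OF L M] act_zero[OF L N]
    act_vector_add[OF M N] act_vector_smult[OF M N] act_vector_zero[OF M N]
  have 1: "act F L N (Pn_comp B n L N (arrow M N \<alpha>) Y) x = act F M N (arrow M N \<alpha>) (act F L M Y x)"
    if a: "\<alpha> \<in> lin_maps B M N" for \<alpha>
    using Hom[OF lm(1,2)] Y
  proof (induct rule: Pn_induct)
    case (pt \<beta>)
    then show ?case
      using a x value_arr[OF L M, of \<beta>]
      by (simp add: Pn_comp_arrow[OF lm] act_arrow[OF L M] act_arrow[OF M N] act_arrow[OF L N]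
          lin_maps_compose[OF lm(1)] value_compose[OF L M N] compose_eq)
  qed (use x a in \<open>simp_all add: s c arrow_closed[OF lm(2,3)]\<close>)
  from Hom[OF lm(2,3)] X show ?thesis
    by (induct rule: Pn_induct) (use 1 x Y in \<open>simp_all add: s c\<close>)
qed

lemma act_ident: "\<lbrakk>M \<in> Ob; x \<in> carrier (fobj F M)\<rbrakk> \<Longrightarrow> act F M M (ident_arrow M) x = x"
  by (simp add: ident_arrow_def act_arrow lin_maps_ident Ob_left_module value_ident)

end

lemma act_natural:
  assumes F: "numerical_into F" and G: "numerical_into G"
    and \<eta>: "\<eta> \<in> Transf F G"
    and M: "M \<in> Ob" and N: "N \<in> Ob" and X: "X \<in> carrier (P M N)" and x: "x \<in> carrier (fobj F M)"
  shows "\<eta> N (act F M N X x) = act G M N X (\<eta> M x)"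
proof -
  have \<eta>M: "\<eta> M \<in> lin_maps B (fobj F M) (fobj G M)" and \<eta>N: "\<eta> N \<in> lin_maps B (fobj F N) (fobj G N)"
    using nat_trans_arr[OF \<eta>] M N by simp_all
  note y = lin_maps_closed[OF \<eta>M x]
  have "left_module B (Hom_mod B M N)"
    by (intro left_module_Hom[OF B.is_cring] Ob_left_module M N)
  from this X show ?thesis
  proof (induct rule: Pn_induct)
    case (pt \<alpha>)
    then have "compose (carrier (fobj F M)) (\<eta> N) (farr F M N \<alpha>)
        = compose (carrier (fobj F M)) (farr G M N \<alpha>) (\<eta> M)"
      using nat_trans_natural[OF \<eta> M N, of \<alpha>] by simp
    from fun_cong[OF this, of x] show ?case
      using pt x by (simp add: act_arrow[OF F M N] act_arrow[OF G M N] compose_def)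
  qed (use x y in \<open>simp_all add: act_zero[OF F M N] act_zero[OF G M N] act_add[OF F M N]
      act_add[OF G M N] act_smult[OF F M N] act_smult[OF G M N] act_closed[OF F M N]
      lin_maps_add[OF \<eta>N] lin_maps_smult[OF \<eta>N]
      lin_maps_zero[OF value_left_module[OF F N] value_left_module[OF G N] \<eta>N]\<close>)
qed

text \<open>Conversely, linear actions define numerical functors, because the map \<open>\<chi> \<mapsto> [\<chi>]\<close> is
  numerical.\<close>

lemma numerical_into_linear:
  fixes F :: "(('b, 'm) module, 'm \<Rightarrow> 'm, ('b, 'k) module, 'k \<Rightarrow> 'k) ftr"
  assumes V: "\<And>M. M \<in> Ob \<Longrightarrow> left_module B (fobj F M)"
    and lin: "\<And>M N. \<lbrakk>M \<in> Ob; N \<in> Ob\<rbrakk> \<Longrightarrow> l M N \<in> lin_maps B (P M N) (Hom_mod B (fobj F M) (fobj F N))"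
    and arr: "\<And>M N \<chi>. \<lbrakk>M \<in> Ob; N \<in> Ob; \<chi> \<in> lin_maps B M N\<rbrakk> \<Longrightarrow> farr F M N \<chi> = l M N (arrow M N \<chi>)"
    and comp: "\<And>L M N X Y x. \<lbrakk>L \<in> Ob; M \<in> Ob; N \<in> Ob; X \<in> carrier (P M N); Y \<in> carrier (P L M);
        x \<in> carrier (fobj F L)\<rbrakk> \<Longrightarrow> l L N (Pn_comp B n L N X Y) x = l M N X (l L M Y x)"
    and ident: "\<And>M x. \<lbrakk>M \<in> Ob; x \<in> carrier (fobj F M)\<rbrakk> \<Longrightarrow> l M M (ident_arrow M) x = x"
  shows "numerical_into F" and "\<lbrakk>M \<in> Ob; N \<in> Ob\<rbrakk> \<Longrightarrow> act F M N = l M N"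
proof -
  have lc: "l M N X \<in> lin_maps B (fobj F M) (fobj F N)"
    if "M \<in> Ob" "N \<in> Ob" "X \<in> carrier (P M N)" for M N X
    using lin_maps_closed[OF lin[OF that(1,2)] that(3)] by simp
  note ac = arrow_closed[OF Ob_left_module Ob_left_module]
  have "numerical_map B n (Hom_mod B M N) (Hom_mod B (fobj F M) (fobj F N)) (farr F M N)"
    if M: "M \<in> Ob" and N: "N \<in> Ob" for M N
  proof -
    note H = left_module_Hom[OF B.is_cring Ob_left_module[OF M] Ob_left_module[OF N]]
    note FH = left_module_Hom[OF B.is_cring V[OF M] V[OF N]]
    show ?thesis
      by (rule numerical_map_cong[OF H FH _ numerical_map_post[OF H left_module_Pn[OF H] FH
              numerical_pt[OF H] lin[OF M N]]]) (simp add: arr[OF M N])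
  qed
  moreover have "is_functor (fmod_cat B) (mod_cat B) F"
    unfolding is_functor_def
  proof (intro conjI ballI category_fmod_cat category_mod_cat)
    fix L M N :: "('b, 'm) module" and \<alpha> \<beta>
    assume O: "L \<in> Ob" "M \<in> Ob"
    show "fobj F L \<in> obj (mod_cat B)" using V[OF O(1)] by simp
    show "farr F L L (ident (fmod_cat B) L) = ident (mod_cat B) (fobj F L)"
      using lin_maps_extensional[OF lc[OF O(1,1) ident_arrow_closed]] O
      by (auto simp: arr lin_maps_ident Ob_left_module ident ident_arrow_def[symmetric]
          intro!: extensionalityI[of _ "carrier (fobj F L)"])
    assume a: "\<alpha> \<in> arr (fmod_cat B) L M"
    then show "farr F L M \<alpha> \<in> arr (mod_cat B) (fobj F L) (fobj F M)"
      using O by (simp add: arr lc ac)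
    assume N: "N \<in> Ob" and b: "\<beta> \<in> arr (fmod_cat B) M N"
    have c: "compose (carrier L) \<beta> \<alpha> \<in> lin_maps B L N"
      using a b by (simp add: lin_maps_compose[OF Ob_left_module[OF O(1)]])
    have "farr F L N (compose (carrier L) \<beta> \<alpha>)
        = compose (carrier (fobj F L)) (farr F M N \<beta>) (farr F L M \<alpha>)" (is "?l = ?r")
    proof (rule extensionalityI[of _ "carrier (fobj F L)"])
      show "?l \<in> extensional (carrier (fobj F L))"
        using lin_maps_extensional[OF lc[OF O(1) N ac[OF O(1) N c]]] by (simp add: arr O N c)
      show "?l x = ?r x" if x: "x \<in> carrier (fobj F L)" for x
        using a b x comp[OF O N ac[OF O(2) N] ac[OF O] x, of \<beta> \<alpha>]
        by (simp add: arr O N c compose_eq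
            flip: Pn_comp_arrow[OF Ob_left_module[OF O(1)] Ob_left_module[OF O(2)] Ob_left_module[OF N]])
    qed simp
    then show "farr F L N (cmp (fmod_cat B) L M N \<beta> \<alpha>)
        = cmp (mod_cat B) (fobj F L) (fobj F M) (fobj F N) (farr F M N \<beta>) (farr F L M \<alpha>)"
      by simp
  qed
  ultimately show F: "numerical_into F" unfolding numerical_into_def by blast
  show "act F M N = l M N" if "M \<in> Ob" "N \<in> Ob"
    by (rule act_unique[OF F that lin[OF that]]) (simp add: arr that)
qed

end

context numerical_degree
begin

context
  fixes F :: "(('b, 'm) module, 'm \<Rightarrow> 'm, ('b, 'k) module, 'k \<Rightarrow> 'k) ftr"
    and j :: "('b, 'm) module \<Rightarrow> 'k \<Rightarrow> 'l"
  assumes F: "numerical_into F" and j: "\<And>M. M \<in> Ob \<Longrightarrow> inj_on (j M) (carrier (fobj F M))"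
begin

private abbreviation "unj M \<equiv> inv_into (carrier (fobj F M)) (j M)"

private definition "copy_act M N = (\<lambda>X\<in>carrier (P M N).
    \<lambda>y\<in>j M ` carrier (fobj F M). j N (act F M N X (unj M y)))"

private lemma copied: "numerical_into (copy_functor j F)"
    "\<lbrakk>M \<in> Ob; N \<in> Ob\<rbrakk> \<Longrightarrow> act (copy_functor j F) M N = copy_act M N"
proof -
  let ?C = "copy_functor j F"
  have o: "fobj ?C M = copy_mod (j M) (fobj F M)" for M by (simp add: copy_functor_def)
  note inv = inv_into_f_f[OF j] and V = value_left_module[OF F]
  have C: "left_module B (fobj ?C M)" if "M \<in> Ob" for M
    unfolding o by (rule left_module_copy[OF V[OF that] j[OF that]])
  have lc: "(\<lambda>y\<in>j M ` carrier (fobj F M). j N (act F M N X (unj M y)))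
      \<in> lin_maps B (fobj ?C M) (fobj ?C N)"
    if M: "M \<in> Ob" and N: "N \<in> Ob" and X: "X \<in> carrier (P M N)" for M N X
  proof -
    interpret M: left_module B "fobj F M" by (rule V[OF M])
    have "(\<lambda>y\<in>carrier (fobj ?C M). j N (act F M N X (unj M y))) \<in> lin_maps B (fobj ?C M) (fobj ?C N)"
      by (rule lin_maps_restrictI[OF C[OF M]])
        (use X in \<open>auto simp: o inv M N act_closed[OF F M N] M.smult_closed
          act_vector_add[OF F M N] act_vector_smult[OF F M N]\<close>)
    then show ?thesis by (simp add: o)
  qed
  have lin: "copy_act M N \<in> lin_maps B (P M N) (Hom_mod B (fobj ?C M) (fobj ?C N))"
    if M: "M \<in> Ob" and N: "N \<in> Ob" for M N
    unfolding copy_act_def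
  proof (rule lin_maps_restrictI[OF left_module_P[OF M N]])
    interpret PMN: left_module B "P M N" by (rule left_module_P[OF M N])
    fix X Y r assume X: "X \<in> carrier (P M N)"
    let ?l = "\<lambda>X. \<lambda>y\<in>j M ` carrier (fobj F M). j N (act F M N X (unj M y))"
    show "?l X \<in> carrier (Hom_mod B (fobj ?C M) (fobj ?C N))"
      using lc[OF M N X] by simp
    show "?l (X \<oplus>\<^bsub>P M N\<^esub> Y) = ?l X \<oplus>\<^bsub>Hom_mod B (fobj ?C M) (fobj ?C N)\<^esub> ?l Y"
      if "Y \<in> carrier (P M N)"
      using X that by (auto simp: o inv M N act_closed[OF F M N] act_add[OF F M N] fun_eq_iff)
    show "?l (r \<odot>\<^bsub>P M N\<^esub> X) = r \<odot>\<^bsub>Hom_mod B (fobj ?C M) (fobj ?C N)\<^esub> ?l X"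
      if "r \<in> carrier B"
      using X that by (auto simp: o inv M N act_closed[OF F M N] act_smult[OF F M N] fun_eq_iff)
  qed
  have arr: "farr ?C M N \<chi> = copy_act M N (arrow M N \<chi>)"
    if "M \<in> Ob" "N \<in> Ob" "\<chi> \<in> lin_maps B M N" for M N \<chi>
    using that by (simp add: copy_functor_def copy_act_def act_arrow[OF F]
        arrow_closed[OF Ob_left_module Ob_left_module])
  have cmp: "copy_act L N (Pn_comp B n L N X Y) y = copy_act M N X (copy_act L M Y y)"
    if O: "L \<in> Ob" "M \<in> Ob" "N \<in> Ob" "X \<in> carrier (P M N)" "Y \<in> carrier (P L M)"
      and y: "y \<in> carrier (fobj ?C L)" for L M N X Y y
  proof -
    obtain x where x: "x \<in> carrier (fobj F L)" "y = j L x" using y by (auto simp: o)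
    have "act F L M Y x \<in> carrier (fobj F M)" by (rule act_closed[OF F O(1,2,5) x(1)])
    then show ?thesis
      using O x by (simp add: copy_act_def inv act_comp[OF F O(1-3)]
          Pn_comp_closed[OF O(1-3)[THEN Ob_left_module]])
  qed
  have ident: "copy_act M M (ident_arrow M) y = y" if "M \<in> Ob" "y \<in> carrier (fobj ?C M)" for M y
    using that by (auto simp: copy_act_def o inv act_ident[OF F] ident_arrow_closed Ob_left_module)
  show "numerical_into ?C" by (rule numerical_into_linear(1)[OF C lin arr cmp ident])
  show "act ?C M N = copy_act M N" if "M \<in> Ob" "N \<in> Ob"
    by (rule numerical_into_linear(2)[OF C lin arr cmp ident that])
qed

lemma numerical_copy: "numerical_into (copy_functor j F)"
  by (rule copied(1))

lemma act_copy:
  assumes "M \<in> Ob" "N \<in> Ob" "X \<in> carrier (P M N)" "x \<in> carrier (fobj F M)"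
  shows "act (copy_functor j F) M N X (j M x) = j N (act F M N X x)"
  using assms by (simp add: copied(2) copy_act_def inv_into_f_f[OF j])

end

lemma
  fixes E :: "('b, 'm) module"
  assumes E: "E \<in> Ob"
  shows numerical_Pn_hom: "numerical_into (Pn_hom B n E)"
    and act_Pn_hom: "\<lbrakk>M \<in> Ob; N \<in> Ob; X \<in> carrier (P M N); A \<in> carrier (P E M)\<rbrakk>
      \<Longrightarrow> act (Pn_hom B n E) M N X A = Pn_comp B n E N X A"
proof -
  let ?Q = "Pn_hom B n E"
  have o: "fobj ?Q M = P E M" for M by (simp add: Pn_hom_def)
  note lm = Ob_left_module
  have c: "comp E M N X A = Pn_comp B n E N X A"
    if "M \<in> Ob" "N \<in> Ob" "X \<in> carrier (P M N)" "A \<in> carrier (P E M)" for M N X A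
    using that by (simp add: Pn_comp_eq_comp[OF lm[OF E] lm lm])
  have V: "left_module B (fobj ?Q M)" if "M \<in> Ob" for M
    unfolding o by (rule left_module_P[OF E that])
  have lin: "comp E M N \<in> lin_maps B (P M N) (Hom_mod B (fobj ?Q M) (fobj ?Q N))"
    if "M \<in> Ob" "N \<in> Ob" for M N
    unfolding o by (rule comp_lin[OF lm[OF E] lm[OF that(1)] lm[OF that(2)]])
  have arr: "farr ?Q M N \<chi> = comp E M N (arrow M N \<chi>)"
    if "M \<in> Ob" "N \<in> Ob" "\<chi> \<in> lin_maps B M N" for M N \<chi>
  proof (rule extensionalityI[of _ "carrier (P E M)"])
    show "farr ?Q M N \<chi> \<in> extensional (carrier (P E M))" by (simp add: Pn_hom_def)
    show "comp E M N (arrow M N \<chi>) \<in> extensional (carrier (P E M))"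
      using lin_maps_closed[OF lin[OF that(1,2)] arrow_closed[OF lm lm that(3)]] that
        lin_maps_extensional by (simp add: o)
    show "farr ?Q M N \<chi> A = comp E M N (arrow M N \<chi>) A" if "A \<in> carrier (P E M)" for A
      using that \<open>M \<in> Ob\<close> \<open>N \<in> Ob\<close> \<open>\<chi> \<in> _\<close>
      by (simp add: c Pn_hom_arr_eq[OF lm[OF E] lm lm] arrow_closed[OF lm lm])
  qed
  have cmp: "comp E L N (Pn_comp B n L N X Y) A = comp E M N X (comp E L M Y A)"
    if "L \<in> Ob" "M \<in> Ob" "N \<in> Ob" "X \<in> carrier (P M N)" "Y \<in> carrier (P L M)"
      "A \<in> carrier (fobj ?Q L)" for L M N X Y A
    using that by (simp add: c o Pn_comp_closed[OF lm[OF E] lm lm, of L M] Pn_comp_closed[OF lm lm lm, of L M N]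
        Pn_comp_assoc[OF lm[OF E] lm lm lm, of L M N])
  have ident: "comp E M M (ident_arrow M) A = A" if "M \<in> Ob" "A \<in> carrier (fobj ?Q M)" for M A
    using that by (simp add: c o ident_arrow_closed[OF lm] Pn_comp_ident_left[OF lm[OF E] lm])
  show "numerical_into ?Q" by (rule numerical_into_linear(1)[OF V lin arr cmp ident])
  show "act ?Q M N X A = Pn_comp B n E N X A"
    if "M \<in> Ob" "N \<in> Ob" "X \<in> carrier (P M N)" "A \<in> carrier (P E M)"
    using numerical_into_linear(2)[OF V lin arr cmp ident that(1,2)] c[OF that] by simp
qed


section \<open>The Yoneda lemma\<close>

context
  fixes E :: "('b, 'm) module" and j :: "('b, 'm) module \<Rightarrow> (('m \<Rightarrow> 'm) \<Rightarrow> 'b) set \<Rightarrow> 'm"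
  assumes E: "E \<in> Ob" and j: "Pn_hom_embedding B n E j"
begin

abbreviation "Q \<equiv> copy_functor j (Pn_hom B n E)"

lemma embedding_inj: "M \<in> Ob \<Longrightarrow> inj_on (j M) (carrier (P E M))"
  using j by (simp add: Pn_hom_embedding_def Pn_hom_def)

lemma Q_carrier: "carrier (fobj Q M) = j M ` carrier (P E M)"
  by (simp add: copy_functor_def Pn_hom_def)

lemma Q_numerical: "numerical_into Q"
  by (rule numerical_copy[OF numerical_Pn_hom[OF E]]) (simp add: Pn_hom_def embedding_inj)

lemma Q_act: "\<lbrakk>M \<in> Ob; N \<in> Ob; X \<in> carrier (P M N); A \<in> carrier (P E M)\<rbrakk>
    \<Longrightarrow> act Q M N X (j M A) = j N (Pn_comp B n E N X A)"
  by (subst act_copy[OF numerical_Pn_hom[OF E]])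
    (simp_all add: Pn_hom_def embedding_inj act_Pn_hom[OF E, unfolded Pn_hom_def])

lemma uncopy: "\<lbrakk>M \<in> Ob; A \<in> carrier (P E M)\<rbrakk>
    \<Longrightarrow> inv_into (carrier (fobj (Pn_hom B n E) M)) (j M) (j M A) = A"
  by (simp add: Pn_hom_def inv_into_f_f[OF embedding_inj])

context
  fixes F :: "('b, 'm) mod_functor"
  assumes F: "numerical_into F"
begin

text \<open>Every element of \<open>P\<^sub>n(Hom(E, M))\<close> is the result of its own action on \<open>[1]\<close>.\<close>

lemma yoneda_eval:
  assumes \<eta>: "\<eta> \<in> Transf Q F" and M: "M \<in> Ob" and A: "A \<in> carrier (P E M)"
  shows "\<eta> M (j M A) = act F E M A (\<eta> E (j E (ident_arrow E)))"
proof -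
  have i: "ident_arrow E \<in> carrier (P E E)" by (rule ident_arrow_closed[OF Ob_left_module[OF E]])
  have "\<eta> M (j M A) = \<eta> M (act Q E M A (j E (ident_arrow E)))"
    by (simp add: Q_act E M A i Pn_comp_ident_right[OF Ob_left_module[OF E] Ob_left_module[OF M] A])
  also have "\<dots> = act F E M A (\<eta> E (j E (ident_arrow E)))"
    by (rule act_natural[OF Q_numerical F \<eta> E M A]) (simp add: Q_carrier i)
  finally show ?thesis .
qed

lemma yoneda_eval_closed:
  assumes "\<eta> \<in> Transf Q F"
  shows "\<eta> E (j E (ident_arrow E)) \<in> carrier (fobj F E)"
  using lin_maps_closed[of "\<eta> E" B "fobj Q E" "fobj F E"] nat_trans_arr[OF assms] E
    ident_arrow_closed[OF Ob_left_module[OF E]] by (simp add: Q_carrier)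

lemma yoneda_inj:
  assumes \<eta>: "\<eta> \<in> Transf Q F"
    and \<theta>: "\<theta> \<in> Transf Q F"
    and eq: "\<eta> E (j E (ident_arrow E)) = \<theta> E (j E (ident_arrow E))"
  shows "\<eta> = \<theta>"
proof (rule extensionalityI[OF nat_trans_extensional[OF \<eta>] nat_trans_extensional[OF \<theta>]])
  fix M :: "('b, 'm) module" assume M: "M \<in> Ob"
  have "\<eta> M \<in> lin_maps B (fobj Q M) (fobj F M)" "\<theta> M \<in> lin_maps B (fobj Q M) (fobj F M)"
    using nat_trans_arr[OF \<eta> M] nat_trans_arr[OF \<theta> M] by simp_all
  then show "\<eta> M = \<theta> M"
  proof (rule lin_maps_eqI)
    fix y assume "y \<in> carrier (fobj Q M)"
    then show "\<eta> M y = \<theta> M y"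
      using yoneda_eval[OF \<eta> M] yoneda_eval[OF \<theta> M] eq by (auto simp: Q_carrier)
  qed
qed

lemma yoneda_surj:
  assumes x: "x \<in> carrier (fobj F E)"
  shows "\<exists>\<eta> \<in> Transf Q F. \<eta> E (j E (ident_arrow E)) = x"
proof -
  define unj where "unj M = inv_into (carrier (fobj (Pn_hom B n E) M)) (j M)" for M
  define \<eta> where "\<eta> = (\<lambda>M\<in>Ob. \<lambda>y\<in>carrier (fobj Q M). act F E M (unj M y) x)"
  have \<eta>: "\<eta> M (j M A) = act F E M A x" if "M \<in> Ob" "A \<in> carrier (P E M)" for M A
    using that by (simp add: \<eta>_def Q_carrier unj_def uncopy)
  have lin: "\<eta> M \<in> lin_maps B (fobj Q M) (fobj F M)" if M: "M \<in> Ob" for M :: "('b, 'm) module"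
  proof -
    let ?u = "\<lambda>y\<in>j M ` carrier (P E M). unj M y" and ?a = "\<lambda>X\<in>carrier (P E M). act F E M X x"
    have "?u \<in> lin_maps B (fobj Q M) (P E M)"
      using uncopy_lin[OF left_module_P[OF E M] embedding_inj[OF M]]
      by (simp add: copy_functor_def Pn_hom_def unj_def)
    from lin_maps_compose[OF value_left_module[OF Q_numerical M] this act_scalar_lin[OF F E M x]]
    have "compose (carrier (fobj Q M)) ?a ?u \<in> lin_maps B (fobj Q M) (fobj F M)" .
    also have "compose (carrier (fobj Q M)) ?a ?u = \<eta> M"
      using M by (auto simp: \<eta>_def compose_def Q_carrier unj_def uncopy fun_eq_iff)
    finally show ?thesis .
  qed
  have "\<eta> \<in> Transf Q F"
  proof (rule nat_transI)
    show "\<eta> \<in> extensional Ob" by (simp add: \<eta>_def)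
    show "\<eta> M \<in> arr (mod_cat B) (fobj Q M) (fobj F M)" if "M \<in> Ob" for M
      using lin[OF that] by simp
    fix M N :: "('b, 'm) module" and \<chi> assume M: "M \<in> Ob" and N: "N \<in> Ob" and "\<chi> \<in> arr (fmod_cat B) M N"
    then have \<chi>: "\<chi> \<in> lin_maps B M N" by simp
    note c = arrow_closed[OF Ob_left_module[OF M] Ob_left_module[OF N] \<chi>]
    have "\<eta> N (farr Q M N \<chi> y) = farr F M N \<chi> (\<eta> M y)" if y: "y \<in> carrier (fobj Q M)" for y
    proof -
      obtain A where A: "A \<in> carrier (P E M)" "y = j M A" using y by (auto simp: Q_carrier)
      have "farr Q M N \<chi> y = j N (Pn_comp B n E N (arrow M N \<chi>) A)"
        using act_arrow[OF Q_numerical M N \<chi>] Q_act[OF M N c A(1)] A(2) by simp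
      then have "\<eta> N (farr Q M N \<chi> y) = act F E N (Pn_comp B n E N (arrow M N \<chi>) A) x"
        using \<eta>[OF N] Pn_comp_closed[OF Ob_left_module[OF E] Ob_left_module[OF M] Ob_left_module[OF N] c A(1)]
        by simp
      also have "\<dots> = farr F M N \<chi> (\<eta> M y)"
        using act_comp[OF F E M N c A(1) x] act_arrow[OF F M N \<chi>] \<eta>[OF M A(1)] A(2) by simp
      finally show ?thesis .
    qed
    then show "cmp (mod_cat B) (fobj Q M) (fobj Q N) (fobj F N) (\<eta> N) (farr Q M N \<chi>)
        = cmp (mod_cat B) (fobj Q M) (fobj F M) (fobj F N) (farr F M N \<chi>) (\<eta> M)"
      by (auto simp: compose_def fun_eq_iff)
  qed
  moreover have "\<eta> E (j E (ident_arrow E)) = x"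
    using \<eta>[OF E ident_arrow_closed[OF Ob_left_module[OF E]]] act_ident[OF F E x] by simp
  ultimately show ?thesis by blast
qed

end
end
end

section \<open>Polynomial maps and sums with many terms\<close>

lemma (in additive_subgroup) finsum_in_subgroup:
  assumes "abelian_group G" "finite A" "f \<in> A \<rightarrow> H"
  shows "finsum G f A \<in> H"
  using assms(2,3)
proof (induct A rule: finite_induct)
  case empty
  interpret G: abelian_group G by fact
  show ?case by simp
next
  case (insert a A)
  interpret G: abelian_group G by fact
  have "f \<in> A \<rightarrow> carrier G" "f a \<in> carrier G" using insert.prems a_subset by auto
  then show ?case using insert by simp
qed

text \<open>If a sum has more than \<open>n\<close> terms, group them into \<open>n + 1\<close> nonempty blocks. The vanishing
  deviation of the block sums expresses the value at the full sum by values at sums over proper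
  subfamilies, which are known by induction.\<close>

lemma polynomial_map_sum:
  assumes M: "abelian_group M" and N: "abelian_group N" and J: "additive_subgroup J N"
    and \<phi>: "polynomial_map n M N \<phi>" and S: "finite S" and f: "f \<in> S \<rightarrow> carrier M"
    and small: "\<And>T. \<lbrakk>T \<subseteq> S; card T \<le> n\<rbrakk> \<Longrightarrow> \<phi> (finsum M f T) \<in> J"
  shows "\<phi> (finsum M f S) \<in> J"
proof -
  interpret M: abelian_group M by fact
  interpret N: abelian_group N by fact
  interpret J: additive_subgroup J N by fact
  have "\<phi> (finsum M f T) \<in> J" if "finite T" "T \<subseteq> S" for T
    using that
  proof (induct T rule: finite_psubset_induct)
    case (psubset T)
    show ?case
    proof (cases "card T \<le> n")
      case True
      then show ?thesis using small psubset.prems by blast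
    next
      case False
      \<comment> \<open>\<open>T\<close> is cut into \<open>n\<close> singletons and one block that holds the rest\<close>
      define m where "m = card T"
      obtain g where g: "bij_betw g {0..<m} T"
        using ex_bij_betw_nat_finite[OF psubset.hyps(1)] unfolding m_def by blast
      define block where "block i = (if i < n then {g i} else g ` {n..<m})" for i
      define U where "U A = (\<Union>i\<in>A. block i)" for A
      define x where "x i = finsum M f (block i)" for i
      have mn: "n < m" using False by (simp add: m_def)
      have block_eq: "block i = g ` (if i < n then {i} else {n..<m})" for i
        by (simp add: block_def)
      have sub: "(if i < n then {i} else {n..<m}) \<subseteq> {0..<m}" for i using mn by auto
      have bT: "block i \<subseteq> T" for i
        unfolding block_eq using image_mono[OF sub, of g i] bij_betw_imp_surj_on[OF g] by simp
      have fin: "finite (block i)" for i by (simp add: block_def)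
      have ne: "block i \<noteq> {}" for i using mn by (auto simp: block_def)
      have disj: "disjnt (block i) (block k)" if "i < Suc n" "k < Suc n" "i \<noteq> k" for i k
      proof -
        have "(if i < n then {i} else {n..<m}) \<inter> (if k < n then {k} else {n..<m}) = {}"
          using that by (auto split: if_splits)
        then show ?thesis
          unfolding disjnt_def block_eq
          using inj_on_image_Int[OF bij_betw_imp_inj_on[OF g] sub[of i] sub[of k]] by simp
      qed
      have fc: "f y \<in> carrier M" if "y \<in> T" for y using that f psubset.prems by auto
      have xc: "x \<in> {..<Suc n} \<rightarrow> carrier M"
        unfolding x_def using fc bT by (intro Pi_I M.finsum_closed) blast
      have xU: "(\<Oplus>\<^bsub>M\<^esub>i\<in>A. x i) = finsum M f (U A)" if A: "A \<subseteq> {..<Suc n}" for A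
      proof -
        have "pairwise (\<lambda>i k. disjnt (block i) (block k)) A"
          using A disj by (intro pairwiseI) auto
        then show ?thesis
          unfolding x_def U_def using finite_subset[OF A] fin fc bT
          by (intro M.add.finprod_UN_disjoint[symmetric]) auto
      qed
      have full: "U {..<Suc n} = T"
      proof
        show "U {..<Suc n} \<subseteq> T" using bT by (auto simp: U_def)
        have "g i \<in> U {..<Suc n}" if "i < m" for i
        proof (cases "i < n")
          case True
          then have "g i \<in> block i" "i \<in> {..<Suc n}" by (simp_all add: block_def)
          then show ?thesis unfolding U_def by blast
        next
          case False
          then have "g i \<in> block n" "n \<in> {..<Suc n}" using that by (simp_all add: block_def)
          then show ?thesis unfolding U_def by blast
        qed
        then show "T \<subseteq> U {..<Suc n}" using bij_betw_imp_surj_on[OF g] by auto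
      qed
      have proper: "U A \<subset> T" if A: "A \<subset> {..<Suc n}" for A
      proof -
        obtain k where k: "k < Suc n" "k \<notin> A" using A by blast
        then have "disjnt (block k) (U A)"
          using A disj[OF k(1)] by (auto simp: U_def disjnt_def)
        then show ?thesis using ne[of k] bT unfolding U_def disjnt_def by blast
      qed
      have UJ: "\<phi> (finsum M f (U A)) \<in> J" if "A \<subset> {..<Suc n}" for A
        using psubset.hyps(2)[OF proper[OF that]] psubset.prems proper[OF that] by blast
      have \<phi>c: "\<phi> y \<in> carrier N" if "y \<in> carrier M" for y
        using \<phi> that by (auto simp: polynomial_map_def)
      define t where "t A = [((-1 :: int) ^ (Suc n - card A))] \<cdot>\<^bsub>N\<^esub> \<phi> (\<Oplus>\<^bsub>M\<^esub>i\<in>A. x i)" for A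
      have tJ: "t A \<in> J" if "A \<in> Pow {..<Suc n} - {{..<Suc n}}" for A
        unfolding t_def using UJ[of A] that xU[of A]
        by (intro N.add.subgroup_int_pow_closed[OF J.a_subgroup]) auto
      have T: "\<phi> (finsum M f T) \<in> carrier N" using fc by (intro \<phi>c M.finsum_closed) auto
      have tfull: "t {..<Suc n} = \<phi> (finsum M f T)"
        using T by (simp add: t_def xU full)
      have "\<zero>\<^bsub>N\<^esub> = finsum N t (Pow {..<Suc n})"
        using \<phi> xc unfolding polynomial_map_def deviation_def t_def by simp
      also have "Pow {..<Suc n} = insert {..<Suc n} (Pow {..<Suc n} - {{..<Suc n}})" by auto
      also have "finsum N t \<dots> = t {..<Suc n} \<oplus>\<^bsub>N\<^esub> finsum N t (Pow {..<Suc n} - {{..<Suc n}})"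
        using tJ J.a_subset T tfull by (intro N.finsum_insert) auto
      finally have z: "\<phi> (finsum M f T) \<oplus>\<^bsub>N\<^esub> finsum N t (Pow {..<Suc n} - {{..<Suc n}}) = \<zero>\<^bsub>N\<^esub>"
        by (simp add: tfull)
      have r: "finsum N t (Pow {..<Suc n} - {{..<Suc n}}) \<in> J"
        using tJ by (intro J.finsum_in_subgroup[OF N]) auto
      then have "\<phi> (finsum M f T) = \<ominus>\<^bsub>N\<^esub> finsum N t (Pow {..<Suc n} - {{..<Suc n}})"
        using z T J.a_subset by (metis N.minus_equality subsetD)
      then show ?thesis using r by simp
    qed
  qed
  then show ?thesis using S by blast
qed


section \<open>Coordinates\<close>

text \<open>Additivity and homogeneity of the coordinates follow from their uniqueness.\<close>

lemma fg_free_coordinates: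
  assumes "cring R" "left_module R M" "fg_free R M"
  obtains S c where "finite S" "S \<subseteq> carrier M"
    "\<And>s x. \<lbrakk>s \<in> S; x \<in> carrier M\<rbrakk> \<Longrightarrow> c s x \<in> carrier R"
    "\<And>s x y. \<lbrakk>s \<in> S; x \<in> carrier M; y \<in> carrier M\<rbrakk> \<Longrightarrow> c s (x \<oplus>\<^bsub>M\<^esub> y) = c s x \<oplus>\<^bsub>R\<^esub> c s y"
    "\<And>s r x. \<lbrakk>s \<in> S; r \<in> carrier R; x \<in> carrier M\<rbrakk> \<Longrightarrow> c s (r \<odot>\<^bsub>M\<^esub> x) = r \<otimes>\<^bsub>R\<^esub> c s x"
    "\<And>x. x \<in> carrier M \<Longrightarrow> x = (\<Oplus>\<^bsub>M\<^esub>s\<in>S. c s x \<odot>\<^bsub>M\<^esub> s)"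
proof -
  interpret R: cring R by fact
  interpret M: left_module R M by fact
  obtain S where fS: "finite S \<and> S \<subseteq> carrier M \<and>
      (\<forall>x \<in> carrier M. \<exists>!c. c \<in> S \<rightarrow>\<^sub>E carrier R \<and> x = (\<Oplus>\<^bsub>M\<^esub>s\<in>S. c s \<odot>\<^bsub>M\<^esub> s))"
    using assms(3) unfolding fg_free_def by (rule exE)
  then have S: "finite S" "S \<subseteq> carrier M" by simp_all
  note ex = bspec[OF fS[THEN conjunct2, THEN conjunct2]]
  define k where "k x = (THE c. c \<in> S \<rightarrow>\<^sub>E carrier R \<and> x = (\<Oplus>\<^bsub>M\<^esub>s\<in>S. c s \<odot>\<^bsub>M\<^esub> s))" for x
  have k: "k x \<in> S \<rightarrow>\<^sub>E carrier R" "x = (\<Oplus>\<^bsub>M\<^esub>s\<in>S. k x s \<odot>\<^bsub>M\<^esub> s)" if "x \<in> carrier M" for x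
    using theI'[OF ex[OF that]] unfolding k_def by (rule conjunct1, rule conjunct2)
  have uniq: "k x = c" if "x \<in> carrier M" "c \<in> S \<rightarrow>\<^sub>E carrier R" "x = (\<Oplus>\<^bsub>M\<^esub>s\<in>S. c s \<odot>\<^bsub>M\<^esub> s)" for x c
    unfolding k_def by (rule the1_equality, rule ex[OF that(1)], intro conjI that(2,3))
  have kc: "k x s \<in> carrier R" if "s \<in> S" "x \<in> carrier M" for s x
    using k(1)[OF that(2)] that(1) by auto
  have sM: "s \<in> carrier M" if "s \<in> S" for s using that S(2) by auto
  show thesis
  proof (rule that[of S "\<lambda>s x. k x s", OF S kc])
    show "x = (\<Oplus>\<^bsub>M\<^esub>s\<in>S. k x s \<odot>\<^bsub>M\<^esub> s)" if "x \<in> carrier M" for x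
      by (rule k(2)[OF that])
    fix s x assume s: "s \<in> S" and x: "x \<in> carrier M"
    show "k (x \<oplus>\<^bsub>M\<^esub> y) s = k x s \<oplus>\<^bsub>R\<^esub> k y s" if y: "y \<in> carrier M" for y
    proof -
      have "(\<Oplus>\<^bsub>M\<^esub>s\<in>S. (\<lambda>s\<in>S. k x s \<oplus>\<^bsub>R\<^esub> k y s) s \<odot>\<^bsub>M\<^esub> s)
          = (\<Oplus>\<^bsub>M\<^esub>s\<in>S. k x s \<odot>\<^bsub>M\<^esub> s \<oplus>\<^bsub>M\<^esub> k y s \<odot>\<^bsub>M\<^esub> s)"
        using kc x y sM by (intro M.M.finsum_cong'[OF refl])
          (auto simp: M.smult_l_distr intro!: M.smult_closed)
      also have "\<dots> = (\<Oplus>\<^bsub>M\<^esub>s\<in>S. k x s \<odot>\<^bsub>M\<^esub> s) \<oplus>\<^bsub>M\<^esub> (\<Oplus>\<^bsub>M\<^esub>s\<in>S. k y s \<odot>\<^bsub>M\<^esub> s)"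
        using kc x y sM by (intro M.M.finsum_addf) (auto intro!: M.smult_closed)
      finally have "k (x \<oplus>\<^bsub>M\<^esub> y) = (\<lambda>s\<in>S. k x s \<oplus>\<^bsub>R\<^esub> k y s)"
        using x y kc k(2)[OF x] k(2)[OF y] by (intro uniq) auto
      then show ?thesis using s by simp
    qed
    show "k (r \<odot>\<^bsub>M\<^esub> x) s = r \<otimes>\<^bsub>R\<^esub> k x s" if r: "r \<in> carrier R" for r
    proof -
      have "(\<Oplus>\<^bsub>M\<^esub>s\<in>S. (\<lambda>s\<in>S. r \<otimes>\<^bsub>R\<^esub> k x s) s \<odot>\<^bsub>M\<^esub> s) = (\<Oplus>\<^bsub>M\<^esub>s\<in>S. r \<odot>\<^bsub>M\<^esub> (k x s \<odot>\<^bsub>M\<^esub> s))"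
        using kc x r sM by (intro M.M.finsum_cong'[OF refl])
          (auto simp: M.smult_assoc1 intro!: M.smult_closed)
      also have "\<dots> = r \<odot>\<^bsub>M\<^esub> (\<Oplus>\<^bsub>M\<^esub>s\<in>S. k x s \<odot>\<^bsub>M\<^esub> s)"
        using kc x r sM by (intro M.finsum_smult_r[symmetric]) (auto intro!: M.smult_closed)
      finally have "k (r \<odot>\<^bsub>M\<^esub> x) = (\<lambda>s\<in>S. r \<otimes>\<^bsub>R\<^esub> k x s)"
        using x r kc k(2)[OF x] M.smult_closed by (intro uniq) auto
      then show ?thesis using s by simp
    qed
  qed
qed

lemma free_mod_simps [simp]:
  "carrier (free_mod R k) = {..<k} \<rightarrow>\<^sub>E carrier R" "zero (free_mod R k) = (\<lambda>i\<in>{..<k}. \<zero>\<^bsub>R\<^esub>)"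
  "add (free_mod R k) x y = (\<lambda>i\<in>{..<k}. x i \<oplus>\<^bsub>R\<^esub> y i)"
  "smult (free_mod R k) r x = (\<lambda>i\<in>{..<k}. r \<otimes>\<^bsub>R\<^esub> x i)"
  by (simp_all add: free_mod_def)

lemma left_module_free_mod:
  assumes "cring R"
  shows "left_module R (free_mod R k)"
proof -
  interpret R: cring R by fact
  have v: "x i \<in> carrier R" if "x \<in> {..<k} \<rightarrow>\<^sub>E carrier R" "i < k" for x i using that by auto
  have u: "x i = undefined" if "x \<in> {..<k} \<rightarrow>\<^sub>E carrier R" "\<not> i < k" for x i using that by auto
  have "abelian_group (free_mod R k)"
  proof (rule abelian_groupI)
    fix x assume "x \<in> carrier (free_mod R k)"
    then show "\<exists>y\<in>carrier (free_mod R k). y \<oplus>\<^bsub>free_mod R k\<^esub> x = \<zero>\<^bsub>free_mod R k\<^esub>"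
      by (intro bexI[of _ "\<lambda>i\<in>{..<k}. \<ominus>\<^bsub>R\<^esub> x i"]) (auto simp: fun_eq_iff R.l_neg v)
  qed (auto simp: v u fun_eq_iff R.a_ac)
  then show ?thesis
    by (intro left_module.intro left_module_axioms.intro R.ring_axioms)
      (auto simp: v u fun_eq_iff R.l_distr R.r_distr R.m_assoc)
qed

lemma free_mod_expand:
  assumes "cring R" "v \<in> {..<k} \<rightarrow>\<^sub>E carrier R"
  shows "(\<Oplus>\<^bsub>free_mod R k\<^esub>i\<in>{..<k}. v i \<odot>\<^bsub>free_mod R k\<^esub> (\<lambda>l\<in>{..<k}. if l = i then \<one>\<^bsub>R\<^esub> else \<zero>\<^bsub>R\<^esub>)) = v"
    (is "?s = v")
proof (rule PiE_ext[OF _ assms(2)])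
  interpret R: cring R by fact
  interpret F: left_module R "free_mod R k" by (rule left_module_free_mod[OF assms(1)])
  have v: "v i \<in> carrier R" if "i < k" for i using that assms(2) by auto
  have t: "(\<lambda>i. v i \<odot>\<^bsub>free_mod R k\<^esub> (\<lambda>l\<in>{..<k}. if l = i then \<one>\<^bsub>R\<^esub> else \<zero>\<^bsub>R\<^esub>))
      \<in> {..<k} \<rightarrow> carrier (free_mod R k)"
    using v by auto
  show "?s \<in> {..<k} \<rightarrow>\<^sub>E carrier R" using F.M.finsum_closed[OF t] by simp
  fix l assume l: "l \<in> {..<k}"
  interpret ev: abelian_group_hom "free_mod R k" R "\<lambda>x. x l"
    using l by (intro abelian_group_hom_of_additive F.M.abelian_group_axioms R.abelian_group_axioms) auto
  have "?s l = (\<Oplus>\<^bsub>R\<^esub>i\<in>{..<k}. if l = i then v i else \<zero>\<^bsub>R\<^esub>)"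
    unfolding ev.hom_finsum[OF t] by (rule R.finsum_cong'[OF refl]) (use v l in auto)
  also have "\<dots> = v l" using v l by (intro R.finsum_singleton) auto
  finally show "?s l = v l" .
qed

locale standard_free = numerical_degree B n
  for B :: "('b, 'z) ring_scheme" and n :: nat +
  fixes e :: "nat \<Rightarrow> (nat \<Rightarrow> 'b) \<Rightarrow> 'm" and E :: "('b, 'm) module"
  assumes universe: "\<And>k. inj_on (e k) (carrier (free_mod B k))"
    and E_def: "E = copy_mod (e n) (free_mod B n)"
begin

definition coord :: "'m \<Rightarrow> nat \<Rightarrow> 'b" where
  "coord = inv_into (carrier (free_mod B n)) (e n)"

lemma E_carrier: "carrier E = e n ` ({..<n} \<rightarrow>\<^sub>E carrier B)"
  by (simp add: E_def)

lemma coord_e: "v \<in> {..<n} \<rightarrow>\<^sub>E carrier B \<Longrightarrow> coord (e n v) = v"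
  unfolding coord_def by (rule inv_into_f_f[OF universe]) simp

lemma E_left_module: "left_module B E"
  unfolding E_def by (rule left_module_copy[OF left_module_free_mod[OF B.is_cring] universe])

lemma coord_mem: "y \<in> carrier E \<Longrightarrow> coord y \<in> {..<n} \<rightarrow>\<^sub>E carrier B"
  using coord_e by (auto simp: E_carrier)

lemma coord_closed: "\<lbrakk>y \<in> carrier E; i < n\<rbrakk> \<Longrightarrow> coord y i \<in> carrier B"
  using coord_mem by (auto simp: PiE_iff)

lemma coord_add:
  assumes "x \<in> carrier E" "y \<in> carrier E" "i < n"
  shows "coord (x \<oplus>\<^bsub>E\<^esub> y) i = coord x i \<oplus>\<^bsub>B\<^esub> coord y i"
proof -
  have "x \<oplus>\<^bsub>E\<^esub> y = e n (\<lambda>i\<in>{..<n}. coord x i \<oplus>\<^bsub>B\<^esub> coord y i)"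
    unfolding E_def copy_mod_simps(3) free_mod_simps(3) coord_def ..
  moreover have "(\<lambda>i\<in>{..<n}. coord x i \<oplus>\<^bsub>B\<^esub> coord y i) \<in> {..<n} \<rightarrow>\<^sub>E carrier B"
    using coord_closed[OF assms(1)] coord_closed[OF assms(2)] by simp
  ultimately have "coord (x \<oplus>\<^bsub>E\<^esub> y) = (\<lambda>i\<in>{..<n}. coord x i \<oplus>\<^bsub>B\<^esub> coord y i)"
    by (simp only: coord_e)
  then show ?thesis using assms(3) by simp
qed

lemma coord_smult:
  assumes "r \<in> carrier B" "y \<in> carrier E" "i < n"
  shows "coord (r \<odot>\<^bsub>E\<^esub> y) i = r \<otimes>\<^bsub>B\<^esub> coord y i"
proof -
  have "r \<odot>\<^bsub>E\<^esub> y = e n (\<lambda>i\<in>{..<n}. r \<otimes>\<^bsub>B\<^esub> coord y i)"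
    unfolding E_def copy_mod_simps(4) free_mod_simps(4) coord_def ..
  moreover have "(\<lambda>i\<in>{..<n}. r \<otimes>\<^bsub>B\<^esub> coord y i) \<in> {..<n} \<rightarrow>\<^sub>E carrier B"
    using coord_closed[OF assms(2)] assms(1) by simp
  ultimately have "coord (r \<odot>\<^bsub>E\<^esub> y) = (\<lambda>i\<in>{..<n}. r \<otimes>\<^bsub>B\<^esub> coord y i)"
    by (simp only: coord_e)
  then show ?thesis using assms(3) by simp
qed

lemma e_add: "\<lbrakk>v \<in> {..<n} \<rightarrow>\<^sub>E carrier B; w \<in> {..<n} \<rightarrow>\<^sub>E carrier B\<rbrakk>
    \<Longrightarrow> e n (v \<oplus>\<^bsub>free_mod B n\<^esub> w) = e n v \<oplus>\<^bsub>E\<^esub> e n w"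
  unfolding E_def copy_mod_simps(3) by (simp only: coord_e flip: coord_def)

lemma e_smult: "v \<in> {..<n} \<rightarrow>\<^sub>E carrier B \<Longrightarrow> e n (r \<odot>\<^bsub>free_mod B n\<^esub> v) = r \<odot>\<^bsub>E\<^esub> e n v"
  unfolding E_def copy_mod_simps(4) by (simp only: coord_e flip: coord_def)

lemma e_lin: "(\<lambda>v\<in>carrier (free_mod B n). e n v) \<in> lin_maps B (free_mod B n) E"
  unfolding E_def by (rule copy_lin[OF left_module_free_mod[OF B.is_cring] universe])

text \<open>The unit vectors form a basis unless \<open>1 = 0\<close>, when they all coincide and the empty basis is taken.\<close>

lemma E_fg_free: "fg_free B E"
proof (cases "\<one>\<^bsub>B\<^esub> = \<zero>\<^bsub>B\<^esub>")
  case True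
  interpret E: left_module B E by (rule E_left_module)
  have "x = \<zero>\<^bsub>E\<^esub>" if "x \<in> carrier E" for x
    using E.smult_one[OF that] E.smult_l_null[OF that] True by simp
  then show ?thesis unfolding fg_free_def by (intro exI[of _ "{}"]) auto
next
  case False
  interpret E: left_module B E by (rule E_left_module)
  let ?F = "free_mod B n"
  define unit where "unit i = (\<lambda>l\<in>{..<n}. if l = i then \<one>\<^bsub>B\<^esub> else \<zero>\<^bsub>B\<^esub>)" for i :: nat
  define b where "b i = e n (unit i)" for i
  have unit: "unit i \<in> {..<n} \<rightarrow>\<^sub>E carrier B" for i by (auto simp: unit_def)
  have bE: "b i \<in> carrier E" for i using unit by (simp add: b_def E_carrier)
  have inj: "inj_on b {..<n}"
  proof (rule inj_onI)
    fix i k assume i: "i \<in> {..<n}" and k: "k \<in> {..<n}" and "b i = b k"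
    then have "unit i = unit k" by (metis b_def coord_e unit)
    from fun_cong[OF this, of i] show "i = k" using i False by (auto simp: unit_def split: if_splits)
  qed
  have sum: "(\<Oplus>\<^bsub>E\<^esub>i\<in>{..<n}. w i \<odot>\<^bsub>E\<^esub> b i) = e n w" if w: "w \<in> {..<n} \<rightarrow>\<^sub>E carrier B" for w
  proof -
    interpret F: left_module B ?F by (rule left_module_free_mod[OF B.is_cring])
    let ?h = "\<lambda>v\<in>carrier ?F. e n v"
    have t: "w i \<odot>\<^bsub>?F\<^esub> unit i \<in> carrier ?F" if "i \<in> {..<n}" for i
      using w unit that by (intro F.smult_closed) auto
    have "e n w = ?h (\<Oplus>\<^bsub>?F\<^esub>i\<in>{..<n}. w i \<odot>\<^bsub>?F\<^esub> unit i)"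
      unfolding unit_def using free_mod_expand[OF B.is_cring w] w by simp
    also have "\<dots> = (\<Oplus>\<^bsub>E\<^esub>i\<in>{..<n}. ?h (w i \<odot>\<^bsub>?F\<^esub> unit i))"
      using t by (intro lin_maps_finsum[OF F.left_module_axioms E_left_module e_lin]) auto
    also have "\<dots> = (\<Oplus>\<^bsub>E\<^esub>i\<in>{..<n}. w i \<odot>\<^bsub>E\<^esub> b i)"
    proof (rule E.M.finsum_cong'[OF refl])
      show "(\<lambda>i. w i \<odot>\<^bsub>E\<^esub> b i) \<in> {..<n} \<rightarrow> carrier E"
        using w bE by (auto intro!: E.smult_closed)
      show "?h (w i \<odot>\<^bsub>?F\<^esub> unit i) = w i \<odot>\<^bsub>E\<^esub> b i" if "i \<in> {..<n}" for i
        using e_smult[OF unit] t[OF that] by (simp only: b_def restrict_apply' free_mod_simps(1))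
    qed
    finally show ?thesis by simp
  qed
  show ?thesis
    unfolding fg_free_def
  proof (intro exI[of _ "b ` {..<n}"] conjI ballI)
    show "b ` {..<n} \<subseteq> carrier E" using bE by blast
    fix y assume y: "y \<in> carrier E"
    have S: "(\<Oplus>\<^bsub>E\<^esub>s\<in>b ` {..<n}. c s \<odot>\<^bsub>E\<^esub> s) = e n (\<lambda>i\<in>{..<n}. c (b i))"
      if c: "c \<in> b ` {..<n} \<rightarrow>\<^sub>E carrier B" for c
    proof -
      have cb: "c (b i) \<in> carrier B" if "i \<in> {..<n}" for i using c that by auto
      have "(\<Oplus>\<^bsub>E\<^esub>s\<in>b ` {..<n}. c s \<odot>\<^bsub>E\<^esub> s) = (\<Oplus>\<^bsub>E\<^esub>i\<in>{..<n}. c (b i) \<odot>\<^bsub>E\<^esub> b i)"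
        using cb bE by (intro E.M.finsum_reindex inj) (auto intro!: E.smult_closed)
      also have "\<dots> = (\<Oplus>\<^bsub>E\<^esub>i\<in>{..<n}. (\<lambda>i\<in>{..<n}. c (b i)) i \<odot>\<^bsub>E\<^esub> b i)"
        using cb bE by (intro E.M.finsum_cong'[OF refl]) (auto intro!: E.smult_closed)
      also have "\<dots> = e n (\<lambda>i\<in>{..<n}. c (b i))" by (intro sum restrict_PiE_iff[THEN iffD2] ballI cb)
      finally show ?thesis .
    qed
    obtain v where v: "v \<in> {..<n} \<rightarrow>\<^sub>E carrier B" "y = e n v"
      using y unfolding E_carrier by blast
    define c0 where "c0 = (\<lambda>s\<in>b ` {..<n}. v (inv_into {..<n} b s))"
    have c0: "c0 (b i) = v i" if "i \<in> {..<n}" for i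
      using that by (simp add: c0_def inv_into_f_f[OF inj])
    have c0E: "c0 \<in> b ` {..<n} \<rightarrow>\<^sub>E carrier B"
      unfolding c0_def restrict_PiE_iff using PiE_mem[OF v(1)] inv_into_into[of _ b "{..<n}"] by blast
    show "\<exists>!c. c \<in> b ` {..<n} \<rightarrow>\<^sub>E carrier B \<and> y = (\<Oplus>\<^bsub>E\<^esub>s\<in>b ` {..<n}. c s \<odot>\<^bsub>E\<^esub> s)"
    proof (rule ex1I[of _ c0], intro conjI c0E)
      have "(\<lambda>i\<in>{..<n}. c0 (b i)) = v"
      proof (rule PiE_ext[OF _ v(1)])
        show "(\<lambda>i\<in>{..<n}. c0 (b i)) \<in> {..<n} \<rightarrow>\<^sub>E carrier B"
          unfolding restrict_PiE_iff using c0E by blast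
      qed (simp add: c0)
      then show "y = (\<Oplus>\<^bsub>E\<^esub>s\<in>b ` {..<n}. c0 s \<odot>\<^bsub>E\<^esub> s)" using S[OF c0E] v(2) by simp
      fix c assume "c \<in> b ` {..<n} \<rightarrow>\<^sub>E carrier B \<and> y = (\<Oplus>\<^bsub>E\<^esub>s\<in>b ` {..<n}. c s \<odot>\<^bsub>E\<^esub> s)"
      then have c: "c \<in> b ` {..<n} \<rightarrow>\<^sub>E carrier B" and yc: "y = (\<Oplus>\<^bsub>E\<^esub>s\<in>b ` {..<n}. c s \<odot>\<^bsub>E\<^esub> s)"
        by (rule conjunct1, rule conjunct2)
      have r: "(\<lambda>i\<in>{..<n}. c (b i)) \<in> {..<n} \<rightarrow>\<^sub>E carrier B"
        unfolding restrict_PiE_iff using c by blast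
      have c1: "coord y = (\<lambda>i\<in>{..<n}. c (b i))" unfolding yc S[OF c] by (rule coord_e[OF r])
      have c2: "coord y = v" unfolding v(2) by (rule coord_e[OF v(1)])
      note v_eq = trans[OF sym[OF c2] c1]
      show "c = c0"
      proof (rule PiE_ext[OF c c0E])
        fix s assume "s \<in> b ` {..<n}"
        then obtain i where "i \<in> {..<n}" "s = b i" by blast
        then show "c s = c0 s" using c0[of i] fun_cong[OF v_eq, of i] by simp
      qed
    qed
  qed simp
qed

lemma E_Ob: "E \<in> Ob"
  using E_left_module E_fg_free by (simp add: obj_fmod_cat)

text \<open>A sum of at most \<open>n\<close> coordinate projections of \<open>M\<close> has rank at most \<open>n\<close>: the coordinates in
  question are listed as a vector of \<open>E\<close>, padded with zeros.\<close>

lemma projection_factors: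
  assumes M: "left_module B M" and T: "finite T" "T \<subseteq> carrier M" "card T \<le> n"
    and c: "\<And>s x. \<lbrakk>s \<in> T; x \<in> carrier M\<rbrakk> \<Longrightarrow> c s x \<in> carrier B"
      "\<And>s x y. \<lbrakk>s \<in> T; x \<in> carrier M; y \<in> carrier M\<rbrakk> \<Longrightarrow> c s (x \<oplus>\<^bsub>M\<^esub> y) = c s x \<oplus>\<^bsub>B\<^esub> c s y"
      "\<And>s r x. \<lbrakk>s \<in> T; r \<in> carrier B; x \<in> carrier M\<rbrakk> \<Longrightarrow> c s (r \<odot>\<^bsub>M\<^esub> x) = r \<otimes>\<^bsub>B\<^esub> c s x"
  shows "\<exists>\<alpha> \<in> lin_maps B E M. \<exists>\<beta> \<in> lin_maps B M E.
    compose (carrier M) \<alpha> \<beta> = (\<lambda>x\<in>carrier M. \<Oplus>\<^bsub>M\<^esub>s\<in>T. c s x \<odot>\<^bsub>M\<^esub> s)"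
proof -
  interpret M: left_module B M by fact
  define m where "m = card T"
  obtain g where g: "bij_betw g {0..<m} T"
    using ex_bij_betw_nat_finite[OF T(1)] unfolding m_def by blast
  have gT: "g i \<in> T" if "i < m" for i using bij_betwE[OF g] that by auto
  have gM: "g i \<in> carrier M" if "i < m" for i using gT[OF that] T(2) by blast
  have mn: "m \<le> n" using T(3) by (simp add: m_def)
  let ?v = "\<lambda>x. \<lambda>i\<in>{..<n}. if i < m then c (g i) x else \<zero>\<^bsub>B\<^esub>"
  let ?\<alpha> = "\<lambda>y. \<Oplus>\<^bsub>M\<^esub>i\<in>{0..<m}. coord y i \<odot>\<^bsub>M\<^esub> g i"
  have v: "?v x \<in> {..<n} \<rightarrow>\<^sub>E carrier B" if "x \<in> carrier M" for x using c(1) gT that by auto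
  have "(\<lambda>x\<in>carrier M. e n (?v x)) \<in> lin_maps B M E"
  proof (rule lin_maps_restrictI[OF M])
    fix x y r assume x: "x \<in> carrier M"
    show "e n (?v x) \<in> carrier E" using v[OF x] by (simp add: E_carrier)
    show "e n (?v (x \<oplus>\<^bsub>M\<^esub> y)) = e n (?v x) \<oplus>\<^bsub>E\<^esub> e n (?v y)" if y: "y \<in> carrier M"
    proof -
      have "?v (x \<oplus>\<^bsub>M\<^esub> y) = ?v x \<oplus>\<^bsub>free_mod B n\<^esub> ?v y"
        using x y c(2) gT by (auto simp: fun_eq_iff)
      then show ?thesis by (simp only: e_add[OF v[OF x] v[OF y]])
    qed
    show "e n (?v (r \<odot>\<^bsub>M\<^esub> x)) = r \<odot>\<^bsub>E\<^esub> e n (?v x)" if r: "r \<in> carrier B"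
    proof -
      have "?v (r \<odot>\<^bsub>M\<^esub> x) = r \<odot>\<^bsub>free_mod B n\<^esub> ?v x"
        using x r c(3) gT by (auto simp: fun_eq_iff)
      then show ?thesis by (simp only: e_smult[OF v[OF x]])
    qed
  qed
  moreover have "(\<lambda>y\<in>carrier E. ?\<alpha> y) \<in> lin_maps B E M"
  proof (rule lin_maps_restrictI[OF E_left_module])
    fix x y r assume x: "x \<in> carrier E"
    have t: "coord y i \<odot>\<^bsub>M\<^esub> g i \<in> carrier M" if "y \<in> carrier E" "i < m" for y i
      using that gM coord_closed mn by (intro M.smult_closed) auto
    show "?\<alpha> x \<in> carrier M" using t[OF x] by (intro M.M.finsum_closed) auto
    show "?\<alpha> (x \<oplus>\<^bsub>E\<^esub> y) = ?\<alpha> x \<oplus>\<^bsub>M\<^esub> ?\<alpha> y" if y: "y \<in> carrier E"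
    proof -
      have "?\<alpha> (x \<oplus>\<^bsub>E\<^esub> y) = (\<Oplus>\<^bsub>M\<^esub>i\<in>{0..<m}. coord x i \<odot>\<^bsub>M\<^esub> g i \<oplus>\<^bsub>M\<^esub> coord y i \<odot>\<^bsub>M\<^esub> g i)"
        using t[OF x] t[OF y] mn gM coord_closed[OF x] coord_closed[OF y]
        by (intro M.M.finsum_cong'[OF refl]) (auto simp: coord_add[OF x y] M.smult_l_distr)
      also have "\<dots> = ?\<alpha> x \<oplus>\<^bsub>M\<^esub> ?\<alpha> y"
        using t[OF x] t[OF y] by (intro M.M.finsum_addf) auto
      finally show ?thesis .
    qed
    show "?\<alpha> (r \<odot>\<^bsub>E\<^esub> x) = r \<odot>\<^bsub>M\<^esub> ?\<alpha> x" if r: "r \<in> carrier B"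
    proof -
      have "?\<alpha> (r \<odot>\<^bsub>E\<^esub> x) = (\<Oplus>\<^bsub>M\<^esub>i\<in>{0..<m}. r \<odot>\<^bsub>M\<^esub> (coord x i \<odot>\<^bsub>M\<^esub> g i))"
        using t[OF x] r mn gM coord_closed[OF x]
        by (intro M.M.finsum_cong'[OF refl])
          (auto simp: coord_smult[OF r x] M.smult_assoc1 intro!: M.smult_closed)
      also have "\<dots> = r \<odot>\<^bsub>M\<^esub> ?\<alpha> x"
        using t[OF x] r by (intro M.finsum_smult_r[symmetric]) auto
      finally show ?thesis .
    qed
  qed
  moreover have "compose (carrier M) (\<lambda>y\<in>carrier E. ?\<alpha> y) (\<lambda>x\<in>carrier M. e n (?v x))
      = (\<lambda>x\<in>carrier M. \<Oplus>\<^bsub>M\<^esub>s\<in>T. c s x \<odot>\<^bsub>M\<^esub> s)"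
  proof (rule extensionalityI[of _ "carrier M"])
    fix x assume x: "x \<in> carrier M"
    have "?\<alpha> (e n (?v x)) = (\<Oplus>\<^bsub>M\<^esub>i\<in>{0..<m}. c (g i) x \<odot>\<^bsub>M\<^esub> g i)"
      unfolding coord_e[OF v[OF x]] using mn gM c(1)[OF gT x]
      by (intro M.M.finsum_cong'[OF refl]) (auto intro!: M.smult_closed)
    also have "\<dots> = (\<Oplus>\<^bsub>M\<^esub>s\<in>g ` {0..<m}. c s x \<odot>\<^bsub>M\<^esub> s)"
      using gM c(1)[OF gT x] bij_betw_imp_inj_on[OF g]
      by (intro M.M.finsum_reindex[symmetric]) (auto intro!: M.smult_closed)
    also have "g ` {0..<m} = T" by (rule bij_betw_imp_surj_on[OF g])
    finally have *: "?\<alpha> (e n (?v x)) = (\<Oplus>\<^bsub>M\<^esub>s\<in>T. c s x \<odot>\<^bsub>M\<^esub> s)" .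
    show "compose (carrier M) (\<lambda>y\<in>carrier E. ?\<alpha> y) (\<lambda>x\<in>carrier M. e n (?v x)) x
        = (\<lambda>x\<in>carrier M. \<Oplus>\<^bsub>M\<^esub>s\<in>T. c s x \<odot>\<^bsub>M\<^esub> s) x"
    proof -
      have "e n (?v x) \<in> carrier E" unfolding E_carrier using v[OF x] by (rule imageI)
      with x * show ?thesis by (simp only: compose_eq restrict_apply')
    qed
  qed (simp_all add: compose_def)
  ultimately show ?thesis by blast
qed

text \<open>The classes of endomorphisms of \<open>M\<close> that are finite sums of composites through \<open>E\<close>. Generating
  them term by term makes closure under addition and an enumeration of the terms two inductions.\<close>

inductive_set through :: "('b, 'm) module \<Rightarrow> (('m \<Rightarrow> 'm) \<Rightarrow> 'b) set set" for M where
  zero: "\<zero>\<^bsub>P M M\<^esub> \<in> through M"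
| step: "\<lbrakk>A \<in> carrier (P E M); C \<in> carrier (P M E); X \<in> through M\<rbrakk>
    \<Longrightarrow> Pn_comp B n M M A C \<oplus>\<^bsub>P M M\<^esub> X \<in> through M"

context
  fixes M :: "('b, 'm) module" assumes M: "M \<in> Ob"
begin

private lemmas lM = Ob_left_module[OF M]

interpretation MM: left_module B "P M M" by (rule left_module_P[OF M M])

lemma through_closed: "X \<in> through M \<Longrightarrow> X \<in> carrier (P M M)"
  by (induct rule: through.induct) (auto intro: Pn_comp_closed[OF lM E_left_module lM])

lemma through_subgroup: "additive_subgroup (through M) (P M M)"
proof -
  interpret EM: left_module B "P E M" by (rule left_module_P[OF E_Ob M])
  note c = Pn_comp_closed[OF lM E_left_module lM]
  have add: "X \<oplus>\<^bsub>P M M\<^esub> Y \<in> through M" if "X \<in> through M" "Y \<in> through M" for X Y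
    using that
  proof (induct X rule: through.induct)
    case zero
    then show ?case by (simp add: through_closed)
  next
    case (step A C X)
    have "Pn_comp B n M M A C \<oplus>\<^bsub>P M M\<^esub> (X \<oplus>\<^bsub>P M M\<^esub> Y) \<in> through M"
      using step by (intro through.step) auto
    then show ?case using step by (simp add: MM.M.a_assoc c through_closed)
  qed
  have neg: "\<ominus>\<^bsub>P M M\<^esub> X \<in> through M" if "X \<in> through M" for X
    using that
  proof (induct X rule: through.induct)
    case zero
    then show ?case
      using MM.smult_minus_one[of "\<zero>\<^bsub>P M M\<^esub>"] MM.smult_r_null[of "\<ominus>\<^bsub>B\<^esub> \<one>\<^bsub>B\<^esub>"]
      by (simp add: through.zero)
  next
    case (step A C X)
    have "\<ominus>\<^bsub>P M M\<^esub> Pn_comp B n M M A C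
        = Pn_comp B n M M ((\<ominus>\<^bsub>B\<^esub> \<one>\<^bsub>B\<^esub>) \<odot>\<^bsub>P E M\<^esub> A) C"
      using step by (simp add: Pn_comp_smult_left[OF lM E_left_module lM] MM.smult_minus_one c)
    then have "\<ominus>\<^bsub>P M M\<^esub> (Pn_comp B n M M A C \<oplus>\<^bsub>P M M\<^esub> X)
        = Pn_comp B n M M ((\<ominus>\<^bsub>B\<^esub> \<one>\<^bsub>B\<^esub>) \<odot>\<^bsub>P E M\<^esub> A) C \<oplus>\<^bsub>P M M\<^esub> \<ominus>\<^bsub>P M M\<^esub> X"
      using step by (simp add: MM.M.minus_add c through_closed)
    also have "\<dots> \<in> through M"
      using step by (intro through.step) (auto intro!: EM.smult_closed)
    finally show ?case .
  qed
  show ?thesis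
  proof (rule additive_subgroupI, rule subgroup.intro)
    show "through M \<subseteq> carrier (add_monoid (P M M))" using through_closed by auto
    show "inv\<^bsub>add_monoid (P M M)\<^esub> X \<in> through M" if "X \<in> through M" for X
      using neg[OF that] by (simp add: a_inv_def)
  qed (simp_all add: add through.zero)
qed

text \<open>The identity is the sum of the coordinate projections, and partial sums with at most \<open>n\<close> terms
  factor through \<open>E\<close>. As \<open>\<chi> \<mapsto> [\<chi>]\<close> is polynomial of degree \<open>n\<close>, longer sums are combinations of these.\<close>

lemma ident_through: "ident_arrow M \<in> through M"
proof -
  interpret M: left_module B M by (rule lM)
  note H = left_module_Hom[OF B.is_cring lM lM]
  interpret H: left_module B "Hom_mod B M M" by (rule H)
  obtain S c where S: "finite S" "S \<subseteq> carrier M"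
    and c: "\<And>s x. \<lbrakk>s \<in> S; x \<in> carrier M\<rbrakk> \<Longrightarrow> c s x \<in> carrier B"
      "\<And>s x y. \<lbrakk>s \<in> S; x \<in> carrier M; y \<in> carrier M\<rbrakk> \<Longrightarrow> c s (x \<oplus>\<^bsub>M\<^esub> y) = c s x \<oplus>\<^bsub>B\<^esub> c s y"
      "\<And>s r x. \<lbrakk>s \<in> S; r \<in> carrier B; x \<in> carrier M\<rbrakk> \<Longrightarrow> c s (r \<odot>\<^bsub>M\<^esub> x) = r \<otimes>\<^bsub>B\<^esub> c s x"
    and expand: "\<And>x. x \<in> carrier M \<Longrightarrow> x = (\<Oplus>\<^bsub>M\<^esub>s\<in>S. c s x \<odot>\<^bsub>M\<^esub> s)"
    by (rule fg_free_coordinates[OF B.is_cring lM]) (use M in \<open>simp add: obj_fmod_cat\<close>, rule that)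
  define \<pi> where "\<pi> s = (\<lambda>x\<in>carrier M. c s x \<odot>\<^bsub>M\<^esub> s)" for s
  have \<pi>: "\<pi> s \<in> lin_maps B M M" if s: "s \<in> S" for s
    unfolding \<pi>_def
  proof (rule lin_maps_restrictI[OF lM])
    have sM: "s \<in> carrier M" using s S(2) by blast
    fix x y r assume x: "x \<in> carrier M"
    show "c s x \<odot>\<^bsub>M\<^esub> s \<in> carrier M" using c(1)[OF s x] sM by (rule M.smult_closed)
    show "c s (x \<oplus>\<^bsub>M\<^esub> y) \<odot>\<^bsub>M\<^esub> s = c s x \<odot>\<^bsub>M\<^esub> s \<oplus>\<^bsub>M\<^esub> c s y \<odot>\<^bsub>M\<^esub> s" if "y \<in> carrier M"
      using c(1)[OF s x] c(1)[OF s that] sM by (simp add: c(2)[OF s x that] M.smult_l_distr)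
    show "c s (r \<odot>\<^bsub>M\<^esub> x) \<odot>\<^bsub>M\<^esub> s = r \<odot>\<^bsub>M\<^esub> (c s x \<odot>\<^bsub>M\<^esub> s)" if "r \<in> carrier B"
      using c(1)[OF s x] that sM by (simp add: c(3)[OF s that x] M.smult_assoc1)
  qed
  have sum: "finsum (Hom_mod B M M) \<pi> T = (\<lambda>x\<in>carrier M. \<Oplus>\<^bsub>M\<^esub>s\<in>T. c s x \<odot>\<^bsub>M\<^esub> s)"
    if T: "T \<subseteq> S" for T
  proof (rule extensionalityI[of _ "carrier M"])
    have p: "\<pi> \<in> T \<rightarrow> carrier (Hom_mod B M M)" using T \<pi> by auto
    show "finsum (Hom_mod B M M) \<pi> T \<in> extensional (carrier M)"
      using H.M.finsum_closed[OF p] by (simp add: lin_maps_extensional)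
    fix x assume x: "x \<in> carrier M"
    show "finsum (Hom_mod B M M) \<pi> T x = (\<lambda>x\<in>carrier M. \<Oplus>\<^bsub>M\<^esub>s\<in>T. c s x \<odot>\<^bsub>M\<^esub> s) x"
      unfolding abelian_group_hom.hom_finsum[OF Hom_mod_eval[OF B.is_cring lM lM x] p]
      using x by (simp add: \<pi>_def)
  qed simp
  have "arrow M M (finsum (Hom_mod B M M) \<pi> S) \<in> through M"
  proof (rule polynomial_map_sum[where \<phi> = "arrow M M", OF H.M.abelian_group_axioms
        MM.M.abelian_group_axioms through_subgroup _ S(1)])
    show "polynomial_map n (Hom_mod B M M) (P M M) (arrow M M)"
      using numerical_pt[OF H] by (simp add: numerical_map_def)
    show "\<pi> \<in> S \<rightarrow> carrier (Hom_mod B M M)" using \<pi> by simp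
    fix T assume T: "T \<subseteq> S" "card T \<le> n"
    have "\<exists>\<alpha> \<in> lin_maps B E M. \<exists>\<beta> \<in> lin_maps B M E.
        compose (carrier M) \<alpha> \<beta> = (\<lambda>x\<in>carrier M. \<Oplus>\<^bsub>M\<^esub>s\<in>T. c s x \<odot>\<^bsub>M\<^esub> s)"
      using T S c finite_subset[OF T(1) S(1)] by (intro projection_factors[OF lM]) auto
    then obtain \<alpha> \<beta> where ab: "\<alpha> \<in> lin_maps B E M" "\<beta> \<in> lin_maps B M E"
        "compose (carrier M) \<alpha> \<beta> = finsum (Hom_mod B M M) \<pi> T"
      using sum[OF T(1)] by auto
    have "Pn_comp B n M M (arrow E M \<alpha>) (arrow M E \<beta>) \<oplus>\<^bsub>P M M\<^esub> \<zero>\<^bsub>P M M\<^esub> \<in> through M"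
      using ab by (intro through.step through.zero arrow_closed lM E_left_module)
    moreover have "arrow M M (compose (carrier M) \<alpha> \<beta>) \<in> carrier (P M M)"
      by (rule arrow_closed[OF lM lM lin_maps_compose[OF lM ab(2,1)]])
    ultimately show "arrow M M (finsum (Hom_mod B M M) \<pi> T) \<in> through M"
      by (simp only: Pn_comp_arrow[OF lM E_left_module lM ab(1,2)] MM.M.r_zero ab(3))
  qed
  moreover have "finsum (Hom_mod B M M) \<pi> S = (\<lambda>x\<in>carrier M. x)"
    unfolding sum[OF subset_refl] using expand by (intro restrict_ext) simp
  ultimately show ?thesis by (simp add: ident_arrow_def)
qed

lemma ident_decomposition:
  "\<exists>K A C. A \<in> {..<K} \<rightarrow> carrier (P E M) \<and> C \<in> {..<K} \<rightarrow> carrier (P M E) \<and>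
     ident_arrow M = (\<Oplus>\<^bsub>P M M\<^esub>i\<in>{..<K::nat}. Pn_comp B n M M (A i) (C i))"
proof -
  note c = Pn_comp_closed[OF lM E_left_module lM]
  have "\<exists>K A C. A \<in> {..<K} \<rightarrow> carrier (P E M) \<and> C \<in> {..<K} \<rightarrow> carrier (P M E) \<and>
     X = (\<Oplus>\<^bsub>P M M\<^esub>i\<in>{..<K::nat}. Pn_comp B n M M (A i) (C i))" if "X \<in> through M" for X
    using that
  proof (induct X rule: through.induct)
    case zero
    show ?case by (intro exI[of _ 0]) simp
  next
    case (step A0 C0 X)
    then obtain K A C where ac: "A \<in> {..<K} \<rightarrow> carrier (P E M)" "C \<in> {..<K} \<rightarrow> carrier (P M E)"
      "X = (\<Oplus>\<^bsub>P M M\<^esub>i\<in>{..<K::nat}. Pn_comp B n M M (A i) (C i))" by blast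
    let ?A = "A(K := A0)" and ?C = "C(K := C0)"
    let ?t = "\<lambda>i. Pn_comp B n M M (?A i) (?C i)"
    have t: "?t \<in> {..<K} \<rightarrow> carrier (P M M)" using ac(1,2) by (auto intro!: c)
    have "(\<Oplus>\<^bsub>P M M\<^esub>i\<in>{..<Suc K}. ?t i) = ?t K \<oplus>\<^bsub>P M M\<^esub> (\<Oplus>\<^bsub>P M M\<^esub>i\<in>{..<K}. ?t i)"
      unfolding lessThan_Suc using step(1,2) t by (intro MM.M.finsum_insert) (auto intro!: c)
    also have "(\<Oplus>\<^bsub>P M M\<^esub>i\<in>{..<K}. ?t i) = X"
      unfolding ac(3) using ac(1,2) by (intro MM.M.finsum_cong'[OF refl]) (auto intro!: c)
    finally have sum: "(\<Oplus>\<^bsub>P M M\<^esub>i\<in>{..<Suc K}. ?t i) = ?t K \<oplus>\<^bsub>P M M\<^esub> X" .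
    show ?case
      by (rule exI[where x = "Suc K"], rule exI[where x = ?A], rule exI[where x = ?C])
        (use step(1,2) ac(1,2) sum in \<open>auto simp: Pi_iff less_Suc_eq\<close>)
  qed
  then show ?thesis using ident_through by blast
qed

end
end

section \<open>Restriction to the free module of rank \<open>n\<close>\<close>

context standard_free
begin

lemma ident_E_closed: "ident_arrow E \<in> carrier (P E E)"
  by (rule ident_arrow_closed[OF E_left_module])

lemma act_expand:
  fixes F :: "(('b, 'm) module, 'm \<Rightarrow> 'm, ('b, 'k) module, 'k \<Rightarrow> 'k) ftr"
  assumes F: "numerical_into F" and M: "M \<in> Ob" and x: "x \<in> carrier (fobj F M)"
    and A: "A \<in> {..<K} \<rightarrow> carrier (P E M)" and C: "C \<in> {..<K} \<rightarrow> carrier (P M E)"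
    and ident: "ident_arrow M = (\<Oplus>\<^bsub>P M M\<^esub>i\<in>{..<K::nat}. Pn_comp B n M M (A i) (C i))"
  shows "x = (\<Oplus>\<^bsub>fobj F M\<^esub>i\<in>{..<K}. act F E M (A i) (act F M E (C i) x))"
proof -
  note lM = Ob_left_module[OF M] and V = value_left_module[OF F M]
  interpret V: left_module B "fobj F M" by (rule V)
  let ?a = "\<lambda>X\<in>carrier (P M M). act F M M X x"
  have c: "Pn_comp B n M M (A i) (C i) \<in> carrier (P M M)" if "i \<in> {..<K}" for i
    using A C that by (intro Pn_comp_closed[OF lM E_left_module lM]) auto
  have "x = act F M M (ident_arrow M) x" by (simp add: act_ident[OF F M x])
  also have "\<dots> = ?a (ident_arrow M)" using ident_arrow_closed[OF lM] by simp
  also have "\<dots> = (\<Oplus>\<^bsub>fobj F M\<^esub>i\<in>{..<K}. ?a (Pn_comp B n M M (A i) (C i)))"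
    unfolding ident using c
    by (intro lin_maps_finsum[OF left_module_P[OF M M] V act_scalar_lin[OF F M M x]]) auto
  also have "\<dots> = (\<Oplus>\<^bsub>fobj F M\<^esub>i\<in>{..<K}. act F E M (A i) (act F M E (C i) x))"
  proof (rule V.M.finsum_cong'[OF refl])
    show "(\<lambda>i. act F E M (A i) (act F M E (C i) x)) \<in> {..<K} \<rightarrow> carrier (fobj F M)"
      using A C x by (intro Pi_I act_closed[OF F E_Ob M] act_closed[OF F M E_Ob]) auto
    show "?a (Pn_comp B n M M (A i) (C i)) = act F E M (A i) (act F M E (C i) x)" if "i \<in> {..<K}" for i
      using c[OF that] act_comp[OF F M E_Ob M Pi_mem[OF A that] Pi_mem[OF C that] x] by simp
  qed
  finally show ?thesis .
qed

text \<open>By the expansion above, an element of \<open>F(M)\<close> can be recovered from its images in \<open>F(E)\<close>.\<close>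

lemma act_separates:
  fixes F :: "(('b, 'm) module, 'm \<Rightarrow> 'm, ('b, 'k) module, 'k \<Rightarrow> 'k) ftr"
  assumes F: "numerical_into F" and M: "M \<in> Ob"
    and x: "x \<in> carrier (fobj F M)" and y: "y \<in> carrier (fobj F M)"
    and eq: "\<And>X. X \<in> carrier (P M E) \<Longrightarrow> act F M E X x = act F M E X y"
  shows "x = y"
proof -
  interpret V: left_module B "fobj F M" by (rule value_left_module[OF F M])
  obtain K A C where d: "A \<in> {..<K} \<rightarrow> carrier (P E M)" "C \<in> {..<K} \<rightarrow> carrier (P M E)"
    "ident_arrow M = (\<Oplus>\<^bsub>P M M\<^esub>i\<in>{..<K::nat}. Pn_comp B n M M (A i) (C i))"
    using ident_decomposition[OF M] by blast
  have "x = (\<Oplus>\<^bsub>fobj F M\<^esub>i\<in>{..<K}. act F E M (A i) (act F M E (C i) x))"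
    by (rule act_expand[OF F M x d])
  also have "\<dots> = (\<Oplus>\<^bsub>fobj F M\<^esub>i\<in>{..<K}. act F E M (A i) (act F M E (C i) y))"
    using d(1,2) y eq
    by (intro V.M.finsum_cong'[OF refl]) (auto simp: Pi_iff intro!: act_closed[OF F E_Ob M] act_closed[OF F M E_Ob])
  also have "\<dots> = y" by (rule act_expand[OF F M y d, symmetric])
  finally show ?thesis .
qed

context
  fixes F G :: "('b, 'm) mod_functor"
  assumes F: "numerical_into F" and G: "numerical_into G"
begin

lemma nat_trans_faithful:
  assumes \<eta>: "\<eta> \<in> Transf F G"
    and \<theta>: "\<theta> \<in> Transf F G" and eq: "\<eta> E = \<theta> E"
  shows "\<eta> = \<theta>"
proof (rule extensionalityI[OF nat_trans_extensional[OF \<eta>] nat_trans_extensional[OF \<theta>]])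
  fix M :: "('b, 'm) module" assume M: "M \<in> Ob"
  have \<eta>M: "\<eta> M \<in> lin_maps B (fobj F M) (fobj G M)" and \<theta>M: "\<theta> M \<in> lin_maps B (fobj F M) (fobj G M)"
    using nat_trans_arr[OF \<eta> M] nat_trans_arr[OF \<theta> M] by simp_all
  show "\<eta> M = \<theta> M"
  proof (rule lin_maps_eqI[OF \<eta>M \<theta>M])
    fix x assume x: "x \<in> carrier (fobj F M)"
    show "\<eta> M x = \<theta> M x"
      by (rule act_separates[OF G M lin_maps_closed[OF \<eta>M x] lin_maps_closed[OF \<theta>M x]])
        (use eq act_natural[OF F G \<eta> M E_Ob _ x] act_natural[OF F G \<theta> M E_Ob _ x] in simp)
  qed
qed

text \<open>The component at \<open>M\<close> sends \<open>x\<close> to the unique element whose images in \<open>G(E)\<close> are those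
  that naturality prescribes. Uniqueness makes it linear and natural; the decomposition of the
  identity of \<open>M\<close> gives existence.\<close>

lemma nat_trans_full:
  assumes u: "u \<in> carrier (fobj F E) \<rightarrow>\<^sub>E carrier (fobj G E)"
    and u_add: "\<And>x y. \<lbrakk>x \<in> carrier (fobj F E); y \<in> carrier (fobj F E)\<rbrakk>
      \<Longrightarrow> u (x \<oplus>\<^bsub>fobj F E\<^esub> y) = u x \<oplus>\<^bsub>fobj G E\<^esub> u y"
    and u_act: "\<And>X x. \<lbrakk>X \<in> carrier (P E E); x \<in> carrier (fobj F E)\<rbrakk>
      \<Longrightarrow> u (act F E E X x) = act G E E X (u x)"
  shows "\<exists>\<eta> \<in> Transf F G. \<eta> E = u"
proof -
  note FE = value_left_module[OF F E_Ob] and GE = value_left_module[OF G E_Ob]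
  interpret FE: left_module B "fobj F E" by (rule FE)
  interpret GE: left_module B "fobj G E" by (rule GE)
  interpret EE: left_module B "P E E" by (rule left_module_P[OF E_Ob E_Ob])
  have uc: "u x \<in> carrier (fobj G E)" if "x \<in> carrier (fobj F E)" for x using u that by auto
  interpret u: abelian_group_hom "fobj F E" "fobj G E" u
    by (rule abelian_group_hom_of_additive[OF FE.M.abelian_group_axioms GE.M.abelian_group_axioms])
      (auto simp: uc u_add)
  \<comment> \<open>scalars act as the multiples of \<open>[1]\<close>\<close>
  have u_smult: "u (r \<odot>\<^bsub>fobj F E\<^esub> x) = r \<odot>\<^bsub>fobj G E\<^esub> u x"
    if r: "r \<in> carrier B" and x: "x \<in> carrier (fobj F E)" for r x
    using u_act[OF EE.smult_closed[OF r ident_E_closed] x]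
    by (simp add: act_smult[OF F E_Ob E_Ob r ident_E_closed x] act_smult[OF G E_Ob E_Ob r ident_E_closed uc[OF x]]
        act_ident[OF F E_Ob x] act_ident[OF G E_Ob uc[OF x]])
  have ex: "\<exists>z \<in> carrier (fobj G M). \<forall>Y \<in> carrier (P M E). act G M E Y z = u (act F M E Y x)"
    if M: "M \<in> Ob" and x: "x \<in> carrier (fobj F M)" for M :: "('b, 'm) module" and x
  proof -
    note lM = Ob_left_module[OF M]
    interpret FM: left_module B "fobj F M" by (rule value_left_module[OF F M])
    interpret GM: left_module B "fobj G M" by (rule value_left_module[OF G M])
    obtain K A C where A: "A \<in> {..<K} \<rightarrow> carrier (P E M)" and C: "C \<in> {..<K} \<rightarrow> carrier (P M E)"
      and d: "ident_arrow M = (\<Oplus>\<^bsub>P M M\<^esub>i\<in>{..<K::nat}. Pn_comp B n M M (A i) (C i))"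
      using ident_decomposition[OF M] by blast
    have Ai: "A i \<in> carrier (P E M)" and Ci: "C i \<in> carrier (P M E)" if "i \<in> {..<K}" for i
      using A C that by auto
    define w where "w i = act F M E (C i) x" for i
    have w: "w i \<in> carrier (fobj F E)" if "i \<in> {..<K}" for i
      unfolding w_def by (rule act_closed[OF F M E_Ob Ci[OF that] x])
    have uw: "act G E M (A i) (u (w i)) \<in> carrier (fobj G M)" if "i \<in> {..<K}" for i
      by (rule act_closed[OF G E_Ob M Ai[OF that] uc[OF w[OF that]]])
    have aw: "act F E M (A i) (w i) \<in> carrier (fobj F M)" if "i \<in> {..<K}" for i
      by (rule act_closed[OF F E_Ob M Ai[OF that] w[OF that]])
    have xe: "x = (\<Oplus>\<^bsub>fobj F M\<^esub>i\<in>{..<K}. act F E M (A i) (w i))"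
      unfolding w_def by (rule act_expand[OF F M x A C d])
    let ?z = "\<Oplus>\<^bsub>fobj G M\<^esub>i\<in>{..<K}. act G E M (A i) (u (w i))"
    have "act G M E Y ?z = u (act F M E Y x)" if Y: "Y \<in> carrier (P M E)" for Y
    proof -
      have YA: "Pn_comp B n E E Y (A i) \<in> carrier (P E E)" if "i \<in> {..<K}" for i
        by (rule Pn_comp_closed[OF E_left_module lM E_left_module Y Ai[OF that]])
      have "act G M E Y ?z = (\<Oplus>\<^bsub>fobj G E\<^esub>i\<in>{..<K}. act G M E Y (act G E M (A i) (u (w i))))"
        using uw by (intro lin_maps_finsum[OF GM.left_module_axioms GE act_in_lin_maps[OF G M E_Ob Y]]) auto
      also have "\<dots> = (\<Oplus>\<^bsub>fobj G E\<^esub>i\<in>{..<K}. u (act F M E Y (act F E M (A i) (w i))))"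
      proof (rule GE.M.finsum_cong'[OF refl])
        fix i assume i: "i \<in> {..<K}"
        show "act G M E Y (act G E M (A i) (u (w i))) = u (act F M E Y (act F E M (A i) (w i)))"
          using act_comp[OF G E_Ob M E_Ob Y Ai[OF i] uc[OF w[OF i]]] act_comp[OF F E_Ob M E_Ob Y Ai[OF i] w[OF i]]
            u_act[OF YA[OF i] w[OF i]] by simp
      qed (use aw Y in \<open>auto intro!: uc act_closed[OF F M E_Ob]\<close>)
      also have "\<dots> = u (\<Oplus>\<^bsub>fobj F E\<^esub>i\<in>{..<K}. act F M E Y (act F E M (A i) (w i)))"
        using aw Y by (intro u.hom_finsum[symmetric]) (auto intro!: act_closed[OF F M E_Ob])
      also have "(\<Oplus>\<^bsub>fobj F E\<^esub>i\<in>{..<K}. act F M E Y (act F E M (A i) (w i))) = act F M E Y x"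
        by (subst xe, rule lin_maps_finsum[OF FM.left_module_axioms FE act_in_lin_maps[OF F M E_Ob Y], symmetric])
          (use aw in auto)
      finally show ?thesis .
    qed
    moreover have "?z \<in> carrier (fobj G M)" using uw by (intro GM.M.finsum_closed) auto
    ultimately show ?thesis by blast
  qed
  define z where "z M x = (SOME z. z \<in> carrier (fobj G M) \<and>
      (\<forall>Y \<in> carrier (P M E). act G M E Y z = u (act F M E Y x)))" for M x
  have z: "z M x \<in> carrier (fobj G M)" "\<And>Y. Y \<in> carrier (P M E) \<Longrightarrow> act G M E Y (z M x) = u (act F M E Y x)"
    if "M \<in> Ob" "x \<in> carrier (fobj F M)" for M x
  proof -
    have "z M x \<in> carrier (fobj G M) \<and> (\<forall>Y \<in> carrier (P M E). act G M E Y (z M x) = u (act F M E Y x))"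
      unfolding z_def by (rule someI_ex) (use ex[OF that] in blast)
    then show "z M x \<in> carrier (fobj G M)" "\<And>Y. Y \<in> carrier (P M E) \<Longrightarrow> act G M E Y (z M x) = u (act F M E Y x)"
      by simp_all
  qed
  have z_eq: "z M x = y" if "M \<in> Ob" "x \<in> carrier (fobj F M)" "y \<in> carrier (fobj G M)"
      "\<And>Y. Y \<in> carrier (P M E) \<Longrightarrow> act G M E Y y = u (act F M E Y x)" for M x y
    by (rule act_separates[OF G that(1) z(1)[OF that(1,2)] that(3)]) (simp add: z(2)[OF that(1,2)] that(4))
  define \<eta> where "\<eta> = (\<lambda>M\<in>Ob. \<lambda>x\<in>carrier (fobj F M). z M x)"
  have "\<eta> \<in> Transf F G"
  proof (rule nat_transI)
    show "\<eta> \<in> extensional Ob" by (simp add: \<eta>_def)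
    fix M :: "('b, 'm) module" assume M: "M \<in> Ob"
    interpret FM: left_module B "fobj F M" by (rule value_left_module[OF F M])
    interpret GM: left_module B "fobj G M" by (rule value_left_module[OF G M])
    note zM = z[OF M]
    have "(\<lambda>x\<in>carrier (fobj F M). z M x) \<in> lin_maps B (fobj F M) (fobj G M)"
    proof (rule lin_maps_restrictI[OF FM.left_module_axioms])
      fix x y r assume x: "x \<in> carrier (fobj F M)"
      show "z M x \<in> carrier (fobj G M)" by (rule zM(1)[OF x])
      show "z M (x \<oplus>\<^bsub>fobj F M\<^esub> y) = z M x \<oplus>\<^bsub>fobj G M\<^esub> z M y" if y: "y \<in> carrier (fobj F M)"
        by (rule z_eq[OF M]) (use x y zM(1)[OF x] zM(1)[OF y] in \<open>simp_all add: act_vector_add[OF G M E_Ob]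
            act_vector_add[OF F M E_Ob] zM(2) u_add act_closed[OF F M E_Ob]\<close>)
      show "z M (r \<odot>\<^bsub>fobj F M\<^esub> x) = r \<odot>\<^bsub>fobj G M\<^esub> z M x" if r: "r \<in> carrier B"
        by (rule z_eq[OF M]) (use x r zM(1)[OF x] in \<open>simp_all add: act_vector_smult[OF G M E_Ob]
            act_vector_smult[OF F M E_Ob] zM(2) u_smult act_closed[OF F M E_Ob]
            FM.smult_closed GM.smult_closed\<close>)
    qed
    then show "\<eta> M \<in> arr (mod_cat B) (fobj F M) (fobj G M)" using M by (simp add: \<eta>_def)
    fix N :: "('b, 'm) module" and \<chi> assume N: "N \<in> Ob" and "\<chi> \<in> arr (fmod_cat B) M N"
    then have \<chi>: "\<chi> \<in> lin_maps B M N" by simp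
    note c = arrow_closed[OF Ob_left_module[OF M] Ob_left_module[OF N] \<chi>]
    have "z N (act F M N (arrow M N \<chi>) x) = act G M N (arrow M N \<chi>) (z M x)"
      if x: "x \<in> carrier (fobj F M)" for x
    proof (rule z_eq[OF N act_closed[OF F M N c x] act_closed[OF G M N c zM(1)[OF x]]])
      fix Y assume Y: "Y \<in> carrier (P N E)"
      note Yc = Pn_comp_closed[OF Ob_left_module[OF M] Ob_left_module[OF N] E_left_module Y c]
      show "act G N E Y (act G M N (arrow M N \<chi>) (z M x)) = u (act F N E Y (act F M N (arrow M N \<chi>) x))"
        using act_comp[OF G M N E_Ob Y c zM(1)[OF x]] act_comp[OF F M N E_Ob Y c x] zM(2)[OF x Yc]
        by simp
    qed
    then have "z N (farr F M N \<chi> x) = farr G M N \<chi> (z M x)" if "x \<in> carrier (fobj F M)" for x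
      using that by (simp add: act_arrow[OF F M N \<chi>] act_arrow[OF G M N \<chi>])
    then show "cmp (mod_cat B) (fobj F M) (fobj F N) (fobj G N) (\<eta> N) (farr F M N \<chi>)
        = cmp (mod_cat B) (fobj F M) (fobj G M) (fobj G N) (farr G M N \<chi>) (\<eta> M)"
      using M N lin_maps_closed[OF value_arr[OF F M N \<chi>]] by (auto simp: \<eta>_def compose_def fun_eq_iff)
  qed
  moreover have "\<eta> E = u"
  proof (rule extensionalityI[of _ "carrier (fobj F E)"])
    fix x assume x: "x \<in> carrier (fobj F E)"
    have "z E x = u x" by (rule z_eq[OF E_Ob x uc[OF x]]) (simp add: u_act x)
    then show "\<eta> E x = u x" using x E_Ob by (simp add: \<eta>_def)
  qed (use u E_Ob in \<open>auto simp: \<eta>_def PiE_def\<close>)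
  ultimately show ?thesis by blast
qed

end
end

section \<open>The functor \<open>\<Phi>\<close>\<close>

lemma Phi_simps:
  "carrier (fobj (Phi B E) F) = carrier (fobj F E)" "zero (fobj (Phi B E) F) = \<zero>\<^bsub>fobj F E\<^esub>"
  "add (fobj (Phi B E) F) = add (fobj F E)" "smult (fobj (Phi B E) F) = Phi_smult B E F"
  "farr (Phi B E) F G \<eta> = \<eta> E"
  by (simp_all add: Phi_def)

lemma iso_arrow_mod_cat:
  assumes M: "left_module R M" and N: "left_module R N" and f: "f \<in> lin_maps R M N"
    and bij: "bij_betw f (carrier M) (carrier N)"
  shows "iso_arrow (mod_cat R) M N f"
proof -
  interpret M: left_module R M by fact
  interpret N: left_module R N by fact
  let ?g = "inv_into (carrier M) f"
  have gf: "?g (f x) = x" if "x \<in> carrier M" for x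
    using bij_betw_inv_into_left[OF bij that] .
  have fg: "f (?g y) = y" if "y \<in> carrier N" for y
    using bij_betw_inv_into_right[OF bij that] .
  have g: "?g y \<in> carrier M" if "y \<in> carrier N" for y
    using bij_betwE[OF bij_betw_inv_into[OF bij]] that by blast
  have "(\<lambda>y\<in>carrier N. ?g y) \<in> lin_maps R N M"
  proof (rule lin_maps_restrictI[OF N g])
    show "?g (x \<oplus>\<^bsub>N\<^esub> y) = ?g x \<oplus>\<^bsub>M\<^esub> ?g y" if "x \<in> carrier N" "y \<in> carrier N" for x y
      using gf[of "?g x \<oplus>\<^bsub>M\<^esub> ?g y"] g that by (simp add: lin_maps_add[OF f] fg)
    show "?g (r \<odot>\<^bsub>N\<^esub> x) = r \<odot>\<^bsub>M\<^esub> ?g x" if "r \<in> carrier R" "x \<in> carrier N" for r x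
      using gf[of "r \<odot>\<^bsub>M\<^esub> ?g x"] g that by (simp add: lin_maps_smult[OF f] fg M.smult_closed)
  qed
  moreover have "compose (carrier M) (\<lambda>y\<in>carrier N. ?g y) f = (\<lambda>x\<in>carrier M. x)"
    by (auto simp: compose_def gf lin_maps_closed[OF f] fun_eq_iff)
  moreover have "compose (carrier N) f (\<lambda>y\<in>carrier N. ?g y) = (\<lambda>x\<in>carrier N. x)"
    by (auto simp: compose_def fg fun_eq_iff)
  ultimately show ?thesis unfolding iso_arrow_def using f by auto
qed

text \<open>With \<open>f\<close> and \<open>g\<close> the evaluations of natural transformations at one element, this reduces direct sums
  of modules of natural transformations to direct sums of values.\<close>

lemma is_direct_sum_transport:
  assumes S: "abelian_group S" and T: "abelian_group T"
    and sum: "is_direct_sum B I X \<iota> S"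
    and f: "\<And>i. i \<in> I \<Longrightarrow> bij_betw (f i) (carrier (N i)) (carrier (X i))"
    and f0: "\<And>i. i \<in> I \<Longrightarrow> \<zero>\<^bsub>N i\<^esub> \<in> carrier (N i) \<and> f i \<zero>\<^bsub>N i\<^esub> = \<zero>\<^bsub>X i\<^esub>"
    and g: "bij_betw g (carrier T) (carrier S)"
    and g_add: "\<And>x y. \<lbrakk>x \<in> carrier T; y \<in> carrier T\<rbrakk> \<Longrightarrow> g (x \<oplus>\<^bsub>T\<^esub> y) = g x \<oplus>\<^bsub>S\<^esub> g y"
    and \<kappa>: "\<And>i. i \<in> I \<Longrightarrow> \<kappa> i \<in> lin_maps B (N i) T"
    and comm: "\<And>i y. \<lbrakk>i \<in> I; y \<in> carrier (N i)\<rbrakk> \<Longrightarrow> g (\<kappa> i y) = \<iota> i (f i y)"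
  shows "is_direct_sum B I N \<kappa> T"
proof -
  interpret S: abelian_group S by fact
  interpret T: abelian_group T by fact
  interpret g: abelian_group_hom T S g
    using bij_betwE[OF g] by (intro abelian_group_hom_of_additive S T) (auto simp: g_add)
  define D where "D = {y \<in> \<Pi>\<^sub>E i\<in>I. carrier (N i). finite {i \<in> I. y i \<noteq> \<zero>\<^bsub>N i\<^esub>}}"
  define D' where "D' = {x \<in> \<Pi>\<^sub>E i\<in>I. carrier (X i). finite {i \<in> I. x i \<noteq> \<zero>\<^bsub>X i\<^esub>}}"
  define h where "h y = (\<lambda>i\<in>I. f i (y i))" for y
  define \<Sigma> where "\<Sigma> y = (\<Oplus>\<^bsub>T\<^esub>i\<in>{i \<in> I. y i \<noteq> \<zero>\<^bsub>N i\<^esub>}. \<kappa> i (y i))" for y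
  define \<Sigma>' where "\<Sigma>' x = (\<Oplus>\<^bsub>S\<^esub>i\<in>{i \<in> I. x i \<noteq> \<zero>\<^bsub>X i\<^esub>}. \<iota> i (x i))" for x
  have bij': "bij_betw \<Sigma>' D' (carrier S)"
    using sum unfolding is_direct_sum_def \<Sigma>'_def D'_def by blast
  have supp: "{i \<in> I. h y i \<noteq> \<zero>\<^bsub>X i\<^esub>} = {i \<in> I. y i \<noteq> \<zero>\<^bsub>N i\<^esub>}"
    if y: "y \<in> (\<Pi>\<^sub>E i\<in>I. carrier (N i))" for y
  proof -
    have "f i (y i) = \<zero>\<^bsub>X i\<^esub> \<longleftrightarrow> y i = \<zero>\<^bsub>N i\<^esub>" if i: "i \<in> I" for i
      using inj_onD[OF bij_betw_imp_inj_on[OF f[OF i]], of "y i" "\<zero>\<^bsub>N i\<^esub>"] f0[OF i] PiE_mem[OF y i] by auto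
    then show ?thesis by (auto simp: h_def)
  qed
  have hb: "bij_betw h D D'"
  proof (rule bij_betw_byWitness[where f' = "\<lambda>x. \<lambda>i\<in>I. inv_into (carrier (N i)) (f i) (x i)"])
    have fi: "f i y \<in> carrier (X i)" "inv_into (carrier (N i)) (f i) (f i y) = y"
      if "i \<in> I" "y \<in> carrier (N i)" for i y
      using f[OF that(1)] that(2) by (auto dest: bij_betwE simp: bij_betw_inv_into_left)
    have if': "inv_into (carrier (N i)) (f i) x \<in> carrier (N i)" "f i (inv_into (carrier (N i)) (f i) x) = x"
      if "i \<in> I" "x \<in> carrier (X i)" for i x
      using bij_betwE[OF bij_betw_inv_into[OF f[OF that(1)]]] f[OF that(1)] that(2)
      by (auto simp: bij_betw_inv_into_right)
    show "\<forall>y\<in>D. (\<lambda>i\<in>I. inv_into (carrier (N i)) (f i) (h y i)) = y"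
    proof
      fix y assume "y \<in> D"
      then have y: "y \<in> (\<Pi>\<^sub>E i\<in>I. carrier (N i))" by (simp add: D_def)
      show "(\<lambda>i\<in>I. inv_into (carrier (N i)) (f i) (h y i)) = y"
        by (rule extensionalityI[of _ I])
          (use y in \<open>auto simp: h_def fi(2)[OF _ PiE_mem[OF y]] PiE_def\<close>)
    qed
    show "\<forall>x\<in>D'. h (\<lambda>i\<in>I. inv_into (carrier (N i)) (f i) (x i)) = x"
    proof
      fix x assume "x \<in> D'"
      then have x: "x \<in> (\<Pi>\<^sub>E i\<in>I. carrier (X i))" by (simp add: D'_def)
      show "h (\<lambda>i\<in>I. inv_into (carrier (N i)) (f i) (x i)) = x"
        by (rule extensionalityI[of _ I])
          (use x in \<open>auto simp: h_def if'(2)[OF _ PiE_mem[OF x]] PiE_def\<close>)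
    qed
    show "h ` D \<subseteq> D'"
    proof
      fix x assume "x \<in> h ` D"
      then obtain y where y: "y \<in> D" "x = h y" by blast
      then have yP: "y \<in> (\<Pi>\<^sub>E i\<in>I. carrier (N i))" by (simp add: D_def)
      have "h y \<in> (\<Pi>\<^sub>E i\<in>I. carrier (X i))"
        unfolding h_def restrict_PiE_iff using fi(1) PiE_mem[OF yP] by blast
      then show "x \<in> D'" using y supp[OF yP] by (simp add: D_def D'_def)
    qed
    show "(\<lambda>x. \<lambda>i\<in>I. inv_into (carrier (N i)) (f i) (x i)) ` D' \<subseteq> D"
    proof
      fix y assume "y \<in> (\<lambda>x. \<lambda>i\<in>I. inv_into (carrier (N i)) (f i) (x i)) ` D'"
      then obtain x where x: "x \<in> D'" "y = (\<lambda>i\<in>I. inv_into (carrier (N i)) (f i) (x i))" by blast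
      then have xP: "x \<in> (\<Pi>\<^sub>E i\<in>I. carrier (X i))" by (simp add: D'_def)
      have yP: "y \<in> (\<Pi>\<^sub>E i\<in>I. carrier (N i))"
        unfolding x(2) restrict_PiE_iff using if'(1) PiE_mem[OF xP] by blast
      have "h y = x"
        unfolding x(2) by (rule extensionalityI[of _ I])
          (use xP in \<open>auto simp: h_def if'(2)[OF _ PiE_mem[OF xP]] PiE_def\<close>)
      then show "y \<in> D" using x(1) supp[OF yP] yP by (simp add: D_def D'_def)
    qed
  qed
  have \<kappa>c: "\<kappa> i (y i) \<in> carrier T" if "y \<in> D" "i \<in> I" for y i
    using lin_maps_closed[OF \<kappa>[OF that(2)]] that PiE_mem[of y I] by (auto simp: D_def)
  have gs: "g (\<Sigma> y) = \<Sigma>' (h y)" if y: "y \<in> D" for y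
  proof -
    have yP: "y \<in> (\<Pi>\<^sub>E i\<in>I. carrier (N i))" using y by (simp add: D_def)
    have "g (\<Sigma> y) = (\<Oplus>\<^bsub>S\<^esub>i\<in>{i \<in> I. y i \<noteq> \<zero>\<^bsub>N i\<^esub>}. g (\<kappa> i (y i)))"
      unfolding \<Sigma>_def using \<kappa>c[OF y] by (intro g.hom_finsum) auto
    also have "\<dots> = \<Sigma>' (h y)"
      unfolding \<Sigma>'_def supp[OF yP]
    proof (rule S.finsum_cong'[OF refl])
      show "g (\<kappa> i (y i)) = \<iota> i (h y i)" if "i \<in> {i \<in> I. y i \<noteq> \<zero>\<^bsub>N i\<^esub>}" for i
        using that comm PiE_mem[OF yP] by (simp add: h_def)
      then show "(\<lambda>i. \<iota> i (h y i)) \<in> {i \<in> I. y i \<noteq> \<zero>\<^bsub>N i\<^esub>} \<rightarrow> carrier S"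
        using \<kappa>c[OF y] g.hom_closed by (metis (mono_tags, lifting) Pi_I mem_Collect_eq)
    qed
    finally show ?thesis .
  qed
  have "\<Sigma> y \<in> carrier T" if "y \<in> D" for y
    unfolding \<Sigma>_def using \<kappa>c[OF that] by (intro T.finsum_closed) auto
  then have im: "\<Sigma> ` D \<subseteq> carrier T" by blast
  have "bij_betw (\<Sigma>' \<circ> h) D (carrier S)" by (rule bij_betw_trans[OF hb bij'])
  then have "bij_betw (g \<circ> \<Sigma>) D (carrier S)"
    using gs by (subst bij_betw_cong[of _ _ "\<Sigma>' \<circ> h"]) auto
  then have "bij_betw \<Sigma> D (carrier T)" by (subst bij_betw_comp_iff2[OF g im])
  then show ?thesis
    unfolding is_direct_sum_def using \<kappa> unfolding \<Sigma>_def D_def by blast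
qed

context standard_free
begin

abbreviation R where "R \<equiv> Pn_End B n E"

lemma ring_R: "ring R"
  by (rule ring_Pn_End[OF E_left_module])

context
  fixes F :: "('b, 'm) mod_functor"
  assumes F: "numerical_into F"
begin

text \<open>All representatives of \<open>A\<close> give the same sum, because it is the action of \<open>A\<close> evaluated at \<open>x\<close>.\<close>

lemma Phi_smult_eq_act:
  assumes A: "A \<in> carrier (P E E)" and x: "x \<in> carrier (fobj F E)"
  shows "Phi_smult B E F A x = act F E E A x"
proof -
  note H = left_module_Hom[OF B.is_cring E_left_module E_left_module]
  note V = value_left_module[OF F E_Ob]
  let ?HF = "Hom_mod B (fobj F E) (fobj F E)"
  let ?ev = "\<lambda>h\<in>lin_maps B (fobj F E) (fobj F E). h x"
  have fc: "farr F E E \<in> carrier (Hom_mod B E E) \<rightarrow> carrier ?HF"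
    using value_arr[OF F E_Ob E_Ob] by simp
  have "act F E E A x = (\<Oplus>\<^bsub>fobj F E\<^esub>\<tau>\<in>supp B f. f \<tau> \<odot>\<^bsub>fobj F E\<^esub> farr F E E \<tau> x)" if f: "f \<in> A" for f
  proof -
    have fF: "f \<in> carrier (free_alg B (Hom_mod B E E))" by (rule Pn_mem_free_alg[OF H A f])
    have a: "act F E E A = lin_ext B ?HF (farr F E E) f"
      by (subst Pn_mem_coset[OF H A f]) (rule act_coset[OF F E_Ob E_Ob fF])
    then have "act F E E A x = ?ev (lin_ext B ?HF (farr F E E) f)"
      using act_in_lin_maps[OF F E_Ob E_Ob A] by simp
    also have "\<dots> = lin_ext B (fobj F E) (\<lambda>\<tau>. ?ev (farr F E E \<tau>)) f"
      by (rule lin_ext_post[OF H left_module_Hom[OF B.is_cring V V] V fc lin_maps_eval[OF B.is_cring V V x] fF,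
            symmetric])
    also have "\<dots> = lin_ext B (fobj F E) (\<lambda>\<tau>. farr F E E \<tau> x) f"
      using fc lin_maps_closed[OF value_arr[OF F E_Ob E_Ob] x] by (intro lin_ext_cong[OF V _ fF]) auto
    finally show ?thesis by (simp add: lin_ext_def)
  qed
  then show ?thesis
    unfolding Phi_smult_def using Pn_nonempty[OF H A] by (intro the_equality) auto
qed

lemma left_module_Phi: "left_module R (fobj (Phi B E) F)"
proof -
  interpret V: left_module B "fobj F E" by (rule value_left_module[OF F E_Ob])
  have "abelian_group (fobj (Phi B E) F)"
  proof (rule abelian_groupI)
    fix x assume "x \<in> carrier (fobj (Phi B E) F)"
    then show "\<exists>y\<in>carrier (fobj (Phi B E) F). y \<oplus>\<^bsub>fobj (Phi B E) F\<^esub> x = \<zero>\<^bsub>fobj (Phi B E) F\<^esub>"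
      using V.M.l_neg V.M.a_inv_closed unfolding Phi_simps by blast
  qed (simp_all add: Phi_simps V.M.a_ac)
  then show ?thesis
    by (intro left_module.intro left_module_axioms.intro ring_R)
      (simp_all add: Pn_End_simps Phi_simps Phi_smult_eq_act act_closed[OF F E_Ob E_Ob]
        act_add[OF F E_Ob E_Ob] act_vector_add[OF F E_Ob E_Ob] act_comp[OF F E_Ob E_Ob E_Ob]
        act_ident[OF F E_Ob] Pn_comp_closed[OF E_left_module E_left_module E_left_module]
        ident_arrow_closed[OF E_left_module] left_module.axioms[OF left_module_P[OF E_Ob E_Ob]]
        abelian_monoid.a_closed[OF abelian_group.axioms(1)[OF
          abelian_group_left_module[OF left_module_P[OF E_Ob E_Ob]]]])
qed

end

lemma lin_maps_Phi_iff:
  assumes F: "numerical_into F" and G: "numerical_into G"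
  shows "u \<in> lin_maps R (fobj (Phi B E) F) (fobj (Phi B E) G) \<longleftrightarrow>
    u \<in> carrier (fobj F E) \<rightarrow>\<^sub>E carrier (fobj G E) \<and>
    (\<forall>x \<in> carrier (fobj F E). \<forall>y \<in> carrier (fobj F E). u (x \<oplus>\<^bsub>fobj F E\<^esub> y) = u x \<oplus>\<^bsub>fobj G E\<^esub> u y) \<and>
    (\<forall>X \<in> carrier (P E E). \<forall>x \<in> carrier (fobj F E). u (act F E E X x) = act G E E X (u x))"
proof -
  have "u (Phi_smult B E F X x) = Phi_smult B E G X (u x) \<longleftrightarrow> u (act F E E X x) = act G E E X (u x)"
    if "u \<in> carrier (fobj F E) \<rightarrow>\<^sub>E carrier (fobj G E)" "X \<in> carrier (P E E)" "x \<in> carrier (fobj F E)" for X x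
    using PiE_mem[OF that(1,3)] that(2,3) by (simp add: Phi_smult_eq_act[OF F] Phi_smult_eq_act[OF G])
  then show ?thesis
    unfolding lin_maps_def by (auto simp: Phi_simps Pn_End_simps)
qed

lemma nat_trans_at_E:
  assumes F: "numerical_into F" and G: "numerical_into G"
    and \<eta>: "\<eta> \<in> Transf F G"
  shows "\<eta> E \<in> lin_maps R (fobj (Phi B E) F) (fobj (Phi B E) G)"
proof -
  have l: "\<eta> E \<in> lin_maps B (fobj F E) (fobj G E)" using nat_trans_arr[OF \<eta> E_Ob] by simp
  then show ?thesis
    unfolding lin_maps_Phi_iff[OF F G]
    using lin_maps_add[OF l] act_natural[OF F G \<eta> E_Ob E_Ob] by (auto simp: lin_maps_def)
qed

lemma Phi_full_faithful:
  assumes F: "numerical_into F" and G: "numerical_into G"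
    and u: "u \<in> lin_maps R (fobj (Phi B E) F) (fobj (Phi B E) G)"
  shows "\<exists>!\<eta>. \<eta> \<in> Transf F G \<and> \<eta> E = u"
proof -
  note u' = u[unfolded lin_maps_Phi_iff[OF F G]]
  obtain \<eta> where "\<eta> \<in> Transf F G" "\<eta> E = u"
    using nat_trans_full[OF F G, of u] u' by blast
  then show ?thesis using nat_trans_faithful[OF F G] by blast
qed

lemma num_cat_obj: "F \<in> obj (num_cat B n) \<longleftrightarrow> numerical_into F"
  by (simp add: num_cat_simps numerical_functor_iff)

lemma Phi_functor: "is_functor (num_cat B n) (mod_cat R) (Phi B E)"
  unfolding is_functor_def
  by (intro conjI ballI category_num_cat category_mod_cat)
    (auto simp: num_cat_obj left_module_Phi num_cat_simps(2-) nat_trans_at_E Phi_simps E_Ob)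

lemma nat_trans_apply:
  assumes F: "numerical_into F" and G: "numerical_into G"
    and \<eta>: "\<eta> \<in> Transf F G"
    and M: "M \<in> Ob" and N: "N \<in> Ob" and \<chi>: "\<chi> \<in> lin_maps B M N" and x: "x \<in> carrier (fobj F M)"
  shows "\<eta> N (farr F M N \<chi> x) = farr G M N \<chi> (\<eta> M x)"
  using act_natural[OF F G \<eta> M N arrow_closed[OF Ob_left_module[OF M] Ob_left_module[OF N] \<chi>] x]
  by (simp add: act_arrow[OF F M N \<chi>] act_arrow[OF G M N \<chi>])

context
  fixes F G :: "('b, 'm) mod_functor"
  assumes F: "numerical_into F" and G: "numerical_into G"
begin

lemma nat_trans_pointwise:
  assumes t: "\<And>M. M \<in> Ob \<Longrightarrow> t M \<in> lin_maps B (fobj F M) (fobj G M)"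
    and nat: "\<And>M N \<chi> x. \<lbrakk>M \<in> Ob; N \<in> Ob; \<chi> \<in> lin_maps B M N; x \<in> carrier (fobj F M)\<rbrakk>
      \<Longrightarrow> t N (farr F M N \<chi> x) = farr G M N \<chi> (t M x)"
  shows "(\<lambda>M\<in>Ob. t M) \<in> Transf F G"
  by (rule nat_transI) (use t nat in \<open>auto simp: compose_def fun_eq_iff\<close>)

lemma nat_trans_add:
  assumes \<eta>: "\<eta> \<in> Transf F G"
    and \<theta>: "\<theta> \<in> Transf F G"
  shows "(\<lambda>M\<in>Ob. \<lambda>x\<in>carrier (fobj F M). \<eta> M x \<oplus>\<^bsub>fobj G M\<^esub> \<theta> M x)
    \<in> Transf F G"
proof (rule nat_trans_pointwise)
  fix M :: "('b, 'm) module" assume M: "M \<in> Ob"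
  interpret H: left_module B "Hom_mod B (fobj F M) (fobj G M)"
    by (rule left_module_Hom[OF B.is_cring value_left_module[OF F M] value_left_module[OF G M]])
  show "(\<lambda>x\<in>carrier (fobj F M). \<eta> M x \<oplus>\<^bsub>fobj G M\<^esub> \<theta> M x) \<in> lin_maps B (fobj F M) (fobj G M)"
    using H.M.a_closed[of "\<eta> M" "\<theta> M"] nat_trans_arr[OF \<eta> M] nat_trans_arr[OF \<theta> M] by simp
  fix N :: "('b, 'm) module" and \<chi> x assume N: "N \<in> Ob" and \<chi>: "\<chi> \<in> lin_maps B M N" and x: "x \<in> carrier (fobj F M)"
  have "\<eta> M x \<in> carrier (fobj G M)" "\<theta> M x \<in> carrier (fobj G M)"
    using nat_trans_arr[OF \<eta> M] nat_trans_arr[OF \<theta> M] x by (auto dest: lin_maps_closed)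
  then show "(\<lambda>x\<in>carrier (fobj F N). \<eta> N x \<oplus>\<^bsub>fobj G N\<^esub> \<theta> N x) (farr F M N \<chi> x)
      = farr G M N \<chi> ((\<lambda>x\<in>carrier (fobj F M). \<eta> M x \<oplus>\<^bsub>fobj G M\<^esub> \<theta> M x) x)"
    using x lin_maps_closed[OF value_arr[OF F M N \<chi>] x]
    by (simp add: nat_trans_apply[OF F G \<eta> M N \<chi> x] nat_trans_apply[OF F G \<theta> M N \<chi> x]
        lin_maps_add[OF value_arr[OF G M N \<chi>]])
qed

lemma nat_trans_smult:
  assumes r: "r \<in> carrier B" and \<eta>: "\<eta> \<in> Transf F G"
  shows "(\<lambda>M\<in>Ob. \<lambda>x\<in>carrier (fobj F M). r \<odot>\<^bsub>fobj G M\<^esub> \<eta> M x)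
    \<in> Transf F G"
proof (rule nat_trans_pointwise)
  fix M :: "('b, 'm) module" assume M: "M \<in> Ob"
  interpret H: left_module B "Hom_mod B (fobj F M) (fobj G M)"
    by (rule left_module_Hom[OF B.is_cring value_left_module[OF F M] value_left_module[OF G M]])
  show "(\<lambda>x\<in>carrier (fobj F M). r \<odot>\<^bsub>fobj G M\<^esub> \<eta> M x) \<in> lin_maps B (fobj F M) (fobj G M)"
    using H.smult_closed[OF r, of "\<eta> M"] nat_trans_arr[OF \<eta> M] by simp
  fix N :: "('b, 'm) module" and \<chi> x assume N: "N \<in> Ob" and \<chi>: "\<chi> \<in> lin_maps B M N" and x: "x \<in> carrier (fobj F M)"
  have "\<eta> M x \<in> carrier (fobj G M)"
    using nat_trans_arr[OF \<eta> M] x by (auto dest: lin_maps_closed)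
  then show "(\<lambda>x\<in>carrier (fobj F N). r \<odot>\<^bsub>fobj G N\<^esub> \<eta> N x) (farr F M N \<chi> x)
      = farr G M N \<chi> ((\<lambda>x\<in>carrier (fobj F M). r \<odot>\<^bsub>fobj G M\<^esub> \<eta> M x) x)"
    using x lin_maps_closed[OF value_arr[OF F M N \<chi>] x] r
    by (simp add: nat_trans_apply[OF F G \<eta> M N \<chi> x] lin_maps_smult[OF value_arr[OF G M N \<chi>]])
qed

lemma nat_trans_zero:
  "(\<lambda>M\<in>Ob. \<lambda>x\<in>carrier (fobj F M). \<zero>\<^bsub>fobj G M\<^esub>) \<in> Transf F G"
proof (rule nat_trans_pointwise)
  fix M :: "('b, 'm) module" assume M: "M \<in> Ob"
  interpret H: left_module B "Hom_mod B (fobj F M) (fobj G M)"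
    by (rule left_module_Hom[OF B.is_cring value_left_module[OF F M] value_left_module[OF G M]])
  show "(\<lambda>x\<in>carrier (fobj F M). \<zero>\<^bsub>fobj G M\<^esub>) \<in> lin_maps B (fobj F M) (fobj G M)"
    using H.M.zero_closed by simp
  fix N :: "('b, 'm) module" and \<chi> x assume N: "N \<in> Ob" and \<chi>: "\<chi> \<in> lin_maps B M N" and x: "x \<in> carrier (fobj F M)"
  show "(\<lambda>x\<in>carrier (fobj F N). \<zero>\<^bsub>fobj G N\<^esub>) (farr F M N \<chi> x)
      = farr G M N \<chi> ((\<lambda>x\<in>carrier (fobj F M). \<zero>\<^bsub>fobj G M\<^esub>) x)"
    using x lin_maps_closed[OF value_arr[OF F M N \<chi>] x]
      lin_maps_zero[OF value_left_module[OF G M] value_left_module[OF G N] value_arr[OF G M N \<chi>]] by simp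
qed

lemma Nat_mod_simps:
  "carrier (Nat_mod B n F G) = Transf F G"
  "zero (Nat_mod B n F G) = (\<lambda>M\<in>Ob. \<lambda>x\<in>carrier (fobj F M). \<zero>\<^bsub>fobj G M\<^esub>)"
  "add (Nat_mod B n F G) \<eta> \<theta> = (\<lambda>M\<in>Ob. \<lambda>x\<in>carrier (fobj F M). \<eta> M x \<oplus>\<^bsub>fobj G M\<^esub> \<theta> M x)"
  "smult (Nat_mod B n F G) r \<eta> = (\<lambda>M\<in>Ob. \<lambda>x\<in>carrier (fobj F M). r \<odot>\<^bsub>fobj G M\<^esub> \<eta> M x)"
  by (simp_all add: Nat_mod_def num_cat_simps)

end

context
  fixes j :: "('b, 'm) module \<Rightarrow> (('m \<Rightarrow> 'm) \<Rightarrow> 'b) set \<Rightarrow> 'm"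
  assumes j: "Pn_hom_embedding B n E j"
begin

abbreviation "Q' \<equiv> copy_functor j (Pn_hom B n E)"

private lemmas Q_num = Q_numerical[OF E_Ob j]
private lemmas Q_car = Q_carrier[OF E_Ob j]

lemma endo_apply:
  assumes "A \<in> carrier (P E E)"
  shows "Pn_hom_endo B n E j A E (j E (ident_arrow E)) = j E A"
  using assms E_Ob ident_E_closed
  by (simp add: Pn_hom_endo_def Q_car uncopy[OF E_Ob j E_Ob ident_E_closed]
      Pn_comp_ident_left[OF E_left_module E_left_module])

context
  fixes F :: "('b, 'm) mod_functor"
  assumes F: "numerical_into F"
begin

lemma yoneda_bij:
  "bij_betw (\<lambda>\<eta>. \<eta> E (j E (ident_arrow E))) (Transf Q' F) (carrier (fobj F E))"
proof (rule bij_betwI')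
  show "\<exists>\<eta>\<in>Transf Q' F. x = \<eta> E (j E (ident_arrow E))"
    if "x \<in> carrier (fobj F E)" for x
    using yoneda_surj[OF E_Ob j F that] by metis
qed (use yoneda_inj[OF E_Ob j F] yoneda_eval_closed[OF E_Ob j F] in blast)+

lemma eval_at_one_iso: "eval_at_one B n E j F \<in> mod_isos R (Nat_left B n E j F) (fobj (Phi B E) F)"
proof -
  let ?N = "Nat_left B n E j F" and ?one = "j E (ident_arrow E)"
  have c: "carrier ?N = Transf Q' F"
    by (simp add: Nat_left_def Let_def Nat_mod_def num_cat_simps)
  have a: "add ?N \<eta> \<theta> = (\<lambda>M\<in>Ob. \<lambda>x\<in>carrier (fobj Q' M). \<eta> M x \<oplus>\<^bsub>fobj F M\<^esub> \<theta> M x)" for \<eta> \<theta>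
    by (simp add: Nat_left_def Let_def Nat_mod_def)
  have s: "smult ?N A \<eta> = (\<lambda>M\<in>Ob. compose (carrier (fobj Q' M)) (\<eta> M) (Pn_hom_endo B n E j A M))" for A \<eta>
    by (simp add: Nat_left_def Let_def num_cat_simps)
  have one: "?one \<in> carrier (fobj Q' E)" using ident_E_closed by (simp add: Q_car)
  have ev: "eval_at_one B n E j F = (\<lambda>\<eta>\<in>carrier ?N. \<eta> E ?one)"
    by (simp add: eval_at_one_def Pn_End_simps)
  have s_closed: "smult ?N A \<eta> \<in> carrier ?N" "smult ?N A \<eta> E ?one = Phi_smult B E F A (\<eta> E ?one)"
    if A: "A \<in> carrier (P E E)" and \<eta>: "\<eta> \<in> carrier ?N" for A \<eta>
  proof -
    show "smult ?N A \<eta> E ?one = Phi_smult B E F A (\<eta> E ?one)"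
      using \<eta> yoneda_eval[OF E_Ob j F _ E_Ob A, of \<eta>] yoneda_eval_closed[OF E_Ob j F, of \<eta>] A one E_Ob
      by (simp add: s c compose_eq endo_apply Phi_smult_eq_act[OF F])
    show "smult ?N A \<eta> \<in> carrier ?N"
    proof -
      obtain \<theta> where t: "\<theta> \<in> Transf Q' F"
          "\<theta> E ?one = act F E E A (\<eta> E ?one)"
        using yoneda_surj[OF E_Ob j F act_closed[OF F E_Ob E_Ob A yoneda_eval_closed[OF E_Ob j F]]] \<eta> c by blast
      have "smult ?N A \<eta> = \<theta>"
      proof (rule extensionalityI[OF _ nat_trans_extensional[OF t(1)]])
        fix M :: "('b, 'm) module" assume M: "M \<in> Ob"
        show "smult ?N A \<eta> M = \<theta> M"
        proof (rule extensionalityI[of _ "carrier (fobj Q' M)"])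
          show "\<theta> M \<in> extensional (carrier (fobj Q' M))"
            using nat_trans_arr[OF t(1) M] lin_maps_extensional by simp
          fix y assume y: "y \<in> carrier (fobj Q' M)"
          then obtain X where X: "X \<in> carrier (P E M)" "y = j M X" by (auto simp: Q_car)
          note XA = Pn_comp_closed[OF E_left_module E_left_module Ob_left_module[OF M] X(1) A]
          have "smult ?N A \<eta> M y = \<eta> M (j M (Pn_comp B n E M X A))"
            using X y M by (simp add: s compose_eq Pn_hom_endo_def uncopy[OF E_Ob j])
          also have "\<dots> = act F E M X (act F E E A (\<eta> E ?one))"
            using yoneda_eval[OF E_Ob j F _ M XA, of \<eta>] \<eta>
              act_comp[OF F E_Ob E_Ob M X(1) A yoneda_eval_closed[OF E_Ob j F]] by (simp add: c)
          also have "\<dots> = \<theta> M y"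
            using yoneda_eval[OF E_Ob j F t(1) M X(1)] t(2) X(2) by simp
          finally show "smult ?N A \<eta> M y = \<theta> M y" .
        qed (use M in \<open>simp add: s compose_def\<close>)
      qed (simp add: s)
      then show ?thesis using t(1) c by simp
    qed
  qed
  have a_closed: "add ?N \<eta> \<theta> \<in> carrier ?N" "add ?N \<eta> \<theta> E ?one = \<eta> E ?one \<oplus>\<^bsub>fobj F E\<^esub> \<theta> E ?one"
    if \<eta>: "\<eta> \<in> carrier ?N" and \<theta>: "\<theta> \<in> carrier ?N" for \<eta> \<theta>
  proof -
    have n: "\<eta> \<in> Transf Q' F" "\<theta> \<in> Transf Q' F"
      using \<eta> \<theta> c by simp_all
    show "add ?N \<eta> \<theta> E ?one = \<eta> E ?one \<oplus>\<^bsub>fobj F E\<^esub> \<theta> E ?one"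
      using one E_Ob by (simp add: a)
    show "add ?N \<eta> \<theta> \<in> carrier ?N" unfolding a c by (rule nat_trans_add[OF Q_num F n])
  qed
  have b: "bij_betw (\<lambda>\<eta>\<in>carrier ?N. \<eta> E ?one) (carrier ?N) (carrier (fobj F E))"
    using yoneda_bij unfolding c by (subst bij_betw_cong[of _ _ "\<lambda>\<eta>. \<eta> E ?one"]) simp_all
  have "(\<lambda>\<eta>\<in>carrier ?N. \<eta> E ?one) \<in> lin_maps R ?N (fobj (Phi B E) F)"
  proof (rule lin_mapsI)
    show "(\<lambda>\<eta>\<in>carrier ?N. \<eta> E ?one) \<in> carrier ?N \<rightarrow> carrier (fobj (Phi B E) F)"
      using bij_betwE[OF b] by (simp add: Phi_simps)
  qed (simp_all add: s_closed a_closed Phi_simps Pn_End_simps)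
  then show ?thesis
    using b unfolding mod_isos_def ev by (simp add: Phi_simps)
qed

text \<open>Evaluation at \<open>[1]\<close> embeds natural transformations into \<open>F(E)\<close>.\<close>

lemma left_module_Nat: "left_module B (Nat_mod B n Q' F)"
proof (rule left_module_by_embedding[OF value_left_module[OF F E_Ob],
      where f = "\<lambda>\<eta>. \<eta> E (j E (ident_arrow E))"])
  note s = Nat_mod_simps[OF Q_num F]
  have one: "j E (ident_arrow E) \<in> carrier (fobj Q' E)" using ident_E_closed by (simp add: Q_car)
  show "(\<lambda>\<eta>. \<eta> E (j E (ident_arrow E))) \<in> carrier (Nat_mod B n Q' F) \<rightarrow> carrier (fobj F E)"
    using bij_betwE[OF yoneda_bij] by (simp add: s)
  show "inj_on (\<lambda>\<eta>. \<eta> E (j E (ident_arrow E))) (carrier (Nat_mod B n Q' F))"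
    using bij_betw_imp_inj_on[OF yoneda_bij] by (simp add: s)
qed (use imageI[OF ident_E_closed, of "j E"] E_Ob in \<open>simp_all add: Nat_mod_simps[OF Q_num F] Q_car[symmetric]
    nat_trans_zero[OF Q_num F] nat_trans_add[OF Q_num F] nat_trans_smult[OF Q_num F]\<close>)

end

text \<open>Under evaluation at \<open>[1]\<close> the maps in question become the components \<open>\<iota> i E\<close>, which form a direct
  sum because direct sums of functors are pointwise.\<close>

lemma Q_small: "small_object TYPE('i) B n Q'"
  unfolding small_object_def
proof (intro conjI allI impI)
  show "Q' \<in> obj (num_cat B n)" by (simp add: num_cat_obj Q_num)
  fix I :: "'i set" and F :: "'i \<Rightarrow> ('b, 'm) mod_functor" and S :: "('b, 'm) mod_functor" and \<iota>
  assume as: "(\<forall>i\<in>I. F i \<in> obj (num_cat B n)) \<and> S \<in> obj (num_cat B n) \<and>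
      (\<forall>i\<in>I. \<iota> i \<in> arr (num_cat B n) (F i) S) \<and>
      (\<forall>M\<in>Ob. is_direct_sum B I (\<lambda>i. fobj (F i) M) (\<lambda>i. \<iota> i M) (fobj S M))"
  have F: "numerical_into (F i)" if "i \<in> I" for i using as that by (simp add: num_cat_obj)
  have S: "numerical_into S" using as by (simp add: num_cat_obj)
  have \<iota>: "\<iota> i \<in> Transf (F i) S" if "i \<in> I" for i
    using as that by (simp add: num_cat_simps)
  let ?one = "j E (ident_arrow E)"
  have one: "?one \<in> carrier (fobj Q' E)" using ident_E_closed by (simp add: Q_car)
  let ?\<kappa> = "\<lambda>i. \<lambda>\<eta>\<in>arr (num_cat B n) Q' (F i). cmp (num_cat B n) Q' (F i) S (\<iota> i) \<eta>"
  show "is_direct_sum B I (\<lambda>i. Nat_mod B n Q' (F i)) ?\<kappa> (Nat_mod B n Q' S)"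
  proof (rule is_direct_sum_transport[where X = "\<lambda>i. fobj (F i) E" and S = "fobj S E" and \<iota> = "\<lambda>i. \<iota> i E"
        and f = "\<lambda>i \<eta>. \<eta> E ?one" and g = "\<lambda>\<eta>. \<eta> E ?one"])
    show "abelian_group (fobj S E)"
      by (rule abelian_group_left_module[OF value_left_module[OF S E_Ob]])
    show "abelian_group (Nat_mod B n Q' S)"
      by (rule abelian_group_left_module[OF left_module_Nat[OF S]])
    show "is_direct_sum B I (\<lambda>i. fobj (F i) E) (\<lambda>i. \<iota> i E) (fobj S E)" using as E_Ob by blast
    show "bij_betw (\<lambda>\<eta>. \<eta> E ?one) (carrier (Nat_mod B n Q' S)) (carrier (fobj S E))"
      using yoneda_bij[OF S] by (simp add: Nat_mod_simps[OF Q_num S])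
    show "(\<eta> \<oplus>\<^bsub>Nat_mod B n Q' S\<^esub> \<theta>) E ?one = \<eta> E ?one \<oplus>\<^bsub>fobj S E\<^esub> \<theta> E ?one" for \<eta> \<theta>
      using one E_Ob by (simp add: Nat_mod_simps[OF Q_num S])
    fix i assume i: "i \<in> I"
    note sF = Nat_mod_simps[OF Q_num F[OF i]] and sS = Nat_mod_simps[OF Q_num S]
    show "bij_betw (\<lambda>\<eta>. \<eta> E ?one) (carrier (Nat_mod B n Q' (F i))) (carrier (fobj (F i) E))"
      using yoneda_bij[OF F[OF i]] by (simp add: sF)
    show "\<zero>\<^bsub>Nat_mod B n Q' (F i)\<^esub> \<in> carrier (Nat_mod B n Q' (F i)) \<and>
        \<zero>\<^bsub>Nat_mod B n Q' (F i)\<^esub> E ?one = \<zero>\<^bsub>fobj (F i) E\<^esub>"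
      using one E_Ob by (simp add: sF nat_trans_zero[OF Q_num F[OF i]])
    show "?\<kappa> i \<eta> E ?one = \<iota> i E (\<eta> E ?one)" if "\<eta> \<in> carrier (Nat_mod B n Q' (F i))" for \<eta>
      using that one E_Ob by (simp add: sF num_cat_simps compose_eq)
    note N = left_module_Nat[OF F[OF i]]
    interpret N: left_module B "Nat_mod B n Q' (F i)" by (rule N)
    have \<iota>M: "\<iota> i M \<in> lin_maps B (fobj (F i) M) (fobj S M)" if "M \<in> Ob" for M
      using nat_trans_arr[OF \<iota>[OF i] that] by simp
    have \<eta>M: "\<eta> M x \<in> carrier (fobj (F i) M)"
      if "\<eta> \<in> Transf Q' (F i)" "M \<in> Ob" "x \<in> carrier (fobj Q' M)" for \<eta> M x
      using nat_trans_arr[OF that(1,2)] that(3) by (auto dest: lin_maps_closed)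
    have car: "arr (num_cat B n) Q' (F i) = carrier (Nat_mod B n Q' (F i))"
      by (simp add: sF num_cat_simps)
    show "?\<kappa> i \<in> lin_maps B (Nat_mod B n Q' (F i)) (Nat_mod B n Q' S)"
      unfolding car
    proof (rule lin_maps_restrictI[OF N])
      fix \<eta> \<theta> r assume "\<eta> \<in> carrier (Nat_mod B n Q' (F i))"
      then have \<eta>: "\<eta> \<in> Transf Q' (F i)" by (simp add: sF)
      show "cmp (num_cat B n) Q' (F i) S (\<iota> i) \<eta> \<in> carrier (Nat_mod B n Q' S)"
        using category.cmp_arr[OF category_num_cat, of Q' B n "F i" S \<eta> "\<iota> i"] \<eta> \<iota>[OF i] Q_num F[OF i] S
        by (simp add: num_cat_obj num_cat_simps(2) sS)
      show "cmp (num_cat B n) Q' (F i) S (\<iota> i) (\<eta> \<oplus>\<^bsub>Nat_mod B n Q' (F i)\<^esub> \<theta>)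
          = cmp (num_cat B n) Q' (F i) S (\<iota> i) \<eta> \<oplus>\<^bsub>Nat_mod B n Q' S\<^esub> cmp (num_cat B n) Q' (F i) S (\<iota> i) \<theta>"
        if "\<theta> \<in> carrier (Nat_mod B n Q' (F i))"
        using that \<eta> by (auto simp: sF sS num_cat_simps(3) compose_def fun_eq_iff \<eta>M lin_maps_add[OF \<iota>M])
      show "cmp (num_cat B n) Q' (F i) S (\<iota> i) (r \<odot>\<^bsub>Nat_mod B n Q' (F i)\<^esub> \<eta>)
          = r \<odot>\<^bsub>Nat_mod B n Q' S\<^esub> cmp (num_cat B n) Q' (F i) S (\<iota> i) \<eta>" if "r \<in> carrier B"
        using that \<eta> by (auto simp: sF sS num_cat_simps(3) compose_def fun_eq_iff \<eta>M lin_maps_smult[OF \<iota>M])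
    qed
  qed
qed

lemma Q_generator: "generator_object (num_cat B n) Q'"
  unfolding generator_object_def
proof (intro conjI ballI impI)
  show "Q' \<in> obj (num_cat B n)" by (simp add: num_cat_obj Q_num)
  fix X Y :: "('b, 'm) mod_functor" and f g assume X: "X \<in> obj (num_cat B n)" and Y: "Y \<in> obj (num_cat B n)"
    and "f \<in> arr (num_cat B n) X Y" "g \<in> arr (num_cat B n) X Y" and "f \<noteq> g"
  then have nX: "numerical_into X" and nY: "numerical_into Y"
    and f: "f \<in> Transf X Y" and g: "g \<in> Transf X Y"
    by (simp_all add: num_cat_obj num_cat_simps(2))
  have "f E \<noteq> g E" using nat_trans_faithful[OF nX nY f g] \<open>f \<noteq> g\<close> by blast
  then obtain x where x: "x \<in> carrier (fobj X E)" "f E x \<noteq> g E x"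
    using lin_maps_eqI[of "f E" B "fobj X E" "fobj Y E" "g E"] nat_trans_arr[OF f E_Ob] nat_trans_arr[OF g E_Ob]
    by auto
  obtain h where h: "h \<in> Transf Q' X" "h E (j E (ident_arrow E)) = x"
    using yoneda_surj[OF E_Ob j nX x(1)] by blast
  have one: "j E (ident_arrow E) \<in> carrier (fobj Q' E)" using ident_E_closed by (simp add: Q_car)
  have "cmp (num_cat B n) Q' X Y f h E (j E (ident_arrow E)) \<noteq> cmp (num_cat B n) Q' X Y g h E (j E (ident_arrow E))"
    using h(2) x(2) one E_Ob by (simp add: num_cat_simps(3) compose_eq)
  then show "\<exists>h\<in>arr (num_cat B n) Q' X. cmp (num_cat B n) Q' X Y f h \<noteq> cmp (num_cat B n) Q' X Y g h"
    using h(1) by (intro bexI[of _ h]) (auto simp: num_cat_simps(2))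
qed

lemma Q_projective:
  assumes epi: "\<And>X Y p. epi_arrow (num_cat B n) X Y p \<Longrightarrow> X \<in> obj (num_cat B n)
      \<Longrightarrow> Y \<in> obj (num_cat B n) \<Longrightarrow> p E ` carrier (fobj X E) = carrier (fobj Y E)"
  shows "projective_object (num_cat B n) Q'"
  unfolding projective_object_def
proof (intro conjI ballI allI impI)
  show Q: "Q' \<in> obj (num_cat B n)" by (simp add: num_cat_obj Q_num)
  fix X Y :: "('b, 'm) mod_functor" and p g assume X: "X \<in> obj (num_cat B n)" and Y: "Y \<in> obj (num_cat B n)"
    and p: "epi_arrow (num_cat B n) X Y p" and "g \<in> arr (num_cat B n) Q' Y"
  then have nX: "numerical_into X" and nY: "numerical_into Y"
    and g: "g \<in> Transf Q' Y"
    by (simp_all add: num_cat_obj num_cat_simps(2))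
  have one: "j E (ident_arrow E) \<in> carrier (fobj Q' E)" using ident_E_closed by (simp add: Q_car)
  have "g E (j E (ident_arrow E)) \<in> p E ` carrier (fobj X E)"
    unfolding epi[OF p X Y] by (rule yoneda_eval_closed[OF E_Ob j nY g])
  then obtain x where x: "x \<in> carrier (fobj X E)" "g E (j E (ident_arrow E)) = p E x" by blast
  obtain h where h: "h \<in> Transf Q' X" "h E (j E (ident_arrow E)) = x"
    using yoneda_surj[OF E_Ob j nX x(1)] by blast
  have "cmp (num_cat B n) Q' X Y p h = g"
  proof (rule yoneda_inj[OF E_Ob j nY _ g])
    show "cmp (num_cat B n) Q' X Y p h \<in> Transf Q' Y"
      using category.cmp_arr[OF category_num_cat Q X Y, of h p] h(1) p
      by (simp add: epi_arrow_def num_cat_simps(2))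
    show "cmp (num_cat B n) Q' X Y p h E (j E (ident_arrow E)) = g E (j E (ident_arrow E))"
      using h(2) x(2) one E_Ob by (simp add: num_cat_simps(3) compose_eq)
  qed
  then show "\<exists>h\<in>arr (num_cat B n) Q' X. cmp (num_cat B n) Q' X Y p h = g"
    using h(1) by (intro bexI[of _ h]) (auto simp: num_cat_simps(2))
qed

end
end

section \<open>Room in the universe\<close>

text \<open>An infinite set is in bijection with its square; lists are nested pairs.\<close>

lemma inj_list_into_infinite:
  assumes "infinite (UNIV :: 'a set)"
  shows "\<exists>c :: 'a list \<Rightarrow> 'a. inj c"
proof -
  have "(card_of (UNIV \<times> UNIV :: ('a \<times> 'a) set), card_of (UNIV :: 'a set)) \<in> ordIso"
    by (rule card_of_Times_same_infinite[OF assms])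
  then obtain p :: "'a \<times> 'a \<Rightarrow> 'a" where "bij_betw p (UNIV \<times> UNIV) UNIV"
    unfolding card_of_ordIso[symmetric] by blast
  from bij_betw_imp_inj_on[OF this] have "inj p" by (simp only: UNIV_Times_UNIV)
  note p = inj_eq[OF this]
  have "\<exists>b. b \<notin> {undefined :: 'a}"
    by (rule ex_new_if_finite[OF assms]) simp
  then obtain a b :: 'a where ab: "a \<noteq> b" by auto
  \<comment> \<open>the first component of the outer pair tells the empty list from the others\<close>
  define c where "c xs = foldr (\<lambda>x r. p (b, p (x, r))) xs (p (a, a))" for xs
  have "c xs = c ys \<Longrightarrow> xs = ys" for xs ys
  proof (induct xs arbitrary: ys)
    case Nil
    then show ?case using ab by (cases ys) (auto simp: c_def p)
  next
    case (Cons x xs)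
    then show ?case using ab by (cases ys) (auto simp: c_def p)
  qed
  then show ?thesis by (auto simp: inj_def)
qed

context standard_free
begin

text \<open>The multiples of \<open>1\<close> are distinct, as \<open>B\<close> is torsion-free.\<close>

lemma infinite_universe:
  assumes "\<one>\<^bsub>B\<^esub> \<noteq> \<zero>\<^bsub>B\<^esub>"
  shows "infinite (UNIV :: 'm set)"
proof -
  let ?v = "\<lambda>k::nat. \<lambda>i\<in>{..<1::nat}. [k] \<cdot>\<^bsub>B\<^esub> \<one>\<^bsub>B\<^esub>"
  have lt: "[k] \<cdot>\<^bsub>B\<^esub> \<one>\<^bsub>B\<^esub> \<noteq> [l] \<cdot>\<^bsub>B\<^esub> \<one>\<^bsub>B\<^esub>" if "k < l" for k l :: nat
  proof
    assume eq: "[k] \<cdot>\<^bsub>B\<^esub> \<one>\<^bsub>B\<^esub> = [l] \<cdot>\<^bsub>B\<^esub> \<one>\<^bsub>B\<^esub>"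
    have "[l] \<cdot>\<^bsub>B\<^esub> \<one>\<^bsub>B\<^esub> = [k] \<cdot>\<^bsub>B\<^esub> \<one>\<^bsub>B\<^esub> \<oplus>\<^bsub>B\<^esub> [(l - k)] \<cdot>\<^bsub>B\<^esub> \<one>\<^bsub>B\<^esub>"
      using that by (simp add: B.add.nat_pow_mult)
    then have z: "[(l - k)] \<cdot>\<^bsub>B\<^esub> \<one>\<^bsub>B\<^esub> = \<zero>\<^bsub>B\<^esub>"
      unfolding eq[symmetric] by (subst (asm) B.add.l_cancel_one') simp_all
    have tf: "\<forall>k::nat. \<forall>r \<in> carrier B. 0 < k \<longrightarrow> [k] \<cdot>\<^bsub>B\<^esub> r = \<zero>\<^bsub>B\<^esub> \<longrightarrow> r = \<zero>\<^bsub>B\<^esub>"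
      using binomial by (simp add: binomial_ring_def)
    show False
      using tf[THEN spec, of "l - k", THEN bspec, OF B.one_closed] z that assms by simp
  qed
  have "inj (\<lambda>k. e 1 (?v k))"
  proof (rule injI)
    fix k l assume "e 1 (?v k) = e 1 (?v l)"
    then have "?v k = ?v l"
      by (rule inj_onD[OF universe]) auto
    from fun_cong[OF this, of 0] have "[k] \<cdot>\<^bsub>B\<^esub> \<one>\<^bsub>B\<^esub> = [l] \<cdot>\<^bsub>B\<^esub> \<one>\<^bsub>B\<^esub>" by simp
    then show "k = l" using lt[of k l] lt[of l k] by (metis linorder_neqE_nat)
  qed
  then show ?thesis using finite_imageD[of "\<lambda>k. e 1 (?v k)" UNIV] by (metis finite_subset infinite_UNIV_nat subset_UNIV)
qed

text \<open>Over the zero ring every module has a single element.\<close>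

lemma embeds_in_universe:
  fixes V :: "('b, 'v) module" and f :: "'v \<Rightarrow> 'm list"
  assumes V: "left_module B V" and f: "\<one>\<^bsub>B\<^esub> \<noteq> \<zero>\<^bsub>B\<^esub> \<Longrightarrow> inj_on f (carrier V)"
  shows "\<exists>h :: 'v \<Rightarrow> 'm. inj_on h (carrier V)"
proof (cases "\<one>\<^bsub>B\<^esub> = \<zero>\<^bsub>B\<^esub>")
  case True
  interpret V: left_module B V by fact
  have "x = \<zero>\<^bsub>V\<^esub>" if "x \<in> carrier V" for x
    using V.smult_one[OF that] V.smult_l_null[OF that] True by simp
  then show ?thesis by (intro exI) (auto intro: inj_onI)
next
  case False
  then obtain c :: "'m list \<Rightarrow> 'm" where "inj c"
    using inj_list_into_infinite[OF infinite_universe] by blast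
  then have "inj_on (c \<circ> f) (carrier V)"
    using f[OF False] by (intro comp_inj_on) (auto intro: inj_on_subset)
  then show ?thesis by blast
qed

text \<open>An element of \<open>P\<^sub>n(Hom(E, M))\<close> has a representative with finite support, each \<open>\<alpha>\<close> in the
  support is given by its values on a basis of \<open>E\<close>, and coefficients are rank one vectors. The module
  need not be finitely generated, so a finite list of coordinates would not do: over a field of
  characteristic 0, each derivation \<open>D\<close> gives a numerical map \<open>(a, b) \<mapsto> D(a) b - a D(b)\<close> of degree 2,
  and the derivations can have infinite dimension.\<close>

lemma Pn_hom_embedding_exists: "\<exists>j. Pn_hom_embedding B n E j"
proof -
  have "\<exists>h :: (('m \<Rightarrow> 'm) \<Rightarrow> 'b) set \<Rightarrow> 'm. inj_on h (carrier (P E M))" if M: "M \<in> Ob" for M :: "('b, 'm) module"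
  proof -
    note lM = Ob_left_module[OF M] and H = left_module_Hom[OF B.is_cring E_left_module Ob_left_module[OF M]]
    obtain S c where S: "finite S" "S \<subseteq> carrier E"
      and cc: "\<And>s x. \<lbrakk>s \<in> S; x \<in> carrier E\<rbrakk> \<Longrightarrow> c s x \<in> carrier B"
      and expand: "\<And>x. x \<in> carrier E \<Longrightarrow> x = (\<Oplus>\<^bsub>E\<^esub>s\<in>S. c s x \<odot>\<^bsub>E\<^esub> s)"
      by (rule fg_free_coordinates[OF B.is_cring E_left_module E_fg_free]) (rule that)
    interpret E: left_module B E by (rule E_left_module)
    interpret M: left_module B M by (rule lM)
    obtain bs where bs: "set bs = S" using finite_list[OF S(1)] by blast
    have hom_eq: "\<alpha> = \<beta>" if a: "\<alpha> \<in> lin_maps B E M" and b: "\<beta> \<in> lin_maps B E M"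
        and eq: "map \<alpha> bs = map \<beta> bs" for \<alpha> \<beta>
    proof (rule lin_maps_eqI[OF a b])
      fix x assume x: "x \<in> carrier E"
      have t: "(\<lambda>s. c s x \<odot>\<^bsub>E\<^esub> s) \<in> S \<rightarrow> carrier E" using cc x S(2) by (auto intro!: E.smult_closed)
      have v: "\<gamma> x = (\<Oplus>\<^bsub>M\<^esub>s\<in>S. c s x \<odot>\<^bsub>M\<^esub> \<gamma> s)" if g: "\<gamma> \<in> lin_maps B E M" for \<gamma>
      proof -
        have "\<gamma> x = \<gamma> (\<Oplus>\<^bsub>E\<^esub>s\<in>S. c s x \<odot>\<^bsub>E\<^esub> s)" using expand[OF x] by simp
        also have "\<dots> = (\<Oplus>\<^bsub>M\<^esub>s\<in>S. \<gamma> (c s x \<odot>\<^bsub>E\<^esub> s))"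
          by (rule lin_maps_finsum[OF E_left_module lM g t])
        also have "\<dots> = (\<Oplus>\<^bsub>M\<^esub>s\<in>S. c s x \<odot>\<^bsub>M\<^esub> \<gamma> s)"
          using cc x S(2) by (intro M.M.finsum_cong'[OF refl])
            (auto intro!: M.smult_closed lin_maps_closed[OF g] lin_maps_smult[OF g])
        finally show ?thesis .
      qed
      have "\<alpha> s = \<beta> s" if "s \<in> S" for s using eq that bs by (auto simp: map_eq_conv)
      then show "\<alpha> x = \<beta> x"
        unfolding v[OF a] v[OF b] using cc x S(2)
        by (intro M.M.finsum_cong'[OF refl]) (auto intro!: M.smult_closed lin_maps_closed[OF b])
    qed
    define code :: "('m \<Rightarrow> 'm) \<Rightarrow> 'b \<Rightarrow> 'm list" where
      "code \<alpha> r = e 1 (\<lambda>i\<in>{..<1}. r) # map \<alpha> bs" for \<alpha> r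
    have code: "\<alpha> = \<beta> \<and> r = s" if "code \<alpha> r = code \<beta> s" "\<alpha> \<in> lin_maps B E M" "\<beta> \<in> lin_maps B E M"
        "r \<in> carrier B" "s \<in> carrier B" for \<alpha> \<beta> r s
    proof
      show "\<alpha> = \<beta>" using that(1) by (intro hom_eq that(2,3)) (simp add: code_def)
      have "e 1 (\<lambda>i\<in>{..<1}. r) = e 1 (\<lambda>i\<in>{..<1}. s)" using that(1) by (simp add: code_def)
      then have "(\<lambda>i\<in>{..<1::nat}. r) = (\<lambda>i\<in>{..<1}. s)"
        by (rule inj_onD[OF universe]) (use that(4,5) in auto)
      from fun_cong[OF this, of 0] show "r = s" by simp
    qed
    define rep :: "(('m \<Rightarrow> 'm) \<Rightarrow> 'b) set \<Rightarrow> ('m \<Rightarrow> 'm) \<Rightarrow> 'b" where "rep X = (SOME f. f \<in> X)" for X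
    have rep: "rep X \<in> X" if "X \<in> carrier (P E M)" for X
      unfolding rep_def by (rule someI_ex[OF Pn_nonempty[OF H that]])
    define sl where "sl f = (SOME xs. set xs = supp B f)" for f :: "('m \<Rightarrow> 'm) \<Rightarrow> 'b"
    show ?thesis
    proof (cases "\<one>\<^bsub>B\<^esub> = \<zero>\<^bsub>B\<^esub>")
      case True
      then show ?thesis by (intro embeds_in_universe[OF left_module_P[OF E_Ob M], of "\<lambda>_. []"]) simp
    next
      case False
      then obtain d :: "'m list \<Rightarrow> 'm" where d: "inj d"
        using inj_list_into_infinite[OF infinite_universe] by blast
      have "inj_on (\<lambda>X. map (\<lambda>\<alpha>. d (code \<alpha> (rep X \<alpha>))) (sl (rep X))) (carrier (P E M))"
      proof (rule inj_onI)
        fix X Y assume X: "X \<in> carrier (P E M)" and Y: "Y \<in> carrier (P E M)"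
          and eq: "map (\<lambda>\<alpha>. d (code \<alpha> (rep X \<alpha>))) (sl (rep X)) = map (\<lambda>\<alpha>. d (code \<alpha> (rep Y \<alpha>))) (sl (rep Y))"
        have fF: "rep Z \<in> carrier (free_alg B (Hom_mod B E M))" if "Z \<in> carrier (P E M)" for Z
          by (rule Pn_mem_free_alg[OF H that rep[OF that]])
        have sl: "set (sl (rep Z)) = supp B (rep Z)" if "Z \<in> carrier (P E M)" for Z
          unfolding sl_def by (rule someI_ex) (rule finite_list, use fF[OF that] in \<open>simp add: free_alg_simps\<close>)
        have im: "(\<lambda>\<alpha>. d (code \<alpha> (rep X \<alpha>))) ` supp B (rep X) = (\<lambda>\<alpha>. d (code \<alpha> (rep Y \<alpha>))) ` supp B (rep Y)"
          using arg_cong[OF eq, of set] by (simp add: sl X Y)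
        have sub: "rep V \<alpha> = rep W \<alpha>" if V: "V \<in> carrier (P E M)" and W: "W \<in> carrier (P E M)"
            and im: "(\<lambda>\<alpha>. d (code \<alpha> (rep V \<alpha>))) ` supp B (rep V) = (\<lambda>\<alpha>. d (code \<alpha> (rep W \<alpha>))) ` supp B (rep W)"
            and \<alpha>: "\<alpha> \<in> supp B (rep V)" for V W \<alpha>
        proof -
          have "d (code \<alpha> (rep V \<alpha>)) \<in> (\<lambda>\<alpha>. d (code \<alpha> (rep W \<alpha>))) ` supp B (rep W)"
            using im \<alpha> by blast
          then obtain \<beta> where b: "\<beta> \<in> supp B (rep W)" "d (code \<alpha> (rep V \<alpha>)) = d (code \<beta> (rep W \<beta>))" by blast
          then have "code \<alpha> (rep V \<alpha>) = code \<beta> (rep W \<beta>)" using d by (simp add: inj_eq)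
          then have "\<alpha> = \<beta> \<and> rep V \<alpha> = rep W \<beta>"
            by (rule code) (use \<alpha> b(1) fF[OF V] fF[OF W] in \<open>auto simp: free_alg_simps\<close>)
          then show ?thesis by metis
        qed
        have "rep X = rep Y"
        proof
          fix \<alpha>
          consider "\<alpha> \<in> supp B (rep X)" | "\<alpha> \<in> supp B (rep Y)"
            | "rep X \<alpha> = \<zero>\<^bsub>B\<^esub>" "rep Y \<alpha> = \<zero>\<^bsub>B\<^esub>" unfolding supp_def by blast
          then show "rep X \<alpha> = rep Y \<alpha>"
          proof cases
            case 1
            then show ?thesis by (rule sub[OF X Y im])
          next
            case 2
            then show ?thesis by (rule sub[OF Y X im[symmetric], symmetric])
          qed simp
        qed
        then show "X = Y" using Pn_mem_coset[OF H X rep[OF X]] Pn_mem_coset[OF H Y rep[OF Y]] by simp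
      qed
      then show ?thesis by (intro embeds_in_universe[OF left_module_P[OF E_Ob M]])
    qed
  qed
  then have "\<forall>M \<in> Ob. \<exists>h :: (('m \<Rightarrow> 'm) \<Rightarrow> 'b) set \<Rightarrow> 'm. inj_on h (carrier (P E M))" by blast
  then obtain j :: "('b, 'm) module \<Rightarrow> (('m \<Rightarrow> 'm) \<Rightarrow> 'b) set \<Rightarrow> 'm"
    where "\<forall>M \<in> Ob. inj_on (j M) (carrier (P E M))" by (rule bchoice[THEN exE])
  then show ?thesis unfolding Pn_hom_embedding_def by (auto simp: Pn_hom_def)
qed


section \<open>Essential surjectivity\<close>

context
  fixes A :: "((('m \<Rightarrow> 'm) \<Rightarrow> 'b) set, 'm) module"
  assumes A: "left_module R A"
begin

interpretation A: left_module R A by (rule A)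
interpretation EE: left_module B "P E E" by (rule left_module_P[OF E_Ob E_Ob])


text \<open>\<open>A\<close> as a module over \<open>B\<close>, which maps to the centre of \<open>R\<close> by \<open>r \<mapsto> r [1]\<close>.\<close>

definition restricted_scalars :: "('b, 'm) module" where
  "restricted_scalars = plain_module (carrier A) \<zero>\<^bsub>A\<^esub> (add A)
     (\<lambda>r a. (r \<odot>\<^bsub>P E E\<^esub> ident_arrow E) \<odot>\<^bsub>A\<^esub> a)"

lemma scalar_in_R: "r \<in> carrier B \<Longrightarrow> r \<odot>\<^bsub>P E E\<^esub> ident_arrow E \<in> carrier R"
  by (simp add: Pn_End_simps EE.smult_closed ident_E_closed)

lemma scalar_comp:
  assumes M: "M \<in> Ob" and r: "r \<in> carrier B" and Y: "Y \<in> carrier (P M E)"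
  shows "Pn_comp B n M E (r \<odot>\<^bsub>P E E\<^esub> ident_arrow E) Y = r \<odot>\<^bsub>P M E\<^esub> Y"
  by (simp add: Pn_comp_smult_left[OF Ob_left_module[OF M] E_left_module E_left_module Y r ident_E_closed]
      Pn_comp_ident_left[OF Ob_left_module[OF M] E_left_module Y])

lemma comp_scalar:
  assumes r: "r \<in> carrier B" and X: "X \<in> carrier (P E E)"
  shows "Pn_comp B n E E X (r \<odot>\<^bsub>P E E\<^esub> ident_arrow E) = r \<odot>\<^bsub>P E E\<^esub> X"
  by (simp add: Pn_comp_smult_right[OF E_left_module E_left_module E_left_module X r ident_E_closed]
      Pn_comp_ident_right[OF E_left_module E_left_module X])

lemma left_module_restricted: "left_module B restricted_scalars"
proof -
  have "abelian_group restricted_scalars"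
  proof (rule abelian_groupI)
    fix x assume "x \<in> carrier restricted_scalars"
    then show "\<exists>y\<in>carrier restricted_scalars. y \<oplus>\<^bsub>restricted_scalars\<^esub> x = \<zero>\<^bsub>restricted_scalars\<^esub>"
      using A.M.l_neg A.M.a_inv_closed unfolding restricted_scalars_def plain_module_simps by blast
  qed (simp_all add: restricted_scalars_def A.M.a_ac)
  moreover have "((a \<oplus>\<^bsub>B\<^esub> b) \<odot>\<^bsub>P E E\<^esub> ident_arrow E) \<odot>\<^bsub>A\<^esub> x
      = (a \<odot>\<^bsub>P E E\<^esub> ident_arrow E) \<odot>\<^bsub>A\<^esub> x \<oplus>\<^bsub>A\<^esub> (b \<odot>\<^bsub>P E E\<^esub> ident_arrow E) \<odot>\<^bsub>A\<^esub> x"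
    if "a \<in> carrier B" "b \<in> carrier B" "x \<in> carrier A" for a b x
    using A.smult_l_distr[OF scalar_in_R[OF that(1)] scalar_in_R[OF that(2)] that(3)]
    by (simp add: EE.smult_l_distr[OF that(1,2) ident_E_closed] Pn_End_simps)
  moreover have "((a \<otimes>\<^bsub>B\<^esub> b) \<odot>\<^bsub>P E E\<^esub> ident_arrow E) \<odot>\<^bsub>A\<^esub> x
      = (a \<odot>\<^bsub>P E E\<^esub> ident_arrow E) \<odot>\<^bsub>A\<^esub> ((b \<odot>\<^bsub>P E E\<^esub> ident_arrow E) \<odot>\<^bsub>A\<^esub> x)"
    if "a \<in> carrier B" "b \<in> carrier B" "x \<in> carrier A" for a b x
    using A.smult_assoc1[OF scalar_in_R[OF that(1)] scalar_in_R[OF that(2)] that(3)]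
      scalar_comp[OF E_Ob that(1) EE.smult_closed[OF that(2) ident_E_closed]]
    by (simp add: EE.smult_assoc1[OF that(1,2) ident_E_closed] Pn_End_simps)
  moreover have "(\<one>\<^bsub>B\<^esub> \<odot>\<^bsub>P E E\<^esub> ident_arrow E) \<odot>\<^bsub>A\<^esub> x = x" if "x \<in> carrier A" for x
    using A.smult_one[OF that] by (simp add: EE.smult_one[OF ident_E_closed] Pn_End_simps)
  ultimately show ?thesis
    by (intro left_module.intro left_module_axioms.intro B.ring_axioms)
      (simp_all add: restricted_scalars_def scalar_in_R A.smult_closed A.smult_r_distr)
qed

definition equivariant :: "('b, 'm) module \<Rightarrow> ((('m \<Rightarrow> 'm) \<Rightarrow> 'b) set \<Rightarrow> 'm) set" where
  "equivariant M = {g \<in> lin_maps B (P M E) restricted_scalars.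
     \<forall>X \<in> carrier (P E E). \<forall>Y \<in> carrier (P M E). g (Pn_comp B n M E X Y) = X \<odot>\<^bsub>A\<^esub> g Y}"

text \<open>\<open>Hom\<^sub>R(P M E, A)\<close>, the right Kan extension of \<open>A\<close> from \<open>E\<close> to all free modules. The equivalence
  makes it isomorphic to the left Kan extension \<open>P E M \<otimes>\<^sub>R A\<close>, but its elements are functions and no
  tensor product has to be built.\<close>

definition coinduced :: "('b, 'm) module \<Rightarrow> ('b, (('m \<Rightarrow> 'm) \<Rightarrow> 'b) set \<Rightarrow> 'm) module" where
  "coinduced M = (Hom_mod B (P M E) restricted_scalars)\<lparr>carrier := equivariant M\<rparr>"

lemma coinduced_simps:
  "carrier (coinduced M) = equivariant M"
  "zero (coinduced M) = (\<lambda>Y\<in>carrier (P M E). \<zero>\<^bsub>A\<^esub>)"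
  "add (coinduced M) g h = (\<lambda>Y\<in>carrier (P M E). g Y \<oplus>\<^bsub>A\<^esub> h Y)"
  "smult (coinduced M) r g = (\<lambda>Y\<in>carrier (P M E). (r \<odot>\<^bsub>P E E\<^esub> ident_arrow E) \<odot>\<^bsub>A\<^esub> g Y)"
  by (simp_all add: coinduced_def restricted_scalars_def Hom_mod_def plain_module_def)

lemma restricted_scalars_simps:
  "carrier restricted_scalars = carrier A" "zero restricted_scalars = \<zero>\<^bsub>A\<^esub>"
  "add restricted_scalars = add A"
  "smult restricted_scalars r a = (r \<odot>\<^bsub>P E E\<^esub> ident_arrow E) \<odot>\<^bsub>A\<^esub> a"
  by (simp_all add: restricted_scalars_def)

lemma
  assumes "g \<in> equivariant M"
  shows equivariant_lin: "g \<in> lin_maps B (P M E) restricted_scalars"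
    and equivariant_closed: "Y \<in> carrier (P M E) \<Longrightarrow> g Y \<in> carrier A"
    and equivariant_act: "\<lbrakk>X \<in> carrier (P E E); Y \<in> carrier (P M E)\<rbrakk> \<Longrightarrow> g (Pn_comp B n M E X Y) = X \<odot>\<^bsub>A\<^esub> g Y"
  using assms lin_maps_closed[of g B "P M E" restricted_scalars Y]
  by (auto simp: equivariant_def restricted_scalars_simps)

lemma left_module_coinduced:
  assumes M: "M \<in> Ob"
  shows "left_module B (coinduced M)"
proof (rule left_module_by_embedding[where f = "\<lambda>g. g"])
  note PM = left_module_P[OF M E_Ob]
  show H: "left_module B (Hom_mod B (P M E) restricted_scalars)"
    by (rule left_module_Hom[OF B.is_cring PM left_module_restricted])
  interpret H: left_module B "Hom_mod B (P M E) restricted_scalars" by (rule H)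
  note c = Pn_comp_closed[OF Ob_left_module[OF M] E_left_module E_left_module]
  show "(\<lambda>g. g) \<in> carrier (coinduced M) \<rightarrow> carrier (Hom_mod B (P M E) restricted_scalars)"
    by (auto simp: coinduced_simps dest: equivariant_lin)
  show "\<zero>\<^bsub>coinduced M\<^esub> \<in> carrier (coinduced M)"
    using H.M.zero_closed by (auto simp: coinduced_simps equivariant_def restricted_scalars_simps c A.smult_r_null Pn_End_simps)
  fix g assume "g \<in> carrier (coinduced M)"
  then have g: "g \<in> equivariant M" by (simp add: coinduced_simps)
  show "g \<oplus>\<^bsub>coinduced M\<^esub> h \<in> carrier (coinduced M)" if "h \<in> carrier (coinduced M)" for h
  proof -
    have h: "h \<in> equivariant M" using that by (simp add: coinduced_simps)
    show ?thesis
      using H.M.a_closed[of g h] equivariant_lin[OF g] equivariant_lin[OF h]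
      by (auto simp: coinduced_simps equivariant_def[of M] restricted_scalars_simps c equivariant_act[OF g] equivariant_act[OF h]
          equivariant_closed[OF g] equivariant_closed[OF h] A.smult_r_distr Pn_End_simps)
  qed
  show "r \<odot>\<^bsub>coinduced M\<^esub> g \<in> carrier (coinduced M)" if r: "r \<in> carrier B" for r
  proof -
    have "(r \<odot>\<^bsub>P E E\<^esub> ident_arrow E) \<odot>\<^bsub>A\<^esub> g (Pn_comp B n M E X Y)
        = X \<odot>\<^bsub>A\<^esub> ((r \<odot>\<^bsub>P E E\<^esub> ident_arrow E) \<odot>\<^bsub>A\<^esub> g Y)"
      if X: "X \<in> carrier (P E E)" and Y: "Y \<in> carrier (P M E)" for X Y
    proof -
      note s = EE.smult_closed[OF r ident_E_closed]
      have "Pn_comp B n E E (r \<odot>\<^bsub>P E E\<^esub> ident_arrow E) X = Pn_comp B n E E X (r \<odot>\<^bsub>P E E\<^esub> ident_arrow E)"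
        using scalar_comp[OF E_Ob r X] comp_scalar[OF r X] by simp
      then show ?thesis
        using A.smult_assoc1[of "r \<odot>\<^bsub>P E E\<^esub> ident_arrow E" X "g Y"]
          A.smult_assoc1[of X "r \<odot>\<^bsub>P E E\<^esub> ident_arrow E" "g Y"] X s equivariant_closed[OF g Y]
        by (simp add: equivariant_act[OF g X Y] Pn_End_simps)
    qed
    then show ?thesis
      using H.smult_closed[OF r, of g] equivariant_lin[OF g]
      by (auto simp: coinduced_simps equivariant_def[of M] restricted_scalars_simps c)
  qed
qed (simp_all add: coinduced_simps restricted_scalars_simps)

definition coinduced_act where
  "coinduced_act M N = (\<lambda>X\<in>carrier (P M N). \<lambda>g\<in>equivariant M. \<lambda>Y\<in>carrier (P N E).
     g (Pn_comp B n M E Y X))"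

definition coinduced_functor where
  "coinduced_functor = \<lparr>fobj = coinduced, farr = (\<lambda>M N \<chi>. coinduced_act M N (arrow M N \<chi>))\<rparr>"

lemma coinduced_act_closed:
  assumes M: "M \<in> Ob" and N: "N \<in> Ob" and X: "X \<in> carrier (P M N)" and g: "g \<in> equivariant M"
  shows "(\<lambda>Y\<in>carrier (P N E). g (Pn_comp B n M E Y X)) \<in> equivariant N"
proof -
  note lm = Ob_left_module[OF M] Ob_left_module[OF N]
  note c = Pn_comp_closed[OF lm E_left_module _ X] Pn_comp_closed[OF lm(2) E_left_module E_left_module]
  have "compose (carrier (P N E)) g (\<lambda>Y\<in>carrier (P N E). Pn_comp B n M E Y X)
      \<in> lin_maps B (P N E) restricted_scalars"
    by (rule lin_maps_compose[OF left_module_P[OF N E_Ob]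
          Pn_comp_right_lin[OF lm E_left_module X] equivariant_lin[OF g]])
  then have "(\<lambda>Y\<in>carrier (P N E). g (Pn_comp B n M E Y X)) \<in> lin_maps B (P N E) restricted_scalars"
    by (simp add: compose_def cong: restrict_cong)
  moreover have "g (Pn_comp B n M E (Pn_comp B n N E Z Y) X) = Z \<odot>\<^bsub>A\<^esub> g (Pn_comp B n M E Y X)"
    if "Z \<in> carrier (P E E)" "Y \<in> carrier (P N E)" for Z Y
    using Pn_comp_assoc[OF lm E_left_module E_left_module that X] equivariant_act[OF g that(1) c(1)[OF that(2)]]
    by simp
  ultimately show ?thesis by (simp add: equivariant_def c)
qed

lemma
  shows coinduced_numerical: "numerical_into coinduced_functor"
    and coinduced_act: "\<lbrakk>M \<in> Ob; N \<in> Ob\<rbrakk> \<Longrightarrow> act coinduced_functor M N = coinduced_act M N"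
proof -
  let ?F = coinduced_functor
  have o: "fobj ?F M = coinduced M" for M by (simp add: coinduced_functor_def)
  have V: "left_module B (fobj ?F M)" if "M \<in> Ob" for M
    unfolding o by (rule left_module_coinduced[OF that])
  have lin: "coinduced_act M N \<in> lin_maps B (P M N) (Hom_mod B (fobj ?F M) (fobj ?F N))"
    if M: "M \<in> Ob" and N: "N \<in> Ob" for M N
    unfolding coinduced_act_def o
  proof (rule lin_maps_restrictI[OF left_module_P[OF M N]])
    note lm = Ob_left_module[OF M] Ob_left_module[OF N]
    note c = Pn_comp_closed[OF lm E_left_module]
    let ?l = "\<lambda>X. \<lambda>g\<in>equivariant M. \<lambda>Y\<in>carrier (P N E). g (Pn_comp B n M E Y X)"
    fix X Z r assume X: "X \<in> carrier (P M N)"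
    have "(\<lambda>g\<in>carrier (coinduced M). \<lambda>Y\<in>carrier (P N E). g (Pn_comp B n M E Y X))
        \<in> lin_maps B (coinduced M) (coinduced N)"
      by (rule lin_maps_restrictI[OF left_module_coinduced[OF M]])
        (use X in \<open>auto simp: coinduced_simps coinduced_act_closed[OF M N X] c fun_eq_iff\<close>)
    then show "?l X \<in> carrier (Hom_mod B (coinduced M) (coinduced N))"
      by (simp add: coinduced_simps)
    show "?l (X \<oplus>\<^bsub>P M N\<^esub> Z) = ?l X \<oplus>\<^bsub>Hom_mod B (coinduced M) (coinduced N)\<^esub> ?l Z"
      if Z: "Z \<in> carrier (P M N)"
      using X Z by (auto simp: coinduced_simps fun_eq_iff Pn_comp_add_right[OF lm E_left_module] c
          lin_maps_add[OF equivariant_lin] restricted_scalars_simps)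
    show "?l (r \<odot>\<^bsub>P M N\<^esub> X) = r \<odot>\<^bsub>Hom_mod B (coinduced M) (coinduced N)\<^esub> ?l X"
      if r: "r \<in> carrier B"
      using X r by (auto simp: coinduced_simps fun_eq_iff Pn_comp_smult_right[OF lm E_left_module] c
          lin_maps_smult[OF equivariant_lin] restricted_scalars_simps)
  qed
  have arr: "farr ?F M N \<chi> = coinduced_act M N (arrow M N \<chi>)" for M N \<chi>
    by (simp add: coinduced_functor_def)
  have cmp: "coinduced_act L N (Pn_comp B n L N X Z) g = coinduced_act M N X (coinduced_act L M Z g)"
    if O: "L \<in> Ob" "M \<in> Ob" "N \<in> Ob" and X: "X \<in> carrier (P M N)" and Z: "Z \<in> carrier (P L M)"
      and g: "g \<in> carrier (fobj ?F L)" for L M N X Z g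
  proof -
    note lm = O[THEN Ob_left_module]
    have g': "g \<in> equivariant L" using g by (simp add: o coinduced_simps)
    show ?thesis
      using X Z g' by (auto simp: coinduced_act_def coinduced_act_closed[OF O(1,2) Z] fun_eq_iff
          Pn_comp_closed[OF lm] Pn_comp_closed[OF lm(2,3) E_left_module] Pn_comp_assoc[OF lm E_left_module])
  qed
  have ident: "coinduced_act M M (ident_arrow M) g = g" if M: "M \<in> Ob" and g: "g \<in> carrier (fobj ?F M)" for M g
  proof -
    note lM = Ob_left_module[OF M]
    have g': "g \<in> equivariant M" using g by (simp add: o coinduced_simps)
    have "(\<lambda>Y\<in>carrier (P M E). g (Pn_comp B n M E Y (ident_arrow M))) = g"
      by (rule extensionalityI[OF _ lin_maps_extensional[OF equivariant_lin[OF g']]])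
        (simp_all add: Pn_comp_ident_right[OF lM E_left_module])
    then show ?thesis using g' by (simp add: coinduced_act_def ident_arrow_closed[OF lM])
  qed
  show "numerical_into ?F" by (rule numerical_into_linear(1)[OF V lin arr cmp ident])
  show "act ?F M N = coinduced_act M N" if "M \<in> Ob" "N \<in> Ob"
    by (rule numerical_into_linear(2)[OF V lin arr cmp ident that])
qed

end
end

context standard_free
begin

context
  fixes A :: "((('m \<Rightarrow> 'm) \<Rightarrow> 'b) set, 'm) module"
  assumes A: "left_module R A"
begin

interpretation A: left_module R A by (rule A)

private lemmas eqv_lin = equivariant_lin[OF A] and eqv_closed = equivariant_closed[OF A] and eqv_act = equivariant_act[OF A]
private lemmas co_simps = coinduced_simps[OF A]
private lemmas F0 = coinduced_numerical[OF A]

text \<open>By the decomposition of the identity of \<open>M\<close>, an equivariant map on \<open>P\<^sub>n(Hom(M, E))\<close> is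
  determined by finitely many values.\<close>

lemma coinduced_embeds:
  assumes M: "M \<in> Ob"
  shows "\<exists>h :: ((('m \<Rightarrow> 'm) \<Rightarrow> 'b) set \<Rightarrow> 'm) \<Rightarrow> 'm. inj_on h (equivariant A M)"
proof -
  note lM = Ob_left_module[OF M]
  interpret RS: left_module B "restricted_scalars A" by (rule left_module_restricted[OF A])
  obtain K a c where ac: "a \<in> {..<K} \<rightarrow> carrier (P E M)" "c \<in> {..<K} \<rightarrow> carrier (P M E)"
    and d: "ident_arrow M = (\<Oplus>\<^bsub>P M M\<^esub>i\<in>{..<K::nat}. Pn_comp B n M M (a i) (c i))"
    using ident_decomposition[OF M] by blast
  have cc: "Pn_comp B n M M (a i) (c i) \<in> carrier (P M M)" if "i \<in> {..<K}" for i
    by (rule Pn_comp_closed[OF lM E_left_module lM Pi_mem[OF ac(1) that] Pi_mem[OF ac(2) that]])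
  have expand: "g Y = (\<Oplus>\<^bsub>restricted_scalars A\<^esub>i\<in>{..<K}. Pn_comp B n E E Y (a i) \<odot>\<^bsub>A\<^esub> g (c i))"
    if g: "g \<in> equivariant A M" and Y: "Y \<in> carrier (P M E)" for g Y
  proof -
    let ?y = "\<lambda>X\<in>carrier (P M M). Pn_comp B n M E Y X"
    have Yc: "?y (Pn_comp B n M M (a i) (c i)) \<in> carrier (P M E)" if "i \<in> {..<K}" for i
      using cc[OF that] Pn_comp_closed[OF lM lM E_left_module Y cc[OF that]] by simp
    have "Y = ?y (ident_arrow M)"
      using Pn_comp_ident_right[OF lM E_left_module Y] ident_arrow_closed[OF lM] by simp
    also have "\<dots> = (\<Oplus>\<^bsub>P M E\<^esub>i\<in>{..<K}. ?y (Pn_comp B n M M (a i) (c i)))"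
      unfolding d using cc
      by (intro lin_maps_finsum[OF left_module_P[OF M M] left_module_P[OF M E_Ob]
            Pn_comp_left_lin[OF lM lM E_left_module Y]]) auto
    finally have "g Y = g (\<Oplus>\<^bsub>P M E\<^esub>i\<in>{..<K}. ?y (Pn_comp B n M M (a i) (c i)))"
      by (rule arg_cong)
    also have "\<dots> = (\<Oplus>\<^bsub>restricted_scalars A\<^esub>i\<in>{..<K}. g (?y (Pn_comp B n M M (a i) (c i))))"
      using Yc by (intro lin_maps_finsum[OF left_module_P[OF M E_Ob] RS.left_module_axioms eqv_lin[OF g]]) auto
    also have "\<dots> = (\<Oplus>\<^bsub>restricted_scalars A\<^esub>i\<in>{..<K}. Pn_comp B n E E Y (a i) \<odot>\<^bsub>A\<^esub> g (c i))"
    proof (rule RS.M.finsum_cong'[OF refl])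
      fix i assume i: "i \<in> {..<K}"
      note ai = Pi_mem[OF ac(1) i] and ci = Pi_mem[OF ac(2) i]
      note Ya = Pn_comp_closed[OF E_left_module lM E_left_module Y ai]
      show "g (?y (Pn_comp B n M M (a i) (c i))) = Pn_comp B n E E Y (a i) \<odot>\<^bsub>A\<^esub> g (c i)"
        using cc[OF i] Pn_comp_assoc[OF lM E_left_module lM E_left_module Y ai ci] eqv_act[OF g Ya ci]
        by simp
    next
      show "(\<lambda>i. Pn_comp B n E E Y (a i) \<odot>\<^bsub>A\<^esub> g (c i)) \<in> {..<K} \<rightarrow> carrier (restricted_scalars A)"
      proof
        fix i assume i: "i \<in> {..<K}"
        show "Pn_comp B n E E Y (a i) \<odot>\<^bsub>A\<^esub> g (c i) \<in> carrier (restricted_scalars A)"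
          using A.smult_closed[of "Pn_comp B n E E Y (a i)" "g (c i)"]
            Pn_comp_closed[OF E_left_module lM E_left_module Y Pi_mem[OF ac(1) i]]
            eqv_closed[OF g Pi_mem[OF ac(2) i]]
          by (simp add: Pn_End_simps restricted_scalars_simps[OF A])
      qed
    qed
    finally show ?thesis .
  qed
  have inj: "inj_on (\<lambda>g. map (\<lambda>i. g (c i)) [0..<K]) (carrier (coinduced A M))"
  proof (rule inj_onI)
    fix g h assume "g \<in> carrier (coinduced A M)" "h \<in> carrier (coinduced A M)"
      and eq: "map (\<lambda>i. g (c i)) [0..<K] = map (\<lambda>i. h (c i)) [0..<K]"
    then have g: "g \<in> equivariant A M" and h: "h \<in> equivariant A M" by (simp_all add: co_simps)
    have e: "g (c i) = h (c i)" if "i < K" for i using eq that by (simp add: map_eq_conv)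
    show "g = h"
    proof (rule lin_maps_eqI[OF eqv_lin[OF g] eqv_lin[OF h]])
      fix Y assume Y: "Y \<in> carrier (P M E)"
      have "(\<lambda>i. Pn_comp B n E E Y (a i) \<odot>\<^bsub>A\<^esub> h (c i)) \<in> {..<K} \<rightarrow> carrier (restricted_scalars A)"
      proof
        fix i assume i: "i \<in> {..<K}"
        show "Pn_comp B n E E Y (a i) \<odot>\<^bsub>A\<^esub> h (c i) \<in> carrier (restricted_scalars A)"
          using A.smult_closed[of "Pn_comp B n E E Y (a i)" "h (c i)"]
            Pn_comp_closed[OF E_left_module lM E_left_module Y Pi_mem[OF ac(1) i]]
            eqv_closed[OF h Pi_mem[OF ac(2) i]]
          by (simp add: Pn_End_simps restricted_scalars_simps[OF A])
      qed
      then show "g Y = h Y"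
        unfolding expand[OF g Y] expand[OF h Y] by (intro RS.M.finsum_cong'[OF refl]) (auto simp: e)
    qed
  qed
  show ?thesis
    using embeds_in_universe[OF left_module_coinduced[OF A M] inj] by (simp add: co_simps)
qed

text \<open>Evaluation at \<open>[1]\<close> is an isomorphism \<open>Hom\<^sub>R(R, A) = A\<close>.\<close>

lemma Phi_essentially_surjective: "\<exists>F. numerical_into F \<and> (\<exists>i. iso_arrow (mod_cat R) (fobj (Phi B E) F) A i)"
proof -
  let ?G = "coinduced_functor A"
  have "\<forall>M \<in> Ob. \<exists>h :: ((('m \<Rightarrow> 'm) \<Rightarrow> 'b) set \<Rightarrow> 'm) \<Rightarrow> 'm. inj_on h (equivariant A M)"
    using coinduced_embeds by blast
  then obtain j :: "('b, 'm) module \<Rightarrow> ((('m \<Rightarrow> 'm) \<Rightarrow> 'b) set \<Rightarrow> 'm) \<Rightarrow> 'm"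
    where j: "\<forall>M \<in> Ob. inj_on (j M) (equivariant A M)" by (rule bchoice[THEN exE])
  have o: "fobj ?G M = coinduced A M" for M by (simp add: coinduced_functor_def[OF A])
  have jG: "inj_on (j M) (carrier (fobj ?G M))" if "M \<in> Ob" for M
    using j that by (simp add: o co_simps)
  define F where "F = copy_functor j ?G"
  have F: "numerical_into F" unfolding F_def by (rule numerical_copy[OF F0 jG])
  have FE: "fobj F E = copy_mod (j E) (coinduced A E)" by (simp add: F_def copy_functor_def o)
  let ?u = "inv_into (equivariant A E) (j E)"
  have u: "?u (j E g) = g" if "g \<in> equivariant A E" for g
    using inv_into_f_f[OF bspec[OF j E_Ob] that] .
  let ?i = "\<lambda>y\<in>carrier (fobj F E). ?u y (ident_arrow E)"
  have car: "carrier (fobj F E) = j E ` equivariant A E" by (simp add: FE co_simps)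
  have i: "?i (j E g) = g (ident_arrow E)" if "g \<in> equivariant A E" for g
    using that by (simp add: car u)
  have g_eval: "g Y = Y \<odot>\<^bsub>A\<^esub> g (ident_arrow E)" if "g \<in> equivariant A E" "Y \<in> carrier (P E E)" for g Y
    using eqv_act[OF that ident_E_closed] Pn_comp_ident_right[OF E_left_module E_left_module that(2)] by simp
  have lin: "?i \<in> lin_maps R (fobj (Phi B E) F) A"
  proof (rule lin_mapsI)
    show "?i \<in> carrier (fobj (Phi B E) F) \<rightarrow> carrier A"
      using i eqv_closed[OF _ ident_E_closed] by (auto simp: Phi_simps car)
    show "?i \<in> extensional (carrier (fobj (Phi B E) F))" by (simp add: Phi_simps)
    interpret V: left_module B "coinduced A E" by (rule left_module_coinduced[OF A E_Ob])
    fix x y X assume "x \<in> carrier (fobj (Phi B E) F)"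
    then obtain g where g: "g \<in> equivariant A E" "x = j E g" by (auto simp: Phi_simps car)
    show "?i (x \<oplus>\<^bsub>fobj (Phi B E) F\<^esub> y) = ?i x \<oplus>\<^bsub>A\<^esub> ?i y" if y: "y \<in> carrier (fobj (Phi B E) F)"
    proof -
      obtain h where h: "h \<in> equivariant A E" "y = j E h" using y by (auto simp: Phi_simps car)
      have "x \<oplus>\<^bsub>fobj (Phi B E) F\<^esub> y = j E (g \<oplus>\<^bsub>coinduced A E\<^esub> h)"
        using g h by (simp add: Phi_simps FE co_simps(1) u)
      moreover have "g \<oplus>\<^bsub>coinduced A E\<^esub> h \<in> equivariant A E"
        using V.M.a_closed[of g h] g(1) h(1) by (simp add: co_simps(1))
      ultimately have "?i (x \<oplus>\<^bsub>fobj (Phi B E) F\<^esub> y) = (g \<oplus>\<^bsub>coinduced A E\<^esub> h) (ident_arrow E)"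
        using i by simp
      also have "\<dots> = ?i x \<oplus>\<^bsub>A\<^esub> ?i y" using ident_E_closed by (simp only: co_simps(3) g(2) h(2) i[OF g(1)] i[OF h(1)] restrict_apply')
      finally show ?thesis .
    qed
    show "?i (X \<odot>\<^bsub>fobj (Phi B E) F\<^esub> x) = X \<odot>\<^bsub>A\<^esub> ?i x" if "X \<in> carrier R"
    proof -
      have X: "X \<in> carrier (P E E)" using that by (simp add: Pn_End_simps)
      have x: "x \<in> carrier (fobj F E)" using g by (simp add: car)
      let ?h = "\<lambda>Y\<in>carrier (P E E). g (Pn_comp B n E E Y X)"
      have h: "?h \<in> equivariant A E" by (rule coinduced_act_closed[OF A E_Ob E_Ob X g(1)])
      have "X \<odot>\<^bsub>fobj (Phi B E) F\<^esub> x = act F E E X x"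
        by (simp add: Phi_simps Phi_smult_eq_act[OF F X x])
      also have "\<dots> = j E (act ?G E E X g)"
        unfolding F_def g(2) using act_copy[OF F0 jG E_Ob E_Ob X, of g] g(1) by (simp add: o co_simps)
      also have "act ?G E E X g = ?h"
        using X g(1) by (simp add: coinduced_act[OF A E_Ob E_Ob] coinduced_act_def[OF A])
      finally have e: "X \<odot>\<^bsub>fobj (Phi B E) F\<^esub> x = j E ?h" .
      have "?i (X \<odot>\<^bsub>fobj (Phi B E) F\<^esub> x) = ?h (ident_arrow E)" unfolding e by (rule i[OF h])
      also have "\<dots> = g X" using ident_E_closed by (simp add: Pn_comp_ident_left[OF E_left_module E_left_module X])
      also have "\<dots> = X \<odot>\<^bsub>A\<^esub> ?i x" using g_eval[OF g(1) X] i[OF g(1)] g(2) by simp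
      finally show ?thesis .
    qed
  qed
  have "bij_betw ?i (carrier (fobj (Phi B E) F)) (carrier A)"
  proof (rule bij_betwI')
    fix x y assume "x \<in> carrier (fobj (Phi B E) F)" "y \<in> carrier (fobj (Phi B E) F)"
    then obtain g h where g: "g \<in> equivariant A E" "x = j E g" and h: "h \<in> equivariant A E" "y = j E h"
      by (auto simp: Phi_simps car)
    show "?i x = ?i y \<longleftrightarrow> x = y"
    proof
      assume "?i x = ?i y"
      then have "g (ident_arrow E) = h (ident_arrow E)" using g h i by simp
      then have "g Y = h Y" if "Y \<in> carrier (P E E)" for Y
        using g_eval[OF g(1) that] g_eval[OF h(1) that] by simp
      then have "g = h" by (rule lin_maps_eqI[OF eqv_lin[OF g(1)] eqv_lin[OF h(1)]])
      then show "x = y" using g h by simp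
    qed simp
  next
    show "?i x \<in> carrier A" if "x \<in> carrier (fobj (Phi B E) F)" for x
      by (rule lin_maps_closed[OF lin that])
    fix a assume a: "a \<in> carrier A"
    let ?g = "\<lambda>Y\<in>carrier (P E E). Y \<odot>\<^bsub>A\<^esub> a"
    note lm = left_module_P[OF E_Ob E_Ob]
    interpret EE: left_module B "P E E" by (rule lm)
    have lA: "?g \<in> lin_maps B (P E E) (restricted_scalars A)"
    proof (rule lin_maps_restrictI[OF lm])
      fix Y Z r assume Y: "Y \<in> carrier (P E E)"
      show "Y \<odot>\<^bsub>A\<^esub> a \<in> carrier (restricted_scalars A)"
        using Y a A.smult_closed by (simp add: restricted_scalars_simps[OF A] Pn_End_simps)
      show "(Y \<oplus>\<^bsub>P E E\<^esub> Z) \<odot>\<^bsub>A\<^esub> a = Y \<odot>\<^bsub>A\<^esub> a \<oplus>\<^bsub>restricted_scalars A\<^esub> Z \<odot>\<^bsub>A\<^esub> a"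
        if "Z \<in> carrier (P E E)"
        using A.smult_l_distr[of Y Z a] Y that a by (simp add: restricted_scalars_simps[OF A] Pn_End_simps)
      show "(r \<odot>\<^bsub>P E E\<^esub> Y) \<odot>\<^bsub>A\<^esub> a = r \<odot>\<^bsub>restricted_scalars A\<^esub> (Y \<odot>\<^bsub>A\<^esub> a)" if r: "r \<in> carrier B"
        using A.smult_assoc1[OF scalar_in_R[OF A r], of Y a] Y a scalar_comp[OF A E_Ob r Y]
        by (simp add: restricted_scalars_simps[OF A] Pn_End_simps)
    qed
    then have g: "?g \<in> equivariant A E"
      using a A.smult_assoc1 Pn_comp_closed[OF E_left_module E_left_module E_left_module]
      by (simp add: equivariant_def[OF A] Pn_End_simps)
    have "a = ?i (j E ?g)" unfolding i[OF g] using ident_E_closed A.smult_one[OF a] by (simp add: Pn_End_simps)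
    moreover have "j E ?g \<in> carrier (fobj (Phi B E) F)" using g by (simp add: Phi_simps car)
    ultimately show "\<exists>x\<in>carrier (fobj (Phi B E) F). a = ?i x" by blast
  qed
  then have "iso_arrow (mod_cat R) (fobj (Phi B E) F) A ?i"
    by (rule iso_arrow_mod_cat[OF left_module_Phi[OF F] A lin])
  then show ?thesis using F by blast
qed

end

lemma Phi_equivalence: "equivalence_functor (num_cat B n) (mod_cat R) (Phi B E)"
proof (rule equivalence_functorI[OF Phi_functor])
  fix F G :: "('b, 'm) mod_functor" and g
  assume "F \<in> obj (num_cat B n)" "G \<in> obj (num_cat B n)"
    "g \<in> arr (mod_cat R) (fobj (Phi B E) F) (fobj (Phi B E) G)"
  then show "\<exists>!f. f \<in> arr (num_cat B n) F G \<and> farr (Phi B E) F G f = g"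
    using Phi_full_faithful[of F G g] by (simp add: num_cat_obj num_cat_simps(2) Phi_simps)
next
  fix A :: "((('m \<Rightarrow> 'm) \<Rightarrow> 'b) set, 'm) module" assume "A \<in> obj (mod_cat R)"
  then show "\<exists>F\<in>obj (num_cat B n). \<exists>i. iso_arrow (mod_cat R) (fobj (Phi B E) F) A i"
    using Phi_essentially_surjective[of A] by (auto simp: num_cat_obj)
qed

section \<open>Epimorphisms\<close>

text \<open>The cokernel of \<open>p\<^sub>E\<close> is isomorphic to \<open>\<Phi> F\<close> for some \<open>F\<close>, so the projection onto it and the zero
  map come from natural transformations \<open>Y \<rightarrow> F\<close>. These agree after composition with \<open>p\<close>, hence are
  equal, and the cokernel vanishes.\<close>

lemma epi_surjective_at_E:
  fixes X Y :: "('b, 'm) mod_functor"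
  assumes epi: "epi_arrow (num_cat B n) X Y p"
    and X: "X \<in> obj (num_cat B n)" and Y: "Y \<in> obj (num_cat B n)"
  shows "p E ` carrier (fobj X E) = carrier (fobj Y E)"
proof -
  note nX = X[unfolded num_cat_obj] and nY = Y[unfolded num_cat_obj]
  have p: "p \<in> Transf X Y"
    using epi by (simp add: epi_arrow_def num_cat_simps(2))
  let ?X = "fobj (Phi B E) X" and ?Y = "fobj (Phi B E) Y"
  have pE: "p E \<in> lin_maps R ?X ?Y" by (rule nat_trans_at_E[OF nX nY p])
  interpret X: left_module R ?X by (rule left_module_Phi[OF nX])
  interpret Y: left_module R ?Y by (rule left_module_Phi[OF nY])
  interpret pE: abelian_group_hom ?X ?Y "p E" by (rule lin_maps_hom[OF X.left_module_axioms Y.left_module_axioms pE])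
  define K where "K = p E ` carrier ?X"
  have "submodule K R ?Y"
  proof (intro submodule.intro subgroup.intro submodule_axioms.intro)
    show "K \<subseteq> carrier (add_monoid ?Y)" by (auto simp: K_def)
    show "x \<otimes>\<^bsub>add_monoid ?Y\<^esub> y \<in> K" if xy: "x \<in> K" "y \<in> K" for x y
    proof -
      obtain a b where "a \<in> carrier ?X" "x = p E a" "b \<in> carrier ?X" "y = p E b"
        using xy by (auto simp: K_def)
      then have "x \<oplus>\<^bsub>?Y\<^esub> y = p E (a \<oplus>\<^bsub>?X\<^esub> b)" "a \<oplus>\<^bsub>?X\<^esub> b \<in> carrier ?X" by simp_all
      then show ?thesis unfolding K_def by (simp only: monoid.simps imageI)
    qed
    show "\<one>\<^bsub>add_monoid ?Y\<^esub> \<in> K"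
      using imageI[OF X.M.zero_closed, of "p E"] pE.hom_zero by (simp add: K_def)
    show "inv\<^bsub>add_monoid ?Y\<^esub> x \<in> K" if x: "x \<in> K" for x
    proof -
      obtain a where a: "a \<in> carrier ?X" "x = p E a" using x by (auto simp: K_def)
      have "\<ominus>\<^bsub>?Y\<^esub> x = p E (\<ominus>\<^bsub>?X\<^esub> a)"
        unfolding a(2) by (rule pE.hom_a_inv[OF a(1), symmetric])
      then show ?thesis
        unfolding K_def a_inv_def[of ?Y, symmetric]
        using imageI[OF X.M.a_inv_closed[OF a(1)], of "p E"] by (simp only:)
    qed
    show "r \<odot>\<^bsub>?Y\<^esub> x \<in> K" if r: "r \<in> carrier R" and x: "x \<in> K" for r x
    proof -
      obtain a where a: "a \<in> carrier ?X" "x = p E a" using x by (auto simp: K_def)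
      have "r \<odot>\<^bsub>?Y\<^esub> x = p E (r \<odot>\<^bsub>?X\<^esub> a)"
        unfolding a(2) by (rule lin_maps_smult[OF pE r a(1), symmetric])
      then show ?thesis
        unfolding K_def using imageI[OF X.smult_closed[OF r a(1)], of "p E"] by (simp only:)
    qed
  qed
  then interpret Q: quotient R ?Y K by (intro quotient.intro quotient_axioms.intro Y.left_module_axioms)
  let ?C = "quot_mod R ?Y K"
  \<comment> \<open>cosets are moved into the universe by a choice of representatives\<close>
  define rep where "rep Z = (SOME y. y \<in> Z)" for Z :: "'m set"
  have rep_inj: "inj_on rep (carrier ?C)"
  proof (rule inj_onI)
    fix Z W assume Z: "Z \<in> carrier ?C" and W: "W \<in> carrier ?C" and eq: "rep Z = rep W"
    have coset: "V = K +>\<^bsub>?Y\<^esub> rep V" if V: "V \<in> carrier ?C" for V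
    proof -
      obtain y where y: "y \<in> carrier ?Y" "V = K +>\<^bsub>?Y\<^esub> y"
        using V unfolding Q.carrier_quot by blast
      have "y \<in> V" unfolding y(2) by (rule Q.K.a_rcos_self[OF y(1)])
      then have "rep V \<in> V" unfolding rep_def by (rule someI)
      then have "rep V \<in> K +>\<^bsub>?Y\<^esub> y" by (rule subst[OF y(2), of "\<lambda>W. rep V \<in> W"])
      from trans[OF y(2) Q.K.a_repr_independence'[OF this y(1)]] show ?thesis .
    qed
    show "Z = W" using coset[OF Z] coset[OF W] unfolding eq by (rule trans[OF _ sym])
  qed
  let ?C' = "copy_mod rep ?C"
  have C': "left_module R ?C'" by (rule left_module_copy[OF Q.left_module_quot rep_inj])
  obtain F i where F: "numerical_into F" and "iso_arrow (mod_cat R) (fobj (Phi B E) F) ?C' i"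
    using Phi_essentially_surjective[OF C'] by blast
  then obtain k where i: "i \<in> lin_maps R (fobj (Phi B E) F) ?C'" and k: "k \<in> lin_maps R ?C' (fobj (Phi B E) F)"
    and ik: "compose (carrier ?C') i k = (\<lambda>x\<in>carrier ?C'. x)"
    by (auto simp: iso_arrow_def)
  let ?q = "\<lambda>y\<in>carrier ?Y. K +>\<^bsub>?Y\<^esub> y" and ?r = "\<lambda>Z\<in>carrier ?C. rep Z"
  define u where "u = compose (carrier ?Y) k (compose (carrier ?Y) ?r ?q)"
  have u: "u \<in> lin_maps R ?Y (fobj (Phi B E) F)"
    unfolding u_def
    by (rule lin_maps_compose[OF Y.left_module_axioms lin_maps_compose[OF Y.left_module_axioms
            Q.quot_lin copy_lin[OF Q.left_module_quot rep_inj]] k])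
  have u_eq: "u y = k (rep (K +>\<^bsub>?Y\<^esub> y))" if "y \<in> carrier ?Y" for y
    using that by (simp add: u_def compose_eq Q.carrier_quot)
  note PF = left_module_Phi[OF F]
  obtain \<eta> where \<eta>: "\<eta> \<in> Transf Y F" "\<eta> E = u"
    using Phi_full_faithful[OF nY F u] by blast
  let ?\<zeta> = "\<lambda>M\<in>Ob. \<lambda>x\<in>carrier (fobj Y M). \<zero>\<^bsub>fobj F M\<^esub>"
  have \<zeta>: "?\<zeta> \<in> Transf Y F" by (rule nat_trans_zero[OF nY F])
  have k0: "k (rep K) = \<zero>\<^bsub>fobj F E\<^esub>"
    using lin_maps_zero[OF C' PF k] by (simp add: Q.quot_zero Phi_simps)
  have cl: "cmp (num_cat B n) X Y F \<theta> p \<in> Transf X F"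
    if "\<theta> \<in> Transf Y F" for \<theta>
    using category.cmp_arr[OF category_num_cat X Y, of F p \<theta>] that p F
    by (simp add: num_cat_obj num_cat_simps(2))
  have "cmp (num_cat B n) X Y F \<eta> p = cmp (num_cat B n) X Y F ?\<zeta> p"
  proof (rule nat_trans_faithful[OF nX F cl[OF \<eta>(1)] cl[OF \<zeta>]])
    have "u (p E x) = \<zero>\<^bsub>fobj F E\<^esub>" if x: "x \<in> carrier (fobj X E)" for x
    proof -
      have x': "x \<in> carrier ?X" using x by (simp add: Phi_simps)
      have px: "p E x \<in> carrier ?Y" by (rule lin_maps_closed[OF pE x'])
      have "K +>\<^bsub>?Y\<^esub> p E x = K"
        using x' by (subst Q.coset_eq_kernel_iff[OF px]) (simp add: K_def)
      then show ?thesis using u_eq[OF px] k0 by simp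
    qed
    moreover have "p E x \<in> carrier (fobj Y E)" if "x \<in> carrier (fobj X E)" for x
      using lin_maps_closed[OF pE, of x] that by (simp add: Phi_simps)
    ultimately show "cmp (num_cat B n) X Y F \<eta> p E = cmp (num_cat B n) X Y F ?\<zeta> p E"
      using \<eta>(2) E_Ob by (auto simp: num_cat_simps(3) compose_def fun_eq_iff)
  qed
  then have "\<eta> = ?\<zeta>"
    using epi F \<eta>(1) \<zeta> by (simp add: epi_arrow_def num_cat_obj num_cat_simps(2))
  then have u0: "u y = \<zero>\<^bsub>fobj F E\<^esub>" if "y \<in> carrier (fobj Y E)" for y
    using \<eta>(2) E_Ob that by auto
  have "y \<in> K" if y: "y \<in> carrier ?Y" for y
  proof -
    have c: "K +>\<^bsub>?Y\<^esub> y \<in> carrier ?C" using y by (simp add: Q.carrier_quot)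
    have cK: "K \<in> carrier ?C" using Q.left_module_quot Q.quot_zero
      by (metis abelian_group_left_module abelian_group.axioms(1) abelian_monoid.zero_closed)
    have "k (rep (K +>\<^bsub>?Y\<^esub> y)) = k (rep K)"
      using u0[of y] u_eq[OF y] k0 y by (simp add: Phi_simps)
    then have "compose (carrier ?C') i k (rep (K +>\<^bsub>?Y\<^esub> y)) = compose (carrier ?C') i k (rep K)"
      using c cK by (simp add: compose_eq)
    then have "rep (K +>\<^bsub>?Y\<^esub> y) = rep K" unfolding ik using c cK by simp
    then have "K +>\<^bsub>?Y\<^esub> y = K" by (rule inj_onD[OF rep_inj _ c cK])
    then show ?thesis using Q.coset_eq_kernel_iff[OF y] by simp
  qed
  then show ?thesis
    using lin_maps_closed[OF pE] unfolding K_def by (auto simp: Phi_simps)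
qed

end

section \<open>Numerical functors as modules\<close>

theorem theorem10:
  fixes B :: "('b, 'z) ring_scheme"
    and n :: nat
    and e :: "nat \<Rightarrow> (nat \<Rightarrow> 'b) \<Rightarrow> 'm"
    and E :: "('b, 'm) module"
  assumes binomial: "binomial_ring B"
    and universe: "\<forall>k. inj_on (e k) (carrier (free_mod B k))"
    and E: "E = copy_mod (e n) (free_mod B n)"
  shows "(\<exists>j. Pn_hom_embedding B n E j)
    \<and> (\<forall>j. Pn_hom_embedding B n E j \<longrightarrow>
         small_object TYPE('i) B n (copy_functor j (Pn_hom B n E))
         \<and> projective_object (num_cat B n) (copy_functor j (Pn_hom B n E))
         \<and> generator_object (num_cat B n) (copy_functor j (Pn_hom B n E))
         \<and> (\<forall>F \<in> obj (num_cat B n). eval_at_one B n E j F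
              \<in> mod_isos (Pn_End B n E) (Nat_left B n E j F) (fobj (Phi B E) F)))
    \<and> equivalence_functor (num_cat B n) (mod_cat (Pn_End B n E)) (Phi B E)
    \<and> (\<forall>F \<in> obj (num_cat B n). \<forall>\<tau> \<in> carrier (Hom_mod B E E). \<forall>x \<in> carrier (fobj F E).
         Pn_coset B n (Hom_mod B E E) (delta B \<tau>) \<odot>\<^bsub>fobj (Phi B E) F\<^esub> x = farr F E E \<tau> x)"
proof -
  interpret standard_free B n e E
    using universe by unfold_locales (simp_all add: binomial E)
  have act: "arrow E E \<tau> \<odot>\<^bsub>fobj (Phi B E) F\<^esub> x = farr F E E \<tau> x"
    if F: "F \<in> obj (num_cat B n)" and \<tau>: "\<tau> \<in> carrier (Hom_mod B E E)" and x: "x \<in> carrier (fobj F E)" for F \<tau> x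
  proof -
    have nF: "numerical_into F" using F by (simp add: num_cat_obj)
    have t: "\<tau> \<in> lin_maps B E E" using \<tau> by simp
    show ?thesis
      using Phi_smult_eq_act[OF nF arrow_closed[OF E_left_module E_left_module t] x]
        act_arrow[OF nF E_Ob E_Ob t] by (simp add: Phi_simps)
  qed
  have proj: "projective_object (num_cat B n) (copy_functor j (Pn_hom B n E))"
    if "Pn_hom_embedding B n E j" for j
    by (rule Q_projective[OF that]) (rule epi_surjective_at_E)
  have eval: "eval_at_one B n E j F \<in> mod_isos R (Nat_left B n E j F) (fobj (Phi B E) F)"
    if "Pn_hom_embedding B n E j" "F \<in> obj (num_cat B n)" for j F
    using eval_at_one_iso[OF that(1)] that(2) by (simp add: num_cat_obj)
  show ?thesis
    by (intro conjI allI impI ballI Pn_hom_embedding_exists Q_small proj Q_generator eval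
        Phi_equivalence act)
qed

end
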